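(* Let $Z$ be the piecewise analytic system given by $X^L$ on $x<0$ and $X^R$ on $x>0$, and suppose that the origin is a $(2k_L,2k_R)$-monodromic tangential singularity of $Z$ and that there is a minimal $n\in\mathbb{N}$, $n\geqslant 1$, such that the Lyapunov coefficient $V_{2n}\neq 0$. Let $k_M=\max\{k_L,k_R\}$, $N=2(n+k_M)-1$, and for $\mu,\varepsilon>0$ let $$S_h^{\mu,\varepsilon}=\left\{(x,y)\in\{\mu\}\times(-\varepsilon,\varepsilon)\colon |y|^{2k_M+\frac12}>\mu,\ \delta y<0\right\}.$$ If $V_{2n}<0$ (resp. $V_{2n}>0$), then there exist $\varepsilon,\overline\mu>0$ such that, for every $\mu\in(0,\overline\mu)$, the hysteretic system $Z_h$ with parameter $\mu$ has a unique periodic orbit (resp. no periodic orbit) intersecting $S_h^{\mu,\varepsilon}$. In the case that the periodic orbit exists, it is a hyperbolic attracting limit cycle. Moreover, letting $(\mu,-\delta\mathcal{P}_h(\mu))$ denote its intersection with $S_h^{\mu,\varepsilon}$ and $\mathcal{T}_h(\mu)$ its period, as $\mu\to0^+$, $$\mathcal{P}_h(\mu)=\left|\frac{\kappa_h}{V_{2n}}\right|^{1/N}\mu^{1/N}+O\big(\mu^{2/N}\big),$$ $$\mathcal{T}_h(\mu)=\left|\frac{2}{b_{00}^L}-\frac{2}{b_{00}^R}\right|\left|\frac{\kappa_h}{V_{2n}}\right|^{1/N}\mu^{1/N}+O\big(\mu^{2/N}\big).$$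
   Context: **Vector fields.** For $J\in\{L,R\}$, $X^J=(f^J,g^J)$ is an analytic planar vector field on a neighborhood $U\subset\mathbb{R}^2$ of the origin, with $f^J(x,y)=\sum_{i,j\ge0}a_{ij}^Jx^iy^j$ and $g^J(x,y)=\sum_{i,j\ge0}b_{ij}^Jx^iy^j$. The system $Z$ equals $X^L$ for $x<0$ and $X^R$ for $x>0$; the switching manifold is $\Sigma=\{x=0\}\cap U$. Let $\Phi^J(t,x,y)=(\varphi^J(t,x,y),\psi^J(t,x,y))$ be the solution of $X^J$ with $\Phi^J(0,x,y)=(x,y)$. **Monodromic tangential singularity.** Let $h(x,y)=x$ and let $(X^J)^ih$ be the iterated Lie derivatives. For integers $k_L,k_R\ge1$, the origin is a $(2k_L,2k_R)$-monodromic tangential singularity of $Z$ if, for each $J$, $(X^J)^ih(0)=0$ for $1\le i\le 2k_J-1$, with $(X^R)^{2k_R}h(0)<0$ and $(X^L)^{2k_L}h(0)>0$ (invisible contacts), and $X^L(0)=\lambda X^R(0)$ for some $\lambda<0$ (so that a first-return map exists near the origin). Equivalently: $a_{0,i}^J=0$ for $0\le i\le 2k_J-2$ and $J\in\{L,R\}$; $b_{00}^Ra_{0,2k_R-1}^R<0$; $b_{00}^La_{0,2k_L-1}^L>0$; and $b_{00}^Lb_{00}^R<0$. Put $\delta=\operatorname{sgn}b_{00}^R\in\{-1,1\}$. **Lyapunov coefficients.** For each $J$ there is near $y=0$ a unique analytic function $T_0^J$ with $T_0^J(y)=-\frac{2}{b_{00}^J}y+O(y^2)$ and $\varphi^J(T_0^J(y),0,y)=0$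 (the nontrivial return time to $\Sigma$). The half-return map is $P_0^J(y)=\psi^J(T_0^J(y),0,y)=-y+\sum_{i\ge2}\alpha_i^Jy^i$, which is analytic. The displacement map is $D_0(y)=\delta(P_0^R(y)-P_0^L(y))=\sum_{i\ge2}V_iy^i$, and $V_i=\delta(\alpha_i^R-\alpha_i^L)$ is the $i$-th Lyapunov coefficient. It is known that the first non-zero $V_i$, if any, has even index. **Hysteretic system $Z_h$.** Given $\mu>0$, an orbit follows $X^R$ until it reaches the line $x=-\mu$, then switches and follows $X^L$ until it reaches the line $x=\mu$, then switches to $X^R$, and so on. An orbit starting in $\{x\ge\mu\}$ starts by following $X^R$; one starting in $\{x\le-\mu\}$ starts by following $X^L$; in $-\mu<x<\mu$ the active vector field is determined by the preceding states. **Constants.** $\eta_h^J=\dfrac{2b_{00}^J}{a_{0,2k_J-1}^J}$, and $\kappa_h=-\eta_h^L$ if $k_L>k_R$, $\kappa_h=\eta_h^R-\eta_h^L$ if $k_L=k_R$, $\kappa_h=\eta_h^R$ if $k_L<k_R$. (One has $\kappa_h<0$.) A periodic orbit is a hyperbolic attracting limit cycle if it is isolated and the one-dimensional first-return map on the line $x=\mu$ has at it a fixed point with multiplier of modulus less than $1$. *)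

theory Defs
  imports "HOL-Analysis.Analysis" "HOL-Library.Landau_Symbols"
begin

definition has_power_series :: "(nat \<Rightarrow> real) \<Rightarrow> (real \<Rightarrow> real) \<Rightarrow> bool" where
  "has_power_series c F \<longleftrightarrow> (\<exists>r>0. \<forall>y. \<bar>y\<bar> < r \<longrightarrow> (\<lambda>i. c i * y ^ i) sums F y)"

definition has_power_series2 ::
    "(nat \<Rightarrow> nat \<Rightarrow> real) \<Rightarrow> (real \<times> real \<Rightarrow> real) \<Rightarrow> real \<times> real \<Rightarrow> bool" where
  "has_power_series2 c F p \<longleftrightarrow>
     (\<exists>r>0. \<forall>u v. \<bar>u\<bar> < r \<and> \<bar>v\<bar> < r \<longrightarrow>
        ((\<lambda>(i, j). c i j * u ^ i * v ^ j) has_sum F (fst p + u, snd p + v)) UNIV)"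

definition real_analytic2_on :: "(real \<times> real \<Rightarrow> real) \<Rightarrow> (real \<times> real) set \<Rightarrow> bool" where
  "real_analytic2_on F U \<longleftrightarrow> (\<forall>p\<in>U. \<exists>c. has_power_series2 c F p)"

type_synonym vfield = "real \<times> real \<Rightarrow> real \<times> real"

definition analytic_vfield_on :: "vfield \<Rightarrow> (real \<times> real) set \<Rightarrow> bool" where
  "analytic_vfield_on X U \<longleftrightarrow>
     real_analytic2_on (\<lambda>p. fst (X p)) U \<and> real_analytic2_on (\<lambda>p. snd (X p)) U"

definition integral_curve ::
    "vfield \<Rightarrow> (real \<times> real) set \<Rightarrow> (real \<Rightarrow> real \<times> real) \<Rightarrow> real set \<Rightarrow> bool" where
  "integral_curve X U \<gamma> I \<longleftrightarrow>
     (\<forall>t\<in>I. \<gamma> t \<in> U \<and> (\<gamma> has_vector_derivative X (\<gamma> t)) (at t within I))"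

text \<open>The relation \<open>\<Phi>(t, p) = q\<close> for the (local) flow of \<open>X\<close> on \<open>U\<close>; \<open>t\<close> may be negative.\<close>

definition flows_to ::
    "vfield \<Rightarrow> (real \<times> real) set \<Rightarrow> real \<Rightarrow> real \<times> real \<Rightarrow> real \<times> real \<Rightarrow> bool" where
  "flows_to X U t p q \<longleftrightarrow>
     (\<exists>\<gamma>. integral_curve X U \<gamma> (closed_segment 0 t) \<and> \<gamma> 0 = p \<and> \<gamma> t = q)"

definition lie_derivative :: "vfield \<Rightarrow> (real \<times> real \<Rightarrow> real) \<Rightarrow> real \<times> real \<Rightarrow> real" where
  "lie_derivative X h p = frechet_derivative h (at p) (X p)"

datatype side = Lft | Rgt

text \<open>The switching function is \<open>h(x, y) = x\<close>, that is \<open>fst\<close>.\<close>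

definition monodromic_tangential :: "(side \<Rightarrow> vfield) \<Rightarrow> (side \<Rightarrow> nat) \<Rightarrow> bool" where
  "monodromic_tangential X k \<longleftrightarrow>
     (\<forall>J. k J \<ge> 1) \<and>
     (\<forall>J. \<forall>i\<in>{1..2 * k J - 1}. (lie_derivative (X J) ^^ i) fst (0, 0) = 0) \<and>
     (lie_derivative (X Rgt) ^^ (2 * k Rgt)) fst (0, 0) < 0 \<and>
     (lie_derivative (X Lft) ^^ (2 * k Lft)) fst (0, 0) > 0 \<and>
     (\<exists>l<0. X Lft (0, 0) = l *\<^sub>R X Rgt (0, 0))"

text \<open>\<open>T\<close> is the analytic nontrivial return time to \<open>x = 0\<close> and \<open>P\<close> the half-return map.
  At a monodromic tangential singularity both are determined as germs at \<open>y = 0\<close>, and for one sign of \<open>y\<close>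
  the time \<open>T y\<close> is negative.\<close>

definition half_return :: "vfield \<Rightarrow> (real \<times> real) set \<Rightarrow> (real \<Rightarrow> real) \<Rightarrow> (real \<Rightarrow> real) \<Rightarrow> bool" where
  "half_return X U T P \<longleftrightarrow>
     (\<exists>c. has_power_series c T) \<and>
     (\<lambda>y. T y + 2 / snd (X (0, 0)) * y) \<in> O[at 0](\<lambda>y. y ^ 2) \<and>
     (\<forall>\<^sub>F y in nhds 0. flows_to X U (T y) (0, y) (0, P y))"

definition half_return_coeff :: "vfield \<Rightarrow> (real \<times> real) set \<Rightarrow> nat \<Rightarrow> real" where
  "half_return_coeff X U = (THE \<alpha>. \<exists>T P. half_return X U T P \<and> has_power_series \<alpha> P)"

definition orientation :: "(side \<Rightarrow> vfield) \<Rightarrow> real" where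
  "orientation X = sgn (snd (X Rgt (0, 0)))"

definition lyapunov_coeff :: "(side \<Rightarrow> vfield) \<Rightarrow> (real \<times> real) set \<Rightarrow> nat \<Rightarrow> real" where
  "lyapunov_coeff X U i =
     orientation X * (half_return_coeff (X Rgt) U i - half_return_coeff (X Lft) U i)"

text \<open>\<open>m t\<close> is the vector field active at time \<open>t\<close>. It is forced to be \<open>X Rgt\<close> on
  \<open>x \<ge> \<mu>\<close> and \<open>X Lft\<close> on \<open>x \<le> -\<mu>\<close>, and it persists as long as the orbit stays in the open
  strip. Hence a switch from \<open>X Rgt\<close> to \<open>X Lft\<close> occurs exactly when \<open>x = -\<mu>\<close> is reached, and
  conversely at \<open>x = \<mu>\<close>. By continuity of \<open>\<gamma>\<close>, \<open>m\<close> is constant on some \<open>{t..<t'}\<close> for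
  each \<open>t\<close>. At switching times \<open>\<gamma>\<close> has one-sided derivatives only.\<close>

definition hysteretic_trajectory ::
    "(side \<Rightarrow> vfield) \<Rightarrow> (real \<times> real) set \<Rightarrow> real \<Rightarrow> (real \<Rightarrow> real \<times> real) \<Rightarrow> (real \<Rightarrow> side) \<Rightarrow> bool" where
  "hysteretic_trajectory X U \<mu> \<gamma> m \<longleftrightarrow>
     continuous_on UNIV \<gamma> \<and>
     (\<forall>t. (fst (\<gamma> t) \<ge> \<mu> \<longrightarrow> m t = Rgt) \<and> (fst (\<gamma> t) \<le> - \<mu> \<longrightarrow> m t = Lft)) \<and>
     (\<forall>s t. s \<le> t \<and> (\<forall>r\<in>{s<..t}. - \<mu> < fst (\<gamma> r) \<and> fst (\<gamma> r) < \<mu>) \<longrightarrow> m t = m s) \<and>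
     (\<forall>J s t. s < t \<and> (\<forall>r\<in>{s..<t}. m r = J) \<longrightarrow> integral_curve (X J) U \<gamma> {s..t})"

text \<open>\<open>T\<close> is the least positive period, so constant trajectories are excluded.\<close>

definition hysteretic_periodic_orbit ::
    "(side \<Rightarrow> vfield) \<Rightarrow> (real \<times> real) set \<Rightarrow> real \<Rightarrow> real \<Rightarrow> (real \<times> real) set \<Rightarrow> bool" where
  "hysteretic_periodic_orbit X U \<mu> T \<Gamma> \<longleftrightarrow>
     (\<exists>\<gamma> m. hysteretic_trajectory X U \<mu> \<gamma> m \<and> \<Gamma> = range \<gamma> \<and> T > 0 \<and>
        (\<forall>t. \<gamma> (t + T) = \<gamma> t \<and> m (t + T) = m t) \<and>
        (\<forall>T'. 0 < T' \<and> T' < T \<longrightarrow> \<not> (\<forall>t. \<gamma> (t + T') = \<gamma> t \<and> m (t + T') = m t)))"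

text \<open>The orbit of \<open>p\<close> reaches the line \<open>x = c\<close> for the first time, and it does so at \<open>q\<close>.\<close>

definition first_hit ::
    "vfield \<Rightarrow> (real \<times> real) set \<Rightarrow> real \<Rightarrow> real \<times> real \<Rightarrow> real \<times> real \<Rightarrow> bool" where
  "first_hit X U c p q \<longleftrightarrow>
     (\<exists>\<gamma> \<tau>. \<tau> > 0 \<and> integral_curve X U \<gamma> {0..\<tau>} \<and> \<gamma> 0 = p \<and> \<gamma> \<tau> = q \<and>
        fst q = c \<and> (\<forall>t\<in>{0..<\<tau>}. fst (\<gamma> t) \<noteq> c))"

text \<open>Graph of the first-return map on \<open>x = \<mu>\<close>: a full cycle consisting of one \<open>X Rgt\<close> phase
  and one \<open>X Lft\<close> phase. The crossing of \<open>x = \<mu>\<close> during the \<open>X Rgt\<close> phase, on the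
  way to \<open>x = -\<mu>\<close>, is not a return.\<close>

definition hysteretic_return ::
    "(side \<Rightarrow> vfield) \<Rightarrow> (real \<times> real) set \<Rightarrow> real \<Rightarrow> real \<Rightarrow> real \<Rightarrow> bool" where
  "hysteretic_return X U \<mu> y y' \<longleftrightarrow>
     (\<exists>z. first_hit (X Rgt) U (- \<mu>) (\<mu>, y) (- \<mu>, z) \<and> first_hit (X Lft) U \<mu> (- \<mu>, z) (\<mu>, y'))"

definition hyperbolic_attracting_limit_cycle ::
    "(side \<Rightarrow> vfield) \<Rightarrow> (real \<times> real) set \<Rightarrow> real \<Rightarrow> (real \<times> real) set \<Rightarrow> bool" where
  "hyperbolic_attracting_limit_cycle X U \<mu> \<Gamma> \<longleftrightarrow>
     (\<exists>T. hysteretic_periodic_orbit X U \<mu> T \<Gamma>) \<and>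
     (\<exists>W. open W \<and> \<Gamma> \<subseteq> W \<and>
        (\<forall>T' \<Gamma>'. hysteretic_periodic_orbit X U \<mu> T' \<Gamma>' \<and> \<Gamma>' \<subseteq> W \<longrightarrow> \<Gamma>' = \<Gamma>)) \<and>
     (\<exists>y \<rho> D. (\<mu>, y) \<in> \<Gamma> \<and> \<rho> y = y \<and>
        (\<forall>\<^sub>F z in nhds y. hysteretic_return X U \<mu> z (\<rho> z)) \<and>
        (\<rho> has_real_derivative D) (at y) \<and> \<bar>D\<bar> < 1)"

definition section_h :: "real \<Rightarrow> nat \<Rightarrow> real \<Rightarrow> real \<Rightarrow> (real \<times> real) set" where
  "section_h \<delta> kM \<mu> \<epsilon> =
     {(x, y). x = \<mu> \<and> - \<epsilon> < y \<and> y < \<epsilon> \<and> \<bar>y\<bar> powr (2 * real kM + 1 / 2) > \<mu> \<and> \<delta> * y < 0}"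

definition eta_h :: "(side \<Rightarrow> nat \<Rightarrow> nat \<Rightarrow> real) \<Rightarrow> (side \<Rightarrow> nat \<Rightarrow> nat \<Rightarrow> real) \<Rightarrow> (side \<Rightarrow> nat) \<Rightarrow> side \<Rightarrow> real" where
  "eta_h a b k J = 2 * b J 0 0 / a J 0 (2 * k J - 1)"

definition kappa_h :: "(side \<Rightarrow> nat \<Rightarrow> nat \<Rightarrow> real) \<Rightarrow> (side \<Rightarrow> nat \<Rightarrow> nat \<Rightarrow> real) \<Rightarrow> (side \<Rightarrow> nat) \<Rightarrow> real" where
  "kappa_h a b k =
     (if k Lft > k Rgt then - eta_h a b k Lft
      else if k Lft = k Rgt then eta_h a b k Rgt - eta_h a b k Lft
      else eta_h a b k Rgt)"

end

theory Submission
  imports Defs "HOL-Complex_Analysis.Complex_Analysis"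
begin

text \<open>A flow box at the tangency carries an analytic first integral \<open>H\<close> and a time function \<open>W\<close>. The
  level sets of \<open>H\<close> describe the half-return map to \<open>x = 0\<close> as well as the passage from \<open>x = mu\<close> to
  \<open>x = -mu\<close>, which is a perturbation of the half-return map by \<open>mu / (k c p^(2k - 1))\<close> to leading order. Fixed points
  of the return map are thus the zeros of a function behaving like \<open>V p^(2n) + |\<kappa>| mu / p^(2 k\<^sub>M - 1)\<close>, which
  balances at \<open>p^N \<approx> |\<kappa> / V| mu\<close>. Convexity of \<open>H\<close> on \<open>x = 0\<close> shows that shifting both sections by
  \<open>mu\<close> decreases the derivative of the displacement, so the zero is unique and attracting
  on the whole section. For \<open>V > 0\<close> the level of \<open>H\<close> at successive arrivals, followed backwards in time, would decrease by at
  least \<open>3 mu / 2\<close> per turn, which is impossible for a periodic orbit.\<close>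

section \<open>Power series and analytic functions of two variables\<close>

text \<open>The width of the section shapes the proof. With k the larger contact index it reaches
  down to p of order mu^(2 / (4 k + 1)), whereas the periodic orbit sits at p of order mu^(1 / N), N
  \<ge> 2 k + 1. The expansion of a passage is proved only for mu = O(p^(2 k + 1)): it locates one
  zero, but is silent on the lower end of the section. Uniqueness and the multiplier therefore rest
  on inequalities between derivatives that need only mu \<le> c p^(2 k); the spare factor sqrt p in
  the section condition absorbs the constants. A second obstacle is that a periodic orbit may turn
  several times before it closes, and is not known to stay near the origin. For V < 0 the return map
  would push its point nearest to the fixed point strictly closer. For V > 0 the forward orbit may
  escape, so it is followed backwards, where level sets confine it. Finally
  \<open>half_return_coeff\<close> is a definite description over analytic germs, so the half-return
  map must be produced as an analytic function and shown to be the only candidate.\<close>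

definition sephol :: "real \<Rightarrow> (complex \<Rightarrow> complex \<Rightarrow> complex) \<Rightarrow> bool" where
  "sephol R F \<longleftrightarrow> (\<forall>y\<in>ball 0 R. (%x. F x y) holomorphic_on ball 0 R) \<and>
     (\<forall>x\<in>ball 0 R. F x holomorphic_on ball 0 R) \<and>
     (\<exists>M. \<forall>x\<in>ball 0 R. \<forall>y\<in>ball 0 R. norm (F x y) \<le> M)"

lemma sephol_swap: "sephol R F ==> sephol R (%x y. F y x)"
  unfolding sephol_def by blast

lemma sephol_mono: "sephol R F ==> R' \<le> R ==> sephol R' F"
  unfolding sephol_def
  by (smt (verit, best) holomorphic_on_subset subset_ball subset_iff)

lemma sephol_mult: assumes "sephol R F" "sephol R G" shows "sephol R (%x y. F x y * G x y)"
proof -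
  obtain M N where M: "\<forall>x\<in>ball 0 R. \<forall>y\<in>ball 0 R. norm (F x y) \<le> M"
    and N: "\<forall>x\<in>ball 0 R. \<forall>y\<in>ball 0 R. norm (G x y) \<le> N"
    using assms unfolding sephol_def by blast
  have "\<forall>x\<in>ball 0 R. \<forall>y\<in>ball 0 R. norm (F x y * G x y) \<le> M * N"
    using M N by (auto simp: norm_mult intro!: mult_mono order_trans[OF norm_ge_zero])
  then show ?thesis using assms unfolding sephol_def by (auto intro!: holomorphic_intros)
qed

lemma sephol_add: assumes "sephol R F" "sephol R G" shows "sephol R (%x y. F x y + G x y)"
proof -
  obtain M N where M: "\<forall>x\<in>ball 0 R. \<forall>y\<in>ball 0 R. norm (F x y) \<le> M"
    and N: "\<forall>x\<in>ball 0 R. \<forall>y\<in>ball 0 R. norm (G x y) \<le> N"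
    using assms unfolding sephol_def by blast
  have "\<forall>x\<in>ball 0 R. \<forall>y\<in>ball 0 R. norm (F x y + G x y) \<le> M + N"
    using M N by (meson add_mono norm_triangle_le order_trans)
  then show ?thesis using assms unfolding sephol_def by (auto intro!: holomorphic_intros)
qed

section \<open>Cauchy estimates, uniform in a second variable\<close>

lemma deriv_bound_ball:
  assumes f: "f holomorphic_on ball 0 R" and M: "!!w. w \<in> ball 0 R ==> norm (f w) \<le> M"
    and d: "d > 0" "norm x + d < R"
  shows "norm ((deriv ^^ n) f x) \<le> fact n * M / d ^ n"
proof (rule Cauchy_inequality)
  have sub: "cball x d \<subseteq> ball 0 R"
  proof
    fix w assume "w \<in> cball x d"
    then have "norm (w - x) \<le> d" by (simp add: dist_norm norm_minus_commute)
    moreover have "norm w \<le> norm x + norm (w - x)" by (metis add.commute diff_add_cancel norm_triangle_ineq)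
    ultimately show "w \<in> ball 0 R" using d by simp
  qed
  show "f holomorphic_on ball x d" using f sub holomorphic_on_subset ball_subset_cball by blast
  show "continuous_on (cball x d) f" using f sub holomorphic_on_imp_continuous_on holomorphic_on_subset by blast
  show "norm (f w) \<le> M" if "norm (x - w) = d" for w
    using that sub by (intro M) (auto simp: dist_norm subset_iff)
qed (use d in auto)

lemma holomorphic_ball_derivs:
  assumes f: "f holomorphic_on ball 0 R" and x: "x \<in> ball 0 R"
  shows "(f has_field_derivative deriv f x) (at x)"
  using f x by (meson holomorphic_derivI open_ball)

lemma holomorphic_lipschitz_ball:
  assumes f: "f holomorphic_on ball 0 R" and M: "!!w. w \<in> ball 0 R ==> norm (f w) \<le> M"
    and d: "d > 0" "R' + d \<le> R" "x \<in> ball 0 R'" "x' \<in> ball 0 R'"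
  shows "norm (f x - f x') \<le> M / d * norm (x - x')"
proof (rule field_differentiable_bound[where S="ball 0 R'" and f'="deriv f"])
  show "(f has_field_derivative deriv f z) (at z within ball 0 R')" if "z \<in> ball 0 R'" for z
    using holomorphic_ball_derivs[OF f, of z] that d by (simp add: has_field_derivative_at_within)
  show "norm (deriv f z) \<le> M / d" if "z \<in> ball 0 R'" for z
    using deriv_bound_ball[OF f M, of d z 1] that d by simp
qed (use d in auto)

text \<open>The mean value inequality is applied twice, to \<open>deriv f\<close> and then to f(z) -
  z f'(x). The constant involves only the bound of \<open>f\<close> and the distance to the
  boundary, so in the presence of a second variable the difference quotients converge uniformly in
  it.\<close>

lemma holomorphic_quotient_bound:
  assumes f: "f holomorphic_on ball 0 R" and M: "!!w. w \<in> ball 0 R ==> norm (f w) \<le> M"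
    and d: "d > 0" "norm x + norm h + d < R"
  shows "norm (f (x + h) - f x - h * deriv f x) \<le> 2 * M / d^2 * (norm h)\<^sup>2"
proof -
  let ?S = "cball x (norm h)"
  have sub: "norm z + d < R" if "z \<in> ?S" for z
  proof -
    have "norm z \<le> norm x + norm (z - x)" by (metis add.commute diff_add_cancel norm_triangle_ineq)
    then show ?thesis using that d by (simp add: dist_norm norm_minus_commute)
  qed
  have in_ball: "z \<in> ball 0 R" if "z \<in> ?S" for z using sub[OF that] d by simp
  have df: "deriv f holomorphic_on ball 0 R" using f by (simp add: holomorphic_deriv)
  have b2: "norm (deriv (deriv f) z) \<le> 2 * M / d^2" if "z \<in> ?S" for z
    using deriv_bound_ball[OF f M, of d z 2] sub[OF that] d(1) by (simp add: numeral_2_eq_2)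
  have b1: "norm (deriv f z - deriv f x) \<le> 2 * M / d^2 * norm h" if z: "z \<in> ?S" for z
  proof -
    have "norm (deriv f z - deriv f x) \<le> 2 * M / d^2 * norm (z - x)"
      by (rule field_differentiable_bound[where S="?S" and f'="deriv (deriv f)"])
        (use z b2 in_ball in \<open>auto intro!: has_field_derivative_at_within holomorphic_ball_derivs[OF df]\<close>)
    also have "\<dots> \<le> 2 * M / d^2 * norm h"
    proof (rule mult_left_mono)
      show "0 \<le> 2 * M / d\<^sup>2" by (rule order_trans[OF norm_ge_zero b2[of x]]) simp
    qed (use z in \<open>simp add: dist_norm norm_minus_commute\<close>)
    finally show ?thesis .
  qed
  have "norm ((f (x + h) - (x + h) * deriv f x) - (f x - x * deriv f x)) \<le> (2 * M / d^2 * norm h) * norm ((x + h) - x)"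
  proof (rule field_differentiable_bound[where S="?S" and f'="%z. deriv f z - deriv f x"])
    show "((%z. f z - z * deriv f x) has_field_derivative deriv f z - deriv f x) (at z within ?S)" if "z \<in> ?S" for z
    proof (rule has_field_derivative_at_within)
      show "((%z. f z - z * deriv f x) has_field_derivative deriv f z - deriv f x) (at z)"
        using DERIV_diff[OF holomorphic_ball_derivs[OF f in_ball[OF that]] DERIV_cmult_Id[of "deriv f x" z]]
        by (simp add: mult.commute)
    qed
    show "norm (deriv f z - deriv f x) \<le> 2 * M / d^2 * norm h" if "z \<in> ?S" for z by (rule b1[OF that])
  qed (simp_all add: dist_norm)
  then show ?thesis by (simp add: algebra_simps power2_eq_square)
qed

text \<open>Holomorphy of the x-derivative in the other variable \<open>y\<close> is the only issue:
  difference quotients in \<open>x\<close> are holomorphic in \<open>y\<close> and converge locally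
  uniformly by \<open>holomorphic_quotient_bound\<close>.\<close>

lemma sephol_deriv1:
  assumes F: "sephol R F" and R': "R' < R"
  shows "sephol R' (%x y. deriv (%w. F w y) x)"
proof -
  from F obtain M where h1: "!!y. y\<in>ball 0 R ==> (%x. F x y) holomorphic_on ball 0 R"
    and h2: "!!x. x\<in>ball 0 R ==> F x holomorphic_on ball 0 R"
    and M: "!!x y. x\<in>ball 0 R ==> y\<in>ball 0 R ==> norm (F x y) \<le> M"
    unfolding sephol_def by metis
  \<comment> \<open>One \<open>d\<close> is room for the increment of the difference quotient and
    one for the Cauchy radius; a third keeps the inequality strict.\<close>
  define d where "d = (R - R') / 3"
  have d: "d > 0" "R' + d + d < R" using R' unfolding d_def by (auto simp: field_simps)
  have "(%y. deriv (%w. F w y) x) holomorphic_on ball 0 R'" if x: "x \<in> ball 0 R'" for x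
  proof (rule holomorphic_uniform_sequence[where f="%n y. (F (x + of_real (d / real (Suc n))) y - F x y) / of_real (d / real (Suc n))"])
    have nh: "norm (complex_of_real (d / real (Suc n))) \<le> d" for n
    proof -
      have "d / real (Suc n) \<le> d / 1" using d by (intro divide_left_mono) auto
      then show ?thesis using d by (simp only: norm_of_real) simp
    qed
    have xin: "x + of_real (d / real (Suc n)) \<in> ball 0 R" for n
    proof -
      have "norm (x + of_real (d / real (Suc n))) \<le> norm x + d"
        using nh[of n] by (meson add_left_mono norm_triangle_le)
      then show ?thesis using x d by simp
    qed
    show "(%y. (F (x + of_real (d / real (Suc n))) y - F x y) / of_real (d / real (Suc n))) holomorphic_on ball 0 R'" for n
      using x d by (intro holomorphic_intros holomorphic_on_subset[OF h2[OF xin[of n]]] holomorphic_on_subset[OF h2]) auto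
    fix y :: complex assume y: "y \<in> ball 0 R'"
    obtain e where e: "e > 0" "cball y e \<subseteq> ball 0 R'"
      using y open_contains_cball by (meson open_ball)
    have est: "norm ((F (x + of_real (d / real (Suc n))) z - F x z) / of_real (d / real (Suc n)) - deriv (%w. F w z) x) \<le> 2 * M / d * inverse (real (Suc n))"
      if z: "z \<in> cball y e" for n z
    proof -
      let ?h = "complex_of_real (d / real (Suc n))"
      have zR: "z \<in> ball 0 R" using z e R' by auto
      have h0: "?h \<noteq> 0" "norm ?h = d / real (Suc n)"
        using d by (simp_all only: norm_of_real of_real_eq_0_iff abs_of_nonneg) auto
      have "norm (F (x + ?h) z - F x z - ?h * deriv (%w. F w z) x) \<le> 2 * M / d^2 * (norm ?h)\<^sup>2"
        by (rule holomorphic_quotient_bound[OF h1[OF zR]]) (use M zR d x nh[of n] in auto)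
      then have "norm (F (x + ?h) z - F x z - ?h * deriv (%w. F w z) x) / norm ?h \<le> 2 * M / d^2 * norm ?h"
        using h0 d by (subst pos_divide_le_eq) (simp_all add: power2_eq_square del: norm_of_real of_real_divide)
      moreover have "(F (x + ?h) z - F x z) / ?h - deriv (%w. F w z) x = (F (x + ?h) z - F x z - ?h * deriv (%w. F w z) x) / ?h"
        using nonzero_mult_div_cancel_left[OF h0(1), of "deriv (%w. F w z) x"] by (simp only: diff_divide_distrib)
      ultimately have "norm ((F (x + ?h) z - F x z) / ?h - deriv (%w. F w z) x) \<le> 2 * M / d^2 * norm ?h"
        by (simp only: norm_divide)
      also have "2 * M / d^2 * norm ?h = 2 * M / d * inverse (real (Suc n))"
        by (subst h0(2)) (use d in \<open>simp add: power2_eq_square field_simps del: of_nat_Suc\<close>)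
      finally show ?thesis .
    qed
    have "uniform_limit (cball y e) (%n y. (F (x + of_real (d / real (Suc n))) y - F x y) / of_real (d / real (Suc n)))
        (%y. deriv (%w. F w y) x) sequentially"
    proof (rule uniform_limitI)
      fix eps :: real assume "eps > 0"
      have "(%n. 2 * M / d * inverse (real (Suc n))) \<longlonglongrightarrow> 2 * M / d * 0"
        by (intro tendsto_intros LIMSEQ_inverse_real_of_nat)
      then have "\<forall>\<^sub>F n in sequentially. 2 * M / d * inverse (real (Suc n)) < eps"
        using \<open>eps > 0\<close> by (auto dest: order_tendstoD(2))
      then show "\<forall>\<^sub>F n in sequentially. \<forall>z\<in>cball y e. dist ((F (x + of_real (d / real (Suc n))) z - F x z) / of_real (d / real (Suc n))) (deriv (%w. F w z) x) < eps"
        unfolding dist_norm by eventually_elim (blast intro: order.strict_trans1[OF est])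
    qed
    then show "\<exists>e>0. cball y e \<subseteq> ball 0 R' \<and> uniform_limit (cball y e) (%n y. (F (x + of_real (d / real (Suc n))) y - F x y) / of_real (d / real (Suc n)))
        (%y. deriv (%w. F w y) x) sequentially" using e by blast
  qed auto
  moreover have "(%x. deriv (%w. F w y) x) holomorphic_on ball 0 R'" if "y \<in> ball 0 R'" for y
    using h1[of y] that R' holomorphic_deriv holomorphic_on_subset[OF _ subset_ball[of R' R]] by fastforce
  moreover have "norm (deriv (%w. F w y) x) \<le> M / d" if "x \<in> ball 0 R'" "y \<in> ball 0 R'" for x y
    using deriv_bound_ball[OF h1, of y M d x 1] M that d R' by auto
  ultimately show ?thesis unfolding sephol_def by blast
qed

lemma sephol_deriv2:
  assumes F: "sephol R F" and R': "R' < R"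
  shows "sephol R' (%x y. deriv (F x) y)"
  using sephol_swap[OF sephol_deriv1[OF sephol_swap[OF F] R']] by simp

text \<open>No theorem of Hartogs type is involved: the common bound \<open>M\<close> turns the
  Cauchy estimate in each variable into a Lipschitz constant independent of the other
  variable.\<close>

lemma sephol_lipschitz:
  assumes F: "sephol R F" and R': "R' < R"
  obtains C where "C \<ge> 0" "!!x y x' y'. [|x \<in> ball 0 R'; y \<in> ball 0 R'; x' \<in> ball 0 R'; y' \<in> ball 0 R'|] ==>
      norm (F x y - F x' y') \<le> C * (norm (x - x') + norm (y - y'))"
proof -
  from F obtain M where h1: "!!y. y\<in>ball 0 R ==> (%x. F x y) holomorphic_on ball 0 R"
    and h2: "!!x. x\<in>ball 0 R ==> F x holomorphic_on ball 0 R"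
    and M: "!!x y. x\<in>ball 0 R ==> y\<in>ball 0 R ==> norm (F x y) \<le> M"
    unfolding sephol_def by metis
  define d where "d = R - R'"
  have d: "d > 0" using R' by (simp add: d_def)
  have M': "norm (F x y) \<le> \<bar>M\<bar>" if "x\<in>ball 0 R" "y\<in>ball 0 R" for x y
    using M[OF that] by linarith
  have "norm (F x y - F x' y') \<le> \<bar>M\<bar> / d * (norm (x - x') + norm (y - y'))"
    if *: "x \<in> ball 0 R'" "y \<in> ball 0 R'" "x' \<in> ball 0 R'" "y' \<in> ball 0 R'" for x y x' y'
  proof -
    have "norm (F x y - F x' y) \<le> \<bar>M\<bar> / d * norm (x - x')"
      by (rule holomorphic_lipschitz_ball[OF h1 M' d _ *(1,3)]) (use * R' in \<open>auto simp: d_def\<close>)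
    moreover have "norm (F x' y - F x' y') \<le> \<bar>M\<bar> / d * norm (y - y')"
      by (rule holomorphic_lipschitz_ball[OF h2 M' d _ *(2,4)]) (use * R' in \<open>auto simp: d_def\<close>)
    ultimately show ?thesis
      using norm_triangle_ineq[of "F x y - F x' y" "F x' y - F x' y'"] by (simp add: algebra_simps)
  qed
  then show thesis using that[of "\<bar>M\<bar> / d"] d by simp
qed

text \<open>Analyticity at the origin, encoded by a bounded complex extension. In this form it
  passes to partial derivatives by Cauchy estimates and to the axis x = 0 by restriction.\<close>

definition an2 :: "(real \<times> real \<Rightarrow> real) \<Rightarrow> bool" where
  "an2 f \<longleftrightarrow> (\<exists>R>0. \<exists>F. sephol R F \<and>
      (\<forall>x y. \<bar>x\<bar> < R \<and> \<bar>y\<bar> < R \<longrightarrow> F (of_real x) (of_real y) = of_real (f (x, y))))"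

lemma an2_cong:
  assumes "an2 f" "r > 0" "!!x y. \<bar>x\<bar> < r ==> \<bar>y\<bar> < r ==> g (x, y) = f (x, y)"
  shows "an2 g"
proof -
  obtain R F where "R > 0" "sephol R F" "!!x y. \<bar>x\<bar> < R \<and> \<bar>y\<bar> < R ==> F (of_real x) (of_real y) = of_real (f (x, y))"
    using assms(1) unfolding an2_def by blast
  then show ?thesis unfolding an2_def using assms(2,3)
    by (intro exI[of _ "min R r"] conjI exI[of _ F]) (auto intro: sephol_mono)
qed

lemma an2_binop:
  assumes "an2 f" "an2 g"
    and "!!R F G. sephol R F ==> sephol R G ==> sephol R (%x y. op (F x y) (G x y))"
    and "!!x y. op (complex_of_real x) (of_real y) = of_real (opr x y)"
  shows "an2 (%p. opr (f p) (g p))"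
proof -
  obtain R F where F: "R > 0" "sephol R F" "!!x y. \<bar>x\<bar> < R \<and> \<bar>y\<bar> < R ==> F (of_real x) (of_real y) = of_real (f (x, y))"
    using assms(1) unfolding an2_def by blast
  obtain S G where G: "S > 0" "sephol S G" "!!x y. \<bar>x\<bar> < S \<and> \<bar>y\<bar> < S ==> G (of_real x) (of_real y) = of_real (g (x, y))"
    using assms(2) unfolding an2_def by blast
  show ?thesis unfolding an2_def using F G assms(4)
    by (intro exI[of _ "min R S"] conjI exI[of _ "%x y. op (F x y) (G x y)"] assms(3))
      (auto intro: sephol_mono)
qed

lemma an2_mult: "an2 f ==> an2 g ==> an2 (%p. f p * g p)"
  by (rule an2_binop[where op="(*)"]) (auto intro: sephol_mult)

lemma an2_add: "an2 f ==> an2 g ==> an2 (%p. f p + g p)"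
  by (rule an2_binop[where op="(+)"]) (auto intro: sephol_add)

text \<open>Im F vanishes along the real axis, hence so does the imaginary part of the derivative
  taken along it.\<close>

lemma real_restriction_deriv:
  assumes F: "(F has_field_derivative D) (at (complex_of_real t))" and r: "\<bar>t\<bar> < r"
    and f: "!!t. \<bar>t\<bar> < r ==> F (of_real t) = of_real (f t)"
  shows "(f has_real_derivative Re D) (at t)" "D = of_real (Re D)"
proof -
  have v: "((%x. F (of_real x)) has_vector_derivative D) (at t)"
    using has_vector_derivative_real_field[OF F] by simp
  have S: "open {-r<..<r}" "t \<in> {-r<..<r}" using r by auto
  have "((%x. Re (F (of_real x))) has_vector_derivative Re D) (at t)"
    using v by (rule bounded_linear.has_vector_derivative[OF bounded_linear_Re])
  then have "(f has_vector_derivative Re D) (at t)"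
    by (rule has_vector_derivative_transform_within_open[OF _ S]) (auto simp: f)
  then show "(f has_real_derivative Re D) (at t)"
    by (simp add: has_real_derivative_iff_has_vector_derivative)
  have "((%x. Im (F (of_real x))) has_vector_derivative Im D) (at t)"
    using v by (rule bounded_linear.has_vector_derivative[OF bounded_linear_Im])
  then have "((%x. 0::real) has_vector_derivative Im D) (at t)"
    by (rule has_vector_derivative_transform_within_open[OF _ S]) (auto simp: f)
  moreover have "((%x. 0::real) has_vector_derivative 0) (at t)" by simp
  ultimately have "Im D = 0" using vector_derivative_unique_at by blast
  then show "D = of_real (Re D)" by (simp add: complex_eq_iff)
qed

lemma an2_lipschitz:
  assumes "an2 f"
  obtains R C where "R > 0" "C \<ge> 0" "!!x y x' y'. [|\<bar>x\<bar> < R; \<bar>y\<bar> < R; \<bar>x'\<bar> < R; \<bar>y'\<bar> < R|] ==>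
     \<bar>f (x, y) - f (x', y')\<bar> \<le> C * (\<bar>x - x'\<bar> + \<bar>y - y'\<bar>)"
proof -
  obtain R F where F: "R > 0" "sephol R F" "!!x y. \<bar>x\<bar> < R \<and> \<bar>y\<bar> < R ==> F (of_real x) (of_real y) = of_real (f (x, y))"
    using assms(1) unfolding an2_def by blast
  obtain C where C: "C \<ge> 0" "!!x y x' y'. [|x \<in> ball 0 (R/2); y \<in> ball 0 (R/2); x' \<in> ball 0 (R/2); y' \<in> ball 0 (R/2)|] ==>
      norm (F x y - F x' y') \<le> C * (norm (x - x') + norm (y - y'))"
    by (rule sephol_lipschitz[OF F(2), of "R/2"]) (use F(1) in auto)
  show thesis
  proof (rule that[of "R/2" C])
    fix x y x' y' :: real assume *: "\<bar>x\<bar> < R/2" "\<bar>y\<bar> < R/2" "\<bar>x'\<bar> < R/2" "\<bar>y'\<bar> < R/2"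
    then have "norm (complex_of_real (f (x, y)) - of_real (f (x', y'))) \<le> C * (\<bar>x - x'\<bar> + \<bar>y - y'\<bar>)"
      using C(2)[of "of_real x" "of_real y" "of_real x'" "of_real y'"] F(1)
      by (subst (1 2) F(3)[symmetric]) (auto simp flip: of_real_diff)
    then show "\<bar>f (x, y) - f (x', y')\<bar> \<le> C * (\<bar>x - x'\<bar> + \<bar>y - y'\<bar>)"
      by (simp flip: of_real_diff)
  qed (use F C in auto)
qed

text \<open>Total differentiability follows from the partial derivatives once one of them is jointly
  continuous. Here that is \<open>fy\<close>, which is again in the class and hence
  Lipschitz.\<close>

lemma an2_deriv:
  assumes "an2 f"
  obtains R fx fy where "R > 0" "an2 fx" "an2 fy"
    "!!x y. \<bar>x\<bar> < R ==> \<bar>y\<bar> < R ==>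
       (f has_derivative (%h. fx (x, y) * fst h + fy (x, y) * snd h)) (at (x, y))"
proof -
  obtain R F where F: "R > 0" "sephol R F" "!!x y. \<bar>x\<bar> < R ==> \<bar>y\<bar> < R ==> F (of_real x) (of_real y) = of_real (f (x, y))"
    using assms(1) unfolding an2_def by blast
  define fx where "fx = (%(x, y). Re (deriv (%w. F w (of_real y)) (of_real x)))"
  define fy where "fy = (%(x, y). Re (deriv (F (of_real x)) (of_real y)))"
  have hol: "!!y. y\<in>ball 0 R ==> (%x. F x y) holomorphic_on ball 0 R" "!!x. x\<in>ball 0 R ==> F x holomorphic_on ball 0 R"
    using F(2) unfolding sephol_def by auto
  have dx: "((%t. f (t, y)) has_real_derivative fx (x, y)) (at x)"
      "deriv (%w. F w (of_real y)) (of_real x) = of_real (fx (x, y))" if "\<bar>x\<bar> < R" "\<bar>y\<bar> < R" for x y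
    using real_restriction_deriv[OF holomorphic_ball_derivs[OF hol(1)[of "of_real y"], of "of_real x"] that(1), of "%t. f (t, y)"]
      that F(3) by (auto simp: fx_def)
  have dy: "((%t. f (x, t)) has_real_derivative fy (x, y)) (at y)"
      "deriv (F (of_real x)) (of_real y) = of_real (fy (x, y))" if "\<bar>x\<bar> < R" "\<bar>y\<bar> < R" for x y
    using real_restriction_deriv[OF holomorphic_ball_derivs[OF hol(2)[of "of_real x"], of "of_real y"] that(2), of "%t. f (x, t)"]
      that F(3) by (auto simp: fy_def)
  have fx: "an2 fx" unfolding an2_def
    by (rule exI[of _ "R/2"], intro conjI exI[of _ "%x y. deriv (%w. F w y) x"] sephol_deriv1[OF F(2)])
       (use F(1) dx in auto)
  have fy: "an2 fy" unfolding an2_def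
    by (rule exI[of _ "R/2"], intro conjI exI[of _ "%x y. deriv (F x) y"] sephol_deriv2[OF F(2)])
       (use F(1) dy in auto)
  obtain S C where C: "S > 0" "C \<ge> 0" "!!x y x' y'. [|\<bar>x\<bar> < S; \<bar>y\<bar> < S; \<bar>x'\<bar> < S; \<bar>y'\<bar> < S|] ==>
     \<bar>fy (x, y) - fy (x', y')\<bar> \<le> C * (\<bar>x - x'\<bar> + \<bar>y - y'\<bar>)"
    using an2_lipschitz[OF fy] by blast
  define r where "r = min R S"
  have r: "r > 0" "r \<le> R" "r \<le> S" using F(1) C(1) by (auto simp: r_def)
  show thesis
  proof (rule that[OF r(1) fx fy])
    fix x y assume xy: "\<bar>x\<bar> < r" "\<bar>y\<bar> < r"
    let ?I = "{-r<..<r}"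
    have xyI: "x \<in> ?I" "y \<in> ?I" using xy by auto
    have "continuous_on (?I \<times> ?I) fy"
      unfolding continuous_on_iff
    proof (intro ballI allI impI)
      fix p and e :: real assume p: "p \<in> ?I \<times> ?I" and e: "e > 0"
      show "\<exists>d>0. \<forall>q\<in>?I \<times> ?I. dist q p < d \<longrightarrow> dist (fy q) (fy p) < e"
      proof (intro exI[of _ "e / (2 * (C + 1))"] conjI ballI impI)
        fix q assume q: "q \<in> ?I \<times> ?I" and d: "dist q p < e / (2 * (C + 1))"
        have "\<bar>fst q - fst p\<bar> \<le> dist q p" "\<bar>snd q - snd p\<bar> \<le> dist q p"
          using dist_fst_le[of q p] dist_snd_le[of q p] by (auto simp: dist_real_def)
        moreover have "\<bar>fy (fst q, snd q) - fy (fst p, snd p)\<bar> \<le> C * (\<bar>fst q - fst p\<bar> + \<bar>snd q - snd p\<bar>)"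
          by (rule C(3)) (use p q r(3) in \<open>auto simp: mem_Times_iff abs_less_iff\<close>)
        ultimately have "\<bar>fy q - fy p\<bar> \<le> C * (2 * dist q p)"
          using C(2) by (smt (verit) mult_left_mono prod.collapse)
        also have "\<dots> \<le> (C + 1) * (2 * dist q p)" by (intro mult_right_mono) auto
        also have "\<dots> < e" using d C(2) by (simp add: field_simps)
        finally show "dist (fy q) (fy p) < e" by (simp add: dist_real_def)
      qed (use e C(2) in auto)
    qed
    then have cf: "continuous (at (x, y) within ?I \<times> ?I) (%(x, y). blinfun_scaleR_left (fy (x, y)))"
      using xyI unfolding case_prod_unfold prod.collapse
      by (intro bounded_linear.continuous[OF bounded_linear_blinfun_scaleR_left])
        (simp add: continuous_on_eq_continuous_within)
    have "((%(x, y). f (x, y)) has_derivative (%(tx, ty). fx (x, y) * tx + blinfun_scaleR_left (fy (x, y)) ty)) (at (x, y) within ?I \<times> ?I)"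
    proof (rule has_derivative_partialsI)
      show "((%x. f (x, y)) has_derivative (*) (fx (x, y))) (at x within ?I)"
        using dx(1)[of x y] xy r by (auto simp: has_field_derivative_def intro: has_derivative_at_withinI)
      show "((%y. f (x', y)) has_derivative blinfun_apply (blinfun_scaleR_left (fy (x', y')))) (at y' within ?I)"
        if "x' \<in> ?I" "y' \<in> ?I" for x' y'
      proof -
        have "((%y. f (x', y)) has_derivative (*) (fy (x', y'))) (at y')"
          using dy(1)[of x' y'] that r by (auto simp: has_field_derivative_def)
        moreover have "blinfun_apply (blinfun_scaleR_left (fy (x', y'))) = (*) (fy (x', y'))"
          by (auto simp: mult.commute)
        ultimately show ?thesis by (metis has_derivative_at_withinI)
      qed
    qed (use cf xyI in auto)
    then have "(f has_derivative (%h. fx (x, y) * fst h + fy (x, y) * snd h)) (at (x, y) within ?I \<times> ?I)"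
      by (simp add: case_prod_unfold mult.commute)
    then show "(f has_derivative (%h. fx (x, y) * fst h + fy (x, y) * snd h)) (at (x, y))"
      using at_within_open[of "(x, y)" "?I \<times> ?I"] xyI by (simp add: open_Times)
  qed
qed

text \<open>Series in \<open>y\<close> whose coefficients are holomorphic functions of
  \<open>x\<close>, with geometric decay and real values on the real axis. A Cauchy problem with
  data on y = 0 determines its solution in this form, coefficient function by coefficient
  function.\<close>

definition yser :: "real \<Rightarrow> real \<Rightarrow> (nat \<Rightarrow> complex \<Rightarrow> complex) \<Rightarrow> bool" where
  "yser R M h \<longleftrightarrow> R > 0 \<and> (\<forall>j. h j holomorphic_on ball 0 R) \<and>
     (\<forall>j. \<forall>x\<in>ball 0 R. norm (h j x) * R ^ j \<le> M) \<and> (\<forall>j t. \<bar>t\<bar> < R \<longrightarrow> h j (of_real t) \<in> \<real>)"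

lemma yserD:
  assumes "yser R M h"
  shows "R > 0" "h j holomorphic_on ball 0 R" "norm x < R ==> norm (h j x) * R ^ j \<le> M"
    "\<bar>t\<bar> < R ==> h j (of_real t) \<in> \<real>" "M \<ge> 0"
proof -
  show *: "R > 0" "h j holomorphic_on ball 0 R" "norm x < R ==> norm (h j x) * R ^ j \<le> M"
    "\<bar>t\<bar> < R ==> h j (of_real t) \<in> \<real>" for j x t using assms unfolding yser_def by auto
  have "norm (h 0 0) * R ^ 0 \<le> M" using assms *(1) unfolding yser_def by (metis centre_in_ball)
  then have "norm (h 0 0) \<le> M" by simp
  then show "M \<ge> 0" using norm_ge_zero[of "h 0 0"] by linarith
qed

lemma yser_norm_le:
  assumes "yser R M h" "norm x < R" "norm y < R"
  shows "norm (h j x * y ^ j) \<le> M * (norm y / R) ^ j"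
proof -
  note D = yserD[OF assms(1)]
  have "norm (h j x * y ^ j) = (norm (h j x) * R ^ j) * (norm y / R) ^ j"
    using D(1) by (simp add: norm_mult norm_power power_divide)
  also have "\<dots> \<le> M * (norm y / R) ^ j"
    using D(1) D(3)[OF assms(2)] by (intro mult_right_mono) auto
  finally show ?thesis .
qed

lemma yser_abs_summable:
  assumes "yser R M h" "norm x < R" "norm y < R"
  shows "summable (%j. norm (h j x * y ^ j))"
proof (rule summable_comparison_test'[where N=0])
  show "summable (%j. M * (norm y / R) ^ j)"
    using assms(3) yserD(1)[OF assms(1)] by (intro summable_mult summable_geometric) simp
qed (use yser_norm_le[OF assms] in simp)

lemma yser_mono:
  assumes "yser R M h" "0 < R'" "R' \<le> R" "M \<le> M'"
  shows "yser R' M' h"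
proof -
  note D = yserD[OF assms(1)]
  have "norm (h j x) * R' ^ j \<le> M'" if "norm x < R'" for j x
  proof -
    have "norm (h j x) * R' ^ j \<le> norm (h j x) * R ^ j"
      using assms by (intro mult_left_mono power_mono) auto
    then show ?thesis using D(3)[of x j] that assms by linarith
  qed
  then show ?thesis unfolding yser_def using D(2,4) assms(2,3)
    by (auto intro: holomorphic_on_subset[OF _ subset_ball])
qed

lemma yser_deriv_x:
  assumes "yser R M h" "norm x < R" "norm y < R"
  shows "((%x. \<Sum>j. h j x * y ^ j) has_field_derivative (\<Sum>j. deriv (h j) x * y ^ j)) (at x)"
proof -
  note D = yserD[OF assms(1)]
  have "\<exists>g g'. \<forall>x\<in>ball 0 R. ((%j. h j x * y ^ j) sums g x) \<and> ((%j. deriv (h j) x * y ^ j) sums g' x) \<and>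
     (g has_field_derivative g' x) (at x)"
  proof (rule series_and_derivative_comparison_complex)
    fix n and x :: complex assume x: "x \<in> ball 0 R"
    show "((%x. h n x * y ^ n) has_field_derivative deriv (h n) x * y ^ n) (at x)"
      by (rule DERIV_cmult_right[OF holomorphic_ball_derivs[OF D(2) x]])
  next
    fix x :: complex assume x: "x \<in> ball 0 R"
    show "\<exists>d q. 0 < d \<and> summable q \<and> range q \<subseteq> \<real>\<^sub>\<ge>\<^sub>0 \<and>
       (\<forall>\<^sub>F n in sequentially. \<forall>z\<in>ball x d \<inter> ball 0 R. cmod (h n z * y ^ n) \<le> cmod (q n))"
    proof (intro exI[of _ 1] exI[of _ "%j. complex_of_real (M * (norm y / R) ^ j)"] conjI)
      show "summable (%j. complex_of_real (M * (norm y / R) ^ j))"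
        using assms(3) D(1) by (intro summable_of_real summable_mult summable_geometric) simp
      show "range (%j. complex_of_real (M * (cmod y / R) ^ j)) \<subseteq> \<real>\<^sub>\<ge>\<^sub>0"
        using D(1,5) by (auto simp: image_subset_iff)
      show "\<forall>\<^sub>F n in sequentially. \<forall>z\<in>ball x 1 \<inter> ball 0 R. cmod (h n z * y ^ n) \<le> cmod (complex_of_real (M * (cmod y / R) ^ n))"
        using yser_norm_le[OF assms(1) _ assms(3)] D(1,5)
        by (intro always_eventually) (auto simp del: of_real_mult of_real_power of_real_divide simp: norm_of_real abs_mult)
    qed simp
  qed simp
  then obtain g g' where g: "!!x. x\<in>ball 0 R ==> (%j. h j x * y ^ j) sums g x"
     "!!x. x\<in>ball 0 R ==> (%j. deriv (h j) x * y ^ j) sums g' x"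
     "!!x. x\<in>ball 0 R ==> (g has_field_derivative g' x) (at x)" by blast
  have x: "x \<in> ball 0 R" using assms by simp
  have "((%x. \<Sum>j. h j x * y ^ j) has_field_derivative g' x) (at x)"
    using has_field_derivative_transform_within_open[OF g(3)[OF x] open_ball x, of "%x. \<Sum>j. h j x * y ^ j"]
      sums_unique[OF g(1)] by blast
  then show ?thesis using sums_unique[OF g(2)[OF x]] by simp
qed

lemma yser_deriv_y:
  assumes "yser R M h" "norm x < R" "norm y < R"
  shows "((%y. \<Sum>j. h j x * y ^ j) has_field_derivative (\<Sum>j. of_nat (Suc j) * h (Suc j) x * y ^ j)) (at y)"
proof -
  obtain r where r: "norm y < r" "r < R" using dense[OF assms(3)] by blast
  have r0: "0 < r" using r norm_ge_zero[of y] by linarith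
  have "summable (%j. h j x * (of_real r) ^ j)"
    by (rule summable_norm_cancel[OF yser_abs_summable[OF assms(1,2)]]) (use r r0 in simp)
  then have "((%y. \<Sum>j. h j x * y ^ j) has_field_derivative (\<Sum>j. diffs (%j. h j x) j * y ^ j)) (at y)"
    by (rule termdiffs_strong) (use r r0 in simp)
  then show ?thesis by (simp add: diffs_def)
qed

text \<open>On the halved radius the terms are dominated by M / 2^j, which supplies the uniform
  bound that \<open>sephol\<close> asks for.\<close>

lemma yser_sephol:
  assumes "yser R M h"
  shows "sephol (R/2) (%x y. \<Sum>j. h j x * y ^ j)"
proof -
  note D = yserD[OF assms(1)]
  have "(%x. \<Sum>j. h j x * y ^ j) holomorphic_on ball 0 (R/2)" if "y \<in> ball 0 (R/2)" for y
    unfolding holomorphic_on_def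
  proof
    fix x :: complex assume "x \<in> ball 0 (R/2)"
    then show "(%x. \<Sum>j. h j x * y ^ j) field_differentiable at x within ball 0 (R/2)"
      using yser_deriv_x[OF assms, of x y] that D(1) field_differentiable_def field_differentiable_at_within by fastforce
  qed
  moreover have "(%y. \<Sum>j. h j x * y ^ j) holomorphic_on ball 0 (R/2)" if "x \<in> ball 0 (R/2)" for x
    unfolding holomorphic_on_def
  proof
    fix y :: complex assume "y \<in> ball 0 (R/2)"
    then show "(%y. \<Sum>j. h j x * y ^ j) field_differentiable at y within ball 0 (R/2)"
      using yser_deriv_y[OF assms, of x y] that D(1) field_differentiable_def field_differentiable_at_within by fastforce
  qed
  moreover have "norm (\<Sum>j. h j x * y ^ j) \<le> (\<Sum>j. M * (1/2) ^ j)" if "x \<in> ball 0 (R/2)" "y \<in> ball 0 (R/2)" for x y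
  proof -
    have xy: "norm x < R" "norm y < R" using that D(1) by auto
    have le: "norm (h j x * y ^ j) \<le> M * (1/2) ^ j" for j
    proof -
      have "(norm y / R) ^ j \<le> (1/2) ^ j" using that D(1) by (intro power_mono) (auto simp: field_simps)
      then show ?thesis using yser_norm_le[OF assms xy, of j] mult_left_mono[OF _ D(5)] order_trans by blast
    qed
    have sm: "summable (%j. M * (1/2::real) ^ j)" by (intro summable_mult summable_geometric) simp
    have "norm (\<Sum>j. h j x * y ^ j) \<le> (\<Sum>j. norm (h j x * y ^ j))"
      by (rule summable_norm[OF yser_abs_summable[OF assms xy]])
    also have "\<dots> \<le> (\<Sum>j. M * (1/2) ^ j)"
      by (rule suminf_le[OF le yser_abs_summable[OF assms xy] sm])
    finally show ?thesis .
  qed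
  ultimately show ?thesis unfolding sephol_def by blast
qed

definition yval :: "(nat \<Rightarrow> complex \<Rightarrow> complex) \<Rightarrow> real \<times> real \<Rightarrow> real" where
  "yval h = (%(x, y). Re (\<Sum>j. h j (of_real x) * of_real y ^ j))"

lemma yval_of_real:
  assumes "yser R M h" "\<bar>x\<bar> < R" "\<bar>y\<bar> < R"
  shows "(\<Sum>j. h j (of_real x) * of_real y ^ j) = of_real (yval h (x, y))"
proof -
  have s: "(%j. h j (of_real x) * of_real y ^ j) sums (\<Sum>j. h j (of_real x) * of_real y ^ j)"
    using yser_abs_summable[OF assms(1), of "of_real x" "of_real y"] assms(2,3)
    by (intro summable_sums summable_norm_cancel[of "%j. h j (of_real x) * of_real y ^ j"]) simp
  have "(%j. Im (h j (of_real x) * of_real y ^ j)) sums Im (\<Sum>j. h j (of_real x) * of_real y ^ j)"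
    by (rule sums_Im[OF s])
  moreover have "Im (h j (of_real x) * of_real y ^ j) = 0" for j
    using yserD(4)[OF assms(1,2), of j] by (simp add: complex_is_Real_iff flip: of_real_power)
  ultimately have "(%j. 0::real) sums Im (\<Sum>j. h j (of_real x) * of_real y ^ j)" by (simp only:)
  then have "Im (\<Sum>j. h j (of_real x) * of_real y ^ j) = 0" using sums_unique2 sums_zero by blast
  then show ?thesis by (simp add: yval_def complex_eq_iff)
qed

lemma yser_an2: assumes "yser R M h" shows "an2 (yval h)"
  unfolding an2_def using yser_sephol[OF assms] yval_of_real[OF assms] yserD(1)[OF assms]
  by (intro exI[of _ "R/2"] conjI exI[of _ "%x y. \<Sum>j. h j x * y ^ j"]) auto

text \<open>A double series is summed over the powers of \<open>x\<close> first. Unconditional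
  summability permits this regrouping and yields the geometric bound on the coefficient
  functions.\<close>

lemma yser_of_power_series2:
  assumes "has_power_series2 c f (0, 0)"
  obtains R M h where "yser R M h" "h 0 0 = of_real (c 0 0)"
    "!!x y. \<bar>x\<bar> < R ==> \<bar>y\<bar> < R ==> f (x, y) = yval h (x, y)"
proof -
  obtain r where r: "r > 0" and hs: "!!u v. \<bar>u\<bar> < r ==> \<bar>v\<bar> < r ==> ((%(i, j). c i j * u ^ i * v ^ j) has_sum f (u, v)) UNIV"
    using assms unfolding has_power_series2_def by auto
  define R where "R = r / 2"
  have R: "R > 0" "R < r" using r by (auto simp: R_def)
  \<comment> \<open>Unconditional convergence at the corner (R, R) is absolute convergence there;
    its total \<open>M\<close> bounds the sum over \<open>i\<close> for every
    \<open>j\<close>.\<close>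
  have as: "(%p. norm ((%(i, j). c i j * R ^ i * R ^ j) p)) summable_on UNIV"
    using hs[of R R] R by (subst summable_on_iff_abs_summable_on_real[symmetric]) (auto simp: summable_on_def)
  define M where "M = infsum (%p. norm ((%(i, j). c i j * R ^ i * R ^ j) p)) UNIV"
  have part: "(\<Sum>i<n. \<bar>c i j\<bar> * R ^ i * R ^ j) \<le> M" for n j
  proof -
    have "(\<Sum>i<n. \<bar>c i j\<bar> * R ^ i * R ^ j) = sum (%p. norm ((%(i, j). c i j * R ^ i * R ^ j) p)) ((%i. (i, j)) ` {..<n})"
      using R by (subst sum.reindex) (auto simp: inj_on_def abs_mult)
    also have "\<dots> \<le> M" unfolding M_def by (rule finite_sum_le_infsum[OF as]) auto
    finally show ?thesis .
  qed
  have sm: "summable (%i. \<bar>c i j\<bar> * R ^ i * R ^ j)" for j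
    by (rule summableI_nonneg_bounded[where x=M]) (use part R in auto)
  have smR: "summable (%i. \<bar>c i j\<bar> * R ^ i)" for j
    using summable_divide[OF sm, of j "R ^ j"] R by simp
  have smx: "summable (%i. norm (of_real (c i j) * x ^ i :: complex))" if "norm x < R" for x j
  proof (rule summable_comparison_test'[OF smR, where N=0])
    show "norm (norm (of_real (c n j) * x ^ n :: complex)) \<le> \<bar>c n j\<bar> * R ^ n" for n
      using that by (auto simp: norm_mult norm_power intro!: mult_left_mono power_mono)
  qed
  define h where "h = (%j x. \<Sum>i. of_real (c i j) * x ^ i :: complex)"
  have hsums: "(%i. of_real (c i j) * x ^ i) sums h j x" if "norm x < R" for x :: complex and j
    unfolding h_def by (rule summable_sums[OF summable_norm_cancel[OF smx[OF that]]])
  have hbd: "norm (h j x) * R ^ j \<le> M" if "norm x < R" for j x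
  proof -
    have "norm (h j x) \<le> (\<Sum>i. norm (of_real (c i j) * x ^ i :: complex))"
      unfolding h_def by (rule summable_norm[OF smx[OF that]])
    also have "\<dots> \<le> (\<Sum>i. \<bar>c i j\<bar> * R ^ i)"
      using that by (intro suminf_le smx smR) (auto simp: norm_mult norm_power intro!: mult_left_mono power_mono)
    finally have "norm (h j x) * R ^ j \<le> (\<Sum>i. \<bar>c i j\<bar> * R ^ i) * R ^ j"
      using R by (intro mult_right_mono) auto
    also have "\<dots> = (\<Sum>i. \<bar>c i j\<bar> * R ^ i * R ^ j)" by (rule suminf_mult2[OF smR])
    also have "\<dots> \<le> M" by (rule suminf_le_const[OF sm part])
    finally show ?thesis .
  qed
  have hreal: "h j (of_real t) = of_real (\<Sum>i. c i j * t ^ i)" if "\<bar>t\<bar> < R" for j t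
  proof -
    have "summable (%i. norm (of_real (c i j) * of_real t ^ i :: complex))" by (rule smx) (use that in simp)
    then have "summable (%i. norm (c i j * t ^ i))" by (simp add: norm_mult norm_power abs_mult power_abs)
    then have "summable (%i. c i j * t ^ i)" by (rule summable_norm_cancel)
    then have "(%i. complex_of_real (c i j * t ^ i)) sums of_real (\<Sum>i. c i j * t ^ i)"
      by (intro sums_of_real summable_sums)
    moreover have "(%i. complex_of_real (c i j * t ^ i)) sums h j (of_real t)"
      using hsums[of "of_real t" j] that by simp
    ultimately show ?thesis using sums_unique2 by blast
  qed
  have ys: "yser R M h" unfolding yser_def
  proof (intro conjI allI ballI impI)
    show "h j holomorphic_on ball 0 R" for j
      using hsums by (intro power_series_holomorphic[where a="%i. of_real (c i j)"]) auto
  qed (use R hbd hreal in auto)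
  have h00: "h 0 0 = of_real (c 0 0)"
    using sums_unique2[OF hsums[of 0 0] powser_sums_zero] R by auto
  have "f (x, y) = yval h (x, y)" if xy: "\<bar>x\<bar> < R" "\<bar>y\<bar> < R" for x y
  proof -
    have "((%(j, i). c i j * x ^ i * y ^ j) has_sum f (x, y)) UNIV"
      using hs[of x y] xy R
      by (subst has_sum_reindex_bij_witness[where i=prod.swap and j=prod.swap and T=UNIV and h="%(i, j). c i j * x ^ i * y ^ j" and s'="f (x,y)"]) auto
    then have "((%j. Re (h j (of_real x)) * y ^ j) has_sum f (x, y)) UNIV"
    proof (rule has_sum_SigmaD[where A=UNIV and B="%_. UNIV" and f="%(j, i). c i j * x ^ i * y ^ j", unfolded UNIV_Times_UNIV])
      fix j :: nat
      have "summable (%i. norm (of_real (c i j) * of_real x ^ i :: complex))" by (rule smx) (use xy in simp)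
      then have s: "summable (%i. norm (c i j * x ^ i))" by (simp add: norm_mult norm_power abs_mult power_abs)
      have "((%i. c i j * x ^ i) has_sum (\<Sum>i. c i j * x ^ i)) UNIV"
        by (rule norm_summable_imp_has_sum[OF s summable_sums[OF summable_norm_cancel[OF s]]])
      then have "((%i. c i j * x ^ i * y ^ j) has_sum (\<Sum>i. c i j * x ^ i) * y ^ j) UNIV"
        by (rule has_sum_cmult_left)
      then show "((%i. case (j, i) of (j, i) \<Rightarrow> c i j * x ^ i * y ^ j) has_sum Re (h j (complex_of_real x)) * y ^ j) UNIV"
        using hreal[OF xy(1)] by simp
    qed
    then have A: "(%j. Re (h j (of_real x)) * y ^ j) sums f (x, y)" by (rule has_sum_imp_sums)
    have "(%j. h j (of_real x) * of_real y ^ j) sums (\<Sum>j. h j (of_real x) * of_real y ^ j)"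
      using yser_abs_summable[OF ys, of "of_real x" "of_real y"] xy
      by (intro summable_sums summable_norm_cancel[of "%j. h j (of_real x) * of_real y ^ j"]) simp
    then have "(%j. Re (h j (of_real x) * of_real y ^ j)) sums yval h (x, y)"
      unfolding yval_def prod.case by (rule sums_Re)
    then have "(%j. Re (h j (of_real x)) * y ^ j) sums yval h (x, y)"
      by (simp add: hreal[OF xy(1)] flip: of_real_power)
    then show ?thesis using A sums_unique2 by blast
  qed
  then show thesis using that[OF ys h00] by blast
qed

lemma yser_deriv:
  assumes "yser R M h"
  shows "yser (R/2) (4 * M / R) (%j. deriv (h j))"
proof -
  note D = yserD[OF assms]
  have bd: "norm (deriv (h j) x) * (R/2) ^ j \<le> 4 * M / R" if x: "norm x < R/2" for j x
  proof -
    have b: "norm (h j w) \<le> M / R ^ j" if "w \<in> ball 0 R" for w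
      using D(1) D(3)[of w j] that by (simp add: pos_le_divide_eq)
    have "norm (deriv (h j) x) \<le> M / R ^ j / (R/4)"
      using deriv_bound_ball[OF D(2) b, of "R/4" x 1] x D(1) by auto
    then have "norm (deriv (h j) x) * (R/2) ^ j \<le> M / R ^ j / (R/4) * R ^ j"
      using D(1,5) by (intro mult_mono power_mono) auto
    then show ?thesis using D(1) by (simp add: mult.commute)
  qed
  have re: "deriv (h j) (of_real t) \<in> \<real>" if t: "\<bar>t\<bar> < R" for j t
  proof -
    have "h j (of_real u) = of_real (Re (h j (of_real u)))" if "\<bar>u\<bar> < R" for u
      using D(4)[OF that] by simp
    from real_restriction_deriv(2)[OF holomorphic_ball_derivs[OF D(2)[of j], of "of_real t"] t this]
    show ?thesis using t by (metis Reals_of_real mem_ball_0 norm_of_real)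
  qed
  show ?thesis unfolding yser_def using D(1,2) bd re
    by (auto intro!: holomorphic_on_subset[OF holomorphic_deriv])
qed

lemma yser_diffs:
  assumes "yser R M h"
  shows "yser (R/2) (M / R) (%j x. of_nat (Suc j) * h (Suc j) x)"
proof -
  note D = yserD[OF assms]
  have bd: "norm (of_nat (Suc j) * h (Suc j) x) * (R/2) ^ j \<le> M / R" if x: "norm x < R/2" for j x
  proof -
    have "real (Suc j) \<le> 2 ^ j" by (induction j) auto
    then have j: "real (Suc j) / 2 ^ j \<le> 1" by simp
    have "norm (of_nat (Suc j) * h (Suc j) x) * (R/2) ^ j = (real (Suc j) / 2 ^ j) * (norm (h (Suc j) x) * R ^ Suc j) / R"
      using D(1) by (simp add: norm_mult power_divide del: of_nat_Suc)
    also have "\<dots> \<le> 1 * M / R"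
      using D(1) D(3)[of x "Suc j"] D(5) x j by (intro divide_right_mono mult_mono) auto
    finally show ?thesis by simp
  qed
  show ?thesis unfolding yser_def using D(1,2,4) bd
    by (auto intro!: holomorphic_intros holomorphic_on_subset[OF D(2)] Reals_mult Reals_add simp del: of_nat_Suc)
qed

section \<open>The linear Cauchy-Kovalevskaya theorem\<close>

text \<open>The next bound is Nagumo's: differentiation costs a factor \<open>m\<close> and a power of the distance
  to the boundary, which the integration in \<open>y\<close> gains back.\<close>

lemma nagumo_deriv:
  assumes h: "h holomorphic_on ball 0 rho" and B: "B \<ge> 0"
    and bd: "!!x. norm x < rho ==> norm (h x) \<le> (B / (rho - norm x)) ^ m"
    and x: "norm x < rho"
  shows "norm (deriv h x) \<le> 2 * exp 1 * real (Suc m) * (B / (rho - norm x)) ^ m / (rho - norm x)"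
proof -
  define s where "s = rho - norm x"
  \<comment> \<open>With this radius the bound on \<open>h\<close> deteriorates only by ((m + 2) /
    (m + 1))^m \<le> e, while dividing by \<open>d\<close> costs m + 2 \<le> 2 (m + 1).\<close>
  define d where "d = s / real (m + 2)"
  have s: "s > 0" using x by (simp add: s_def)
  have d: "d > 0" using s by (simp add: d_def)
  have ds: "s - d = s * real (m + 1) / real (m + 2)"
    by (simp add: d_def field_simps)
  have ds0: "s - d > 0" unfolding ds using s by simp
  have near: "s - d \<le> rho - norm w" if "norm (x - w) \<le> d" for w
  proof -
    have "norm w \<le> norm x + norm (x - w)"
      by (metis add.commute norm_minus_commute norm_triangle_sub)
    then show ?thesis using that by (simp add: s_def)
  qed
  have sub: "cball x d \<subseteq> ball 0 rho"
    using near ds0 by (force simp: dist_norm)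
  have e: "(real (m + 2) / real (m + 1)) ^ m \<le> exp 1"
  proof -
    have "(real (m + 2) / real (m + 1)) ^ m \<le> (real (m + 2) / real (m + 1)) ^ Suc m"
      by (rule power_increasing) auto
    also have "\<dots> = (1 + 1 / real (Suc m)) ^ Suc m"
      by (intro arg_cong[where f="%t. t ^ Suc m"]) (simp add: field_simps)
    also have "(1 + 1 / real (Suc m)) ^ Suc m \<le> exp 1"
      by (rule exp_ge_one_plus_x_over_n_power_n) auto
    finally show ?thesis .
  qed
  have "norm ((deriv ^^ 1) h x) \<le> fact 1 * (exp 1 * (B / s) ^ m) / d ^ 1"
  proof (rule Cauchy_inequality)
    show "h holomorphic_on ball x d" using h sub holomorphic_on_subset ball_subset_cball by blast
    show "continuous_on (cball x d) h"
      using h sub holomorphic_on_imp_continuous_on holomorphic_on_subset by blast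
    fix w assume w: "norm (x - w) = d"
    then have n: "s - d \<le> rho - norm w" using near[of w] by simp
    have "norm (h w) \<le> (B / (rho - norm w)) ^ m" using n ds0 by (intro bd) auto
    also have "\<dots> \<le> (B / (s - d)) ^ m"
      using n ds0 B by (intro power_mono divide_left_mono) auto
    also have "B / (s - d) = real (m + 2) / real (m + 1) * (B / s)" unfolding ds by (simp add: field_simps)
    also have "(\<dots>) ^ m = (real (m + 2) / real (m + 1)) ^ m * (B / s) ^ m" by (rule power_mult_distrib)
    also have "\<dots> \<le> exp 1 * (B / s) ^ m" using B s by (intro mult_right_mono e) auto
    finally show "norm (h w) \<le> exp 1 * (B / s) ^ m" .
  qed (use d in auto)
  also have "\<dots> = (exp 1 * (B / s) ^ m / s) * real (m + 2)" by (simp add: d_def)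
  also have "\<dots> \<le> (exp 1 * (B / s) ^ m / s) * (2 * real (Suc m))"
    using s B by (intro mult_left_mono) auto
  finally show ?thesis by (simp add: s_def mult_ac)
qed

text \<open>Obtained by inserting H = \<Sum> h_j(x) y^j into f H_x + g H_y = sig and solving the
  equation for the coefficient of y^m for h_(m+1); this is possible where g(x, 0) \<noteq> 0. The
  source \<open>sig\<close> enters only at m = 0.\<close>

fun ck :: "(nat \<Rightarrow> complex \<Rightarrow> complex) \<Rightarrow> (nat \<Rightarrow> complex \<Rightarrow> complex) \<Rightarrow> complex \<Rightarrow> (complex \<Rightarrow> complex) \<Rightarrow> nat \<Rightarrow> complex \<Rightarrow> complex" where
  "ck f g sig h0 0 = h0"
| "ck f g sig h0 (Suc m) = (%x. ((if m = 0 then sig else 0) - (\<Sum>j\<le>m. f j x * deriv (ck f g sig h0 (m - j)) x)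
      - (\<Sum>j<m. g (Suc j) x * (of_nat (m - j) * ck f g sig h0 (m - j) x))) / (of_nat (Suc m) * g 0 x))"

lemma sum_half_powers: "(\<Sum>j<n. (1/2::real) ^ j) \<le> 2" for n :: nat
  using sum_le_suminf[OF summable_geometric[of "1/2::real"], of "{..<n}"] by (simp add: suminf_geometric)

text \<open>Induction on the weighted bound (B / (rho - |x|))^m. Differentiation in \<open>x\<close>
  costs a factor m and one power of 1 / (rho - |x|) by \<open>nagumo_deriv\<close>; the denominator
  m + 1 of the recursion cancels the former, and the step from m to m + 1 provides the latter. The
  sums over \<open>j\<close> are dominated by geometric series of ratio 1 / 2.\<close>

lemma yser_ck:
  assumes f: "yser R M f" and g: "yser R M g" and g0: "g 0 0 \<noteq> 0"
    and h0: "h0 holomorphic_on ball 0 1" "!!x. norm x < 1 ==> norm (h0 x) \<le> 1" "!!t. \<bar>t\<bar> < 1 ==> h0 (of_real t) \<in> \<real>"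
    and sig: "sig \<in> \<real>"
  obtains R' where "0 < R'" "R' \<le> R" "yser R' 1 (ck f g sig h0)" "!!x. norm x < R' ==> g 0 x \<noteq> 0"
proof -
  note Df = yserD[OF f] and Dg = yserD[OF g]
  let ?h = "ck f g sig h0"
  define \<beta> where "\<beta> = norm (g 0 0) / 2"
  have \<beta>: "\<beta> > 0" using g0 by (simp add: \<beta>_def)
  have "isCont (g 0) 0"
    using holomorphic_on_imp_continuous_on[OF Dg(2)[of 0]] Dg(1) by (simp add: continuous_on_eq_continuous_at)
  then obtain d where d: "d > 0" "!!x. norm x < d ==> dist (g 0 x) (g 0 0) < \<beta>"
    unfolding continuous_at_eps_delta using \<beta> by (metis dist_0_norm dist_commute)
  define rho where "rho = Min {d, R, 1}"
  have rho: "rho > 0" "rho \<le> d" "rho \<le> R" "rho \<le> 1" using d Df(1) by (auto simp: rho_def)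
  have gb: "norm (g 0 x) \<ge> \<beta>" if "norm x < rho" for x
  proof -
    have "dist (g 0 x) (g 0 0) < \<beta>" using d(2)[of x] that rho by simp
    moreover have "norm (g 0 0) \<le> norm (g 0 x) + dist (g 0 x) (g 0 0)"
      by (metis add.commute dist_commute dist_norm norm_triangle_sub)
    moreover have "norm (g 0 0) = 2 * \<beta>" by (simp add: \<beta>_def)
    ultimately show ?thesis by linarith
  qed
  \<comment> \<open>The lower bound 2 makes 1 / R \<le> w / 2 for w = B / (rho - |x|). The other
    entry collects the contributions of the \<open>f\<close> sum, the \<open>g\<close> sum and the
    source, divided by the lower bound \<beta> of |g(x, 0)|.\<close>
  define B where "B = max 2 ((4 * exp 1 * M + 2 * M + norm sig) / \<beta>)"
  have B: "B \<ge> 2" "4 * exp 1 * M + 2 * M + norm sig \<le> \<beta> * B"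
  proof -
    show "B \<ge> 2" by (simp add: B_def)
    have "(4 * exp 1 * M + 2 * M + norm sig) / \<beta> \<le> B" by (simp add: B_def)
    then show "4 * exp 1 * M + 2 * M + norm sig \<le> \<beta> * B" using \<beta> by (simp add: pos_divide_le_eq mult.commute)
  qed
  have hol: "?h m holomorphic_on ball 0 rho" for m
  proof (induction m rule: less_induct)
    case (less m)
    show ?case
    proof (cases m)
      case 0
      then show ?thesis using h0(1) rho by (auto intro: holomorphic_on_subset[OF _ subset_ball])
    next
      case (Suc k)
      have nz: "of_nat (Suc k) * g 0 x \<noteq> 0" if "x \<in> ball 0 rho" for x
        using gb[of x] \<beta> that by (auto simp del: of_nat_Suc)
      show ?thesis unfolding Suc ck.simps
        by (intro holomorphic_intros holomorphic_on_subset[OF Df(2)] holomorphic_on_subset[OF Dg(2)] less)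
          (use Suc rho nz in \<open>auto simp del: of_nat_Suc mult_eq_0_iff\<close>)
    qed
  qed
  have bound: "norm (?h m x) \<le> (B / (rho - norm x)) ^ m" if "norm x < rho" for m x
    using that
  proof (induction m arbitrary: x rule: less_induct)
    case (less m)
    define s where "s = rho - norm x"
    define w where "w = B / s"
    have s: "s > 0" "s \<le> rho" using less.prems by (auto simp: s_def)
    have B0: "B > 0" using B by simp
    have wB: "w * s = B" using s by (simp add: w_def)
    have "w * s \<le> w * R" using s rho B0 by (intro mult_left_mono) (auto simp: w_def)
    then have wR: "B \<le> w * R" using wB by simp
    have "w * s \<le> w * 1" using s rho B0 by (intro mult_left_mono) (auto simp: w_def)
    then have wB1: "B \<le> w" using wB by simp
    have R0: "R > 0" by (rule Df(1))
    have iR: "1 / R \<le> w / B" using wR R0 B0 by (simp add: field_simps)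
    have iR2: "1 / R \<le> w / 2"
    proof -
      have "w / B \<le> w / 2" using wB1 B by (intro divide_left_mono) auto
      then show ?thesis using iR by linarith
    qed
    have coef: "norm (c j x) \<le> M * (w / 2) ^ j" if "yser R M c" for c j
    proof -
      have "norm (c j x) \<le> M * (1 / R) ^ j"
        using yserD(3)[OF that, of x j] less.prems rho R0 by (simp add: power_divide pos_le_divide_eq)
      also have "\<dots> \<le> M * (w / 2) ^ j" using Df(5) R0 iR2 by (intro mult_left_mono power_mono) auto
      finally show ?thesis .
    qed
    show ?case
    proof (cases m)
      case 0
      then show ?thesis using h0(2)[of x] less.prems rho by simp
    next
      case (Suc k)
      have hb: "norm (?h (k - j) x) \<le> w ^ (k - j)" for j
        using less.IH[of "k - j" x] less.prems Suc by (simp add: w_def s_def)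
      have db: "norm (deriv (?h (k - j)) x) \<le> 2 * exp 1 * real (Suc k) * w ^ (k - j) * (w / B)" for j
      proof -
        have "norm (deriv (?h (k - j)) x) \<le> 2 * exp 1 * real (Suc (k - j)) * (B / (rho - norm x)) ^ (k - j) / (rho - norm x)"
          by (rule nagumo_deriv[OF hol]) (use B less.IH Suc less.prems in auto)
        also have "\<dots> = 2 * exp 1 * real (Suc (k - j)) * w ^ (k - j) * (w / B)"
          using B0 by (simp add: w_def s_def)
        also have "\<dots> \<le> 2 * exp 1 * real (Suc k) * w ^ (k - j) * (w / B)"
          using wB1 B0 by (intro mult_right_mono mult_left_mono) auto
        finally show ?thesis .
      qed
      have w0: "w > 0" using wB1 B0 by simp
      have S1: "norm (\<Sum>j\<le>k. f j x * deriv (?h (k - j)) x) \<le> 4 * exp 1 * M * (real (Suc k) * w ^ Suc k / B)"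
      proof -
        have "norm (f j x * deriv (?h (k - j)) x) \<le> (2 * exp 1 * M * (real (Suc k) * w ^ Suc k / B)) * (1/2) ^ j" if "j \<le> k" for j
        proof -
          have "norm (f j x * deriv (?h (k - j)) x) \<le> (M * (w / 2) ^ j) * (2 * exp 1 * real (Suc k) * w ^ (k - j) * (w / B))"
            unfolding norm_mult using Df(5) w0 by (intro mult_mono coef[OF f] db) auto
          also have "\<dots> = (2 * exp 1 * M * (real (Suc k) * (w ^ (j + (k - j)) * w) / B)) * (1/2) ^ j"
            unfolding power_add by (simp add: power_divide mult_ac)
          finally show ?thesis using that by (simp add: mult_ac)
        qed
        then have "norm (\<Sum>j\<le>k. f j x * deriv (?h (k - j)) x) \<le> (\<Sum>j\<le>k. (2 * exp 1 * M * (real (Suc k) * w ^ Suc k / B)) * (1/2) ^ j)"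
          by (intro sum_norm_le) auto
        also have "\<dots> = (2 * exp 1 * M * (real (Suc k) * w ^ Suc k / B)) * (\<Sum>j<Suc k. (1/2) ^ j)"
          by (simp only: sum_distrib_left lessThan_Suc_atMost)
        also have "\<dots> \<le> (2 * exp 1 * M * (real (Suc k) * w ^ Suc k / B)) * 2"
          using Df(5) w0 B0 by (intro mult_left_mono sum_half_powers) auto
        finally show ?thesis by simp
      qed
      have S2: "norm (\<Sum>j<k. g (Suc j) x * (of_nat (k - j) * ?h (k - j) x)) \<le> 2 * M * (real (Suc k) * w ^ Suc k / B)"
      proof -
        have "norm (g (Suc j) x * (of_nat (k - j) * ?h (k - j) x)) \<le> (M * (real (Suc k) * w ^ Suc k / B)) * (1/2) ^ j" if "j < k" for j
        proof -
          have "norm (g (Suc j) x) \<le> M * (1 / R) ^ Suc j"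
            using Dg(3)[of x "Suc j"] less.prems rho R0 by (simp add: power_divide pos_le_divide_eq)
          also have "\<dots> = M * ((1 / R) * (1 / R) ^ j)" by simp
          also have "\<dots> \<le> M * ((w / B) * (w / 2) ^ j)"
            using Df(5) R0 iR iR2 w0 B0 by (intro mult_left_mono mult_mono power_mono) auto
          finally have "norm (g (Suc j) x) \<le> M * ((w / B) * (w / 2) ^ j)" .
          moreover have "norm (of_nat (k - j) * ?h (k - j) x) \<le> real (Suc k) * w ^ (k - j)"
            unfolding norm_mult using hb[of j] w0 by (intro mult_mono) auto
          ultimately have "norm (g (Suc j) x * (of_nat (k - j) * ?h (k - j) x)) \<le> (M * ((w / B) * (w / 2) ^ j)) * (real (Suc k) * w ^ (k - j))"
            unfolding norm_mult[of "g (Suc j) x"] using Df(5) w0 B0 by (intro mult_mono) auto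
          also have "\<dots> = (M * (real (Suc k) * (w ^ (j + (k - j)) * w) / B)) * (1/2) ^ j"
            unfolding power_add by (simp add: power_divide mult_ac)
          finally show ?thesis using that by (simp add: mult_ac)
        qed
        then have "norm (\<Sum>j<k. g (Suc j) x * (of_nat (k - j) * ?h (k - j) x)) \<le> (\<Sum>j<k. (M * (real (Suc k) * w ^ Suc k / B)) * (1/2) ^ j)"
          by (intro sum_norm_le) auto
        also have "\<dots> = (M * (real (Suc k) * w ^ Suc k / B)) * (\<Sum>j<k. (1/2) ^ j)"
          by (simp only: sum_distrib_left)
        also have "\<dots> \<le> (M * (real (Suc k) * w ^ Suc k / B)) * 2"
          using Df(5) w0 B0 by (intro mult_left_mono sum_half_powers) auto
        finally show ?thesis by (simp only: mult_ac)
      qed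
      have S0: "norm (if k = 0 then sig else 0) \<le> norm sig * (real (Suc k) * w ^ Suc k / B)"
      proof (cases "k = 0")
        case True
        have "norm sig * 1 \<le> norm sig * (w / B)" using wB1 B0 by (intro mult_left_mono) auto
        then show ?thesis using True by simp
      qed (use w0 B0 in auto)
      let ?Q = "real (Suc k) * w ^ Suc k / B"
      have Q0: "?Q \<ge> 0" using w0 B0 by simp
      have "norm ((if k = 0 then sig else 0) - (\<Sum>j\<le>k. f j x * deriv (?h (k - j)) x)
          - (\<Sum>j<k. g (Suc j) x * (of_nat (k - j) * ?h (k - j) x))) \<le> (norm sig * ?Q + 4 * exp 1 * M * ?Q) + 2 * M * ?Q"
        using S0 S1 S2 by (intro order_trans[OF norm_triangle_ineq4] add_mono) auto
      also have "\<dots> = (4 * exp 1 * M + 2 * M + norm sig) * ?Q" by (simp only: algebra_simps)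
      also have "\<dots> \<le> (\<beta> * B) * ?Q" using B(2) Q0 by (rule mult_right_mono)
      also have "\<dots> = \<beta> * (real (Suc k) * w ^ Suc k)" using B0 by simp
      finally have num: "norm ((if k = 0 then sig else 0) - (\<Sum>j\<le>k. f j x * deriv (?h (k - j)) x)
          - (\<Sum>j<k. g (Suc j) x * (of_nat (k - j) * ?h (k - j) x))) \<le> \<beta> * (real (Suc k) * w ^ Suc k)" .
      have den: "norm (of_nat (Suc k) * g 0 x) \<ge> real (Suc k) * \<beta>"
        using gb[OF less.prems] by (simp add: norm_mult del: of_nat_Suc)
      have "norm (?h (Suc k) x) \<le> \<beta> * (real (Suc k) * w ^ Suc k) / (real (Suc k) * \<beta>)"
        unfolding ck.simps norm_divide using num den \<beta> w0
        by (intro frac_le) (auto simp del: of_nat_Suc)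
      also have "\<dots> = w ^ Suc k" using \<beta> by (simp del: of_nat_Suc power_Suc)
      finally show ?thesis using Suc by (simp add: w_def s_def)
    qed
  qed
  \<comment> \<open>For |x| < R' the distance rho - |x| is at least rho / 2, and (2 B / rho)^m times
    R'^m is exactly 1.\<close>
  define R' where "R' = rho / (2 * B)"
  have "rho / (2 * B) \<le> rho / (2 * 2)" using B rho by (intro divide_left_mono) auto
  then have R': "0 < R'" "R' \<le> rho / 4" using B rho by (auto simp: R'_def)
  have bd: "norm (?h m x) * R' ^ m \<le> 1" if "norm x < R'" for m x
  proof -
    have l: "rho / 2 \<le> rho - norm x" using that R' rho by simp
    have "norm (?h m x) \<le> (B / (rho - norm x)) ^ m" using that R' rho by (intro bound) auto
    also have "\<dots> \<le> (B / (rho / 2)) ^ m" using l rho B by (intro power_mono divide_left_mono) auto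
    finally have "norm (?h m x) * R' ^ m \<le> (B / (rho / 2)) ^ m * R' ^ m" using R' by (intro mult_right_mono) auto
    also have "\<dots> = 1" using rho B by (simp add: R'_def flip: power_mult_distrib)
    finally show ?thesis .
  qed
  have re: "?h m (of_real t) \<in> \<real>" if "\<bar>t\<bar> < rho" for m t
    using that
  proof (induction m arbitrary: t rule: less_induct)
    case (less m)
    show ?case
    proof (cases m)
      case 0
      then show ?thesis using h0(3) less.prems rho by simp
    next
      case (Suc k)
      have dr: "deriv (?h (k - j)) (of_real t) \<in> \<real>" for j
      proof -
        have "?h (k - j) (of_real u) = of_real (Re (?h (k - j) (of_real u)))" if "\<bar>u\<bar> < rho" for u
          using less.IH[of "k - j" u] that Suc by simp
        from real_restriction_deriv(2)[OF holomorphic_ball_derivs[OF hol[of "k - j"], of "of_real t"] less.prems this]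
        show ?thesis using less.prems by (metis Reals_of_real mem_ball_0 norm_of_real)
      qed
      show ?thesis unfolding Suc ck.simps
        by (intro Reals_divide Reals_diff sum_in_Reals Reals_mult Df(4) Dg(4) dr less.IH)
          (use Suc less.prems rho sig in auto)
    qed
  qed
  show thesis
  proof (rule that[of R'])
    show "yser R' 1 ?h" unfolding yser_def
      using R' rho bd re hol by (auto intro: holomorphic_on_subset[OF hol])
    show "g 0 x \<noteq> 0" if "norm x < R'" for x
    proof -
      have "norm (g 0 x) \<ge> \<beta>" using gb[of x] that R' rho by simp
      then show ?thesis using \<beta> by auto
    qed
  qed (use R' rho in auto)
qed

text \<open>Both products are Cauchy products whose m-th coefficients add up to the left side of the
  recursion. The halved radius is where the differentiated series are known to converge.\<close>

lemma ck_pde: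
  assumes f: "yser R M f" and g: "yser R M g" and h: "yser R M h"
    and rec: "!!m x. norm x < R ==> (\<Sum>j\<le>m. f j x * deriv (h (m - j)) x) +
        (\<Sum>j\<le>m. g j x * (of_nat (Suc (m - j)) * h (Suc (m - j)) x)) = (if m = 0 then sig else 0)"
    and xy: "norm x < R/2" "norm y < R/2"
  shows "(\<Sum>j. f j x * y ^ j) * (\<Sum>j. deriv (h j) x * y ^ j) + (\<Sum>j. g j x * y ^ j) * (\<Sum>j. of_nat (Suc j) * h (Suc j) x * y ^ j) = sig"
proof -
  have R: "R > 0" by (rule yserD(1)[OF f])
  have xy': "norm x < R" "norm y < R" using xy R by auto
  have *: "a * y ^ i * (b * y ^ (m - i)) = (a * b) * y ^ m" if "i \<le> m" for a b i m
    using that by (simp add: mult_ac flip: power_add)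
  have "(%m. \<Sum>i\<le>m. (f i x * y ^ i) * (deriv (h (m - i)) x * y ^ (m - i))) sums
      ((\<Sum>j. f j x * y ^ j) * (\<Sum>j. deriv (h j) x * y ^ j))"
    by (rule Cauchy_product_sums[OF yser_abs_summable[OF f xy'] yser_abs_summable[OF yser_deriv[OF h] xy]])
  moreover have "(%m. \<Sum>i\<le>m. (g i x * y ^ i) * (of_nat (Suc (m - i)) * h (Suc (m - i)) x * y ^ (m - i))) sums
      ((\<Sum>j. g j x * y ^ j) * (\<Sum>j. of_nat (Suc j) * h (Suc j) x * y ^ j))"
    by (rule Cauchy_product_sums[OF yser_abs_summable[OF g xy'] yser_abs_summable[OF yser_diffs[OF h] xy]])
  ultimately have "(%m. (\<Sum>i\<le>m. (f i x * y ^ i) * (deriv (h (m - i)) x * y ^ (m - i))) +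
      (\<Sum>i\<le>m. (g i x * y ^ i) * (of_nat (Suc (m - i)) * h (Suc (m - i)) x * y ^ (m - i)))) sums
      ((\<Sum>j. f j x * y ^ j) * (\<Sum>j. deriv (h j) x * y ^ j) + (\<Sum>j. g j x * y ^ j) * (\<Sum>j. of_nat (Suc j) * h (Suc j) x * y ^ j))"
    (is "?a sums ?S") by (rule sums_add)
  moreover have "?a = (%m. (if m = 0 then sig else 0) * y ^ m)"
  proof
    fix m
    have "?a m = ((\<Sum>j\<le>m. f j x * deriv (h (m - j)) x) +
        (\<Sum>j\<le>m. g j x * (of_nat (Suc (m - j)) * h (Suc (m - j)) x))) * y ^ m"
      unfolding distrib_right sum_distrib_right by (intro arg_cong2[where f="(+)"] sum.cong refl *) auto
    then show "?a m = (if m = 0 then sig else 0) * y ^ m" using rec[OF xy'(1), of m] by simp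
  qed
  ultimately have "(%m. (if m = 0 then sig else 0) * y ^ m) sums ?S" by simp
  moreover have "(%m. (if m = 0 then sig else 0) * y ^ m) sums ((if (0::nat) = 0 then sig else 0) * y ^ 0)"
    using sums_finite[of "{0}" "%m. (if m = 0 then sig else 0) * y ^ m"] by simp
  ultimately show ?thesis using sums_unique2 by fastforce
qed

lemma partial_derivs:
  fixes F :: "real \<times> real \<Rightarrow> real"
  assumes "(F has_derivative (%v. p * fst v + q * snd v)) (at (x, y))"
  shows "((%t. F (t, y)) has_real_derivative p) (at x)" "((%t. F (x, t)) has_real_derivative q) (at y)"
proof -
  have "((%t. (t, y)) has_derivative (%v. (v, 0))) (at x)" by (auto intro!: derivative_eq_intros)
  from has_derivative_compose[OF this assms] show "((%t. F (t, y)) has_real_derivative p) (at x)"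
    by (simp add: has_field_derivative_def mult_commute_abs)
  have "((%t. (x, t)) has_derivative (%v. (0, v))) (at y)" by (auto intro!: derivative_eq_intros)
  from has_derivative_compose[OF this assms] show "((%t. F (x, t)) has_real_derivative q) (at y)"
    by (simp add: has_field_derivative_def mult_commute_abs)
qed

lemma ck_rec:
  assumes "g 0 x \<noteq> 0"
  shows "(\<Sum>j\<le>m. f j x * deriv (ck f g sig h0 (m - j)) x) +
        (\<Sum>j\<le>m. g j x * (of_nat (Suc (m - j)) * ck f g sig h0 (Suc (m - j)) x)) = (if m = 0 then sig else 0)"
proof -
  let ?h = "ck f g sig h0"
  let ?S = "\<Sum>j<m. g (Suc j) x * (of_nat (m - j) * ?h (m - j) x)"
  let ?F = "\<Sum>j\<le>m. f j x * deriv (?h (m - j)) x"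
  have "(\<Sum>j\<le>m. g j x * (of_nat (Suc (m - j)) * ?h (Suc (m - j)) x)) =
     g 0 x * (of_nat (Suc m) * ?h (Suc m) x) + (\<Sum>j<m. g (Suc j) x * (of_nat (Suc (m - Suc j)) * ?h (Suc (m - Suc j)) x))"
    by (subst sum.atMost_shift) simp
  also have "(\<Sum>j<m. g (Suc j) x * (of_nat (Suc (m - Suc j)) * ?h (Suc (m - Suc j)) x)) = ?S"
    by (intro sum.cong refl) (simp only: lessThan_iff Suc_diff_Suc)
  also have "g 0 x * (of_nat (Suc m) * ?h (Suc m) x) = (if m = 0 then sig else 0) - ?F - ?S"
    unfolding ck.simps using assms by (simp del: of_nat_Suc)
  finally show ?thesis by simp
qed

text \<open>Two instances are needed: initial value x with source 0 gives the first integral,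
  initial value 0 with source 1 the time function. Both data are bounded by 1 on the unit disc. The
  real partial derivatives are identified with the termwise differentiated series by uniqueness of
  derivatives.\<close>

theorem cauchy_kovalevskaya_linear:
  fixes sig :: real and h0 :: "complex \<Rightarrow> complex"
  assumes a: "has_power_series2 a f (0, 0)" and b: "has_power_series2 b g (0, 0)" and b0: "b 0 0 \<noteq> 0"
    and h0: "h0 holomorphic_on ball 0 1" "!!x. norm x < 1 ==> norm (h0 x) \<le> 1" "!!t. \<bar>t\<bar> < 1 ==> h0 (of_real t) \<in> \<real>"
  obtains R H Hx Hy where "R > 0" "an2 H" "an2 Hx" "an2 Hy"
    "!!x y. \<bar>x\<bar> < R ==> \<bar>y\<bar> < R ==> (H has_derivative (%v. Hx (x, y) * fst v + Hy (x, y) * snd v)) (at (x, y))"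
    "!!x y. \<bar>x\<bar> < R ==> \<bar>y\<bar> < R ==> f (x, y) * Hx (x, y) + g (x, y) * Hy (x, y) = sig"
    "!!x. H (x, 0) = Re (h0 (of_real x))"
proof -
  obtain R1 M1 F where F: "yser R1 M1 F" "!!x y. \<bar>x\<bar> < R1 ==> \<bar>y\<bar> < R1 ==> f (x, y) = yval F (x, y)"
    using yser_of_power_series2[OF a] by metis
  obtain R2 M2 G where G: "yser R2 M2 G" "G 0 0 = of_real (b 0 0)" "!!x y. \<bar>x\<bar> < R2 ==> \<bar>y\<bar> < R2 ==> g (x, y) = yval G (x, y)"
    using yser_of_power_series2[OF b] by metis
  define R3 where "R3 = min R1 R2"
  have R3: "R3 > 0" "R3 \<le> R1" "R3 \<le> R2" using yserD(1)[OF F(1)] yserD(1)[OF G(1)] by (auto simp: R3_def)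
  define M where "M = Max {M1, M2, 1}"
  have M: "M1 \<le> M" "M2 \<le> M" "1 \<le> M" by (auto simp: M_def)
  have F3: "yser R3 M F" and G3: "yser R3 M G"
    using yser_mono[OF F(1)] yser_mono[OF G(1)] R3 M by auto
  have G0: "G 0 0 \<noteq> 0" using G(2) b0 by simp
  let ?h = "ck F G (of_real sig) h0"
  obtain R where R: "0 < R" "R \<le> R3" "yser R 1 ?h" "!!x. norm x < R ==> G 0 x \<noteq> 0"
    using yser_ck[OF F3 G3 G0 h0, of "of_real sig"] by auto
  have FR: "yser R M F" and GR: "yser R M G" and hR: "yser R M ?h"
    using yser_mono[OF F3] yser_mono[OF G3] yser_mono[OF R(3)] R M by auto
  define H where "H = yval ?h"
  have anH: "an2 H" unfolding H_def by (rule yser_an2[OF hR])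
  obtain S Hx Hy where S: "S > 0" "an2 Hx" "an2 Hy"
    "!!x y. \<bar>x\<bar> < S ==> \<bar>y\<bar> < S ==> (H has_derivative (%v. Hx (x, y) * fst v + Hy (x, y) * snd v)) (at (x, y))"
    using an2_deriv[OF anH] by blast
  show thesis
  proof (rule that[of "min S (R/2)" H Hx Hy])
    show "f (x, y) * Hx (x, y) + g (x, y) * Hy (x, y) = sig" if "\<bar>x\<bar> < min S (R/2)" "\<bar>y\<bar> < min S (R/2)" for x y
    proof -
      have xy: "\<bar>x\<bar> < S" "\<bar>y\<bar> < S" "\<bar>x\<bar> < R/2" "\<bar>y\<bar> < R/2" "\<bar>x\<bar> < R" "\<bar>y\<bar> < R" using that R(1) by auto
      let ?Dx = "\<Sum>j. deriv (?h j) (of_real x) * of_real y ^ j"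
      let ?Dy = "\<Sum>j. of_nat (Suc j) * ?h (Suc j) (of_real x) * of_real y ^ j"
      have vf: "(\<Sum>j. F j (of_real x) * of_real y ^ j) = of_real (f (x, y))"
        using yval_of_real[OF FR xy(5,6)] F(2)[of x y] xy R R3 by auto
      have vg: "(\<Sum>j. G j (of_real x) * of_real y ^ j) = of_real (g (x, y))"
        using yval_of_real[OF GR xy(5,6)] G(3)[of x y] xy R R3 by auto
      have "(\<Sum>j. F j (of_real x) * of_real y ^ j) * ?Dx + (\<Sum>j. G j (of_real x) * of_real y ^ j) * ?Dy = of_real sig"
        by (rule ck_pde[OF FR GR hR], rule ck_rec, erule R(4)) (use xy in auto)
      then have "of_real (f (x, y)) * ?Dx + of_real (g (x, y)) * ?Dy = of_real sig"
        unfolding vf vg .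
      then have eq: "f (x, y) * Re ?Dx + g (x, y) * Re ?Dy = sig"
        by (drule_tac arg_cong[where f=Re]) (simp del: ck.simps of_nat_Suc)
      have Hd: "(H has_derivative (%v. Hx (x, y) * fst v + Hy (x, y) * snd v)) (at (x, y))" by (rule S(4)[OF xy(1,2)])
      have "((%t. H (t, y)) has_real_derivative Hx (x, y)) (at x)"
        by (rule partial_derivs(1)[OF Hd])
      moreover have "((%t. H (t, y)) has_real_derivative Re ?Dx) (at x)"
        by (rule real_restriction_deriv(1)[OF yser_deriv_x[OF hR] xy(5)])
          (use xy yval_of_real[OF hR] in \<open>auto simp: H_def\<close>)
      ultimately have hx: "Hx (x, y) = Re ?Dx" by (rule DERIV_unique)
      have "((%t. H (x, t)) has_real_derivative Hy (x, y)) (at y)"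
        by (rule partial_derivs(2)[OF Hd])
      moreover have "((%t. H (x, t)) has_real_derivative Re ?Dy) (at y)"
        by (rule real_restriction_deriv(1)[OF yser_deriv_y[OF hR] xy(6)])
          (use xy yval_of_real[OF hR] in \<open>auto simp: H_def\<close>)
      ultimately have hy: "Hy (x, y) = Re ?Dy" by (rule DERIV_unique)
      show ?thesis using eq hx hy by simp
    qed
    show "H (x, 0) = Re (h0 (of_real x))" for x
      by (simp add: H_def yval_def powser_zero[of "%j. ck F G (of_real sig) h0 j (of_real x)", simplified])
  qed (use S R anH in auto)
qed

section \<open>Flow boxes\<close>

lemma an2_of_power_series2:
  assumes "has_power_series2 c f (0, 0)" shows "an2 f" and "f (0, 0) = c 0 0"
proof -
  obtain R M h where h: "yser R M h" "h 0 0 = of_real (c 0 0)"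
    "!!x y. \<bar>x\<bar> < R ==> \<bar>y\<bar> < R ==> f (x, y) = yval h (x, y)"
    using yser_of_power_series2[OF assms] by metis
  show "an2 f" using an2_cong[OF yser_an2[OF h(1)] yserD(1)[OF h(1)]] h(3) by blast
  have "f (0, 0) = yval h (0, 0)" using h(3)[of 0 0] yserD(1)[OF h(1)] by simp
  then show "f (0, 0) = c 0 0"
    using h(2) by (simp add: yval_def powser_zero[of "%j. h j 0"])
qed

lemma real_deriv_bound:
  fixes f :: "real \<Rightarrow> real"
  assumes "!!t. \<bar>t\<bar> < r ==> (f has_real_derivative f' t) (at t)" "!!t. \<bar>t\<bar> < r ==> \<bar>f' t - c\<bar> \<le> B"
    "\<bar>s\<bar> < r" "\<bar>t\<bar> < r"
  shows "\<bar>f s - f t - c * (s - t)\<bar> \<le> B * \<bar>s - t\<bar>"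
proof -
  have "norm ((f s - c * s) - (f t - c * t)) \<le> B * norm (s - t)"
  proof (rule field_differentiable_bound[where S="{-r<..<r}" and f'="%t. f' t - c"])
    show "((%t. f t - c * t) has_real_derivative f' z - c) (at z within {- r<..<r})" if "z \<in> {-r<..<r}" for z
      using DERIV_diff[OF assms(1)[of z] DERIV_cmult_Id[of c z]] that by (auto intro: has_field_derivative_at_within)
  qed (use assms in auto)
  then show ?thesis by (simp add: algebra_simps)
qed

lemma real_deriv2_bound:
  fixes F :: "real \<times> real \<Rightarrow> real"
  assumes dF: "!!x y. \<bar>x\<bar> < r ==> \<bar>y\<bar> < r ==> (F has_derivative (%v. Fx (x, y) * fst v + Fy (x, y) * snd v)) (at (x, y))"
    and B: "!!x y. \<bar>x\<bar> < r ==> \<bar>y\<bar> < r ==> \<bar>Fx (x, y) - c\<bar> \<le> B" "!!x y. \<bar>x\<bar> < r ==> \<bar>y\<bar> < r ==> \<bar>Fy (x, y) - d\<bar> \<le> B"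
    and xy: "\<bar>x\<bar> < r" "\<bar>y\<bar> < r" "\<bar>x'\<bar> < r" "\<bar>y'\<bar> < r"
  shows "\<bar>F (x, y) - F (x', y') - c * (x - x') - d * (y - y')\<bar> \<le> B * (\<bar>x - x'\<bar> + \<bar>y - y'\<bar>)"
proof -
  have "\<bar>F (x, y) - F (x', y) - c * (x - x')\<bar> \<le> B * \<bar>x - x'\<bar>"
    by (rule real_deriv_bound[where f'="%t. Fx (t, y)" and r=r]) (use partial_derivs(1)[OF dF] B xy in auto)
  moreover have "\<bar>F (x', y) - F (x', y') - d * (y - y')\<bar> \<le> B * \<bar>y - y'\<bar>"
    by (rule real_deriv_bound[where f'="%t. Fy (x', t)" and r=r]) (use partial_derivs(2)[OF dF] B xy in auto)
  ultimately show ?thesis by (simp add: distrib_left)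
qed

definition sqr :: "real \<Rightarrow> (real \<times> real) set" where
  "sqr r = {-r<..<r} \<times> {-r<..<r}"

lemma sqr_iff: "(x, y) \<in> sqr r \<longleftrightarrow> \<bar>x\<bar> < r \<and> \<bar>y\<bar> < r" by (auto simp: sqr_def)
lemma open_sqr: "open (sqr r)" by (simp add: sqr_def open_Times)

lemma sqr_mono: "r \<le> r' ==> sqr r \<subseteq> sqr r'" by (auto simp: sqr_def)

lemma open_contains_sqr:
  assumes "open A" "(0, 0) \<in> A" obtains r where "r > 0" "sqr r \<subseteq> A"
proof -
  obtain e where e: "e > 0" "ball (0, 0) e \<subseteq> A" using assms open_contains_ball by blast
  have "sqr (e / 2) \<subseteq> ball (0, 0) e"
  proof
    fix p assume "p \<in> sqr (e / 2)"
    then have "\<bar>fst p\<bar> < e / 2" "\<bar>snd p\<bar> < e / 2" by (auto simp: sqr_def)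
    moreover have "norm p \<le> \<bar>fst p\<bar> + \<bar>snd p\<bar>" using norm_Pair_le[of "fst p" "snd p"] by simp
    ultimately show "p \<in> ball (0, 0) e" by (simp add: dist_norm flip: zero_prod_def)
  qed
  then show thesis using that[of "e / 2"] e by auto
qed

text \<open>\<open>H\<close> is a first integral and \<open>W\<close> a time function of \<open>X\<close>, so in the coordinates \<open>(H, W)\<close> the
  orbits are vertical lines traversed with unit speed; this replaces the local theory of
  ordinary differential equations.\<close>

locale flow_box =
  fixes X :: vfield and U :: "(real \<times> real) set" and r L :: real
    and H Hx Hy W Wx Wy :: "real \<times> real \<Rightarrow> real"
  assumes r: "r > 0" and sub: "sqr r \<subseteq> U" and L: "L \<ge> 0"
    and b0: "snd (X (0, 0)) \<noteq> 0"
    and g_bound: "!!p. p \<in> sqr r ==> \<bar>snd (X p) - snd (X (0, 0))\<bar> \<le> \<bar>snd (X (0, 0))\<bar> / 2"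
    and dH: "!!p. p \<in> sqr r ==> (H has_derivative (%v. Hx p * fst v + Hy p * snd v)) (at p)"
    and dW: "!!p. p \<in> sqr r ==> (W has_derivative (%v. Wx p * fst v + Wy p * snd v)) (at p)"
    and pdeH: "!!p. p \<in> sqr r ==> fst (X p) * Hx p + snd (X p) * Hy p = 0"
    and pdeW: "!!p. p \<in> sqr r ==> fst (X p) * Wx p + snd (X p) * Wy p = 1"
    and H0: "!!x. H (x, 0) = x" and W0: "!!x. W (x, 0) = 0"
    and at0: "Hx (0, 0) = 1" "Hy (0, 0) = 0" "Wx (0, 0) = 0" "Wy (0, 0) = 1 / snd (X (0, 0))"
    and lip: "!!x y x' y' F. F \<in> {Hx, Hy, Wx, Wy} ==> (x, y) \<in> sqr r ==> (x', y') \<in> sqr r ==>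
        \<bar>F (x, y) - F (x', y')\<bar> \<le> L * (\<bar>x - x'\<bar> + \<bar>y - y'\<bar>)"
    and Hx_half: "!!p. p \<in> sqr r ==> \<bar>Hx p - 1\<bar> \<le> 1 / 4"
    and Wy_near: "!!p. p \<in> sqr r ==> \<bar>Wy p - 1 / snd (X (0, 0))\<bar> \<le> 1 / (4 * \<bar>snd (X (0, 0))\<bar>)"
    and inj: "inj_on (%p. (H p, W p)) (sqr r)"

lemma flow_box_exists:
  assumes U: "open U" "(0, 0) \<in> U"
    and a: "has_power_series2 a (%p. fst (X p)) (0, 0)" and b: "has_power_series2 b (%p. snd (X p)) (0, 0)"
    and a0: "fst (X (0, 0)) = 0" and b0: "snd (X (0, 0)) \<noteq> 0"
  obtains r L H Hx Hy W Wx Wy where "flow_box X U r L H Hx Hy W Wx Wy" "an2 H" "an2 W"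
proof -
  define \<beta> where "\<beta> = snd (X (0, 0))"
  have b00: "b 0 0 \<noteq> 0" using an2_of_power_series2(2)[OF b] b0 by simp
  obtain R1 H Hx Hy where H: "R1 > 0" "an2 H" "an2 Hx" "an2 Hy"
    "!!x y. \<bar>x\<bar> < R1 ==> \<bar>y\<bar> < R1 ==> (H has_derivative (%v. Hx (x, y) * fst v + Hy (x, y) * snd v)) (at (x, y))"
    "!!x y. \<bar>x\<bar> < R1 ==> \<bar>y\<bar> < R1 ==> fst (X (x, y)) * Hx (x, y) + snd (X (x, y)) * Hy (x, y) = 0"
    "!!x. H (x, 0) = x"
    by (rule cauchy_kovalevskaya_linear[OF a b b00, of "%x. x" 0]) (simp_all only:, simp_all)
  obtain R2 W Wx Wy where W: "R2 > 0" "an2 W" "an2 Wx" "an2 Wy"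
    "!!x y. \<bar>x\<bar> < R2 ==> \<bar>y\<bar> < R2 ==> (W has_derivative (%v. Wx (x, y) * fst v + Wy (x, y) * snd v)) (at (x, y))"
    "!!x y. \<bar>x\<bar> < R2 ==> \<bar>y\<bar> < R2 ==> fst (X (x, y)) * Wx (x, y) + snd (X (x, y)) * Wy (x, y) = 1"
    "!!x. W (x, 0) = 0"
    by (rule cauchy_kovalevskaya_linear[OF a b b00, of "%x. 0" 1]) (simp_all only: zero_complex.sel, simp_all)
  have lipex: "\<exists>R>0. \<exists>C\<ge>0. \<forall>x y x' y'. \<bar>x\<bar> < R \<longrightarrow> \<bar>y\<bar> < R \<longrightarrow> \<bar>x'\<bar> < R \<longrightarrow> \<bar>y'\<bar> < R \<longrightarrow>
       \<bar>f (x, y) - f (x', y')\<bar> \<le> C * (\<bar>x - x'\<bar> + \<bar>y - y'\<bar>)" if "an2 f" for f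
    using an2_lipschitz[OF that] by metis
  have an: "an2 F" if "F \<in> {Hx, Hy, Wx, Wy, %p. snd (X p)}" for F
    using that H W an2_of_power_series2(1)[OF b] by auto
  obtain RR CC where RC: "!!F. F \<in> {Hx, Hy, Wx, Wy, %p. snd (X p)} ==> RR F > (0::real) \<and> CC F \<ge> (0::real) \<and> (\<forall>x y x' y'. \<bar>x\<bar> < RR F \<longrightarrow> \<bar>y\<bar> < RR F \<longrightarrow> \<bar>x'\<bar> < RR F \<longrightarrow> \<bar>y'\<bar> < RR F \<longrightarrow>
       \<bar>F (x, y) - F (x', y')\<bar> \<le> CC F * (\<bar>x - x'\<bar> + \<bar>y - y'\<bar>))"
    using lipex[OF an] by metis
  define L where "L = Max (CC ` {Hx, Hy, Wx, Wy, %p. snd (X p)})"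
  define R3 where "R3 = Min (RR ` {Hx, Hy, Wx, Wy, %p. snd (X p)})"
  have L: "CC F \<le> L" if "F \<in> {Hx, Hy, Wx, Wy, %p. snd (X p)}" for F
    unfolding L_def by (rule Max_ge) (use that in auto)
  have R3: "R3 \<le> RR F" if "F \<in> {Hx, Hy, Wx, Wy, %p. snd (X p)}" for F
    unfolding R3_def by (rule Min_le) (use that in auto)
  have R30: "R3 > 0" unfolding R3_def using RC by (subst Min_gr_iff) auto
  have L0: "L \<ge> 0" using L[of Hx] RC[of Hx] by auto
  obtain r4 where r4: "r4 > 0" "sqr r4 \<subseteq> U" using open_contains_sqr[OF U] by blast
  \<comment> \<open>The entries serve \<open>Hx_half\<close>, \<open>g_bound\<close> and
    \<open>Wy_near\<close>; \<open>r\<close> is then chosen so small that no function on the list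
    moves by more than \<open>eps\<close> from its value at the origin.\<close>
  define eps where "eps = Min {1 / 4, \<bar>\<beta>\<bar> / 2, 1 / (2 * \<bar>\<beta>\<bar>) / 2}"
  have \<beta>: "\<beta> \<noteq> 0" using b0 by (simp add: \<beta>_def)
  have eps: "eps > 0" "eps \<le> 1 / 4" "eps \<le> \<bar>\<beta>\<bar> / 2" "eps \<le> 1 / (4 * \<bar>\<beta>\<bar>)" using \<beta> by (auto simp: eps_def min_le_iff_disj)
  define r where "r = Min {R1, R2, R3, r4, eps / (2 * (L + 1))}"
  have r: "r > 0" "r \<le> R1" "r \<le> R2" "r \<le> R3" "r \<le> r4" "r \<le> eps / (2 * (L + 1))"
    using H(1) W(1) R30 r4 eps(1) L0 by (auto simp: r_def)
  have Lr: "L * (2 * r) \<le> eps"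
  proof -
    have "L * (2 * r) \<le> (L + 1) * (2 * (eps / (2 * (L + 1))))" using r L0 by (intro mult_mono) auto
    also have "\<dots> = eps" using L0 by (simp add: field_simps)
    finally show ?thesis .
  qed
  have lip: "\<bar>F (x, y) - F (x', y')\<bar> \<le> L * (\<bar>x - x'\<bar> + \<bar>y - y'\<bar>)"
    if "F \<in> {Hx, Hy, Wx, Wy, %p. snd (X p)}" "\<bar>x\<bar> < r" "\<bar>y\<bar> < r" "\<bar>x'\<bar> < r" "\<bar>y'\<bar> < r" for F x y x' y'
  proof -
    have "\<bar>F (x, y) - F (x', y')\<bar> \<le> CC F * (\<bar>x - x'\<bar> + \<bar>y - y'\<bar>)"
      using RC[OF that(1)] R3[OF that(1)] r that(2-) by auto
    also have "\<dots> \<le> L * (\<bar>x - x'\<bar> + \<bar>y - y'\<bar>)" by (intro mult_right_mono L that(1)) auto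
    finally show ?thesis .
  qed
  have near0: "\<bar>F (x, y) - F (0, 0)\<bar> \<le> eps"
    if "F \<in> {Hx, Hy, Wx, Wy, %p. snd (X p)}" "\<bar>x\<bar> < r" "\<bar>y\<bar> < r" for F x y
  proof -
    have "\<bar>F (x, y) - F (0, 0)\<bar> \<le> L * (\<bar>x - 0\<bar> + \<bar>y - 0\<bar>)" using lip[OF that, of 0 0] r by simp
    also have "\<dots> \<le> L * (2 * r)" using L0 that by (intro mult_left_mono) auto
    finally show ?thesis using Lr by linarith
  qed
  have Hx0: "Hx (0, 0) = 1"
  proof (rule DERIV_unique)
    show "((%t. H (t, 0)) has_real_derivative Hx (0, 0)) (at 0)" using partial_derivs(1)[OF H(5)[of 0 0]] H(1) by simp
    show "((%t. H (t, 0)) has_real_derivative 1) (at 0)" unfolding H(7) by (rule DERIV_ident)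
  qed
  have Wx0: "Wx (0, 0) = 0"
  proof (rule DERIV_unique)
    show "((%t. W (t, 0)) has_real_derivative Wx (0, 0)) (at 0)" using partial_derivs(1)[OF W(5)[of 0 0]] W(1) by simp
    show "((%t. W (t, 0)) has_real_derivative 0) (at 0)" unfolding W(7) by (rule DERIV_const)
  qed
  have Hy0: "Hy (0, 0) = 0" using H(6)[of 0 0] H(1) a0 b0 by simp
  have Wy0: "Wy (0, 0) = 1 / \<beta>" using W(6)[of 0 0] W(1) a0 b0 by (simp add: \<beta>_def field_simps)
  \<comment> \<open>The map (H, W) differs from the linear map (x, y / \<beta>) by a Lipschitz
    perturbation with small constant; equal images force the distance |x - x'| + |y - y'| to be at
    most half of itself.\<close>
  have "inj_on (%p. (H p, W p)) (sqr r)"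
  proof (rule inj_onI)
    fix p q assume pq: "p \<in> sqr r" "q \<in> sqr r" and eq: "(H p, W p) = (H q, W q)"
    obtain x y x' y' where p: "p = (x, y)" and q: "q = (x', y')" by (cases p, cases q)
    have xy: "\<bar>x\<bar> < r" "\<bar>y\<bar> < r" "\<bar>x'\<bar> < r" "\<bar>y'\<bar> < r" using pq p q by (auto simp: sqr_iff)
    have "\<bar>H (x, y) - H (x', y') - Hx (0,0) * (x - x') - Hy (0,0) * (y - y')\<bar> \<le> eps * (\<bar>x - x'\<bar> + \<bar>y - y'\<bar>)"
      by (rule real_deriv2_bound[where r=r]) (use r near0 xy in \<open>auto intro!: H(5)\<close>)
    then have 1: "\<bar>x - x'\<bar> \<le> eps * (\<bar>x - x'\<bar> + \<bar>y - y'\<bar>)" using eq p q Hx0 Hy0 by simp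
    have "\<bar>W (x, y) - W (x', y') - Wx (0,0) * (x - x') - Wy (0,0) * (y - y')\<bar> \<le> eps * (\<bar>x - x'\<bar> + \<bar>y - y'\<bar>)"
      by (rule real_deriv2_bound[where r=r]) (use r near0 xy in \<open>auto intro!: W(5)\<close>)
    then have 2: "\<bar>y - y'\<bar> / \<bar>\<beta>\<bar> \<le> eps * (\<bar>x - x'\<bar> + \<bar>y - y'\<bar>)"
      using eq p q Wx0 Wy0 by (simp add: abs_divide)
    have "eps * (\<bar>x - x'\<bar> + \<bar>y - y'\<bar>) \<le> 1 / (4 * \<bar>\<beta>\<bar>) * (\<bar>x - x'\<bar> + \<bar>y - y'\<bar>)" using eps by (intro mult_right_mono) auto
    with 2 have "\<bar>y - y'\<bar> / \<bar>\<beta>\<bar> * \<bar>\<beta>\<bar> \<le> 1 / (4 * \<bar>\<beta>\<bar>) * (\<bar>x - x'\<bar> + \<bar>y - y'\<bar>) * \<bar>\<beta>\<bar>" by (intro mult_right_mono) auto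
    then have 3: "\<bar>y - y'\<bar> \<le> (\<bar>x - x'\<bar> + \<bar>y - y'\<bar>) / 4" using \<beta> by simp
    have "eps * (\<bar>x - x'\<bar> + \<bar>y - y'\<bar>) \<le> 1 / 4 * (\<bar>x - x'\<bar> + \<bar>y - y'\<bar>)" using eps by (intro mult_right_mono) auto
    with 1 3 have "\<bar>x - x'\<bar> + \<bar>y - y'\<bar> \<le> (\<bar>x - x'\<bar> + \<bar>y - y'\<bar>) / 2" by simp
    then have "\<bar>x - x'\<bar> + \<bar>y - y'\<bar> \<le> 0" by simp
    then have "\<bar>x - x'\<bar> + \<bar>y - y'\<bar> = 0" by (rule antisym) simp
    then have "\<bar>x - x'\<bar> = 0 \<and> \<bar>y - y'\<bar> = 0" by (subst (asm) add_nonneg_eq_0_iff) auto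
    then show "p = q" using p q by simp
  qed
  then have "flow_box X U r L H Hx Hy W Wx Wy"
    apply unfold_locales
    subgoal using r by simp
    subgoal using r r4 sqr_mono by blast
    subgoal using L0 .
    subgoal using b0 .
    subgoal for p using near0[of "%p. snd (X p)" "fst p" "snd p"] eps by (auto simp: sqr_def \<beta>_def abs_less_iff)
    subgoal for p using H(5)[of "fst p" "snd p"] r by (auto simp: sqr_def)
    subgoal for p using W(5)[of "fst p" "snd p"] r by (auto simp: sqr_def)
    subgoal for p using H(6)[of "fst p" "snd p"] r by (auto simp: sqr_def)
    subgoal for p using W(6)[of "fst p" "snd p"] r by (auto simp: sqr_def)
    subgoal using H(7) .
    subgoal using W(7) .
    subgoal using Hx0 .
    subgoal using Hy0 .
    subgoal using Wx0 .
    subgoal using Wy0 by (simp add: \<beta>_def)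
    subgoal for x y x' y' F using lip[of F x y x' y'] by (auto simp: sqr_iff)
    subgoal for p using near0[of Hx "fst p" "snd p"] eps Hx0 by (auto simp: sqr_def abs_less_iff)
    subgoal for p using near0[of Wy "fst p" "snd p"] eps(4) Wy0 by (fastforce simp: sqr_def abs_less_iff \<beta>_def)
    .
  then show thesis using that H W by blast
qed

section \<open>Integral curves in the coordinates (H, W)\<close>

context flow_box begin

lemma zero_in: "(0, 0) \<in> sqr r" using r by (simp add: sqr_iff)

lemma integral_curve_constant:
  assumes c: "integral_curve X U gam I" "convex I" "gam ` I \<subseteq> sqr r" and st: "s \<in> I" "t \<in> I"
  shows "H (gam t) = H (gam s)" "W (gam t) = W (gam s) + (t - s)"
proof -
  have d: "(gam has_derivative (%h. h *\<^sub>R X (gam u))) (at u within I)" if "u \<in> I" for u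
    using c(1) that unfolding integral_curve_def has_vector_derivative_def by blast
  have 1: "((%u. H (gam u)) has_derivative (%h. 0)) (at u within I)" if u: "u \<in> I" for u
  proof -
    have p: "gam u \<in> sqr r" using c(3) u by blast
    have "((%u. H (gam u)) has_derivative (%h. Hx (gam u) * fst (h *\<^sub>R X (gam u)) + Hy (gam u) * snd (h *\<^sub>R X (gam u)))) (at u within I)"
      by (rule has_derivative_compose[OF d[OF u] dH[OF p]])
    moreover have "(%h. Hx (gam u) * fst (h *\<^sub>R X (gam u)) + Hy (gam u) * snd (h *\<^sub>R X (gam u))) = (%h. 0)"
    proof
      fix h
      have "Hx (gam u) * fst (h *\<^sub>R X (gam u)) + Hy (gam u) * snd (h *\<^sub>R X (gam u)) = h * (fst (X (gam u)) * Hx (gam u) + snd (X (gam u)) * Hy (gam u))"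
        by (simp add: algebra_simps)
      then show "Hx (gam u) * fst (h *\<^sub>R X (gam u)) + Hy (gam u) * snd (h *\<^sub>R X (gam u)) = 0" using pdeH[OF p] by simp
    qed
    ultimately show ?thesis by simp
  qed
  have 2: "((%u. W (gam u) - u) has_derivative (%h. 0)) (at u within I)" if u: "u \<in> I" for u
  proof -
    have p: "gam u \<in> sqr r" using c(3) u by blast
    have "((%u. W (gam u) - u) has_derivative (%h. (Wx (gam u) * fst (h *\<^sub>R X (gam u)) + Wy (gam u) * snd (h *\<^sub>R X (gam u))) - h)) (at u within I)"
      by (rule has_derivative_diff[OF has_derivative_compose[OF d[OF u] dW[OF p]] has_derivative_ident])
    moreover have "(%h. (Wx (gam u) * fst (h *\<^sub>R X (gam u)) + Wy (gam u) * snd (h *\<^sub>R X (gam u))) - h) = (%h. 0)"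
    proof
      fix h
      have "Wx (gam u) * fst (h *\<^sub>R X (gam u)) + Wy (gam u) * snd (h *\<^sub>R X (gam u)) - h = h * (fst (X (gam u)) * Wx (gam u) + snd (X (gam u)) * Wy (gam u)) - h"
        by (simp add: algebra_simps)
      then show "(Wx (gam u) * fst (h *\<^sub>R X (gam u)) + Wy (gam u) * snd (h *\<^sub>R X (gam u))) - h = 0" using pdeW[OF p] by simp
    qed
    ultimately show ?thesis by simp
  qed
  obtain c1 where "!!u. u \<in> I ==> H (gam u) = c1"
    using has_derivative_zero_constant[OF c(2) 1] by blast
  then show "H (gam t) = H (gam s)" using st by simp
  obtain c2 where "!!u. u \<in> I ==> W (gam u) - u = c2"
    using has_derivative_zero_constant[OF c(2) 2] by blast
  then have "W (gam t) - t = W (gam s) - s" using st by simp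
  then show "W (gam t) = W (gam s) + (t - s)" by simp
qed

text \<open>Only \<open>gam1\<close> is assumed to stay in the square, so the lemma also prevents
  \<open>gam2\<close> from leaving it. The set of agreement is closed by continuity, and open
  because near an agreement time both curves lie in the square, where (H, W) determines the
  point.\<close>

lemma integral_curve_unique:
  assumes c1: "integral_curve X U gam1 I" "gam1 ` I \<subseteq> sqr r" and c2: "integral_curve X U gam2 I"
    and I: "convex I" "c \<in> I" "gam1 c = gam2 c" and t: "t \<in> I"
  shows "gam2 t = gam1 t"
proof -
  have cont: "continuous_on I gam" if "integral_curve X U gam I" for gam
    using that unfolding integral_curve_def continuous_on_eq_continuous_within
    using has_vector_derivative_continuous by blast
  define S where "S = {t \<in> I. gam2 t = gam1 t}"
  have "closedin (top_of_set I) S"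
  proof -
    have "closedin (top_of_set I) {t \<in> I. gam2 t - gam1 t = 0}"
      by (intro continuous_closedin_preimage_constant continuous_on_diff cont c1 c2)
    then show ?thesis by (simp add: S_def)
  qed
  moreover have "openin (top_of_set I) S"
    unfolding openin_contains_ball
  proof (intro conjI ballI)
    show "S \<subseteq> I" by (auto simp: S_def)
    fix u assume u: "u \<in> S"
    then have uI: "u \<in> I" and eq: "gam2 u = gam1 u" by (auto simp: S_def)
    have "gam2 u \<in> sqr r" using c1(2) uI eq by (metis image_subset_iff)
    then obtain e where e: "e > 0" "ball (gam2 u) e \<subseteq> sqr r" using open_sqr open_contains_ball by blast
    obtain d where d: "d > 0" "!!v. v \<in> I ==> dist v u < d ==> dist (gam2 v) (gam2 u) < e"
      using cont[OF c2] uI e(1) unfolding continuous_on_iff by blast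
    have "v \<in> S" if v: "v \<in> ball u d \<inter> I" for v
    proof -
      let ?J = "ball u d \<inter> I"
      have J: "convex ?J" "u \<in> ?J" using I(1) d uI by (auto intro: convex_Int)
      have sub1: "gam1 ` ?J \<subseteq> sqr r" using c1(2) by blast
      have sub2: "gam2 ` ?J \<subseteq> sqr r" using d(2) e(2) by (force simp: dist_commute)
      have ic: "integral_curve X U gam ?J" if "integral_curve X U gam I" for gam
        using that unfolding integral_curve_def by (meson IntD2 has_vector_derivative_within_subset inf_le2)
      have "H (gam1 v) = H (gam1 u)" "W (gam1 v) = W (gam1 u) + (v - u)"
        using integral_curve_constant[OF ic[OF c1(1)] J(1) sub1 J(2) v] by auto
      moreover have "H (gam2 v) = H (gam2 u)" "W (gam2 v) = W (gam2 u) + (v - u)"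
        using integral_curve_constant[OF ic[OF c2(1)] J(1) sub2 J(2) v] by auto
      ultimately have "(H (gam2 v), W (gam2 v)) = (H (gam1 v), W (gam1 v))" using eq by simp
      then have "gam2 v = gam1 v" using inj_onD[OF inj, of "gam2 v" "gam1 v"] sub1 sub2 v by blast
      then show "v \<in> S" using v by (simp add: S_def)
    qed
    then show "\<exists>d>0. ball u d \<inter> I \<subseteq> S" using d by blast
  qed
  ultimately have "S = {} \<or> S = I"
    using I(1) convex_connected connected_clopen by blast
  then show ?thesis using I t by (auto simp: S_def)
qed

definition Psi :: "real \<times> real \<Rightarrow> real \<times> real" where "Psi p = (H p, W p)"

definition line :: "real \<Rightarrow> real \<Rightarrow> real \<times> real" where
  "line h t = the_inv_into (sqr r) Psi (h, t)"

lemma Psi_inj: "inj_on Psi (sqr r)" using inj unfolding Psi_def .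

lemma line_Psi: "p \<in> sqr r ==> line (H p) (W p) = p"
  unfolding line_def using the_inv_into_f_f[OF Psi_inj] by (simp add: Psi_def)

lemma Psi_line:
  assumes "(h, t) \<in> Psi ` sqr r" shows "line h t \<in> sqr r" "H (line h t) = h" "W (line h t) = t"
proof -
  show "line h t \<in> sqr r" unfolding line_def using the_inv_into_into[OF Psi_inj assms order_refl] .
  have "Psi (line h t) = (h, t)" unfolding line_def by (rule f_the_inv_into_f[OF Psi_inj assms])
  then show "H (line h t) = h" "W (line h t) = t" by (auto simp: Psi_def)
qed

lemma Psi_deriv:
  assumes "p \<in> sqr r"
  shows "(Psi has_derivative (%v. (Hx p * fst v + Hy p * snd v, Wx p * fst v + Wy p * snd v))) (at p)"
  unfolding Psi_def by (rule has_derivative_Pair[OF dH[OF assms] dW[OF assms]])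

lemma Psi_open: "open (Psi ` sqr r)"
proof (rule invariance_of_domain)
  show "continuous_on (sqr r) Psi"
    using Psi_deriv by (meson continuous_at_imp_continuous_on has_derivative_continuous)
qed (use open_sqr Psi_inj in auto)

text \<open>In the coordinates (H, W) the field is (0, 1). Cramer's rule for the two equations X.H =
  0 and X.W = 1 identifies \<open>X\<close> with the second column of the inverse Jacobian.\<close>

lemma line_deriv:
  assumes ht: "(h, t) \<in> Psi ` sqr r"
  shows "((%t. line h t) has_vector_derivative X (line h t)) (at t)"
proof -
  define p where "p = line h t"
  have p: "p \<in> sqr r" "H p = h" "W p = t" using Psi_line[OF ht] by (auto simp: p_def)
  define D where "D = Hx p * Wy p - Hy p * Wx p"
  have f: "fst (X p) * D = - Hy p"
  proof -
    have "fst (X p) * D = (fst (X p) * Hx p + snd (X p) * Hy p) * Wy p - Hy p * (fst (X p) * Wx p + snd (X p) * Wy p)"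
      by (simp add: D_def algebra_simps)
    then show ?thesis using pdeH[OF p(1)] pdeW[OF p(1)] by simp
  qed
  have g: "snd (X p) * D = Hx p"
  proof -
    have "snd (X p) * D = Hx p * (fst (X p) * Wx p + snd (X p) * Wy p) - Wx p * (fst (X p) * Hx p + snd (X p) * Hy p)"
      by (simp add: D_def algebra_simps)
    then show ?thesis using pdeH[OF p(1)] pdeW[OF p(1)] by simp
  qed
  have "Hx p \<noteq> 0" using Hx_half[OF p(1)] by auto
  then have D: "D \<noteq> 0" using g by auto
  let ?f' = "%v. (Hx p * fst v + Hy p * snd v, Wx p * fst v + Wy p * snd v)"
  let ?g' = "%v. ((Wy p * fst v - Hy p * snd v) / D, (Hx p * snd v - Wx p * fst v) / D)"
  have id: "?f' \<circ> ?g' = id"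
  proof
    fix v :: "real \<times> real"
    have 1: "Hx p * ((Wy p * fst v - Hy p * snd v) / D) + Hy p * ((Hx p * snd v - Wx p * fst v) / D) = D * fst v / D"
      unfolding D_def by (simp add: algebra_simps flip: add_divide_distrib diff_divide_distrib)
    have 2: "Wx p * ((Wy p * fst v - Hy p * snd v) / D) + Wy p * ((Hx p * snd v - Wx p * fst v) / D) = D * snd v / D"
      unfolding D_def by (simp add: algebra_simps flip: add_divide_distrib diff_divide_distrib)
    show "(?f' \<circ> ?g') v = id v" using 1 2 D by (simp add: prod_eq_iff)
  qed
  have "(the_inv_into (sqr r) Psi has_derivative ?g') (at (Psi p))"
  proof (rule has_derivative_inverse_strong[OF open_sqr p(1) _ _ Psi_deriv[OF p(1)] id])
    show "continuous_on (sqr r) Psi"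
      using Psi_deriv by (meson continuous_at_imp_continuous_on has_derivative_continuous)
    show "!!x. x \<in> sqr r ==> the_inv_into (sqr r) Psi (Psi x) = x" by (rule the_inv_into_f_f[OF Psi_inj])
  qed
  then have "(the_inv_into (sqr r) Psi has_derivative ?g') (at (h, t))" using p by (simp add: Psi_def)
  moreover have "((%t. (h, t)) has_derivative (%v. (0, v))) (at t)" by (auto intro!: derivative_eq_intros)
  ultimately have "((%t. line h t) has_derivative (%v. ?g' (0, v))) (at t)"
    unfolding line_def using has_derivative_compose by blast
  moreover have "(%v. ?g' (0, v)) = (%v. v *\<^sub>R X p)"
  proof
    fix v :: real
    have "fst (X p) = - Hy p / D" "snd (X p) = Hx p / D" using f g D by (simp_all add: field_simps)
    then show "?g' (0, v) = v *\<^sub>R X p" by (simp add: prod_eq_iff)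
  qed
  ultimately show ?thesis unfolding has_vector_derivative_def p_def by simp
qed

lemma line_integral_curve:
  assumes "!!t. t \<in> I ==> (h, w + t) \<in> Psi ` sqr r"
  shows "integral_curve X U (%t. line h (w + t)) I"
  unfolding integral_curve_def
proof (intro ballI conjI)
  fix t assume t: "t \<in> I"
  show "line h (w + t) \<in> U" using Psi_line(1)[OF assms[OF t]] sub by blast
  have "((%t. line h t) \<circ> (%t. w + t) has_vector_derivative 1 *\<^sub>R X (line h (w + t))) (at t)"
  proof (rule vector_diff_chain_at)
    show "((+) w has_vector_derivative 1) (at t)" by (auto intro!: derivative_eq_intros simp: has_vector_derivative_def)
  qed (rule line_deriv[OF assms[OF t]])
  then show "((%t. line h (w + t)) has_vector_derivative X (line h (w + t))) (at t within I)"
    by (simp add: o_def has_vector_derivative_at_within)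
qed

text \<open>A uniform existence time: one \<eta> serves all points near the origin, whose orbits
  exist in the box as long as the time function stays below \<eta> in modulus.\<close>

lemma Psi_nbhd:
  obtains rho \<eta> where "0 < rho" "rho \<le> r" "0 < \<eta>" "!!p t. p \<in> sqr rho ==> \<bar>t\<bar> < \<eta> ==> (H p, t) \<in> Psi ` sqr r"
    "!!p. p \<in> sqr rho ==> \<bar>W p\<bar> < \<eta>"
proof -
  have "Psi (0, 0) = (0, 0)" by (simp add: Psi_def H0 W0)
  then have "(0, 0) \<in> Psi ` sqr r" using zero_in by (metis image_eqI)
  then obtain \<eta> where \<eta>: "\<eta> > 0" "sqr \<eta> \<subseteq> Psi ` sqr r" using open_contains_sqr[OF Psi_open] by blast
  have cont: "continuous_on (sqr r) Psi"
    using Psi_deriv by (meson continuous_at_imp_continuous_on has_derivative_continuous)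
  have "open (sqr r \<inter> Psi -` sqr \<eta>)"
    using continuous_on_open_vimage[OF open_sqr] cont open_sqr by (metis Int_commute)
  moreover have "(0, 0) \<in> sqr r \<inter> Psi -` sqr \<eta>" using zero_in \<open>Psi (0, 0) = (0, 0)\<close> \<eta> by (simp add: sqr_iff)
  ultimately obtain rho where rho: "rho > 0" "sqr rho \<subseteq> sqr r \<inter> Psi -` sqr \<eta>" using open_contains_sqr by blast
  have "\<bar>H p\<bar> < \<eta> \<and> \<bar>W p\<bar> < \<eta>" if "p \<in> sqr (min rho r)" for p
    using that rho(2) sqr_mono[of "min rho r" rho] by (auto simp: Psi_def sqr_iff)
  then show thesis using that[of "min rho r" \<eta>] rho \<eta> r
    by (metis min.cobounded2 min_less_iff_conj sqr_iff subsetD)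
qed

end

section \<open>Germs given by real power series in one variable\<close>

lemma ps_shift:
  assumes f: "has_power_series c f" and z: "!!j. j < m ==> c j = 0"
  obtains e r where "has_power_series (%i. c (i + m)) e" "r > 0" "!!y. \<bar>y\<bar> < r ==> f y = y ^ m * e y"
proof -
  obtain r where r: "r > 0" "!!y. \<bar>y\<bar> < r ==> (%i. c i * y ^ i) sums f y"
    using f unfolding has_power_series_def by blast
  define e where "e = (%y. if y = 0 then c m else f y / y ^ m)"
  have s: "(%i. c (i + m) * y ^ (i + m)) sums f y" if "\<bar>y\<bar> < r" for y
    using sums_split_initial_segment[OF r(2)[OF that], of m] z by simp
  have e: "(%i. c (i + m) * y ^ i) sums e y" if y: "\<bar>y\<bar> < r" for y
  proof (cases "y = 0")
    case True
    then show ?thesis using powser_sums_zero[of "%i. c (i + m)"] by (simp add: e_def)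
  next
    case False
    then show ?thesis using sums_divide[OF s[OF y], of "y ^ m"] by (simp add: e_def power_add mult.assoc[symmetric])
  qed
  show thesis
  proof (rule that[of e r])
    show "has_power_series (%i. c (i + m)) e" unfolding has_power_series_def using e r by blast
    show "f y = y ^ m * e y" if y: "\<bar>y\<bar> < r" for y
    proof (cases "y = 0")
      case True
      have "f 0 = c 0" using sums_unique2[OF r(2)[of 0] powser_sums_zero] r(1) by simp
      then show ?thesis using True z[of 0] by (cases m) (auto simp: e_def)
    qed (simp add: e_def)
  qed (rule r)
qed

lemma ps_deriv:
  assumes f: "has_power_series c f"
  obtains r where "r > 0" "!!y. \<bar>y\<bar> < r ==> (f has_real_derivative deriv f y) (at y)"
    "has_power_series (%i. real (Suc i) * c (Suc i)) (deriv f)"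
proof -
  obtain r where r: "r > 0" "!!y. \<bar>y\<bar> < r ==> (%i. c i * y ^ i) sums f y"
    using f unfolding has_power_series_def by blast
  have sm: "summable (%i. c i * y ^ i)" if "norm y < r" for y using r(2)[of y] that sums_summable by auto
  have D: "(f has_real_derivative (\<Sum>n. diffs c n * y ^ n)) (at y)" if y: "\<bar>y\<bar> < r" for y
  proof -
    have 1: "((%y. \<Sum>n. c n * y ^ n) has_real_derivative (\<Sum>n. diffs c n * y ^ n)) (at y)"
      by (rule termdiffs_strong'[where K=r]) (use sm y in auto)
    show ?thesis
      by (rule has_field_derivative_transform_within_open[OF 1, of "{-r<..<r}"])
        (use y sums_unique[OF r(2)] in auto)
  qed
  have D': "deriv f y = (\<Sum>n. diffs c n * y ^ n)" if "\<bar>y\<bar> < r" for y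
    by (rule DERIV_imp_deriv[OF D[OF that]])
  show thesis
  proof (rule that[OF r(1)])
    show "(f has_real_derivative deriv f y) (at y)" if "\<bar>y\<bar> < r" for y using D[OF that] D'[OF that] by simp
    have "(%i. real (Suc i) * c (Suc i) * y ^ i) sums deriv f y" if "\<bar>y\<bar> < r" for y
    proof -
      have "summable (%n. diffs c n * y ^ n)"
        by (rule termdiff_converges[where K=r]) (use sm that in auto)
      then show ?thesis using D'[OF that] summable_sums by (fastforce simp: diffs_def)
    qed
    then show "has_power_series (%i. real (Suc i) * c (Suc i)) (deriv f)"
      unfolding has_power_series_def using r(1) by blast
  qed
qed

lemma ps_0: "has_power_series c f ==> f 0 = c 0"
  unfolding has_power_series_def using powser_sums_zero sums_unique2 by (metis abs_zero)

lemma ps_isCont: "has_power_series c f ==> isCont f 0"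
  by (metis ps_deriv DERIV_isCont abs_zero)

lemma ps_leading:
  assumes f: "has_power_series c f" and z: "!!j. j < m ==> c j = 0"
  shows "((%y. f y / y ^ m) \<longlongrightarrow> c m) (at 0)"
proof -
  obtain e r where e: "has_power_series (%i. c (i + m)) e" "r > 0" "!!y. \<bar>y\<bar> < r ==> f y = y ^ m * e y"
    using ps_shift[OF f z] by blast
  have "(e \<longlongrightarrow> c m) (at 0)" using ps_isCont[OF e(1)] ps_0[OF e(1)] by (simp add: isCont_def)
  moreover have "\<forall>\<^sub>F y in at 0. f y / y ^ m = e y"
    unfolding eventually_at using e(2,3) by (intro exI[of _ r]) auto
  ultimately show ?thesis by (simp add: tendsto_cong)
qed

lemma ps_remainder:
  assumes f: "has_power_series c f" and z: "!!j. j < m ==> c j = 0"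
  obtains r C where "r > 0" "C \<ge> 0" "!!y. \<bar>y\<bar> < r ==> \<bar>f y - c m * y ^ m\<bar> \<le> C * \<bar>y\<bar> ^ Suc m"
proof -
  obtain e r where e: "has_power_series (%i. c (i + m)) e" "r > 0" "!!y. \<bar>y\<bar> < r ==> f y = y ^ m * e y"
    using ps_shift[OF f z] by blast
  obtain r1 where r1: "r1 > 0" "!!y. \<bar>y\<bar> < r1 ==> (%i. c (i + m) * y ^ i) sums e y"
    using e(1) unfolding has_power_series_def by blast
  define e0 where "e0 = (%y. e y - c m)"
  define c0 where "c0 = (%i. if i = 0 then 0 else c (i + m))"
  have ps0: "has_power_series c0 e0"
    unfolding c0_def has_power_series_def
  proof (intro exI[of _ r1] conjI allI impI r1(1))
    fix y :: real assume y: "\<bar>y\<bar> < r1"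
    have "(%i. c (i + m) * y ^ i - (if i = 0 then c m else 0)) sums (e y - c m)"
      by (intro sums_diff r1(2)[OF y] sums_single[of 0 "%_. c m"])
    moreover have "(%i. c (i + m) * y ^ i - (if i = 0 then c m else 0)) = (%i. (if i = 0 then 0 else c (i + m)) * y ^ i)"
      by auto
    ultimately show "(%i. (if i = 0 then 0 else c (i + m)) * y ^ i) sums e0 y" by (simp add: e0_def)
  qed
  obtain e1 r2 where e1: "has_power_series (%i. c0 (i + 1)) e1" "r2 > 0" "!!y. \<bar>y\<bar> < r2 ==> e0 y = y ^ 1 * e1 y"
    by (rule ps_shift[OF ps0, of 1]) (auto simp: c0_def)
  have "\<exists>d>0. \<forall>y. dist y 0 < d \<longrightarrow> dist (e1 y) (e1 0) < 1"
    using ps_isCont[OF e1(1)] unfolding continuous_at_eps_delta by (meson zero_less_one)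
  then obtain d where d: "d > 0" "!!y. \<bar>y\<bar> < d ==> \<bar>e1 y - e1 0\<bar> < 1"
    by (auto simp: dist_real_def)
  define C where "C = \<bar>e1 0\<bar> + 1"
  show thesis
  proof (rule that[of "Min {r, r2, d}" C])
    fix y assume y: "\<bar>y\<bar> < Min {r, r2, d}"
    have b: "\<bar>e1 y\<bar> \<le> C" using d(2)[of y] y by (simp add: C_def)
    have "f y - c m * y ^ m = y ^ m * (y * e1 y)"
      using e(3)[of y] e1(3)[of y] y by (simp add: e0_def algebra_simps)
    then have "\<bar>f y - c m * y ^ m\<bar> = \<bar>y\<bar> ^ Suc m * \<bar>e1 y\<bar>" by (simp add: abs_mult power_abs)
    also have "\<dots> \<le> \<bar>y\<bar> ^ Suc m * C" by (intro mult_left_mono b) auto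
    finally show "\<bar>f y - c m * y ^ m\<bar> \<le> C * \<bar>y\<bar> ^ Suc m" by (simp add: mult.commute)
  qed (use e e1 d in \<open>auto simp: C_def\<close>)
qed

lemma ps_diff:
  assumes "has_power_series c f" "has_power_series d g"
  shows "has_power_series (%i. c i - d i) (%y. f y - g y)"
proof -
  obtain r where r: "r > 0" "!!y. \<bar>y\<bar> < r ==> (%i. c i * y ^ i) sums f y"
    using assms(1) unfolding has_power_series_def by blast
  obtain s where s: "s > 0" "!!y. \<bar>y\<bar> < s ==> (%i. d i * y ^ i) sums g y"
    using assms(2) unfolding has_power_series_def by blast
  show ?thesis unfolding has_power_series_def
    by (intro exI[of _ "min r s"]) (use r s in \<open>auto simp: left_diff_distrib intro!: sums_diff\<close>)
qed

lemma ps_scale: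
  assumes "has_power_series c f"
  shows "has_power_series (%i. a * c i * b ^ i) (%y. a * f (b * y))"
proof -
  obtain r where r: "r > 0" "!!y. \<bar>y\<bar> < r ==> (%i. c i * y ^ i) sums f y"
    using assms unfolding has_power_series_def by metis
  have "(%i. a * c i * b ^ i * y ^ i) sums (a * f (b * y))" if y: "\<bar>y\<bar> < r / (\<bar>b\<bar> + 1)" for y
  proof -
    have "\<bar>b * y\<bar> \<le> (\<bar>b\<bar> + 1) * \<bar>y\<bar>" by (simp add: abs_mult mult_right_mono)
    also have "\<dots> < r" using y by (simp add: pos_less_divide_eq mult.commute)
    finally have "(%i. a * (c i * (b * y) ^ i)) sums (a * f (b * y))" by (intro sums_mult r(2))
    then show ?thesis by (simp add: power_mult_distrib mult_ac)
  qed
  then show ?thesis unfolding has_power_series_def using r(1) by (intro exI[of _ "r / (\<bar>b\<bar> + 1)"]) auto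
qed

text \<open>The order and the leading coefficient can be read along any single approach
  \<open>y\<close> to 0, in particular along an orbit. Lower coefficients vanish by induction, since
  f / y^j = (f / y^n) y^(n - j) tends to 0.\<close>

lemma ps_coeff_of_leading:
  assumes f: "has_power_series c f" and F: "F \<noteq> bot" "filterlim y (at 0) F" "((%t. f (y t) / y t ^ n) \<longlongrightarrow> l) F"
  shows "(\<forall>j<n. c j = 0) \<and> c n = l"
proof -
  have y0: "(y \<longlongrightarrow> 0) F" and ynz: "\<forall>\<^sub>F t in F. y t \<noteq> 0"
    using F(2) by (auto simp: filterlim_at)
  have z: "c j = 0" if "j < n" for j
    using that
  proof (induction j rule: less_induct)
    case (less j)
    have lj: "((%t. f (y t) / y t ^ j) \<longlongrightarrow> c j) F"
      by (rule filterlim_compose[OF ps_leading[OF f] F(2)]) (use less in auto)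
    have "((%t. f (y t) / y t ^ n * y t ^ (n - j)) \<longlongrightarrow> l * 0 ^ (n - j)) F"
      by (intro tendsto_intros F(3) y0)
    moreover have "\<forall>\<^sub>F t in F. f (y t) / y t ^ n * y t ^ (n - j) = f (y t) / y t ^ j"
      using ynz by eventually_elim (use less.prems in \<open>simp add: field_simps flip: power_add\<close>)
    ultimately have "((%t. f (y t) / y t ^ j) \<longlongrightarrow> l * 0 ^ (n - j)) F" by (rule Lim_transform_eventually)
    then have "c j = l * 0 ^ (n - j)" using tendsto_unique[OF F(1) lj] by blast
    then show ?case using less.prems by simp
  qed
  have "((%t. f (y t) / y t ^ n) \<longlongrightarrow> c n) F"
    by (rule filterlim_compose[OF ps_leading[OF f] F(2)]) (use z in auto)
  then show ?thesis using z tendsto_unique[OF F(1) F(3)] by auto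
qed

lemma ps_unique:
  assumes c: "has_power_series c f" and d: "has_power_series d g" and eq: "\<forall>\<^sub>F y in at 0. f y = g y"
  shows "c = d"
proof
  fix i
  have "((%y. (f y - g y) / y ^ i) \<longlongrightarrow> 0) (at 0)"
    by (rule tendsto_eventually) (use eq in \<open>eventually_elim, simp\<close>)
  then have "c i - d i = 0"
    using ps_coeff_of_leading[OF ps_diff[OF c d], of "at 0" "%y. y" i 0] by (simp add: filterlim_ident)
  then show "c i = d i" by simp
qed

text \<open>Same germs as those with a power series, described by a holomorphic extension:
  composition and inversion are available here, coefficients there.\<close>

definition ran1 :: "(real \<Rightarrow> real) \<Rightarrow> bool" where
  "ran1 f \<longleftrightarrow> (\<exists>R>0. \<exists>F. F holomorphic_on ball 0 R \<and> (\<forall>t. \<bar>t\<bar> < R \<longrightarrow> F (of_real t) = of_real (f t)))"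

lemma ran_ps:
  assumes "ran1 f" obtains c where "has_power_series c f"
proof -
  obtain R F where F: "R > 0" "F holomorphic_on ball 0 R" "!!t. \<bar>t\<bar> < R ==> F (of_real t) = of_real (f t)"
    using assms unfolding ran1_def by blast
  let ?c = "%n. (deriv ^^ n) F 0 / fact n"
  have "(%n. Re (?c n) * t ^ n) sums f t" if t: "\<bar>t\<bar> < R" for t
  proof -
    have "(%n. ?c n * (of_real t - 0) ^ n) sums F (of_real t)"
      by (rule holomorphic_power_series[OF F(2)]) (use t in simp)
    from sums_Re[OF this] have "(%n. Re (?c n * of_real (t ^ n))) sums f t" using F(3)[OF t] by simp
    moreover have "Re (a * of_real x) = Re a * x" for a x by simp
    ultimately show ?thesis by (simp only:)
  qed
  then show thesis using that[of "%n. Re (?c n)"] F(1) unfolding has_power_series_def by blast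
qed

lemma ps_ran:
  assumes "has_power_series c f" shows "ran1 f"
proof -
  obtain r where r: "r > 0" "!!y. \<bar>y\<bar> < r ==> (%i. c i * y ^ i) sums f y"
    using assms unfolding has_power_series_def by metis
  define F where "F = (%z::complex. \<Sum>i. of_real (c i) * z ^ i)"
  have s: "(%i. of_real (c i) * z ^ i) sums F z" if z: "norm z < r" for z
  proof -
    obtain t where t: "norm z < t" "t < r" using dense[OF z] by blast
    have t0: "0 < t" using t norm_ge_zero[of z] by linarith
    have "summable (%i. c i * t ^ i)" using r(2)[of t] t t0 sums_summable by auto
    then have "summable (%i. complex_of_real (c i * t ^ i))" by (rule summable_of_real)
    then have "summable (%i. of_real (c i) * (of_real t :: complex) ^ i)" by simp
    then have "summable (%i. of_real (c i) * z ^ i)"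
      by (rule powser_inside) (use t t0 in simp)
    then show ?thesis unfolding F_def by (rule summable_sums)
  qed
  have "F holomorphic_on ball 0 r"
    by (rule power_series_holomorphic[where a="%i. of_real (c i)"]) (use s in auto)
  moreover have "F (of_real t) = of_real (f t)" if t: "\<bar>t\<bar> < r" for t
  proof -
    have "(%i. complex_of_real (c i * t ^ i)) sums of_real (f t)" by (rule sums_of_real[OF r(2)[OF t]])
    moreover have "(%i. complex_of_real (c i * t ^ i)) sums F (of_real t)" using s[of "of_real t"] t by simp
    ultimately show ?thesis using sums_unique2 by blast
  qed
  ultimately show ?thesis unfolding ran1_def using r(1) by blast
qed

lemma ran_diff: assumes "ran1 f" "ran1 g" shows "ran1 (%y. f y - g y)"
proof -
  obtain c d where "has_power_series c f" "has_power_series d g" using assms ran_ps by metis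
  then show ?thesis by (rule ps_ran[OF ps_diff])
qed

lemma ran_comp:
  assumes "ran1 f" "ran1 g" "g 0 = 0" shows "ran1 (%y. f (g y))"
proof -
  obtain R F where F: "R > 0" "F holomorphic_on ball 0 R" "!!t. \<bar>t\<bar> < R ==> F (of_real t) = of_real (f t)"
    using assms unfolding ran1_def by blast
  obtain S G where G: "S > 0" "G holomorphic_on ball 0 S" "!!t. \<bar>t\<bar> < S ==> G (of_real t) = of_real (g t)"
    using assms unfolding ran1_def by blast
  have "isCont G 0" using holomorphic_on_imp_continuous_on[OF G(2)] G(1) by (simp add: continuous_on_eq_continuous_at)
  moreover have G0: "G 0 = 0" using G(3)[of 0] G(1) assms(3) by simp
  ultimately obtain d where d: "d > 0" "!!z. norm z < d ==> norm (G z) < R"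
    unfolding continuous_at_eps_delta using F(1) by (metis dist_0_norm dist_commute)
  let ?d = "min d S"
  have "(F \<circ> G) holomorphic_on ball 0 ?d"
    by (rule holomorphic_on_compose_gen[OF holomorphic_on_subset[OF G(2)] F(2)]) (use d in auto)
  moreover have "(F \<circ> G) (of_real t) = of_real (f (g t))" if "\<bar>t\<bar> < ?d" for t
  proof -
    have "norm (G (of_real t)) < R" using d(2)[of "of_real t"] that by simp
    then show ?thesis using F(3)[of "g t"] G(3)[of t] that by simp
  qed
  ultimately show ?thesis unfolding ran1_def using d(1) G(1) by (intro exI[of _ ?d]) auto
qed

lemma an2_ran: assumes "an2 f" shows "ran1 (%y. f (0, y))"
proof -
  obtain R F where F: "R > 0" "sephol R F" "!!x y. \<bar>x\<bar> < R ==> \<bar>y\<bar> < R ==> F (of_real x) (of_real y) = of_real (f (x, y))"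
    using assms(1) unfolding an2_def by blast
  have "F 0 holomorphic_on ball 0 R" using F(1,2) unfolding sephol_def by simp
  then show ?thesis unfolding ran1_def using F(1) F(3)[of 0] by (intro exI[of _ R]) auto
qed

text \<open>The involution is read off a \<open>2k\<close>-th root \<open>s\<close> of \<open>G\<close> as the solution of \<open>s (P y) = - s y\<close>.\<close>

lemma analytic_involution:
  assumes G: "has_power_series c G" and z: "!!j. j < 2 * k ==> c j = 0" and c0: "c (2 * k) \<noteq> 0" and k: "k \<ge> 1"
  obtains P d where "ran1 P" "d > 0" "P 0 = 0" "!!y. \<bar>y\<bar> < d ==> G (P y) = G y" "!!y. \<bar>y\<bar> < d ==> sgn (P y) = - sgn y"
    "!!y. \<bar>y\<bar> < d ==> \<bar>P y\<bar> < d ==> P (P y) = y"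
    "!!u v. \<bar>u\<bar> < d ==> \<bar>v\<bar> < d ==> G u = G v ==> u = v \<or> u = P v"
proof -
  obtain e0 r0 where e0: "has_power_series (%i. c (i + 2 * k)) e0" "r0 > 0" "!!y. \<bar>y\<bar> < r0 ==> G y = y ^ (2 * k) * e0 y"
    using ps_shift[OF G z] by blast
  define e where "e = (%y. e0 y / c (2 * k))"
  have "has_power_series (%i. (1 / c (2 * k)) * c (i + 2 * k) * 1 ^ i) (%y. (1 / c (2 * k)) * e0 (1 * y))"
    by (rule ps_scale[OF e0(1)])
  then have "ran1 e" using ps_ran by (simp add: e_def)
  then obtain R E where E: "R > 0" "E holomorphic_on ball 0 R" "!!t. \<bar>t\<bar> < R ==> E (of_real t) = of_real (e t)"
    unfolding ran1_def by blast
  have e00: "e 0 = 1" using ps_0[OF e0(1)] c0 by (simp add: e_def)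
  then have E0: "E 0 = 1" using E(3)[of 0] E(1) by simp
  have "isCont E 0" using holomorphic_on_imp_continuous_on[OF E(2)] E(1) by (simp add: continuous_on_eq_continuous_at)
  then obtain d1 where d1: "d1 > 0" "!!z. norm z < d1 ==> dist (E z) (E 0) < 1"
    unfolding continuous_at_eps_delta by (metis dist_0_norm dist_commute zero_less_one)
  define r1 where "r1 = Min {d1, R, r0}"
  have r1: "r1 > 0" "r1 \<le> d1" "r1 \<le> R" "r1 \<le> r0" using d1 E(1) e0(2) by (auto simp: r1_def)
  have ReE: "Re (E z) > 0" if "norm z < r1" for z
  proof -
    have "\<bar>Re (E z - 1)\<bar> < 1" using d1(2)[of z] that r1 E0 abs_Re_le_cmod[of "E z - 1"] by (simp add: dist_norm)
    then show ?thesis by simp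
  qed
  have epos: "e t > 0" if "\<bar>t\<bar> < r1" for t using ReE[of "of_real t"] E(3)[of t] that r1 by simp
  \<comment> \<open>The holomorphic root of \<open>G / c (2 * k)\<close>: S(z) = z E(z)^(1 / (2 k)),
    with the principal logarithm because Re E > 0 on the disc. Its derivative at 0 is 1, so it is
    locally invertible; \<open>s\<close> is its real trace.\<close>
  define S where "S = (%z. z * exp (Ln (E z) / of_nat (2 * k)))"
  define s where "s = (%t. t * exp (ln (e t) / real (2 * k)))"
  have S_hol: "S holomorphic_on ball 0 r1"
    unfolding S_def using ReE r1 k
    by (intro holomorphic_intros holomorphic_on_subset[OF E(2)]) (force simp: complex_nonpos_Reals_iff)+
  have Ss: "S (of_real t) = of_real (s t)" if "\<bar>t\<bar> < r1" for t
    using epos[OF that] E(3)[of t] that r1 by (simp add: S_def s_def Ln_of_real flip: exp_of_real)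
  have S0: "S 0 = 0" by (simp add: S_def)
  have s_sgn: "sgn (s t) = sgn t" for t by (simp add: s_def sgn_mult)
  have Gs: "G t = c (2 * k) * s t ^ (2 * k)" if t: "\<bar>t\<bar> < r1" for t
  proof -
    have "exp (ln (e t) / real (2 * k)) ^ (2 * k) = e t"
      using epos[OF t] k by (simp flip: exp_of_nat_mult)
    then have "c (2 * k) * s t ^ (2 * k) = t ^ (2 * k) * (c (2 * k) * e t)" by (simp add: s_def power_mult_distrib)
    then show ?thesis using e0(3)[of t] t r1 c0 by (simp add: e_def)
  qed
  have dS: "deriv S 0 \<noteq> 0"
  proof -
    have "(%z. exp (Ln (E z) / of_nat (2 * k))) holomorphic_on ball 0 r1"
      using ReE r1 k
      by (intro holomorphic_intros holomorphic_on_subset[OF E(2)]) (force simp: complex_nonpos_Reals_iff)+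
    then obtain D where "((%z. exp (Ln (E z) / of_nat (2 * k))) has_field_derivative D) (at 0)"
      using r1(1) holomorphic_ball_derivs by (metis centre_in_ball)
    from DERIV_mult[OF DERIV_ident this] have "(S has_field_derivative 1) (at 0)"
      unfolding S_def using E0 by simp
    then show ?thesis using DERIV_imp_deriv by force
  qed
  have z0: "0 \<in> ball 0 r1" using r1(1) by simp
  obtain r2 where r2: "r2 > 0" "ball (0::complex) r2 \<subseteq> ball 0 r1" "inj_on S (ball 0 r2)"
    by (rule has_complex_derivative_locally_injective[OF S_hol z0 open_ball dS])
  have r21: "r2 \<le> r1" using r2(1,2) by (simp add: ball_subset_ball_iff)
  have Sh2: "S holomorphic_on ball 0 r2" by (rule holomorphic_on_subset[OF S_hol r2(2)])
  obtain g where g: "g holomorphic_on (S ` ball 0 r2)" "!!z. z \<in> ball 0 r2 ==> deriv S z * deriv g (S z) = 1"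
      "!!z. z \<in> ball 0 r2 ==> g (S z) = z"
    by (rule holomorphic_has_inverse[OF Sh2 open_ball r2(3)]) (rule that; assumption)
  have "open (S ` ball 0 r2)" by (rule open_mapping_thm3[OF Sh2 open_ball r2(3)])
  moreover have "0 \<in> S ` ball 0 r2" using S0 r2(1) by (metis centre_in_ball image_eqI)
  ultimately obtain \<eta> where \<eta>: "\<eta> > 0" "ball 0 \<eta> \<subseteq> S ` ball 0 r2" using open_contains_ball by blast
  have contS: "continuous_on (ball 0 r2) S" by (rule holomorphic_on_imp_continuous_on[OF Sh2])
  have cs: "continuous_on {-r2<..<r2} s"
  proof -
    have "continuous_on {-r2<..<r2} (%t. Re (S (of_real t)))"
      by (intro continuous_intros continuous_on_compose2[OF contS]) auto
    then show ?thesis by (rule continuous_on_eq) (use Ss r21 in auto)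
  qed
  \<comment> \<open>The first two entries keep - s(t) inside the range of \<open>s\<close> on
    [- r2 / 2, r2 / 2], the third inside the domain of the holomorphic inverse.\<close>
  define \<theta> where "\<theta> = Min {s (r2 / 2), - s (- r2 / 2), \<eta>}"
  have \<theta>: "\<theta> > 0" "\<theta> \<le> s (r2 / 2)" "\<theta> \<le> - s (- r2 / 2)" "\<theta> \<le> \<eta>"
  proof -
    have "s (r2 / 2) > 0" "s (- r2 / 2) < 0" using r2(1) by (auto simp: s_def mult_neg_pos)
    then show "\<theta> > 0" "\<theta> \<le> s (r2 / 2)" "\<theta> \<le> - s (- r2 / 2)" "\<theta> \<le> \<eta>" using \<eta>(1) by (auto simp: \<theta>_def)
  qed
  have "isCont S 0" using contS r2(1) by (simp add: continuous_on_eq_continuous_at)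
  then obtain d2 where d2: "d2 > 0" "!!z. norm z < d2 ==> norm (S z) < \<theta>"
    unfolding continuous_at_eps_delta using \<theta>(1) S0 by (metis dist_0_norm dist_commute)
  define d where "d = min d2 r2"
  have d: "d > 0" "d \<le> d2" "d \<le> r2" using d2 r2 by (auto simp: d_def)
  \<comment> \<open>Taking the real part loses nothing: the intermediate value theorem yields a real
    v with s v = - s t, and the inverse \<open>g\<close> of \<open>S\<close> returns exactly this
    v.\<close>
  define P where "P = (%t. Re (g (- S (of_real t))))"
  have P: "g (- S (of_real t)) = of_real (P t) \<and> \<bar>P t\<bar> < r2 \<and> s (P t) = - s t" if t: "\<bar>t\<bar> < d" for t
  proof -
    have "\<bar>s t\<bar> < \<theta>" using d2(2)[of "of_real t"] Ss[of t] t d r21 by simp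
    then have "s (- r2 / 2) \<le> - s t" "- s t \<le> s (r2 / 2)" using \<theta> by auto
    moreover have "continuous_on {- r2 / 2 .. r2 / 2} s" by (rule continuous_on_subset[OF cs]) (use r2 in auto)
    ultimately obtain v where v: "- r2 / 2 \<le> v" "v \<le> r2 / 2" "s v = - s t"
      using IVT'[of s "- r2 / 2" "- s t" "r2 / 2"] r2(1) by auto
    then have vr: "\<bar>v\<bar> < r2" using r2(1) by auto
    have "- S (of_real t) = S (of_real v)" using Ss[of t] Ss[of v] v vr t d r21 by simp
    then have "g (- S (of_real t)) = of_real v" using g(3)[of "of_real v"] vr by simp
    then show ?thesis using v vr by (simp add: P_def)
  qed
  have s_inj: "u = v" if "s u = s v" "\<bar>u\<bar> < r2" "\<bar>v\<bar> < r2" for u v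
  proof -
    have "S (of_real u) = S (of_real v)" using Ss[of u] Ss[of v] that r21 by simp
    then have "complex_of_real u = of_real v" by (rule inj_onD[OF r2(3)]) (use that in auto)
    then show ?thesis by simp
  qed
  have ran1: "ran1 P" unfolding ran1_def
  proof (intro exI[of _ d] conjI exI[of _ "%z. g (- S z)"])
    have "(g \<circ> (%z. - S z)) holomorphic_on ball 0 d"
    proof (rule holomorphic_on_compose_gen[OF _ g(1)])
      show "(%z. - S z) holomorphic_on ball 0 d"
        using d by (intro holomorphic_intros holomorphic_on_subset[OF Sh2]) auto
      show "(%z. - S z) ` ball 0 d \<subseteq> S ` ball 0 r2"
      proof
        fix w assume "w \<in> (%z. - S z) ` ball 0 d"
        then have "norm w < \<theta>" using d2(2) d by auto
        then show "w \<in> S ` ball 0 r2" using \<eta>(2) \<theta>(4) by (auto simp: subset_iff)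
      qed
    qed
    then show "(%z. g (- S z)) holomorphic_on ball 0 d" by (simp add: o_def)
  qed (use d P in auto)
  show thesis
  proof (rule that[OF ran1 d(1)])
    show "P 0 = 0" using P[of 0] d(1) s_sgn[of "P 0"] s_sgn[of 0] by (simp add: sgn_zero_iff)
    show "G (P y) = G y" if y: "\<bar>y\<bar> < d" for y
      using P[OF y] Gs[of y] Gs[of "P y"] y d r21 by simp
    show "sgn (P y) = - sgn y" if y: "\<bar>y\<bar> < d" for y
      using P[OF y] s_sgn[of y] s_sgn[of "P y"] by (simp add: sgn_minus)
    show "P (P y) = y" if y: "\<bar>y\<bar> < d" "\<bar>P y\<bar> < d" for y
      using P[OF y(1)] P[OF y(2)] s_inj[of "P (P y)" y] y d by simp
    show "u = v \<or> u = P v" if uv: "\<bar>u\<bar> < d" "\<bar>v\<bar> < d" "G u = G v" for u v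
    proof -
      have "s u ^ (2 * k) = s v ^ (2 * k)" using Gs[of u] Gs[of v] uv d r21 c0 by simp
      then have "\<bar>s u\<bar> ^ (2 * k) = \<bar>s v\<bar> ^ (2 * k)" by (metis power_abs)
      then have "\<bar>s u\<bar> = \<bar>s v\<bar>" by (rule power_eq_imp_eq_base) (use k in auto)
      then have "s u = s v \<or> s u = s (P v)" using P[OF uv(2)] by (auto simp: abs_eq_iff)
      then show ?thesis using s_inj[of u v] s_inj[of u "P v"] P[OF uv(2)] uv d by auto
    qed
  qed
qed

text \<open>Dividing G(P y) = G(y) by y^(2 k) shows that the limit of P(y) / y has 2k-th power 1;
  the reversal of sign selects - 1.\<close>

lemma involution_coeffs:
  assumes G: "has_power_series c G" and z: "!!j. j < 2 * k ==> c j = 0" and c0: "c (2 * k) \<noteq> 0" and k: "k \<ge> 1"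
    and P: "has_power_series \<alpha> P" "P 0 = 0" and d: "d > 0" "!!y. \<bar>y\<bar> < d ==> G (P y) = G y" "!!y. \<bar>y\<bar> < d ==> sgn (P y) = - sgn y"
  shows "\<alpha> 0 = 0" "\<alpha> 1 = - 1"
proof -
  show a0: "\<alpha> 0 = 0" using ps_0[OF P(1)] P(2) by simp
  have q: "((%y. P y / y) \<longlongrightarrow> \<alpha> 1) (at 0)" using ps_leading[OF P(1), of 1] a0 by simp
  have near: "\<forall>\<^sub>F y in at 0. \<bar>y\<bar> < d \<and> y \<noteq> (0::real)"
    unfolding eventually_at using d(1) by (intro exI[of _ d]) auto
  have Pnz: "\<forall>\<^sub>F y in at 0. P y \<noteq> 0"
    using near by eventually_elim (use d(3) in \<open>metis neg_equal_0_iff_equal sgn_zero_iff\<close>)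
  have P0: "filterlim P (at 0) (at 0)"
    using ps_isCont[OF P(1)] P(2) Pnz by (simp add: filterlim_at isCont_def)
  have "((%y. (G y / y ^ (2 * k)) / (G (P y) / P y ^ (2 * k))) \<longlongrightarrow> c (2 * k) / c (2 * k)) (at 0)"
    by (intro tendsto_divide ps_leading[OF G] z filterlim_compose[OF ps_leading[OF G] P0] c0)
  moreover have "\<forall>\<^sub>F y in at 0. (G y / y ^ (2 * k)) / (G (P y) / P y ^ (2 * k)) = (P y / y) ^ (2 * k)"
  proof -
    have "\<forall>\<^sub>F y in at 0. G y / y ^ (2 * k) \<noteq> 0"
      by (rule tendsto_imp_eventually_ne[OF ps_leading[OF G]]) (use z c0 in auto)
    then show ?thesis using near Pnz by eventually_elim (use d(2) in \<open>auto simp: power_divide\<close>)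
  qed
  ultimately have "((%y. (P y / y) ^ (2 * k)) \<longlongrightarrow> 1) (at 0)" using c0 by (simp add: tendsto_cong)
  moreover have "((%y. (P y / y) ^ (2 * k)) \<longlongrightarrow> \<alpha> 1 ^ (2 * k)) (at 0)" by (intro tendsto_intros q)
  ultimately have "\<alpha> 1 ^ (2 * k) = 1" using tendsto_unique[OF at_neq_bot] by blast
  then have "\<bar>\<alpha> 1\<bar> ^ (2 * k) = 1" by (metis abs_one power_abs)
  then have "\<bar>\<alpha> 1\<bar> = 1" using k power_eq_imp_eq_base[of "\<bar>\<alpha> 1\<bar>" "2 * k" 1] by simp
  moreover have "\<alpha> 1 \<le> 0"
  proof (rule tendsto_upperbound[OF q])
    show "\<forall>\<^sub>F y in at 0. P y / y \<le> 0"
      using near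
    proof eventually_elim
      case (elim y)
      then show ?case using d(3)[of y] by (auto simp: sgn_if divide_le_0_iff split: if_splits)
    qed
  qed simp
  ultimately show "\<alpha> 1 = - 1" by simp
qed

section \<open>Iterated Lie derivatives and the order of contact\<close>

lemma an2_fst: "an2 fst"
  unfolding an2_def
proof (intro exI[of _ 1] conjI exI[of _ "%x y. x"])
  show "sephol 1 (%x y. x)" unfolding sephol_def
    by (auto intro!: holomorphic_intros exI[of _ 1] less_imp_le)
qed auto

lemma an2_lie:
  assumes h: "an2 h" and f: "an2 (%p. fst (X p))" and g: "an2 (%p. snd (X p))"
  shows "an2 (lie_derivative X h)"
    and "\<exists>R>0. \<forall>p\<in>sqr R. (h has_derivative frechet_derivative h (at p)) (at p)"
proof -
  obtain R hx hy where h': "R > 0" "an2 hx" "an2 hy"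
    "!!x y. \<bar>x\<bar> < R ==> \<bar>y\<bar> < R ==> (h has_derivative (%v. hx (x, y) * fst v + hy (x, y) * snd v)) (at (x, y))"
    using an2_deriv[OF h] by blast
  have fd: "frechet_derivative h (at (x, y)) = (%v. hx (x, y) * fst v + hy (x, y) * snd v)" if "\<bar>x\<bar> < R" "\<bar>y\<bar> < R" for x y
    using frechet_derivative_at[OF h'(4)[OF that]] by simp
  have "an2 (%p. hx p * fst (X p) + hy p * snd (X p))"
    by (intro an2_add an2_mult h' f g)
  then show "an2 (lie_derivative X h)"
    by (rule an2_cong[OF _ h'(1)]) (simp add: lie_derivative_def fd)
  have "(h has_derivative frechet_derivative h (at p)) (at p)" if "p \<in> sqr R" for p
    using h'(4)[of "fst p" "snd p"] fd[of "fst p" "snd p"] that by (cases p) (auto simp: sqr_iff)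
  then show "\<exists>R>0. \<forall>p\<in>sqr R. (h has_derivative frechet_derivative h (at p)) (at p)" using h'(1) by blast
qed

lemma an2_lie_iter:
  assumes f: "an2 (%p. fst (X p))" and g: "an2 (%p. snd (X p))"
  shows "an2 ((lie_derivative X ^^ i) fst)"
  by (induction i) (auto intro: an2_fst an2_lie(1)[OF _ f g])

text \<open>Used contrapositively: a nonzero iterated Lie derivative at the origin excludes an
  equilibrium, so that at a tangency the vertical component of the field is nonzero.\<close>

lemma lie_iter_zero_field:
  assumes f: "an2 (%p. fst (X p))" and g: "an2 (%p. snd (X p))" and X0: "X (0, 0) = 0"
  shows "(lie_derivative X ^^ Suc i) fst (0, 0) = 0"
proof -
  obtain R where "R > 0" "!!p. p \<in> sqr R ==> ((lie_derivative X ^^ i) fst has_derivative frechet_derivative ((lie_derivative X ^^ i) fst) (at p)) (at p)"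
    using an2_lie(2)[OF an2_lie_iter[OF f g] f g] by blast
  then have "((lie_derivative X ^^ i) fst has_derivative frechet_derivative ((lie_derivative X ^^ i) fst) (at (0,0))) (at (0,0))"
    by (simp add: sqr_iff)
  then have "linear (frechet_derivative ((lie_derivative X ^^ i) fst) (at (0,0)))"
    by (rule has_derivative_linear)
  then show ?thesis using X0 by (simp add: lie_derivative_def linear_0)
qed

lemma lie_derivative_fst: "lie_derivative X fst p = fst (X p)"
proof -
  have "(fst has_derivative fst) (at p)" by (rule bounded_linear_imp_has_derivative[OF bounded_linear_fst])
  then show ?thesis using frechet_derivative_at[of fst fst p] by (simp add: lie_derivative_def)
qed

lemma real_deriv_bound_closed:
  fixes f :: "real \<Rightarrow> real"
  assumes "!!t. \<bar>t\<bar> \<le> rho ==> (f has_real_derivative f' t) (at t)" "!!t. \<bar>t\<bar> \<le> rho ==> \<bar>f' t - c\<bar> \<le> B"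
    "\<bar>s\<bar> \<le> rho" "\<bar>t\<bar> \<le> rho"
  shows "\<bar>f s - f t - c * (s - t)\<bar> \<le> B * \<bar>s - t\<bar>"
proof -
  have "norm ((f s - c * s) - (f t - c * t)) \<le> B * norm (s - t)"
  proof (rule field_differentiable_bound[where S="{-rho..rho}" and f'="%t. f' t - c"])
    show "((%t. f t - c * t) has_real_derivative f' z - c) (at z within {- rho..rho})" if "z \<in> {-rho..rho}" for z
      using DERIV_diff[OF assms(1)[of z] DERIV_cmult_Id[of c z]] that by (auto intro: has_field_derivative_at_within)
  qed (use assms in auto)
  then show ?thesis by (simp add: algebra_simps)
qed

lemma has_power_series2_slice:
  assumes "has_power_series2 c f (0, 0)"
  shows "has_power_series (c 0) (%y. f (0, y))"
proof -
  obtain r where r: "r > 0" and hs: "!!u v. \<bar>u\<bar> < r ==> \<bar>v\<bar> < r ==> ((%(i, j). c i j * u ^ i * v ^ j) has_sum f (u, v)) UNIV"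
    using assms unfolding has_power_series2_def by auto
  have "(%j. c 0 j * y ^ j) sums f (0, y)" if y: "\<bar>y\<bar> < r" for y
  proof -
    have "((%(i, j). c i j * 0 ^ i * y ^ j) has_sum f (0, y)) UNIV" using hs[of 0 y] r y by simp
    also have "?this \<longleftrightarrow> ((%(i, j). c i j * 0 ^ i * y ^ j) has_sum f (0, y)) (range (Pair 0))"
      by (rule has_sum_cong_neutral) (auto simp: image_iff)
    also have "\<dots> \<longleftrightarrow> (((%(i, j). c i j * 0 ^ i * y ^ j) \<circ> Pair 0) has_sum f (0, y)) UNIV"
      by (rule has_sum_reindex) (auto simp: inj_on_def)
    finally show ?thesis by (intro has_sum_imp_sums) (simp add: o_def)
  qed
  then show ?thesis unfolding has_power_series_def using r by blast
qed

context flow_box begin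

lemma sqr_closed_sub: "(x, y) \<in> sqr r ==> \<bar>x'\<bar> \<le> \<bar>x\<bar> ==> \<bar>y'\<bar> \<le> \<bar>y\<bar> ==> (x', y') \<in> sqr r"
  by (auto simp: sqr_iff)

lemma H_shift:
  assumes "(x, y) \<in> sqr r"
  shows "\<bar>H (x, y) - H (0, y) - x\<bar> \<le> L * (\<bar>x\<bar> + \<bar>y\<bar>) * \<bar>x\<bar>"
proof -
  have "\<bar>H (x, y) - H (0, y) - 1 * (x - 0)\<bar> \<le> L * (\<bar>x\<bar> + \<bar>y\<bar>) * \<bar>x - 0\<bar>"
  proof (rule real_deriv_bound_closed[where rho="\<bar>x\<bar>" and f'="%t. Hx (t, y)"])
    fix t assume t: "\<bar>t\<bar> \<le> \<bar>x\<bar>"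
    then have ty: "(t, y) \<in> sqr r" using assms sqr_closed_sub by blast
    show "((%t. H (t, y)) has_real_derivative Hx (t, y)) (at t)" by (rule partial_derivs(1)[OF dH[OF ty]])
    have "\<bar>Hx (t, y) - Hx (0, 0)\<bar> \<le> L * (\<bar>t - 0\<bar> + \<bar>y - 0\<bar>)" using lip[of Hx, OF _ ty zero_in] by simp
    also have "\<dots> \<le> L * (\<bar>x\<bar> + \<bar>y\<bar>)" using t L by (intro mult_left_mono) auto
    finally show "\<bar>Hx (t, y) - 1\<bar> \<le> L * (\<bar>x\<bar> + \<bar>y\<bar>)" using at0 by simp
  qed auto
  then show ?thesis by simp
qed

lemma line_0_0: "line 0 0 = (0, 0)"
  using line_Psi[OF zero_in] by (simp add: H0 W0)

text \<open>Along the orbit through the origin H is 0 while x(t) is \<Lambda> t^n / n! to leading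
  order, with \<Lambda> the n-th Lie derivative, and y(t) is b t. Since H(x, y) - H(0, y) is x to
  leading order, H(0, y(t)) behaves like - \<Lambda> t^n / n!, and substituting t = y / b gives the
  coefficient.\<close>

theorem first_integral_order:
  assumes f: "an2 (%p. fst (X p))" and g: "an2 (%p. snd (X p))" and n: "n \<ge> 1"
    and z: "!!i. i < n ==> (lie_derivative X ^^ i) fst (0, 0) = 0"
    and G: "has_power_series c (%y. H (0, y))"
  shows "(\<forall>j<n. c j = 0) \<and> c n = - ((lie_derivative X ^^ n) fst (0, 0) / (fact n * snd (X (0, 0)) ^ n))"
proof -
  define LL where "LL = (%i. (lie_derivative X ^^ i) fst)"
  define b where "b = snd (X (0, 0))"
  have b: "b \<noteq> 0" using b0 by (simp add: b_def)
  have LLS: "LL (Suc i) = lie_derivative X (LL i)" for i by (simp add: LL_def)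
  have "\<exists>R>0. \<forall>p\<in>sqr R. (LL i has_derivative frechet_derivative (LL i) (at p)) (at p)" for i
    unfolding LL_def by (rule an2_lie(2)[OF an2_lie_iter[OF f g] f g])
  then obtain Rf where Rf: "!!i. Rf i > (0::real)" "!!i p. p \<in> sqr (Rf i) ==> (LL i has_derivative frechet_derivative (LL i) (at p)) (at p)"
    by metis
  define R where "R = Min (Rf ` {..n})"
  have R: "R > 0" "!!i. i \<le> n ==> R \<le> Rf i" unfolding R_def using Rf(1) by auto
  obtain rho \<eta> where rho: "0 < rho" "0 < \<eta>" "!!p t. p \<in> sqr rho ==> \<bar>t\<bar> < \<eta> ==> (H p, t) \<in> Psi ` sqr r"
    using Psi_nbhd by metis
  define gam where "gam = line 0"
  have img: "(0, t) \<in> Psi ` sqr r" if "\<bar>t\<bar> < \<eta>" for t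
    using rho(3)[of "(0, 0)" t] that rho(1) H0 by (simp add: sqr_iff)
  have gam0: "gam 0 = (0, 0)" by (simp add: gam_def line_0_0)
  have dgam: "(gam has_vector_derivative X (gam t)) (at t)" if "\<bar>t\<bar> < \<eta>" for t
    unfolding gam_def using line_deriv[OF img[OF that]] by simp
  have "isCont gam 0" using dgam[of 0] rho(2) has_vector_derivative_continuous by (metis abs_zero)
  then have cgam: "(gam \<longlongrightarrow> (0, 0)) (at 0)" using gam0 by (simp add: isCont_def)
  have "\<forall>\<^sub>F t in at 0. gam t \<in> sqr R"
    by (rule topological_tendstoD[OF cgam open_sqr]) (use R in \<open>simp add: sqr_iff\<close>)
  then obtain t1 where t1: "t1 > 0" "!!t. t \<noteq> 0 ==> \<bar>t\<bar> < t1 ==> gam t \<in> sqr R"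
    unfolding eventually_at by (auto simp: dist_real_def)
  define t0 where "t0 = min t1 \<eta>"
  have t0: "t0 > 0" "t0 \<le> \<eta>" using t1 rho by (auto simp: t0_def)
  have inR: "gam t \<in> sqr R" if "\<bar>t\<bar> < t0" for t
    using t1(2)[of t] that gam0 R(1) by (cases "t = 0") (auto simp: t0_def sqr_iff)
  have dLL: "((%t. LL i (gam t)) has_real_derivative LL (Suc i) (gam t)) (at t)" if "i \<le> n" "\<bar>t\<bar> < t0" for i t
  proof -
    have "gam t \<in> sqr (Rf i)" using inR[OF that(2)] R(2)[OF that(1)] sqr_mono by blast
    have t\<eta>: "\<bar>t\<bar> < \<eta>" using that t0 by linarith
    have "((%t. LL i (gam t)) has_derivative (%h. frechet_derivative (LL i) (at (gam t)) (h *\<^sub>R X (gam t)))) (at t)"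
      by (rule has_derivative_compose[OF dgam[OF t\<eta>, unfolded has_vector_derivative_def] Rf(2)[OF \<open>gam t \<in> sqr (Rf i)\<close>]])
    moreover have "linear (frechet_derivative (LL i) (at (gam t)))" using Rf(2)[OF \<open>gam t \<in> sqr (Rf i)\<close>] by (rule has_derivative_linear)
    ultimately show ?thesis
      by (simp add: has_field_derivative_def LLS lie_derivative_def linear_scale mult_commute_abs)
  qed
  define \<Lambda> where "\<Lambda> = LL n (0, 0)"
  \<comment> \<open>Taylor's formula with Lagrange remainder; the m-th time derivative of x along
    the orbit is the m-th Lie derivative of \<open>fst\<close>, and those below n vanish at time
    0.\<close>
  have tay: "\<exists>u. \<bar>u\<bar> < \<bar>t\<bar> \<and> fst (gam t) = LL n (gam u) / fact n * t ^ n" if t: "t \<noteq> 0" "\<bar>t\<bar> < t0" for t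
  proof -
    have "\<exists>u. (if t < 0 then t < u \<and> u < 0 else 0 < u \<and> u < t) \<and>
       fst (gam t) = (\<Sum>m<n. (LL m (gam 0) / fact m) * (t - 0) ^ m) + (LL n (gam u) / fact n) * (t - 0) ^ n"
      by (rule Taylor[where a="-\<bar>t\<bar>" and b="\<bar>t\<bar>" and diff="%m t. LL m (gam t)"])
        (use n t dLL in \<open>auto simp: LL_def\<close>)
    then obtain u where u: "if t < 0 then t < u \<and> u < 0 else 0 < u \<and> u < t"
       "fst (gam t) = (\<Sum>m<n. (LL m (gam 0) / fact m) * (t - 0) ^ m) + (LL n (gam u) / fact n) * (t - 0) ^ n" by blast
    have "(\<Sum>m<n. (LL m (gam 0) / fact m) * (t - 0) ^ m) = 0"
      using z gam0 by (intro sum.neutral) (auto simp: LL_def)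
    then have "fst (gam t) = LL n (gam u) / fact n * t ^ n" using u(2) by simp
    moreover have "\<bar>u\<bar> < \<bar>t\<bar>" using u(1) by (auto split: if_splits)
    ultimately show ?thesis by blast
  qed
  have contL: "((%t. LL n (gam t)) \<longlongrightarrow> \<Lambda>) (at 0)"
    using DERIV_isCont[OF dLL[of n 0]] t0 gam0 by (simp add: isCont_def \<Lambda>_def)
  have xlim: "((%t. fst (gam t) / t ^ n) \<longlongrightarrow> \<Lambda> / fact n) (at 0)"
  proof (rule LIM_I)
    fix eps :: real assume eps: "eps > 0"
    then have "eps * fact n > 0" by simp
    then obtain d where d: "d > 0" "!!u. u \<noteq> 0 ==> norm (u - 0) < d ==> norm (LL n (gam u) - \<Lambda>) < eps * fact n"
      using LIM_D[OF contL] by blast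
    show "\<exists>s>0. \<forall>t. t \<noteq> 0 \<and> norm (t - 0) < s \<longrightarrow> norm (fst (gam t) / t ^ n - \<Lambda> / fact n) < eps"
    proof (intro exI[of _ "min d t0"] conjI allI impI)
      fix t :: real assume t: "t \<noteq> 0 \<and> norm (t - 0) < min d t0"
      then obtain u where u: "\<bar>u\<bar> < \<bar>t\<bar>" "fst (gam t) = LL n (gam u) / fact n * t ^ n" using tay[of t] by auto
      have "\<bar>LL n (gam u) - \<Lambda>\<bar> < eps * fact n"
        using d(2)[of u] u(1) t eps gam0 by (cases "u = 0") (auto simp: \<Lambda>_def)
      moreover have "fst (gam t) / t ^ n - \<Lambda> / fact n = (LL n (gam u) - \<Lambda>) / fact n"
        using u(2) t by (simp add: diff_divide_distrib)
      ultimately show "norm (fst (gam t) / t ^ n - \<Lambda> / fact n) < eps" by (simp add: abs_divide pos_divide_less_eq)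
    qed (use d t0 in auto)
  qed
  define y where "y = (%t. snd (gam t))"
  have "((%t. snd (gam t)) has_vector_derivative snd (X (gam 0))) (at 0)"
    using bounded_linear.has_vector_derivative[OF bounded_linear_snd dgam[of 0]] rho(2) by simp
  then have "(y has_real_derivative b) (at 0)"
    unfolding y_def using gam0 by (simp add: has_real_derivative_iff_has_vector_derivative b_def)
  then have ylim: "((%t. y t / t) \<longlongrightarrow> b) (at 0)" using gam0 by (simp add: has_field_derivative_iff y_def)
  have y0: "(y \<longlongrightarrow> 0) (at 0)" and x0: "((%t. fst (gam t)) \<longlongrightarrow> 0) (at 0)"
    using tendsto_snd[OF cgam] tendsto_fst[OF cgam] by (auto simp: y_def)
  have ynz: "\<forall>\<^sub>F t in at 0. y t \<noteq> 0"
    using tendsto_imp_eventually_ne[OF ylim b] by eventually_elim auto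
  have tnear: "\<forall>\<^sub>F t in at 0. \<bar>t\<bar> < \<eta> \<and> t \<noteq> (0::real)"
    unfolding eventually_at using rho(2) by (intro exI[of _ \<eta>]) auto
  have "((%t. H (0, y t) / t ^ n + fst (gam t) / t ^ n) \<longlongrightarrow> 0) (at 0)"
  proof (rule Lim_null_comparison)
    show "\<forall>\<^sub>F t in at 0. norm (H (0, y t) / t ^ n + fst (gam t) / t ^ n) \<le> L * (\<bar>fst (gam t)\<bar> + \<bar>y t\<bar>) * \<bar>fst (gam t) / t ^ n\<bar>"
      using tnear
    proof eventually_elim
      case (elim t)
      have "gam t \<in> sqr r" "H (gam t) = 0" using Psi_line[OF img[of t]] elim by (auto simp: gam_def)
      then have "\<bar>H (0, y t) + fst (gam t)\<bar> \<le> L * (\<bar>fst (gam t)\<bar> + \<bar>y t\<bar>) * \<bar>fst (gam t)\<bar>"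
        using H_shift[of "fst (gam t)" "y t"] by (simp add: y_def)
      then have "\<bar>H (0, y t) + fst (gam t)\<bar> / \<bar>t ^ n\<bar> \<le> L * (\<bar>fst (gam t)\<bar> + \<bar>y t\<bar>) * \<bar>fst (gam t)\<bar> / \<bar>t ^ n\<bar>"
        by (rule divide_right_mono) simp
      then show ?case by (simp add: abs_divide flip: add_divide_distrib)
    qed
    have "((%t. L * (\<bar>fst (gam t)\<bar> + \<bar>y t\<bar>) * \<bar>fst (gam t) / t ^ n\<bar>) \<longlongrightarrow> L * (\<bar>0\<bar> + \<bar>0\<bar>) * \<bar>\<Lambda> / fact n\<bar>) (at 0)"
      by (intro tendsto_intros x0 y0 xlim)
    then show "((%t. L * (\<bar>fst (gam t)\<bar> + \<bar>y t\<bar>) * \<bar>fst (gam t) / t ^ n\<bar>) \<longlongrightarrow> 0) (at 0)" by simp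
  qed
  from tendsto_diff[OF this xlim] have "((%t. H (0, y t) / t ^ n) \<longlongrightarrow> - (\<Lambda> / fact n)) (at 0)" by simp
  then have "((%t. (H (0, y t) / t ^ n) / (y t / t) ^ n) \<longlongrightarrow> - (\<Lambda> / fact n) / b ^ n) (at 0)"
    by (intro tendsto_divide tendsto_power ylim) (use b in auto)
  moreover have "\<forall>\<^sub>F t in at 0. (H (0, y t) / t ^ n) / (y t / t) ^ n = H (0, y t) / y t ^ n"
    using tnear by eventually_elim (simp add: power_divide)
  ultimately have "((%t. H (0, y t) / y t ^ n) \<longlongrightarrow> - (\<Lambda> / fact n) / b ^ n) (at 0)"
    by (rule Lim_transform_eventually)
  moreover have "filterlim y (at 0) (at 0)" using y0 ynz by (simp add: filterlim_at)
  ultimately show ?thesis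
    using ps_coeff_of_leading[OF G at_neq_bot, where y=y and n=n and l="- (\<Lambda> / fact n) / b ^ n"] by (simp add: \<Lambda>_def LL_def b_def)
qed

lemma Hy_series:
  assumes G: "has_power_series c (%y. H (0, y))"
  shows "has_power_series (%i. real (Suc i) * c (Suc i)) (%y. Hy (0, y))"
proof -
  obtain d where d: "d > 0" "!!y. \<bar>y\<bar> < d ==> ((%y. H (0, y)) has_real_derivative deriv (%y. H (0, y)) y) (at y)"
    "has_power_series (%i. real (Suc i) * c (Suc i)) (deriv (%y. H (0, y)))" using ps_deriv[OF G] by blast
  obtain d' where d': "d' > 0" "!!y. \<bar>y\<bar> < d' ==> (%i. real (Suc i) * c (Suc i) * y ^ i) sums deriv (%y. H (0, y)) y"
    using d(3) unfolding has_power_series_def by blast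
  have "deriv (%y. H (0, y)) y = Hy (0, y)" if "\<bar>y\<bar> < r" for y
    by (rule DERIV_imp_deriv[OF partial_derivs(2)[OF dH]]) (use that r in \<open>simp add: sqr_iff\<close>)
  then show ?thesis unfolding has_power_series_def using d'(1) r
    by (intro exI[of _ "min d' r"]) (auto dest: d'(2))
qed

text \<open>Relates the coefficient of the horizontal component that occurs in \<open>eta_h\<close>
  to the leading coefficient of the first integral, in terms of which all estimates are made. The
  determinant of the two transport equations tends to 1 / b.\<close>

lemma vertical_component_order:
  assumes G: "has_power_series c (%y. H (0, y))" and z: "!!j. j < n ==> c j = 0" and n: "n \<ge> 1"
    and a: "has_power_series a (%y. fst (X (0, y)))"
  shows "a (n - 1) = - (snd (X (0, 0)) * real n * c n)"
proof -
  have Hx0: "((%y. Hx (0, y)) \<longlongrightarrow> 1) (at 0)" and Wy0: "((%y. Wy (0, y)) \<longlongrightarrow> 1 / snd (X (0,0))) (at 0)" and Wx0: "((%y. Wx (0, y)) \<longlongrightarrow> 0) (at 0)"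
  proof -
    have *: "((%y. F (0, y)) \<longlongrightarrow> F (0, 0)) (at 0)" if F: "F \<in> {Hx, Hy, Wx, Wy}" for F
    proof (rule LIM_zero_cancel)
      show "((%y. F (0, y) - F (0, 0)) \<longlongrightarrow> 0) (at 0)"
      proof (rule Lim_null_comparison)
        show "\<forall>\<^sub>F y in at 0. norm (F (0, y) - F (0, 0)) \<le> L * \<bar>y\<bar>"
          unfolding eventually_at using lip[OF F _ zero_in, of 0] r
          by (intro exI[of _ r]) (auto simp: sqr_iff)
        have "((%y. L * \<bar>y\<bar>) \<longlongrightarrow> L * \<bar>0\<bar>) (at (0::real))" by (intro tendsto_intros)
        then show "((%y. L * \<bar>y\<bar>) \<longlongrightarrow> 0) (at (0::real))" by simp
      qed
    qed
    show "((%y. Hx (0, y)) \<longlongrightarrow> 1) (at 0)" "((%y. Wy (0, y)) \<longlongrightarrow> 1 / snd (X (0,0))) (at 0)" "((%y. Wx (0, y)) \<longlongrightarrow> 0) (at 0)"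
      using *[of Hx] *[of Wy] *[of Wx] at0 by auto
  qed
  let ?m = "n - 1"
  have hy: "((%y. Hy (0, y) / y ^ ?m) \<longlongrightarrow> real (Suc ?m) * c (Suc ?m)) (at 0)"
    by (rule ps_leading[OF Hy_series[OF G]]) (use z n in auto)
  \<comment> \<open>Cramer's rule for the two equations \<open>X.H = 0\<close>, \<open>X.W = 1\<close>\<close>
  have f: "fst (X (0, y)) * (Hx (0, y) * Wy (0, y) - Hy (0, y) * Wx (0, y)) = - Hy (0, y)" if "\<bar>y\<bar> < r" for y
  proof -
    have p: "(0, y) \<in> sqr r" using that r by (simp add: sqr_iff)
    have "fst (X (0, y)) * (Hx (0, y) * Wy (0, y) - Hy (0, y) * Wx (0, y))
        = (fst (X (0, y)) * Hx (0, y) + snd (X (0, y)) * Hy (0, y)) * Wy (0, y) - Hy (0, y) * (fst (X (0, y)) * Wx (0, y) + snd (X (0, y)) * Wy (0, y))"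
      by (simp add: algebra_simps)
    then show ?thesis using pdeH[OF p] pdeW[OF p] by simp
  qed
  have hy0: "((%y. Hy (0, y)) \<longlongrightarrow> 0) (at 0)"
  proof -
    have "isCont (%y. Hy (0, y)) 0" by (rule ps_isCont[OF Hy_series[OF G]])
    then show ?thesis using at0 by (simp add: isCont_def)
  qed
  let ?D = "%y. Hx (0, y) * Wy (0, y) - Hy (0, y) * Wx (0, y)"
  have D: "(?D \<longlongrightarrow> 1 * (1 / snd (X (0, 0))) - 0 * 0) (at 0)" by (intro tendsto_intros Hx0 Wy0 Wx0 hy0)
  then have "((%y. - (Hy (0, y) / y ^ ?m) / ?D y) \<longlongrightarrow> - (real (Suc ?m) * c (Suc ?m)) / (1 * (1 / snd (X (0, 0))) - 0 * 0)) (at 0)"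
    by (intro tendsto_divide tendsto_minus hy) (use b0 in auto)
  moreover have "\<forall>\<^sub>F y in at 0. - (Hy (0, y) / y ^ ?m) / ?D y = fst (X (0, y)) / y ^ ?m"
  proof -
    have "\<forall>\<^sub>F y in at 0. ?D y \<noteq> 0" by (rule tendsto_imp_eventually_ne[OF D]) (use b0 in auto)
    moreover have "\<forall>\<^sub>F y in at 0. \<bar>y\<bar> < r \<and> y \<noteq> (0::real)" unfolding eventually_at using r by (intro exI[of _ r]) auto
    ultimately show ?thesis
    proof eventually_elim
      case (elim y)
      have "- Hy (0, y) / ?D y = fst (X (0, y))" using f[of y] elim by (metis nonzero_mult_div_cancel_right)
      from this[symmetric] show ?case by (simp only: divide_divide_eq_left minus_divide_left mult.commute)
    qed
  qed
  ultimately have "((%y. fst (X (0, y)) / y ^ ?m) \<longlongrightarrow> - (real (Suc ?m) * c (Suc ?m)) / (1 * (1 / snd (X (0, 0))) - 0 * 0)) (at 0)"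
    by (rule Lim_transform_eventually)
  then have "((%y. fst (X (0, y)) / y ^ ?m) \<longlongrightarrow> - (snd (X (0, 0)) * real n * c n)) (at 0)" using n by (simp add: mult_ac)
  then show ?thesis using ps_coeff_of_leading[OF a at_neq_bot filterlim_ident] by blast
qed

text \<open>Two points on one level are joined by a vertical line in the coordinates (H, W), and the
  times between W p and W q stay in the chart. The connecting time W q - W p may be
  negative.\<close>

lemma flow_between:
  obtains rho where "0 < rho" "rho \<le> r" "!!p q. p \<in> sqr rho ==> q \<in> sqr rho ==> H p = H q ==>
     \<exists>gam. integral_curve X U gam (closed_segment 0 (W q - W p)) \<and> gam 0 = p \<and> gam (W q - W p) = q \<and>
         gam ` closed_segment 0 (W q - W p) \<subseteq> sqr r"
proof -
  obtain rho \<eta> where rho: "0 < rho" "rho \<le> r" "0 < \<eta>" "!!p t. p \<in> sqr rho ==> \<bar>t\<bar> < \<eta> ==> (H p, t) \<in> Psi ` sqr r"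
    "!!p. p \<in> sqr rho ==> \<bar>W p\<bar> < \<eta>" using Psi_nbhd by metis
  show thesis
  proof (rule that[OF rho(1,2)])
    fix p q assume pq: "p \<in> sqr rho" "q \<in> sqr rho" "H p = H q"
    have img: "(H p, W p + t) \<in> Psi ` sqr r" if "t \<in> closed_segment 0 (W q - W p)" for t
    proof (rule rho(4)[OF pq(1)])
      have "\<bar>W p + t\<bar> \<le> max \<bar>W p\<bar> \<bar>W q\<bar>" using that by (auto simp: closed_segment_eq_real_ivl split: if_splits)
      then show "\<bar>W p + t\<bar> < \<eta>" using rho(5)[OF pq(1)] rho(5)[OF pq(2)] by linarith
    qed
    have "p \<in> sqr r" "q \<in> sqr r" using pq rho(2) sqr_mono by blast+
    then have "line (H p) (W p + 0) = p" "line (H p) (W p + (W q - W p)) = q"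
      using line_Psi[of p] line_Psi[of q] pq(3) by simp_all
    then show "\<exists>gam. integral_curve X U gam (closed_segment 0 (W q - W p)) \<and> gam 0 = p \<and> gam (W q - W p) = q \<and>
         gam ` closed_segment 0 (W q - W p) \<subseteq> sqr r"
      using line_integral_curve[of "closed_segment 0 (W q - W p)" "H p" "W p", OF img] Psi_line(1)[OF img]
      by (intro exI[of _ "%t. line (H p) (W p + t)"]) auto
  qed
qed

lemma W_axis:
  assumes "\<bar>y\<bar> < r" "\<bar>y'\<bar> < r"
  shows "\<bar>W (0, y) - W (0, y') - (y - y') / snd (X (0, 0))\<bar> \<le> \<bar>y - y'\<bar> / (4 * \<bar>snd (X (0, 0))\<bar>)"
proof -
  have "\<bar>W (0, y) - W (0, y') - 1 / snd (X (0, 0)) * (y - y')\<bar> \<le> 1 / (4 * \<bar>snd (X (0, 0))\<bar>) * \<bar>y - y'\<bar>"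
    by (rule real_deriv_bound[where r=r and f'="%t. Wy (0, t)"])
      (use assms r partial_derivs(2)[OF dW] Wy_near in \<open>auto simp: sqr_iff\<close>)
  then show ?thesis by simp
qed

end

text \<open>Existence: the involution \<open>P\<close> on the levels of H(0, y), with T(y) = W(0, P
  y) - W(0, y). Uniqueness: a competing pair has T' = - 2 y / b + O(y^2), a time so short that its
  orbit stays in the box; hence P' y is on the level of y, and its time function places it near - y.
  A level has no other points than y and \<open>P y\<close> close to 0.\<close>

lemma (in flow_box) half_return_coeff_eq:
  assumes G: "has_power_series c (%y. H (0, y))" and z: "!!j. j < 2 * k ==> c j = 0" and c0: "c (2 * k) \<noteq> 0" and k: "k \<ge> 1"
    and anW: "an2 W"
  obtains P d where "has_power_series (half_return_coeff X U) P"
    "half_return_coeff X U 0 = 0" "half_return_coeff X U 1 = - 1" "d > 0" "P 0 = 0"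
    "!!y. \<bar>y\<bar> < d ==> H (0, P y) = H (0, y)" "!!y. \<bar>y\<bar> < d ==> sgn (P y) = - sgn y"
    "!!y. \<bar>y\<bar> < d ==> \<bar>P y\<bar> < d ==> P (P y) = y"
proof -
  define b where "b = snd (X (0, 0))"
  have b: "b \<noteq> 0" using b0 by (simp add: b_def)
  obtain P d where P: "ran1 P" "d > 0" "P 0 = 0" "!!y. \<bar>y\<bar> < d ==> H (0, P y) = H (0, y)" "!!y. \<bar>y\<bar> < d ==> sgn (P y) = - sgn y"
    "!!y. \<bar>y\<bar> < d ==> \<bar>P y\<bar> < d ==> P (P y) = y"
    "!!u v. \<bar>u\<bar> < d ==> \<bar>v\<bar> < d ==> H (0, u) = H (0, v) ==> u = v \<or> u = P v"
    by (rule analytic_involution[OF G z c0 k]) (assumption, (rule that; assumption))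
  obtain \<alpha> where \<alpha>: "has_power_series \<alpha> P" using ran_ps[OF P(1)] by blast
  have \<alpha>01: "\<alpha> 0 = 0" "\<alpha> 1 = - 1" using involution_coeffs[OF G z c0 k \<alpha> P(3) P(2,4,5)] by auto
  define T where "T = (%y. W (0, P y) - W (0, y))"
  have "ran1 T" unfolding T_def by (intro ran_diff ran_comp[OF an2_ran[OF anW]] an2_ran[OF anW] P)
  then obtain \<tau> where \<tau>: "has_power_series \<tau> T" using ran_ps by blast
  have cP: "(P \<longlongrightarrow> 0) (at 0)" using ps_isCont[OF \<alpha>] P(3) by (simp add: isCont_def)
  have Pnz: "\<forall>\<^sub>F y in at 0. P y \<noteq> 0"
    unfolding eventually_at using P(2,5) by (intro exI[of _ d]) (auto, metis neg_equal_0_iff_equal sgn_zero_iff)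
  have Wd: "((%y. W (0, y)) has_real_derivative 1 / b) (at 0)"
    using partial_derivs(2)[OF dW[OF zero_in]] at0 by (simp add: b_def)
  then have Wl: "((%y. W (0, y) / y) \<longlongrightarrow> 1 / b) (at 0)" using W0[of 0] by (simp add: has_field_derivative_iff)
  have Pl: "((%y. P y / y) \<longlongrightarrow> - 1) (at 0)" using ps_leading[OF \<alpha>, of 1] \<alpha>01 by simp
  have "((%y. W (0, P y) / P y) \<longlongrightarrow> 1 / b) (at 0)"
    by (rule filterlim_compose[OF Wl]) (use cP Pnz in \<open>simp add: filterlim_at\<close>)
  then have "((%y. W (0, P y) / P y * (P y / y) - W (0, y) / y) \<longlongrightarrow> 1 / b * (- 1) - 1 / b) (at 0)"
    by (intro tendsto_diff tendsto_mult Pl Wl)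
  moreover have "\<forall>\<^sub>F y in at 0. W (0, P y) / P y * (P y / y) - W (0, y) / y = T y / y ^ 1"
    using Pnz by eventually_elim (simp add: T_def diff_divide_distrib)
  ultimately have "((%y. T y / y ^ 1) \<longlongrightarrow> 1 / b * (- 1) - 1 / b) (at 0)" by (rule Lim_transform_eventually)
  then have "(\<forall>j<1. \<tau> j = 0) \<and> \<tau> 1 = 1 / b * (- 1) - 1 / b"
    by (rule ps_coeff_of_leading[OF \<tau> at_neq_bot filterlim_ident])
  then have \<tau>01: "\<tau> 0 = 0" "\<tau> 1 = - 2 / b" by auto
  obtain rT CT where CT: "rT > 0" "CT \<ge> 0" "!!y. \<bar>y\<bar> < rT ==> \<bar>T y - \<tau> 1 * y ^ 1\<bar> \<le> CT * \<bar>y\<bar> ^ Suc 1"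
    using ps_remainder[OF \<tau>, of 1] \<tau>01 by auto
  have TO: "(%y. T y + 2 / b * y) \<in> O[at 0](%y. y ^ 2)"
  proof (rule bigoI[of _ CT])
    show "\<forall>\<^sub>F y in at 0. norm (T y + 2 / b * y) \<le> CT * norm (y ^ 2)"
      unfolding eventually_at using CT(1,3) \<tau>01 by (intro exI[of _ rT]) (auto simp: power2_eq_square abs_mult)
  qed
  obtain rho \<eta> where rho: "0 < rho" "rho \<le> r" "0 < \<eta>" "!!p t. p \<in> sqr rho ==> \<bar>t\<bar> < \<eta> ==> (H p, t) \<in> Psi ` sqr r"
    "!!p. p \<in> sqr rho ==> \<bar>W p\<bar> < \<eta>" using Psi_nbhd by metis
  obtain rho2 where rho2: "0 < rho2" "rho2 \<le> r" "!!p q. p \<in> sqr rho2 ==> q \<in> sqr rho2 ==> H p = H q ==>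
     \<exists>gam. integral_curve X U gam (closed_segment 0 (W q - W p)) \<and> gam 0 = p \<and> gam (W q - W p) = q \<and>
         gam ` closed_segment 0 (W q - W p) \<subseteq> sqr r"
    by (rule flow_between) (rule that; assumption)
  have "half_return X U T P"
    unfolding half_return_def
  proof (intro conjI)
    show "\<exists>c. has_power_series c T" using \<tau> by blast
    show "(%y. T y + 2 / snd (X (0, 0)) * y) \<in> O[at 0](%y. y ^ 2)" using TO by (simp add: b_def)
    have "(P \<longlongrightarrow> 0) (nhds 0)" using cP P(3) tendsto_at_iff_tendsto_nhds[of P 0] by simp
    then have "\<forall>\<^sub>F y in nhds 0. P y \<in> {-rho2<..<rho2}" by (rule topological_tendstoD) (use rho2 in auto)
    moreover have "\<forall>\<^sub>F y in nhds 0. y \<in> {-min d rho2<..<min d rho2}"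
      by (rule eventually_nhds_in_open) (use P(2) rho2 in auto)
    ultimately show "\<forall>\<^sub>F y in nhds 0. flows_to X U (T y) (0, y) (0, P y)"
    proof eventually_elim
      case (elim y)
      have "\<exists>gam. integral_curve X U gam (closed_segment 0 (W (0, P y) - W (0, y))) \<and> gam 0 = (0, y) \<and> gam (W (0, P y) - W (0, y)) = (0, P y) \<and>
         gam ` closed_segment 0 (W (0, P y) - W (0, y)) \<subseteq> sqr r"
        by (rule rho2(3)) (use elim rho2 P(4)[of y] in \<open>auto simp: sqr_iff\<close>)
      then show ?case unfolding flows_to_def T_def by blast
    qed
  qed
  moreover have "\<alpha>' = \<alpha>" if hr: "\<exists>T P. half_return X U T P \<and> has_power_series \<alpha>' P" for \<alpha>'
  proof -
    obtain T' P' where T'P': "half_return X U T' P'" "has_power_series \<alpha>' P'" using hr by blast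
    have O': "(%y. T' y + 2 / b * y) \<in> O[at 0](%y. y ^ 2)" and
      fl: "\<forall>\<^sub>F y in nhds 0. flows_to X U (T' y) (0, y) (0, P' y)"
      using T'P'(1) unfolding half_return_def b_def by auto
    obtain C where C: "C > 0" "\<forall>\<^sub>F y in at 0. norm (T' y + 2 / b * y) \<le> C * norm (y ^ 2)"
      using landau_o.bigE[OF O'] by blast
    define D where "D = 4 * (1 / \<bar>b\<bar>) + 1"
    have D: "D > 0" unfolding D_def using b by (intro add_nonneg_pos) auto
    \<comment> \<open>In turn: the start lies in the chart; the travelled times stay below \<eta>,
      being at most D |y|; the remainder of T' is at most |y| / (4 |b|); P' y stays in the domain of
      the involution; the remainder is at most |y|.\<close>
    define \<delta> where "\<delta> = Min {rho, \<eta> / D, 1 / (4 * \<bar>b\<bar> * C), d / 4, 1 / C, r}"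
    have \<delta>: "\<delta> > 0" "\<delta> \<le> rho" "\<delta> \<le> \<eta> / D" "\<delta> \<le> 1 / (4 * \<bar>b\<bar> * C)" "\<delta> \<le> d / 4" "\<delta> \<le> 1 / C" "\<delta> \<le> r"
    proof -
      show "\<delta> > 0" using rho b C P(2) r D by (auto simp: \<delta>_def)
    qed (unfold \<delta>_def, (rule Min_le; simp)+)
    have "\<forall>\<^sub>F y in at 0. y \<noteq> 0 \<and> \<bar>y\<bar> < \<delta>"
      unfolding eventually_at using \<delta>(1) by (intro exI[of _ \<delta>]) auto
    moreover have "\<forall>\<^sub>F y in at 0. flows_to X U (T' y) (0, y) (0, P' y)"
      using fl by (simp add: eventually_nhds_conv_at)
    ultimately have "\<forall>\<^sub>F y in at 0. P' y = P y"
      using C(2)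
    proof eventually_elim
      case (elim y)
      then have y: "y \<noteq> 0" "\<bar>y\<bar> < \<delta>" and f: "flows_to X U (T' y) (0, y) (0, P' y)" and TC: "\<bar>T' y + 2 / b * y\<bar> \<le> C * y\<^sup>2" by auto
      have "C * y\<^sup>2 = (C * \<bar>y\<bar>) * \<bar>y\<bar>" by (simp add: power2_eq_square)
      also have "\<dots> \<le> min (1 / (4 * \<bar>b\<bar>)) 1 * \<bar>y\<bar>"
      proof (rule mult_right_mono)
        have A: "C * \<bar>y\<bar> \<le> C * \<delta>" by (rule mult_left_mono) (use y C in auto)
        have "C * \<delta> \<le> C * (1 / (4 * \<bar>b\<bar> * C))" by (rule mult_left_mono[OF \<delta>(4)]) (use C in simp)
        then have B: "C * \<delta> \<le> 1 / (4 * \<bar>b\<bar>)" using C(1) by simp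
        have "C * \<delta> \<le> C * (1 / C)" by (rule mult_left_mono[OF \<delta>(6)]) (use C in simp)
        then have D: "C * \<delta> \<le> 1" using C(1) by simp
        show "C * \<bar>y\<bar> \<le> min (1 / (4 * \<bar>b\<bar>)) 1"
          by (intro min.boundedI order_trans[OF A B] order_trans[OF A D])
      qed simp
      finally have TC': "\<bar>T' y + 2 / b * y\<bar> \<le> min (1 / (4 * \<bar>b\<bar>)) 1 * \<bar>y\<bar>" by (rule order_trans[OF TC])
      have TCa: "\<bar>T' y + 2 / b * y\<bar> \<le> \<bar>y\<bar>"
        by (rule order_trans[OF TC']) (rule order_trans[OF mult_right_mono[OF min.cobounded2]], simp_all)
      have TCb: "\<bar>T' y + 2 / b * y\<bar> \<le> \<bar>y\<bar> / (4 * \<bar>b\<bar>)"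
        by (rule order_trans[OF TC']) (rule order_trans[OF mult_right_mono[OF min.cobounded1]], simp_all)
      have yrho: "(0, y) \<in> sqr rho" "(0, y) \<in> sqr r" using y \<delta> rho r by (auto simp: sqr_iff)
      have wy: "\<bar>W (0, y) - y / b\<bar> \<le> \<bar>y\<bar> / (4 * \<bar>b\<bar>)"
        using W_axis[of y 0] y \<delta> r W0[of 0] by (simp add: b_def)
      have small: "\<bar>W (0, y) + t\<bar> < \<eta>" if "t \<in> closed_segment 0 (T' y)" for t
      proof -
        have t: "\<bar>t\<bar> \<le> \<bar>T' y\<bar>" using that by (auto simp: closed_segment_eq_real_ivl split: if_splits)
        define m where "m = \<bar>y\<bar> / \<bar>b\<bar>"
        have m: "m \<ge> 0" "\<bar>2 / b * y\<bar> = 2 * m" "\<bar>y / b\<bar> = m" "\<bar>y\<bar> / (4 * \<bar>b\<bar>) = m / 4"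
          by (simp_all add: m_def abs_mult abs_divide)
        have "\<bar>T' y\<bar> \<le> \<bar>T' y + 2 / b * y\<bar> + \<bar>2 / b * y\<bar>" by linarith
        then have "\<bar>T' y\<bar> \<le> 2 * m + \<bar>y\<bar>" using TCa unfolding m(2) by linarith
        moreover have "\<bar>W (0, y)\<bar> \<le> m + m / 4" using wy unfolding m(4) using m(3) by linarith
        ultimately have "\<bar>W (0, y) + t\<bar> \<le> 4 * m + \<bar>y\<bar>" using t m(1) by linarith
        also have "\<dots> = D * \<bar>y\<bar>" by (simp add: m_def D_def distrib_right)
        also have "\<dots> < D * (\<eta> / D)"
          using y \<delta>(3) D by (intro mult_strict_left_mono) auto
        also have "\<dots> = \<eta>" using D by simp
        finally show ?thesis .
      qed
      let ?h = "H (0, y)" and ?I = "closed_segment 0 (T' y)"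
      have img: "(?h, W (0, y) + t) \<in> Psi ` sqr r" if "t \<in> ?I" for t by (rule rho(4)[OF yrho(1) small[OF that]])
      have lc: "integral_curve X U (%t. line ?h (W (0, y) + t)) ?I" by (rule line_integral_curve[OF img])
      obtain gam where gam: "integral_curve X U gam ?I" "gam 0 = (0, y)" "gam (T' y) = (0, P' y)"
        using f unfolding flows_to_def by blast
      have "gam (T' y) = line ?h (W (0, y) + T' y)"
        by (rule integral_curve_unique[OF lc _ gam(1), of 0])
          (use Psi_line(1)[OF img] gam(2) line_Psi[OF yrho(2)] in auto)
      then have "(0, P' y) = line ?h (W (0, y) + T' y)" using gam by simp
      with Psi_line[OF img[of "T' y"]] have p: "(0, P' y) \<in> sqr r" "H (0, P' y) = H (0, y)" "W (0, P' y) = W (0, y) + T' y" by auto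
      have wp: "\<bar>W (0, P' y) - P' y / b\<bar> \<le> \<bar>P' y\<bar> / (4 * \<bar>b\<bar>)"
        using W_axis[of "P' y" 0] p(1) r W0[of 0] by (simp add: b_def sqr_iff)
      note TCb
      moreover have "P' y / b + y / b = (T' y + 2 / b * y) - (W (0, P' y) - P' y / b) + (W (0, y) - y / b)"
        using p(3) by (simp add: algebra_simps)
      ultimately have "\<bar>P' y / b + y / b\<bar> \<le> \<bar>y\<bar> / (4 * \<bar>b\<bar>) + \<bar>P' y\<bar> / (4 * \<bar>b\<bar>) + \<bar>y\<bar> / (4 * \<bar>b\<bar>)"
        using wp wy by linarith
      moreover have "\<bar>P' y / b + y / b\<bar> = \<bar>P' y + y\<bar> / \<bar>b\<bar>" by (simp add: abs_divide flip: add_divide_distrib)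
      moreover have "\<bar>y\<bar> / (4 * \<bar>b\<bar>) + \<bar>P' y\<bar> / (4 * \<bar>b\<bar>) + \<bar>y\<bar> / (4 * \<bar>b\<bar>) = ((2 * \<bar>y\<bar> + \<bar>P' y\<bar>) / 4) / \<bar>b\<bar>"
        by (simp add: add_divide_distrib)
      ultimately have "\<bar>P' y + y\<bar> / \<bar>b\<bar> \<le> ((2 * \<bar>y\<bar> + \<bar>P' y\<bar>) / 4) / \<bar>b\<bar>" by (simp only:)
      then have "\<bar>P' y + y\<bar> \<le> (2 * \<bar>y\<bar> + \<bar>P' y\<bar>) / 4" using b by (subst (asm) divide_le_cancel) auto
      \<comment> \<open>From this both |P' y| \<le> 2 |y| and P' y \<noteq> y: equality would give 8
        |y| \<le> 3 |y|.\<close>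
      then have key: "4 * \<bar>P' y + y\<bar> \<le> 2 * \<bar>y\<bar> + \<bar>P' y\<bar>" by simp
      have "\<bar>P' y\<bar> - \<bar>y\<bar> \<le> \<bar>P' y + y\<bar>" using abs_triangle_ineq2[of "P' y" "- y"] by simp
      with key have "\<bar>P' y\<bar> \<le> 2 * \<bar>y\<bar>" by (simp add: field_simps)
      moreover have "P' y \<noteq> y" using key y(1) by auto
      moreover have "2 * \<bar>y\<bar> < d" using y(2) \<delta>(5) P(2) by simp
      ultimately have "\<bar>P' y\<bar> < d" "P' y \<noteq> y" by simp_all
      moreover have "\<bar>y\<bar> < d" using y \<delta>(5) P(2) by auto
      ultimately show ?case using P(7)[of "P' y" y] p(2) by auto
    qed
    then show "\<alpha>' = \<alpha>" using ps_unique[OF T'P'(2) \<alpha>] by simp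
  qed
  ultimately have "half_return_coeff X U = \<alpha>"
    unfolding half_return_coeff_def using \<alpha> by (intro the_equality) auto
  then show thesis using that[of P d] \<alpha> \<alpha>01 P by simp
qed

section \<open>The half-return map of an invisible tangency\<close>

lemma flow_box_mono:
  assumes "flow_box X U r L H Hx Hy W Wx Wy" and r': "0 < r'" "r' \<le> r" and L': "L \<le> L'"
  shows "flow_box X U r' L' H Hx Hy W Wx Wy"
proof -
  interpret flow_box X U r L H Hx Hy W Wx Wy by fact
  have sub': "p \<in> sqr r' ==> p \<in> sqr r" for p using sqr_mono[OF r'(2)] by blast
  show ?thesis
  proof (unfold_locales, goal_cases)
    case (16 x y x' y' F)
    have "\<bar>F (x, y) - F (x', y')\<bar> \<le> L * (\<bar>x - x'\<bar> + \<bar>y - y'\<bar>)" by (rule lip) (use 16 sub' in auto)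
    also have "\<dots> \<le> L' * (\<bar>x - x'\<bar> + \<bar>y - y'\<bar>)" using L' by (intro mult_right_mono) auto
    finally show ?case .
  next
    case 19
    then show ?case using inj inj_on_subset[OF inj sqr_mono[OF r'(2)]] by blast
  qed (use r' L L' sub sub' b0 g_bound dH dW pdeH pdeW H0 W0 at0 Hx_half Wy_near in \<open>auto simp del: split_paired_All\<close>)
qed

text \<open>The signs \<open>s\<close>, \<open>e\<close> normalise the two half systems simultaneously: in the coordinates
  \<open>(s x, e y)\<close> both orbits run upwards and enter the region \<open>x > 0\<close> at \<open>y < 0\<close>; there \<open>K\<close>, \<open>Q\<close> are the
  first integral and the half-return map.\<close>

locale half_flow = flow_box +
  fixes s e c :: real and k :: nat and Q :: "real \<Rightarrow> real" and q :: "nat \<Rightarrow> real"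
  assumes s: "s = 1 \<or> s = - 1" and e: "e = sgn (snd (X (0, 0)))"
    and k: "k \<ge> 1" and c: "c > 0"
    and small: "L * r \<le> c / 8" "L * r \<le> 1 / 8" "r \<le> 1 / 2"
    and G_est: "!!u. \<bar>u\<bar> < r ==> \<bar>s * H (0, e * u) - c * u ^ (2 * k)\<bar> \<le> L * \<bar>u\<bar> ^ (2 * k + 1)"
    and G'_est: "!!u. \<bar>u\<bar> < r ==> \<bar>s * e * Hy (0, e * u) - 2 * real k * c * u ^ (2 * k - 1)\<bar> \<le> L * \<bar>u\<bar> ^ (2 * k)"
    and G'_convex: "!!u v. - r < u ==> u \<le> v ==> v < r ==>
        real k * c * (v ^ (2 * k - 1) - u ^ (2 * k - 1)) \<le> s * e * Hy (0, e * v) - s * e * Hy (0, e * u)"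
    and Q_series: "has_power_series q Q"
    and Q_level: "!!u. \<bar>u\<bar> < r ==> H (0, e * Q u) = H (0, e * u)"
    and Q_sgn: "!!u. \<bar>u\<bar> < r ==> sgn (Q u) = - sgn u"
    and Q_est: "!!u. \<bar>u\<bar> < r ==> \<bar>Q u + u\<bar> \<le> L * u\<^sup>2"
    and Q_deriv: "!!u. \<bar>u\<bar> < r ==> (Q has_real_derivative deriv Q u) (at u)"

text \<open>The choice of \<open>s\<close> makes the leading coefficient c of s H(0, e u) positive;
  even exponents are insensitive to \<open>e\<close>. The involution property of \<open>P\<close> is
  exported as well, because the parity of the first nonzero Lyapunov coefficient depends on
  it.\<close>

lemma half_flow_exists:
  assumes U: "open U" "(0, 0) \<in> U"
    and a: "has_power_series2 a (%p. fst (X p)) (0, 0)" and b: "has_power_series2 b (%p. snd (X p)) (0, 0)"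
    and k: "k \<ge> 1" and lie: "!!i. i \<in> {1..2 * k - 1} ==> (lie_derivative X ^^ i) fst (0, 0) = 0"
    and lie2: "(lie_derivative X ^^ (2 * k)) fst (0, 0) \<noteq> 0"
    and s: "s = - sgn ((lie_derivative X ^^ (2 * k)) fst (0, 0))" and e: "e = sgn (b 0 0)"
  obtains r L H Hx Hy W Wx Wy c Q P d where
    "half_flow X U r L H Hx Hy W Wx Wy s e c k Q (%i. e * half_return_coeff X U i * e ^ i)"
    "b 0 0 \<noteq> 0" "a 0 (2 * k - 1) = - (b 0 0 * (2 * real k) * (s * c))"
    "has_power_series (half_return_coeff X U) P" "half_return_coeff X U 0 = 0" "half_return_coeff X U 1 = - 1"
    "d > 0" "P 0 = 0" "!!y. \<bar>y\<bar> < d ==> \<bar>P y\<bar> < d ==> P (P y) = y"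
proof -
  define \<alpha> where "\<alpha> = half_return_coeff X U"
  define \<Lambda> where "\<Lambda> = (lie_derivative X ^^ (2 * k)) fst (0, 0)"
  have an: "an2 (%p. fst (X p))" "an2 (%p. snd (X p))" using an2_of_power_series2(1)[OF a] an2_of_power_series2(1)[OF b] by auto
  have a0: "fst (X (0, 0)) = 0" using lie[of 1] k by (simp add: lie_derivative_fst)
  have b00: "snd (X (0, 0)) = b 0 0" using an2_of_power_series2(2)[OF b] .
  have b0: "b 0 0 \<noteq> 0"
  proof
    assume "b 0 0 = 0"
    then have "X (0, 0) = 0" using a0 b00 by (simp add: prod_eq_iff)
    from lie_iter_zero_field[OF an this, of "2 * k - 1"] show False using lie2 k by simp
  qed
  obtain r0 L0 H Hx Hy W Wx Wy where fb: "flow_box X U r0 L0 H Hx Hy W Wx Wy" "an2 H" "an2 W"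
    using flow_box_exists[OF U a b a0] b0 b00 by metis
  interpret fb: flow_box X U r0 L0 H Hx Hy W Wx Wy by (rule fb)
  obtain g where g: "has_power_series g (%y. H (0, y))" using ran_ps[OF an2_ran[OF fb(2)]] by blast
  have "(\<forall>j<2 * k. g j = 0) \<and> g (2 * k) = - (\<Lambda> / (fact (2 * k) * snd (X (0, 0)) ^ (2 * k)))"
    unfolding \<Lambda>_def
  proof (rule fb.first_integral_order[OF an _ _ g])
    show "(lie_derivative X ^^ i) fst (0, 0) = 0" if "i < 2 * k" for i
      using lie[of i] that by (cases "i = 0") auto
  qed (use k in auto)
  then have g0: "!!j. j < 2 * k ==> g j = 0" and g2: "g (2 * k) = - (\<Lambda> / (fact (2 * k) * b 0 0 ^ (2 * k)))"
    by (auto simp: b00)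
  define c where "c = s * g (2 * k)"
  have s1: "s = 1 \<or> s = - 1" using lie2 s by (auto simp: sgn_if)
  have ss: "s * s = 1" using s1 by auto
  have ee: "e * e = 1" "\<bar>e\<bar> = 1" "e = 1 \<or> e = - 1" using b0 e by (auto simp: sgn_if)
  have e2k: "e ^ (2 * k) = 1" using ee(3) by auto
  have c: "c > 0"
  proof -
    have "c = \<bar>\<Lambda>\<bar> / (fact (2 * k) * b 0 0 ^ (2 * k))"
      unfolding c_def g2 s \<Lambda>_def[symmetric] by (simp add: sgn_mult_self_eq abs_sgn mult.commute)
    moreover have "b 0 0 ^ (2 * k) > 0" using b0 by (simp add: zero_less_power_eq)
    ultimately show ?thesis using lie2 by (simp add: \<Lambda>_def)
  qed
  have gc: "g (2 * k) = s * c" using ss by (simp add: c_def flip: mult.assoc)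
  have gnz: "g (2 * k) \<noteq> 0" using c gc s1 by auto
  have aeq: "a 0 (2 * k - 1) = - (b 0 0 * (2 * real k) * (s * c))"
  proof -
    have "a 0 (2 * k - 1) = - (snd (X (0, 0)) * real (2 * k) * g (2 * k))"
      by (rule fb.vertical_component_order[OF g g0 _ has_power_series2_slice[OF a]]) (use k in auto)
    then show ?thesis using gc b00 by simp
  qed
  obtain P d where P: "has_power_series \<alpha> P" "\<alpha> 0 = 0" "\<alpha> 1 = - 1" "d > 0" "P 0 = 0"
    "!!y. \<bar>y\<bar> < d ==> H (0, P y) = H (0, y)" "!!y. \<bar>y\<bar> < d ==> sgn (P y) = - sgn y"
    "!!y. \<bar>y\<bar> < d ==> \<bar>P y\<bar> < d ==> P (P y) = y"
    by (rule fb.half_return_coeff_eq[OF g g0 gnz k fb(3), folded \<alpha>_def]) (assumption, (rule that; assumption))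
  define q where "q = (%i. e * \<alpha> i * e ^ i)"
  define Q where "Q = (%u. e * P (e * u))"
  have Qs: "has_power_series q Q" unfolding q_def Q_def by (rule ps_scale[OF P(1)])
  have q01: "q 0 = 0" "q 1 = - 1" using P(2,3) ee(1) by (auto simp: q_def)
  obtain d1 C1 where d1: "d1 > 0" "C1 \<ge> 0" "!!u. \<bar>u\<bar> < d1 ==> \<bar>Q u - q 1 * u ^ 1\<bar> \<le> C1 * \<bar>u\<bar> ^ Suc 1"
    by (rule ps_remainder[OF Qs, of 1]) (use q01 in auto)
  obtain d2 where d2: "d2 > 0" "!!u. \<bar>u\<bar> < d2 ==> (Q has_real_derivative deriv Q u) (at u)"
    using ps_deriv[OF Qs] by blast
  have Gs: "has_power_series (%i. s * g i * e ^ i) (%u. s * H (0, e * u))" by (rule ps_scale[OF g])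
  obtain d3 C3 where d3: "d3 > 0" "C3 \<ge> 0" "!!u. \<bar>u\<bar> < d3 ==> \<bar>s * H (0, e * u) - (s * g (2 * k) * e ^ (2 * k)) * u ^ (2 * k)\<bar> \<le> C3 * \<bar>u\<bar> ^ Suc (2 * k)"
    by (rule ps_remainder[OF Gs, of "2 * k"]) (use g0 in auto)
  have G's: "has_power_series (%i. (s * e) * (real (Suc i) * g (Suc i)) * e ^ i) (%u. (s * e) * Hy (0, e * u))"
    by (rule ps_scale[OF fb.Hy_series[OF g]])
  let ?g' = "%i. (s * e) * (real (Suc i) * g (Suc i)) * e ^ i"
  have g'0: "?g' j = 0" if "j < 2 * k - 1" for j using g0[of "Suc j"] that by simp
  have g'1: "?g' (2 * k - 1) = 2 * real k * c"
  proof -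
    have "?g' (2 * k - 1) = s * (real (2 * k) * g (2 * k)) * (e * e ^ (2 * k - 1))" using k by (simp add: mult_ac)
    also have "e * e ^ (2 * k - 1) = e ^ (2 * k)" using k by (metis mult_eq_if power_Suc Suc_pred' mult_is_0 neq0_conv zero_neq_numeral not_one_le_zero)
    finally show ?thesis using e2k by (simp add: c_def)
  qed
  obtain d4 C4 where d4: "d4 > 0" "C4 \<ge> 0" "!!u. \<bar>u\<bar> < d4 ==> \<bar>(s * e) * Hy (0, e * u) - ?g' (2 * k - 1) * u ^ (2 * k - 1)\<bar> \<le> C4 * \<bar>u\<bar> ^ Suc (2 * k - 1)"
    by (rule ps_remainder[OF G's, of "2 * k - 1"]) (use g'0 in auto)
  let ?G' = "%u. (s * e) * Hy (0, e * u)"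
  obtain d5 where d5: "d5 > 0" "!!u. \<bar>u\<bar> < d5 ==> (?G' has_real_derivative deriv ?G' u) (at u)"
    and G''s: "has_power_series (%i. real (Suc i) * ?g' (Suc i)) (deriv ?G')"
    using ps_deriv[OF G's] by blast
  obtain d6 C6 where d6: "d6 > 0" "C6 \<ge> 0" "!!u. \<bar>u\<bar> < d6 ==> \<bar>deriv ?G' u - (real (Suc (2 * k - 2)) * ?g' (Suc (2 * k - 2))) * u ^ (2 * k - 2)\<bar> \<le> C6 * \<bar>u\<bar> ^ Suc (2 * k - 2)"
    by (rule ps_remainder[OF G''s, of "2 * k - 2"]) (use g0 in auto)
  have k1: "Suc (2 * k - 2) = 2 * k - 1" "Suc (2 * k - 1) = 2 * k" using k by auto
  define L where "L = Max {L0, C1, C3, C4}"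
  have L: "L0 \<le> L" "C1 \<le> L" "C3 \<le> L" "C4 \<le> L" by (auto simp: L_def)
  have L0: "L \<ge> 0" using L d1 by linarith
  \<comment> \<open>The entries with L + 1 give \<open>L * r \<le> c / 8\<close> and
    \<open>L * r \<le> 1 / 8\<close>. The last one keeps the error of the second derivative of s
    H(0, e u) below c x^(2 k - 2), as needed for \<open>G'_convex\<close>.\<close>
  define r where "r = Min {r0, d, d1, d2, d3, d4, d5, d6, 1 / 2, c / (8 * (L + 1)), 1 / (8 * (L + 1)), c / (C6 + 1)}"
  have r: "r > 0" "r \<le> r0" "r \<le> d" "r \<le> d1" "r \<le> d2" "r \<le> d3" "r \<le> d4" "r \<le> d5" "r \<le> d6" "r \<le> 1 / 2"
    "r \<le> c / (8 * (L + 1))" "r \<le> 1 / (8 * (L + 1))" "r \<le> c / (C6 + 1)"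
  proof -
    have "c / (8 * (L + 1)) > 0" "1 / (8 * (L + 1)) > 0" "c / (C6 + 1) > 0" using c L0 d6(2) by auto
    then show "r > 0" unfolding r_def using fb.r P(4) d1 d2 d3 d4 d5 d6 by (subst Min_gr_iff) auto
  qed (unfold r_def, (rule Min_le; simp)+)
  have fbr: "flow_box X U r L H Hx Hy W Wx Wy" by (rule flow_box_mono[OF fb(1) r(1,2) L(1)])
  have eu: "\<bar>e * u\<bar> = \<bar>u\<bar>" for u using ee(2) by (simp add: abs_mult)
  have "half_flow X U r L H Hx Hy W Wx Wy s e c k Q q"
  proof (intro half_flow.intro[OF fbr] half_flow_axioms.intro)
    have Lr: "L * r \<le> x / 8" if "r \<le> x / (8 * (L + 1))" for x
    proof -
      have "8 * (L + 1) > 0" using L0 by simp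
      then have "r * (8 * (L + 1)) \<le> x" using that by (simp only: pos_le_divide_eq)
      moreover have "r * (8 * (L + 1)) = 8 * (L * r) + 8 * r" by (simp add: algebra_simps)
      ultimately show ?thesis using r(1) by linarith
    qed
    show "L * r \<le> c / 8" by (rule Lr[OF r(11)])
    show "L * r \<le> 1 / 8" by (rule Lr[OF r(12)])
    show "\<bar>s * H (0, e * u) - c * u ^ (2 * k)\<bar> \<le> L * \<bar>u\<bar> ^ (2 * k + 1)" if "\<bar>u\<bar> < r" for u
    proof -
      have "\<bar>s * H (0, e * u) - c * u ^ (2 * k)\<bar> \<le> C3 * \<bar>u\<bar> ^ Suc (2 * k)" using d3(3)[of u] that r e2k by (simp add: c_def)
      also have "\<dots> \<le> L * \<bar>u\<bar> ^ (2 * k + 1)" using L by (simp add: mult_right_mono)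
      finally show ?thesis .
    qed
    show "\<bar>s * e * Hy (0, e * u) - 2 * real k * c * u ^ (2 * k - 1)\<bar> \<le> L * \<bar>u\<bar> ^ (2 * k)" if "\<bar>u\<bar> < r" for u
    proof -
      have "\<bar>s * e * Hy (0, e * u) - 2 * real k * c * u ^ (2 * k - 1)\<bar> \<le> C4 * \<bar>u\<bar> ^ (2 * k)"
        using d4(3)[of u, unfolded g'1, unfolded k1(2)] that r by simp
      also have "\<dots> \<le> L * \<bar>u\<bar> ^ (2 * k)" using L by (intro mult_right_mono) auto
      finally show ?thesis .
    qed
    show "real k * c * (v ^ (2 * k - 1) - u ^ (2 * k - 1)) \<le> s * e * Hy (0, e * v) - s * e * Hy (0, e * u)"
      if uv: "- r < u" "u \<le> v" "v < r" for u v
    proof -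
      \<comment> \<open>Half of the leading part of G' is subtracted. The derivative of the
        difference is at least (k (2 k - 1) - 1) c x^(2 k - 2), which is nonnegative.\<close>
      let ?\<phi> = "%u. ?G' u - real k * c * u ^ (2 * k - 1)"
      have "?\<phi> u \<le> ?\<phi> v"
      proof (rule DERIV_nonneg_imp_nondecreasing[OF uv(2)])
        fix x assume x: "u \<le> x" "x \<le> v"
        then have xr: "\<bar>x\<bar> < r" using uv by auto
        let ?D = "deriv ?G' x - real k * c * (real (2 * k - 1) * x ^ (2 * k - 1 - Suc 0))"
        have "(?\<phi> has_real_derivative ?D) (at x)"
          by (rule DERIV_diff[OF d5(2) DERIV_cmult[OF DERIV_pow]]) (use xr r in auto)
        moreover have "?D \<ge> 0"
        proof -
          have e1: "2 * k - 1 - Suc 0 = 2 * k - 2" by simp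
          have "\<bar>deriv ?G' x - real (2 * k - 1) * (2 * real k * c) * x ^ (2 * k - 2)\<bar> \<le> C6 * \<bar>x\<bar> ^ (2 * k - 1)"
            using d6(3)[of x] xr r unfolding k1(1) g'1 by simp
          also have "C6 * \<bar>x\<bar> ^ (2 * k - 1) = (C6 * \<bar>x\<bar>) * x ^ (2 * k - 2)"
          proof -
            have "\<bar>x\<bar> ^ (2 * k - 1) = \<bar>x\<bar> * \<bar>x\<bar> ^ (2 * k - 2)" using k1(1) by (metis power_Suc)
            moreover have "\<bar>x\<bar> ^ (2 * k - 2) = x ^ (2 * k - 2)" by (rule power_even_abs) simp
            ultimately show ?thesis by simp
          qed
          also have "\<dots> \<le> c * x ^ (2 * k - 2)"
          proof (rule mult_right_mono)
            have "C6 * \<bar>x\<bar> \<le> (C6 + 1) * (c / (C6 + 1))" using xr r d6(2) c by (intro mult_mono) auto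
            then show "C6 * \<bar>x\<bar> \<le> c" using d6(2) by simp
            show "0 \<le> x ^ (2 * k - 2)" by (rule zero_le_even_power) simp
          qed
          finally have A: "deriv ?G' x \<ge> real (2 * k - 1) * (2 * real k * c) * x ^ (2 * k - 2) - c * x ^ (2 * k - 2)" by linarith
          define m where "m = real (2 * k - 1)"
          have "m \<ge> 1" unfolding m_def using k by simp
          then have km: "1 \<le> real k * m" using mult_mono[of 1 "real k" 1 m] k by simp
          have z0: "0 \<le> c * x ^ (2 * k - 2)" using c by (intro mult_nonneg_nonneg zero_le_even_power) auto
          have "c * x ^ (2 * k - 2) * 1 \<le> c * x ^ (2 * k - 2) * (real k * m)"
            by (rule mult_left_mono[OF km z0])
          then show ?thesis using A unfolding e1 m_def[symmetric] by (simp add: algebra_simps)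
        qed
        ultimately show "\<exists>D. (?\<phi> has_real_derivative D) (at x) \<and> 0 \<le> D" by blast
      qed
      then show ?thesis by (simp add: algebra_simps)
    qed
    show "H (0, e * Q u) = H (0, e * u)" if "\<bar>u\<bar> < r" for u
    proof -
      have "e * Q u = P (e * u)" using ee(1) by (simp add: Q_def flip: mult.assoc)
      then show ?thesis using P(6)[of "e * u"] that r eu by simp
    qed
    show "sgn (Q u) = - sgn u" if "\<bar>u\<bar> < r" for u
    proof -
      have "sgn (Q u) = sgn e * (- (sgn e * sgn u))" using P(7)[of "e * u"] that r eu by (simp add: Q_def sgn_mult)
      then show ?thesis using ee(3) by auto
    qed
    show "\<bar>Q u + u\<bar> \<le> L * u\<^sup>2" if "\<bar>u\<bar> < r" for u
    proof -
      have "\<bar>Q u + u\<bar> \<le> C1 * u\<^sup>2" using d1(3)[of u] that r q01 by (simp add: power2_eq_square abs_mult)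
      also have "\<dots> \<le> L * u\<^sup>2" using L by (intro mult_right_mono) auto
      finally show ?thesis .
    qed
  qed (use s1 e b00 k c r Qs d2 in auto)
  then show thesis
    using that[of r L H Hx Hy W Wx Wy c Q P d] b0 aeq P unfolding q_def \<alpha>_def by simp
qed

section \<open>Level sets near the tangency in normalised coordinates\<close>

context half_flow begin

text \<open>In these coordinates the first integral of either half behaves like c u^(2 k) + x, so
  one set of estimates covers both.\<close>

definition K :: "real \<Rightarrow> real \<Rightarrow> real" where "K x u = s * H (s * x, e * u)"
definition Ku :: "real \<Rightarrow> real \<Rightarrow> real" where "Ku x u = s * e * Hy (s * x, e * u)"
definition tm :: "real \<Rightarrow> real \<Rightarrow> real" where "tm x u = W (s * x, e * u)"
definition pt :: "real \<Rightarrow> real \<Rightarrow> real \<times> real" where "pt x u = (s * x, e * u)"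
definition \<beta> :: real where "\<beta> = \<bar>snd (X (0, 0))\<bar>"

lemma ss: "s * s = 1" "\<bar>s\<bar> = 1" using s by auto
lemma ee: "e * e = 1" "\<bar>e\<bar> = 1" "e = 1 \<or> e = - 1" using b0 e by (auto simp: sgn_if)
lemma \<beta>: "\<beta> > 0" using b0 by (simp add: \<beta>_def)
lemma b_eq: "snd (X (0, 0)) = e * \<beta>" unfolding \<beta>_def e by (simp add: sgn_mult_abs)

lemma pt_in: "pt x u \<in> sqr r \<longleftrightarrow> \<bar>x\<bar> < r \<and> \<bar>u\<bar> < r"
  by (simp add: pt_def sqr_iff abs_mult ss ee)

lemma pt_surj: obtains x u where "p = pt x u" "s * fst p = x" "e * snd p = u"
  using that[of "s * fst p" "e * snd p"] by (simp add: pt_def ss ee flip: mult.assoc)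

lemma fst_pt: "s * fst (pt x u) = x" and snd_pt: "e * snd (pt x u) = u"
  by (simp_all add: pt_def ss ee flip: mult.assoc)

lemma K_pt: "H (pt x u) = s * K x u" by (simp add: pt_def K_def ss flip: mult.assoc)
lemma tm_pt: "W (pt x u) = tm x u" by (simp add: pt_def tm_def)

lemma K0: "K 0 u = s * H (0, e * u)" and Ku0: "Ku 0 u = s * e * Hy (0, e * u)"
  by (simp_all add: K_def Ku_def)

lemma K_deriv_u:
  assumes "\<bar>x\<bar> < r" "\<bar>u\<bar> < r"
  shows "((%u. K x u) has_real_derivative Ku x u) (at u)"
proof -
  have p: "(s * x, e * u) \<in> sqr r" using assms by (simp add: sqr_iff abs_mult ss ee)
  have "((%u. H (s * x, e * u)) has_real_derivative Hy (s * x, e * u) * e) (at u)"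
    using DERIV_chain2[OF partial_derivs(2)[OF dH[OF p]] DERIV_cmult_Id[of e u]] by simp
  from DERIV_cmult[OF this, of s] show ?thesis unfolding K_def Ku_def by (simp add: mult_ac)
qed

lemma K_deriv_x:
  assumes "\<bar>x\<bar> < r" "\<bar>u\<bar> < r"
  shows "((%x. K x u) has_real_derivative Hx (s * x, e * u)) (at x)"
proof -
  have p: "(s * x, e * u) \<in> sqr r" using assms by (simp add: sqr_iff abs_mult ss ee)
  have "((%x. H (s * x, e * u)) has_real_derivative Hx (s * x, e * u) * s) (at x)"
    using DERIV_chain2[OF partial_derivs(1)[OF dH[OF p]] DERIV_cmult_Id[of s x]] by simp
  from DERIV_cmult[OF this, of s] show ?thesis unfolding K_def using ss by (simp add: mult_ac flip: mult.assoc)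
qed

lemma Hx_ge: "p \<in> sqr r ==> Hx p \<ge> 3 / 4" "p \<in> sqr r ==> Hx p > 0"
  using Hx_half[of p] by linarith+

lemma K_mono_x:
  assumes "- r < x" "x < y" "y < r" "\<bar>u\<bar> < r" shows "K x u < K y u"
proof (rule DERIV_pos_imp_increasing[OF assms(2)])
  fix t assume t: "x \<le> t" "t \<le> y"
  then have "\<bar>t\<bar> < r" using assms by auto
  then show "\<exists>D. ((%x. K x u) has_real_derivative D) (at t) \<and> 0 < D"
    using K_deriv_x[of t u] assms Hx_ge(2)[of "(s * t, e * u)"] by (auto simp: sqr_iff abs_mult ss ee)
qed

lemma Ku_lip:
  assumes "\<bar>x\<bar> < r" "\<bar>u\<bar> < r" shows "\<bar>Ku x u - Ku 0 u\<bar> \<le> L * \<bar>x\<bar>"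
proof -
  have "Ku x u - Ku 0 u = (s * e) * (Hy (s * x, e * u) - Hy (s * 0, e * u))" by (simp add: Ku_def algebra_simps)
  then have "\<bar>Ku x u - Ku 0 u\<bar> = \<bar>Hy (s * x, e * u) - Hy (s * 0, e * u)\<bar>" by (simp add: abs_mult ss ee)
  also have "\<dots> \<le> L * (\<bar>s * x - s * 0\<bar> + \<bar>e * u - e * u\<bar>)"
    by (rule lip) (use assms r in \<open>auto simp: sqr_iff abs_mult ss ee\<close>)
  finally show ?thesis by (simp add: abs_mult ss)
qed

lemma K_shift:
  assumes "\<bar>x\<bar> < r" "\<bar>u\<bar> < r"
  shows "\<bar>K x u - K 0 u - x\<bar> \<le> L * (\<bar>x\<bar> + \<bar>u\<bar>) * \<bar>x\<bar>" "\<bar>K x u - K 0 u - x\<bar> \<le> \<bar>x\<bar> / 4"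
proof -
  have p: "(s * x, e * u) \<in> sqr r" using assms by (simp add: sqr_iff abs_mult ss ee)
  have "K x u - K 0 u - x = s * (H (s * x, e * u) - H (0, e * u) - s * x)"
    using ss by (simp add: K_def algebra_simps flip: mult.assoc)
  then have "\<bar>K x u - K 0 u - x\<bar> = \<bar>H (s * x, e * u) - H (0, e * u) - s * x\<bar>" by (simp add: abs_mult ss)
  also have "\<dots> \<le> L * (\<bar>s * x\<bar> + \<bar>e * u\<bar>) * \<bar>s * x\<bar>" by (rule H_shift[OF p])
  finally show *: "\<bar>K x u - K 0 u - x\<bar> \<le> L * (\<bar>x\<bar> + \<bar>u\<bar>) * \<bar>x\<bar>" by (simp add: abs_mult ss ee)
  have "L * (\<bar>x\<bar> + \<bar>u\<bar>) \<le> L * (2 * r)" using assms L by (intro mult_left_mono) auto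
  also have "\<dots> \<le> 1 / 4" using small(2) by simp
  finally have "L * (\<bar>x\<bar> + \<bar>u\<bar>) * \<bar>x\<bar> \<le> 1 / 4 * \<bar>x\<bar>" by (intro mult_right_mono) auto
  then show "\<bar>K x u - K 0 u - x\<bar> \<le> \<bar>x\<bar> / 4" using * by simp
qed

lemma K_bounds:
  assumes "0 \<le> mu" "mu < r" "\<bar>u\<bar> < r"
  shows "K 0 u + 3 / 4 * mu \<le> K mu u" "K mu u \<le> K 0 u + 5 / 4 * mu"
    "K 0 u - 5 / 4 * mu \<le> K (- mu) u" "K (- mu) u \<le> K 0 u - 3 / 4 * mu"
proof -
  have a: "\<bar>K mu u - K 0 u - mu\<bar> \<le> mu / 4" using K_shift(2)[of mu u] assms by simp
  have b: "\<bar>K (- mu) u - K 0 u - - mu\<bar> \<le> mu / 4" using K_shift(2)[of "- mu" u] assms by simp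
  show "K 0 u + 3 / 4 * mu \<le> K mu u" using a by linarith
  show "K mu u \<le> K 0 u + 5 / 4 * mu" using a by linarith
  show "K 0 u - 5 / 4 * mu \<le> K (- mu) u" using b by linarith
  show "K (- mu) u \<le> K 0 u - 3 / 4 * mu" using b by linarith
qed

lemma pow_split: "x ^ (2 * k) = x * x ^ (2 * k - 1)" for x :: real
  using k by (metis One_nat_def Suc_pred mult_pos_pos order_less_le_trans power_Suc zero_less_numeral zero_less_one)

lemma odd_pow: "(- x) ^ (2 * k - 1) = - (x ^ (2 * k - 1))" for x :: real
  using k by (intro power_minus_odd) simp

lemma even_pow: "(- x) ^ (2 * k) = x ^ (2 * k)" "\<bar>x\<bar> ^ (2 * k) = x ^ (2 * k)" for x :: real
  by (simp_all add: power_even_abs)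

lemma kc1: "c \<le> real k * c" using k c by simp

lemma G'_bounds:
  assumes "0 \<le> u" "u < r"
  shows "real k * c * u ^ (2 * k - 1) \<le> Ku 0 u" "Ku 0 u \<le> 3 * real k * c * u ^ (2 * k - 1)"
    "real k * c * u ^ (2 * k - 1) \<le> - Ku 0 (- u)" "- Ku 0 (- u) \<le> 3 * real k * c * u ^ (2 * k - 1)"
proof -
  let ?w = "u ^ (2 * k - 1)"
  have w: "?w \<ge> 0" using assms by simp
  have "L * \<bar>u\<bar> \<le> L * r" using assms L by (intro mult_left_mono) auto
  then have "L * \<bar>u\<bar> \<le> real k * c" using small(1) kc1 c by linarith
  then have "L * \<bar>u\<bar> * ?w \<le> real k * c * ?w" using w by (rule mult_right_mono)
  then have R: "L * \<bar>u\<bar> ^ (2 * k) \<le> real k * c * ?w" using assms by (simp add: even_pow pow_split mult.assoc)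
  have g1: "\<bar>Ku 0 u - 2 * real k * c * ?w\<bar> \<le> L * \<bar>u\<bar> ^ (2 * k)" unfolding Ku0 by (rule G'_est) (use assms in simp)
  have g2: "\<bar>Ku 0 (- u) - 2 * real k * c * (- u) ^ (2 * k - 1)\<bar> \<le> L * \<bar>- u\<bar> ^ (2 * k)" unfolding Ku0 by (rule G'_est) (use assms in simp)
  have 1: "\<bar>Ku 0 u - 2 * real k * c * ?w\<bar> \<le> real k * c * ?w" using g1 R by linarith
  have 2: "\<bar>Ku 0 (- u) + 2 * real k * c * ?w\<bar> \<le> real k * c * ?w"
    using g2[unfolded odd_pow abs_minus_cancel mult_minus_right diff_minus_eq_add] R by linarith
  show "real k * c * ?w \<le> Ku 0 u" using 1 by linarith
  show "Ku 0 u \<le> 3 * real k * c * ?w" using 1 by linarith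
  show "real k * c * ?w \<le> - Ku 0 (- u)" using 2 by linarith
  show "- Ku 0 (- u) \<le> 3 * real k * c * ?w" using 2 by linarith
qed

lemma G_bounds:
  assumes "\<bar>u\<bar> < r" shows "c / 2 * u ^ (2 * k) \<le> K 0 u" "K 0 u \<le> 2 * c * u ^ (2 * k)"
proof -
  have "L * \<bar>u\<bar> \<le> L * r" using assms L by (intro mult_left_mono) auto
  then have "L * \<bar>u\<bar> \<le> c / 2" using small(1) c by linarith
  then have "L * \<bar>u\<bar> * u ^ (2 * k) \<le> c / 2 * u ^ (2 * k)" by (intro mult_right_mono) auto
  moreover have "L * \<bar>u\<bar> ^ (2 * k + 1) = L * \<bar>u\<bar> * u ^ (2 * k)" by (simp add: even_pow)
  ultimately have "\<bar>K 0 u - c * u ^ (2 * k)\<bar> \<le> c / 2 * u ^ (2 * k)" using G_est[OF assms] unfolding K0 by linarith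
  moreover have "0 \<le> c * u ^ (2 * k)" using c by simp
  ultimately have "c / 2 * u ^ (2 * k) \<le> K 0 u \<and> K 0 u \<le> 2 * c * u ^ (2 * k)" by linarith
  then show "c / 2 * u ^ (2 * k) \<le> K 0 u" "K 0 u \<le> 2 * c * u ^ (2 * k)" by blast+
qed

lemma K00: "K x 0 = x" by (simp add: K_def H0 ss flip: mult.assoc)

text \<open>On the line x the derivative in u differs from the one on x = 0 by at most L |x|, and
  w^(2 k) - v^(2 k) \<ge> w^(2 k - 1) (w - v). Only the larger argument \<open>w\<close> enters the
  bound, so \<open>v\<close> may lie in the inner zone where K x is not monotone. The sign
  \<open>sig\<close> selects the branch u > 0 or u < 0.\<close>

lemma K_increment:
  assumes sig: "sig = 1 \<or> sig = - 1" and vw: "0 \<le> v" "v \<le> w" "w < r" and x: "\<bar>x\<bar> < r"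
  shows "(c / 2 * w ^ (2 * k - 1) - L * \<bar>x\<bar>) * (w - v) \<le> K x (sig * w) - K x (sig * v)"
proof -
  let ?\<phi> = "%u. K x (sig * u) - (c / 2) * u ^ (2 * k) + (L * \<bar>x\<bar>) * u"
  have "?\<phi> v \<le> ?\<phi> w"
  proof (rule DERIV_nonneg_imp_nondecreasing[OF vw(2)])
    fix u assume u: "v \<le> u" "u \<le> w"
    then have ur: "0 \<le> u" "u < r" "\<bar>sig * u\<bar> < r" using vw sig by auto
    let ?D = "Ku x (sig * u) * sig - (c / 2) * (real (2 * k) * u ^ (2 * k - 1)) + L * \<bar>x\<bar>"
    have "((%u. K x (sig * u)) has_real_derivative Ku x (sig * u) * sig) (at u)"
      using DERIV_chain2[OF K_deriv_u[OF x ur(3)] DERIV_cmult_Id[of sig u]] by simp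
    from DERIV_add[OF DERIV_diff[OF this DERIV_cmult[OF DERIV_pow, of "c / 2" "2 * k"]] DERIV_cmult_Id[of "L * \<bar>x\<bar>" u]]
    have "(?\<phi> has_real_derivative ?D) (at u)" by simp
    moreover have "?D \<ge> 0"
    proof -
      have "Ku 0 (sig * u) * sig \<ge> real k * c * u ^ (2 * k - 1)" using G'_bounds(1,3)[OF ur(1,2)] sig by auto
      moreover have "\<bar>Ku x (sig * u) * sig - Ku 0 (sig * u) * sig\<bar> \<le> L * \<bar>x\<bar>" using Ku_lip[OF x ur(3)] sig by auto
      moreover have "(c / 2) * (real (2 * k) * u ^ (2 * k - 1)) = real k * c * u ^ (2 * k - 1)" by simp
      ultimately show ?thesis by linarith
    qed
    ultimately show "\<exists>D. (?\<phi> has_real_derivative D) (at u) \<and> 0 \<le> D" by blast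
  qed
  then have A: "(c / 2) * (w ^ (2 * k) - v ^ (2 * k)) - (L * \<bar>x\<bar>) * (w - v) \<le> K x (sig * w) - K x (sig * v)"
    by (simp add: algebra_simps)
  have "v * v ^ (2 * k - 1) \<le> v * w ^ (2 * k - 1)" using vw by (intro mult_left_mono power_mono) auto
  then have "w ^ (2 * k - 1) * (w - v) \<le> w ^ (2 * k) - v ^ (2 * k)"
    unfolding pow_split[of w] pow_split[of v] by (simp add: algebra_simps)
  then have "(c / 2) * (w ^ (2 * k - 1) * (w - v)) \<le> (c / 2) * (w ^ (2 * k) - v ^ (2 * k))"
    using c by (intro mult_left_mono) auto
  moreover have "(c / 2 * w ^ (2 * k - 1) - L * \<bar>x\<bar>) * (w - v) = (c / 2) * (w ^ (2 * k - 1) * (w - v)) - (L * \<bar>x\<bar>) * (w - v)"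
    by (simp add: left_diff_distrib)
  ultimately show ?thesis using A by linarith
qed

lemma G_mono:
  assumes "sig = 1 \<or> sig = - 1" "0 \<le> v" "v \<le> w" "w < r" shows "K 0 (sig * v) \<le> K 0 (sig * w)"
proof -
  have "0 \<le> (c / 2 * w ^ (2 * k - 1) - L * \<bar>0\<bar>) * (w - v)" using assms c by (intro mult_nonneg_nonneg) auto
  also have "\<dots> \<le> K 0 (sig * w) - K 0 (sig * v)" by (rule K_increment) (use assms r in auto)
  finally show ?thesis by simp
qed

text \<open>\<open>outer mu w\<close>: beyond the scale on which the orbits may fail to be unimodal.\<close>

definition outer :: "real \<Rightarrow> real \<Rightarrow> bool" where
  "outer mu w \<longleftrightarrow> 0 < w \<and> w < r \<and> L * mu < c / 2 * w ^ (2 * k - 1)"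

lemma outer_mono: "outer mu w ==> w \<le> w' ==> w' < r ==> outer mu w'"
proof -
  assume o: "outer mu w" and w: "w \<le> w'" "w' < r"
  have "w ^ (2 * k - 1) \<le> w' ^ (2 * k - 1)" using o w by (intro power_mono) (auto simp: outer_def)
  then have "c / 2 * w ^ (2 * k - 1) \<le> c / 2 * w' ^ (2 * k - 1)" using c by (intro mult_left_mono) auto
  then show "outer mu w'" using o w unfolding outer_def by linarith
qed

lemma outer_increasing:
  assumes "outer mu w" "sig = 1 \<or> sig = - 1" "0 \<le> v" "v < w" "\<bar>x\<bar> = mu" "mu < r"
  shows "K x (sig * v) < K x (sig * w)"
proof -
  have "0 < (c / 2 * w ^ (2 * k - 1) - L * \<bar>x\<bar>) * (w - v)" using assms unfolding outer_def by (intro mult_pos_pos) auto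
  also have "\<dots> \<le> K x (sig * w) - K x (sig * v)" by (rule K_increment) (use assms in \<open>auto simp: outer_def\<close>)
  finally show ?thesis by simp
qed

lemma outerI:
  assumes "0 < w" "w < r" "0 < mu" "3 / (8 * c) * mu \<le> w ^ (2 * k)" shows "outer mu w"
proof -
  have "3 / (8 * c) * mu \<le> w * w ^ (2 * k - 1)" using assms(4) by (simp add: pow_split)
  also have "\<dots> < r * w ^ (2 * k - 1)" using assms by (intro mult_strict_right_mono) auto
  finally have A: "3 / (8 * c) * mu < r * w ^ (2 * k - 1)" .
  have "L * mu * r \<le> 1 / 8 * mu" using small(2) mult_right_mono[of "L * r" "1 / 8" mu] assms by (simp add: mult_ac)
  also have "\<dots> \<le> c / 2 * (3 / (8 * c) * mu)" using c assms by simp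
  also have "\<dots> < c / 2 * (r * w ^ (2 * k - 1))" using A c by (intro mult_strict_left_mono) auto
  finally have "(L * mu) * r < (c / 2 * w ^ (2 * k - 1)) * r" by (simp add: mult_ac)
  then have "L * mu < c / 2 * w ^ (2 * k - 1)" using mult_less_cancel_right_pos[OF r] by blast
  then show ?thesis using assms by (simp add: outer_def)
qed

lemma outer_of_level:
  assumes "0 < w" "w < r" "0 < mu" "mu < r" "0 \<le> K (- mu) w" shows "outer mu w"
proof (rule outerI)
  have "3 / 4 * mu \<le> 2 * c * w ^ (2 * k)" using K_bounds(4)[of mu w] G_bounds(2)[of w] assms by auto
  then show "3 / (8 * c) * mu \<le> w ^ (2 * k)" using c by (simp add: field_simps)
qed (use assms in auto)

text \<open>The passage from x = mu at height - p to x = - mu at height w, reduced to an equation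
  between levels. That an orbit realises it without reaching x = - mu earlier is
  \<open>arc_exists\<close>.\<close>

definition step :: "real \<Rightarrow> real \<Rightarrow> real \<Rightarrow> bool" where
  "step mu p w \<longleftrightarrow> 0 \<le> p \<and> p < r \<and> 0 < w \<and> w < r \<and> K (- mu) w = K mu (- p)"

lemma step_outer:
  assumes "step mu p w" "0 < mu" "mu < r" shows "outer mu w"
proof (rule outer_of_level)
  have "0 \<le> K 0 (- p)" using G_mono[of "- 1" 0 p] K00[of 0] assms by (simp add: step_def)
  then show "0 \<le> K (- mu) w" using K_bounds(1)[of mu "- p"] assms unfolding step_def by auto
qed (use assms in \<open>auto simp: step_def\<close>)

lemma step_unique:
  assumes "step mu p w" "step mu p w'" "0 < mu" "mu < r" shows "w = w'"
proof (rule ccontr)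
  assume "w \<noteq> w'"
  then consider "w < w'" | "w' < w" by linarith
  then show False
    using outer_increasing[OF step_outer[OF assms(1,3,4)], of 1 w' "- mu"] outer_increasing[OF step_outer[OF assms(2-4)], of 1 w "- mu"] assms
    by cases (auto simp: step_def)
qed

text \<open>Intermediate value theorem on [0, r0]. The hypotheses keep the starting level below c
  r0^(2 k) / 8 + 5 mu / 4, whereas the level at (- mu, r0) is at least c r0^(2 k) / 2 - 5 mu /
  4.\<close>

lemma step_exists:
  assumes r0: "0 < r0" "r0 < r" and p: "0 \<le> p" "p \<le> r0 / 4" and mu: "0 < mu" "mu < r" "mu \<le> c * r0 ^ (2 * k) / 16"
  obtains w where "step mu p w" "w \<le> r0"
proof -
  have pr: "p < r" using p r0 by linarith
  have G0: "0 \<le> K 0 (- p)" using G_mono[of "- 1" 0 p] K00[of 0] p pr by simp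
  have lo: "K (- mu) 0 \<le> K mu (- p)" using K00[of "- mu"] K_bounds(1)[of mu "- p"] G0 mu p pr by auto
  have "p ^ (2 * k) \<le> (r0 / 4) ^ (2 * k)" using p by (intro power_mono) auto
  also have "\<dots> = r0 ^ (2 * k) * (1 / 4) ^ (2 * k)" by (simp add: power_divide)
  also have "\<dots> \<le> r0 ^ (2 * k) * (1 / 4) ^ 2" using k by (intro mult_left_mono power_decreasing) auto
  finally have "2 * c * p ^ (2 * k) \<le> 2 * c * (r0 ^ (2 * k) / 16)" using c by (intro mult_left_mono) (auto simp: power2_eq_square)
  then have "K mu (- p) \<le> c * r0 ^ (2 * k) / 8 + 5 / 4 * mu"
    using K_bounds(2)[of mu "- p"] G_bounds(2)[of "- p"] mu p pr by (simp add: even_pow)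
  moreover have "c / 2 * r0 ^ (2 * k) - 5 / 4 * mu \<le> K (- mu) r0"
    using K_bounds(3)[of mu r0] G_bounds(1)[of r0] mu r0 by simp
  moreover have "5 / 2 * mu \<le> c * r0 ^ (2 * k) * (3 / 8)"
  proof -
    have "0 \<le> c * r0 ^ (2 * k)" using c by simp
    then show ?thesis using mu(3) by linarith
  qed
  ultimately have hi: "K mu (- p) \<le> K (- mu) r0" by linarith
  have "continuous_on {0..r0} (K (- mu))"
    by (rule DERIV_continuous_on[OF has_field_derivative_at_within[OF K_deriv_u]]) (use r0 mu in auto)
  then obtain w where w: "0 \<le> w" "w \<le> r0" "K (- mu) w = K mu (- p)"
    using IVT'[of "K (- mu)" 0 "K mu (- p)" r0] lo hi r0 by auto
  have "K (- mu) 0 < K mu (- p)" using K00[of "- mu"] K_bounds(1)[of mu "- p"] G0 mu p pr by auto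
  then have "w \<noteq> 0" using w by auto
  then show thesis using that[of w] w r0 p pr by (auto simp: step_def)
qed

text \<open>The source of the drift: leaving the line x = mu and arriving at x = - mu, measured on x
  = 0, adds about mu twice to the level.\<close>

lemma step_level_gain:
  assumes "step mu p w" "0 < mu" "mu < r" shows "K 0 (- p) + 3 / 2 * mu \<le> K 0 w" "K 0 w \<le> K 0 (- p) + 5 / 2 * mu"
  using K_bounds(1,2)[of mu "- p"] K_bounds(3,4)[of mu w] assms by (auto simp: step_def)

lemma speed:
  assumes "p \<in> sqr r" shows "e * snd (X p) \<ge> \<beta> / 2"
proof -
  have "\<bar>e * snd (X p) - \<beta>\<bar> = \<bar>e * (snd (X p) - snd (X (0, 0)))\<bar>"
    using b_eq by (simp add: algebra_simps ee flip: mult.assoc)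
  also have "\<dots> = \<bar>snd (X p) - snd (X (0, 0))\<bar>" by (simp add: abs_mult ee)
  also have "\<dots> \<le> \<beta> / 2" using g_bound[OF assms] by (simp add: \<beta>_def)
  finally show ?thesis by linarith
qed

lemma curve_rises:
  assumes gam: "integral_curve X U gam {a..b}" "gam ` {a..b} \<subseteq> sqr r" and st: "a \<le> t1" "t1 < t2" "t2 \<le> b"
  shows "e * snd (gam t1) < e * snd (gam t2)"
proof -
  have d: "((%t. e * snd (gam t)) has_derivative (%h. h * (e * snd (X (gam t))))) (at t within {a..b})" if "t \<in> {a..b}" for t
  proof -
    have "(gam has_derivative (%h. h *\<^sub>R X (gam t))) (at t within {a..b})"
      using gam(1) that unfolding integral_curve_def has_vector_derivative_def by blast
    from has_derivative_mult_right[OF has_derivative_snd[OF this], of e] show ?thesis by (simp add: mult_ac)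
  qed
  have "\<exists>x\<in>{t1<..<t2}. e * snd (gam t2) - e * snd (gam t1) = (t2 - t1) * (e * snd (X (gam x)))"
    by (rule mvt_simple[OF st(2)]) (rule has_derivative_subset[OF d], use st in auto)
  then obtain x where x: "x \<in> {t1<..<t2}" "e * snd (gam t2) - e * snd (gam t1) = (t2 - t1) * (e * snd (X (gam x)))" by blast
  have "gam x \<in> sqr r" using gam(2) x(1) st by auto
  then have "e * snd (X (gam x)) > 0" using speed \<beta> by fastforce
  then have "(t2 - t1) * (e * snd (X (gam x))) > 0" using st by simp
  then show ?thesis using x(2) by linarith
qed

text \<open>At an earlier contact with x \<le> - mu at height u the level would be too small. For u
  \<ge> 0 it is below that of (- mu, w) because \<open>w\<close> is outer and u < w; for u < 0 the
  level on x = 0 is at most that of - p, and both shifts by mu go in the wrong direction.\<close>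

lemma arc_exists:
  obtains rho where "0 < rho" "rho \<le> r" "!!mu p w. 0 < mu ==> mu < rho ==> step mu p w ==> p < rho ==> w < rho ==>
     \<exists>gam. let T = tm (- mu) w - tm mu (- p) in T > 0 \<and> integral_curve X U gam {0..T} \<and> gam 0 = pt mu (- p) \<and> gam T = pt (- mu) w \<and>
        gam ` {0..T} \<subseteq> sqr r \<and> (\<forall>t. 0 \<le> t \<and> t < T \<longrightarrow> s * fst (gam t) > - mu)"
proof -
  obtain rho where rho: "0 < rho" "rho \<le> r" "!!p q. p \<in> sqr rho ==> q \<in> sqr rho ==> H p = H q ==>
     \<exists>gam. integral_curve X U gam (closed_segment 0 (W q - W p)) \<and> gam 0 = p \<and> gam (W q - W p) = q \<and>
         gam ` closed_segment 0 (W q - W p) \<subseteq> sqr r" by (rule flow_between) (rule that; assumption)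
  show thesis
  proof (rule that[OF rho(1,2)])
    fix mu p w assume mu: "0 < mu" "mu < rho" and st: "step mu p w" and pw: "p < rho" "w < rho"
    have p0: "0 \<le> p" "0 < w" and lev: "K (- mu) w = K mu (- p)" using st by (auto simp: step_def)
    have mur: "mu < r" "p < r" "w < r" using mu pw rho by auto
    define T where "T = tm (- mu) w - tm mu (- p)"
    have "\<exists>gam. integral_curve X U gam (closed_segment 0 (W (pt (- mu) w) - W (pt mu (- p)))) \<and> gam 0 = pt mu (- p) \<and> gam (W (pt (- mu) w) - W (pt mu (- p))) = pt (- mu) w \<and>
         gam ` closed_segment 0 (W (pt (- mu) w) - W (pt mu (- p))) \<subseteq> sqr r"
    proof (rule rho(3))
      show "pt mu (- p) \<in> sqr rho" "pt (- mu) w \<in> sqr rho" using mu pw p0 by (simp_all add: pt_def sqr_iff abs_mult ss ee)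
      show "H (pt mu (- p)) = H (pt (- mu) w)" by (simp add: K_pt lev)
    qed
    then obtain gam where gam: "integral_curve X U gam (closed_segment 0 T)" "gam 0 = pt mu (- p)" "gam T = pt (- mu) w" "gam ` closed_segment 0 T \<subseteq> sqr r"
      unfolding tm_pt T_def by blast
    have T: "T > 0"
    proof (rule ccontr)
      assume "\<not> T > 0"
      then consider "T < 0" | "T = 0" by linarith
      then show False
      proof cases
        case 1
        then have seg: "closed_segment 0 T = {T..0}" by (simp add: closed_segment_eq_real_ivl)
        have "e * snd (gam T) < e * snd (gam 0)" by (rule curve_rises[where a=T and b=0]) (use gam seg 1 in auto)
        then show False using gam p0 by (simp add: snd_pt)
      next
        case 2
        then have "s * fst (pt mu (- p)) = s * fst (pt (- mu) w)" using gam by simp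
        then show False using mu by (simp add: fst_pt)
      qed
    qed
    then have seg: "closed_segment 0 T = {0..T}" by (simp add: closed_segment_eq_real_ivl)
    have out: "outer mu w" by (rule step_outer[OF st mu(1) mur(1)])
    have "s * fst (gam t) > - mu" if t: "0 \<le> t" "t < T" for t
    proof (rule ccontr)
      assume neg: "\<not> s * fst (gam t) > - mu"
      obtain x u where xu: "gam t = pt x u" "s * fst (gam t) = x" "e * snd (gam t) = u" by (rule pt_surj)
      have "gam t \<in> sqr r" using gam(4) t seg by auto
      then have in_r: "\<bar>x\<bar> < r" "\<bar>u\<bar> < r" unfolding xu(1) pt_in by auto
      have uw: "u < w" using curve_rises[OF gam(1)[unfolded seg] gam(4)[unfolded seg], of t T] t gam(3) xu by (simp add: snd_pt)
      have "e * snd (gam 0) = - p" unfolding gam(2) by (rule snd_pt)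
      moreover have "e * snd (gam 0) \<le> e * snd (gam t)"
        using curve_rises[OF gam(1)[unfolded seg] gam(4)[unfolded seg], of 0 t] t by (cases "t = 0") auto
      ultimately have up: "- p \<le> u" using xu(3) by linarith
      have "H (gam t) = H (gam 0)" by (rule integral_curve_constant(1)[OF gam(1) _ gam(4)]) (use seg t T in auto)
      then have "s * K x u = s * K mu (- p)" using xu gam(2) by (simp add: K_pt)
      then have lev': "K x u = K mu (- p)" using s by auto
      have le: "K x u \<le> K (- mu) u"
        using K_mono_x[of x "- mu" u] neg xu in_r mu(1) mur by (cases "x = - mu") auto
      show False
      proof (cases "u \<ge> 0")
        case True
        then show False using outer_increasing[OF out, of 1 u "- mu"] uw mu mur le lev lev' by simp
      next
        case False
        then have "K 0 u \<le> K 0 (- p)" using G_mono[of "- 1" "- u" p] up mur by simp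
        then show False using K_bounds(4)[of mu u] K_bounds(1)[of mu "- p"] mu mur in_r p0 le lev' by simp
      qed
    qed
    then show "\<exists>gam. let T = tm (- mu) w - tm mu (- p) in T > 0 \<and> integral_curve X U gam {0..T} \<and> gam 0 = pt mu (- p) \<and> gam T = pt (- mu) w \<and>
        gam ` {0..T} \<subseteq> sqr r \<and> (\<forall>t. 0 \<le> t \<and> t < T \<longrightarrow> s * fst (gam t) > - mu)"
      unfolding Let_def T_def[symmetric] using T gam unfolding seg by blast
  qed
qed

text \<open>Confinement backwards in time: on x \<ge> - mu a level set of K close to that of the
  origin is small, as K bounds u^(2 k) and positive x from above. A curve that ends near the origin
  and respects x \<ge> - mu therefore cannot have come from far away.\<close>

lemma confinement:
  assumes r0: "0 < r0" "r0 < r"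
  obtains rho where "0 < rho" "rho < r0" "!!mu gam a b. [|0 < mu; mu < rho; a \<le> b; integral_curve X U gam {a..b}; gam b \<in> sqr rho;
     !!t. a \<le> t ==> t \<le> b ==> - mu \<le> s * fst (gam t)|] ==> gam ` {a..b} \<subseteq> sqr r0"
proof -
  \<comment> \<open>A point of level h with h + 5 mu / 4 \<le> m and x \<ge> - mu lies in the closed
    square of half-width r0 / 2: the first entry controls u, the second x.\<close>
  define m where "m = min (c / 2 * (r0 / 2) ^ (2 * k)) (3 / 8 * r0)"
  have m: "m > 0" "m \<le> c / 2 * (r0 / 2) ^ (2 * k)" "m \<le> 3 / 8 * r0" using r0 c by (auto simp: m_def)
  define rho where "rho = min (r0 / 2) (m / (2 * c + 5))"
  have rho: "rho > 0" "rho \<le> r0 / 2" "rho \<le> m / (2 * c + 5)"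
    unfolding rho_def by (rule_tac [2] min.cobounded1, rule_tac [2] min.cobounded2) (use r0 m(1) c in simp)
  have rhom: "(2 * c + 5) * rho \<le> m" using rho(3) c by (simp add: pos_le_divide_eq mult.commute)
  show thesis
  proof (rule that[OF rho(1)])
    show "rho < r0" using rho r0 by simp
  next
    fix mu gam a b assume mu: "0 < mu" "mu < rho" and ab: "a \<le> b" and gam: "integral_curve X U gam {a..b}" and fin: "gam b \<in> sqr rho"
      and up: "!!t. a \<le> t ==> t \<le> b ==> - mu \<le> s * fst (gam t)"
    obtain x1 u1 where xu1: "gam b = pt x1 u1" "s * fst (gam b) = x1" "e * snd (gam b) = u1" by (rule pt_surj)
    have b1: "\<bar>x1\<bar> < rho" "\<bar>u1\<bar> < rho" using fin xu1 by (auto simp: pt_def sqr_iff abs_mult ss ee)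
    define h where "h = K x1 u1"
    have hb: "h + 5 / 4 * mu \<le> m"
    proof -
      have "h \<le> K 0 u1 + 5 / 4 * \<bar>x1\<bar>" using K_shift(2)[of x1 u1] b1 rho r0 unfolding h_def by (auto simp: abs_le_iff abs_if split: if_splits)
      also have "K 0 u1 \<le> 2 * c * u1 ^ (2 * k)" by (rule G_bounds(2)) (use b1 rho r0 in auto)
      also have "u1 ^ (2 * k) \<le> \<bar>u1\<bar> ^ 1"
      proof -
        have "\<bar>u1\<bar> ^ (2 * k) \<le> \<bar>u1\<bar> ^ 1" using k b1 rho r0 small(3) by (intro power_decreasing) auto
        then show ?thesis by (simp add: even_pow)
      qed
      finally have "h \<le> 2 * c * \<bar>u1\<bar> + 5 / 4 * \<bar>x1\<bar>" using c by simp
      also have "\<dots> \<le> 2 * c * rho + 5 / 4 * rho" using b1 c by (intro add_mono mult_left_mono) auto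
      finally have "h + 5 / 4 * mu \<le> 2 * c * rho + 5 / 2 * rho" using mu by linarith
      also have "\<dots> \<le> (2 * c + 5) * rho" using rho by (simp add: algebra_simps)
      finally show ?thesis using rhom by linarith
    qed
    have box: "\<bar>x\<bar> \<le> r0 / 2 \<and> \<bar>u\<bar> \<le> r0 / 2" if lev: "K x u = h" "\<bar>x\<bar> < r" "\<bar>u\<bar> < r" "- mu \<le> x" for x u
    proof -
      have G0: "0 \<le> c / 2 * u ^ (2 * k)" using c by simp
      have sh: "K 0 u - 5 / 4 * mu \<le> K x u"
        using K_shift(2)[of x u] lev mu by (auto simp: abs_le_iff abs_if split: if_splits)
      have "c / 2 * u ^ (2 * k) \<le> m" using G_bounds(1)[of u] sh lev hb by simp
      then have "c / 2 * u ^ (2 * k) \<le> c / 2 * (r0 / 2) ^ (2 * k)" using m(2) by linarith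
      then have "\<bar>u\<bar> ^ (2 * k) \<le> (r0 / 2) ^ (2 * k)" using c by (simp add: even_pow)
      then have u: "\<bar>u\<bar> \<le> r0 / 2" using k r0 by (subst (asm) power_mono_iff) auto
      have "x \<le> r0 / 2"
      proof (cases "x \<ge> 0")
        case True
        then have "\<bar>K x u - K 0 u - x\<bar> \<le> x / 4" using K_shift(2)[of x u] lev by simp
        then have "3 / 4 * x \<le> K x u" using G_bounds(1)[OF lev(3)] G0 by linarith
        then show ?thesis using lev hb mu m(3) by simp
      qed (use r0 in simp)
      moreover have "- (r0 / 2) \<le> x" using lev(4) mu rho by linarith
      ultimately show ?thesis using u by auto
    qed
    show "gam ` {a..b} \<subseteq> sqr r0"
    proof (rule ccontr)
      assume "\<not> gam ` {a..b} \<subseteq> sqr r0"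
      define B where "B = {t \<in> {a..b}. gam t \<in> - sqr r0}"
      have Bne: "B \<noteq> {}" using \<open>\<not> gam ` {a..b} \<subseteq> sqr r0\<close> by (auto simp: B_def)
      have cont: "continuous_on {a..b} gam"
        using gam unfolding integral_curve_def continuous_on_eq_continuous_within using has_vector_derivative_continuous by blast
      have "B = {a..b} \<inter> gam -` (- sqr r0)" by (auto simp: B_def)
      then have "closed B" using continuous_closed_preimage[OF cont, of "- sqr r0"] open_sqr by (simp add: closed_Compl)
      moreover have bd: "bdd_above B" by (auto simp: B_def intro!: bdd_aboveI[of _ b])
      ultimately have tB: "Sup B \<in> B" using Bne closed_contains_Sup by blast
      \<comment> \<open>The last time outside the open square. Afterwards the level is constant, so
        the curve is even in the closed square of half the size; by continuity it is there at time t
        as well, a contradiction.\<close>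
      define t where "t = Sup B"
      have t: "a \<le> t" "t \<le> b" "gam t \<notin> sqr r0" using tB by (auto simp: B_def t_def)
      have "t \<noteq> b" using t(3) fin rho r0 sqr_mono[of rho r0] by auto
      then have tb: "t < b" using t by simp
      have after: "gam t' \<in> sqr r0" if "t < t'" "t' \<le> b" for t'
      proof (rule ccontr)
        assume "gam t' \<notin> sqr r0"
        then have "t' \<in> B" using that t by (auto simp: B_def)
        then show False using cSup_upper[OF _ bd] that(1) unfolding t_def by fastforce
      qed
      have sub: "gam ` {t<..b} \<subseteq> sqr r" using after r0 sqr_mono[of r0 r] by auto
      have ic: "integral_curve X U gam {t<..b}" using gam t unfolding integral_curve_def
        by (meson atLeastAtMost_iff greaterThanAtMost_iff has_vector_derivative_within_subset less_imp_le order_trans subsetI)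
      have cb: "gam t' \<in> {- (r0 / 2)..r0 / 2} \<times> {- (r0 / 2)..r0 / 2}" if t': "t < t'" "t' \<le> b" for t'
      proof -
        obtain x u where xu: "gam t' = pt x u" "s * fst (gam t') = x" "e * snd (gam t') = u" by (rule pt_surj)
        have "H (gam t') = H (gam b)" by (rule integral_curve_constant(1)[OF ic _ sub]) (use t' tb in auto)
        then have "K x u = h" using xu xu1 s by (auto simp: K_pt h_def)
        moreover have "gam t' \<in> sqr r" using sub t' by auto
        then have "\<bar>x\<bar> < r" "\<bar>u\<bar> < r" using xu(1) pt_in by auto
        ultimately have "\<bar>x\<bar> \<le> r0 / 2 \<and> \<bar>u\<bar> \<le> r0 / 2" using box up[of t'] t' t xu by auto
        then have "\<bar>fst (gam t')\<bar> \<le> r0 / 2" "\<bar>snd (gam t')\<bar> \<le> r0 / 2"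
          unfolding xu(1) by (simp_all add: pt_def abs_mult ss ee)
        then show ?thesis by (auto simp: mem_Times_iff abs_le_iff)
      qed
      have "(gam \<longlongrightarrow> gam t) (at t within {a..b})" using cont t by (simp add: continuous_on_def)
      then have "(gam \<longlongrightarrow> gam t) (at t within {t..b})" by (rule tendsto_within_subset) (use t in auto)
      then have "(gam \<longlongrightarrow> gam t) (at_right t)" unfolding at_within_Icc_at_right[OF tb] .
      moreover have "\<forall>\<^sub>F t' in at_right t. gam t' \<in> {- (r0 / 2)..r0 / 2} \<times> {- (r0 / 2)..r0 / 2}"
        unfolding eventually_at_right[OF tb] using cb tb by (intro bexI[of _ b] exI[of _ b]) auto
      ultimately have "gam t \<in> {- (r0 / 2)..r0 / 2} \<times> {- (r0 / 2)..r0 / 2}"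
        by (intro Lim_in_closed_set[of _ gam "at_right t" "gam t"]) (auto intro!: closed_Times)
      then have "gam t \<in> sqr r0" using r0 by (auto simp: sqr_def)
      then show False using t(3) by blast
    qed
  qed
qed

text \<open>Here \<open>v\<close> has arbitrary sign, as the arc comes from an unknown trajectory.
  The level rises while u increases; were the end height not positive, rising towards 0 would lower
  the level.\<close>

lemma arrival_outer:
  assumes gam: "integral_curve X U gam {a..b}" "gam ` {a..b} \<subseteq> sqr r" and ab: "a < b" and mu: "0 < mu" "mu < r"
    and ends: "gam a = pt mu v" "gam b = pt (- mu) u"
  shows "0 < u" "v < u" "K mu v = K (- mu) u" "K 0 v + 3 / 2 * mu \<le> K 0 u"
proof -
  have "H (gam b) = H (gam a)" by (rule integral_curve_constant(1)[OF gam(1) _ gam(2)]) (use ab in auto)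
  then show lev: "K mu v = K (- mu) u" using ends s by (auto simp: K_pt)
  have "gam a \<in> sqr r" "gam b \<in> sqr r" using gam(2) ab by auto
  then have in_r: "\<bar>v\<bar> < r" "\<bar>u\<bar> < r" using ends pt_in by auto
  show vu: "v < u" using curve_rises[OF gam, of a b] ab ends by (simp add: snd_pt)
  show gain: "K 0 v + 3 / 2 * mu \<le> K 0 u"
    using K_bounds(1)[of mu v] K_bounds(4)[of mu u] mu in_r lev by linarith
  show "0 < u"
  proof (rule ccontr)
    assume "\<not> 0 < u"
    then have "K 0 u \<le> K 0 v" using G_mono[of "- 1" "- u" "- v"] vu in_r by simp
    then show False using gain mu by linarith
  qed
qed

end

section \<open>Crossing the strip\<close>

text \<open>Injectivity replaces continuity of the derivative: invariance of domain makes the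
  inverse live on an open set, and a nonzero derivative at the single point \<open>w0\<close>
  suffices.\<close>

lemma implicit_function_1d:
  fixes a b :: "real \<Rightarrow> real"
  assumes S: "open S" "w0 \<in> S" and inj: "inj_on b S"
    and db: "!!w. w \<in> S ==> (b has_real_derivative b' w) (at w)" and nz: "b' w0 \<noteq> 0"
    and da: "(a has_real_derivative a') (at p0)" and eq: "a p0 = b w0"
  obtains g where "(g has_real_derivative a' / b' w0) (at p0)" "\<forall>\<^sub>F p in nhds p0. g p \<in> S \<and> b (g p) = a p"
proof -
  define h where "h = the_inv_into S b"
  have cb: "continuous_on S b" using db by (meson DERIV_isCont continuous_at_imp_continuous_on)
  have op: "open (b ` S)" by (rule invariance_of_domain[OF cb S(1) inj])
  have hb: "h (b w) = w" if "w \<in> S" for w unfolding h_def by (rule the_inv_into_f_f[OF inj that])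
  have "(h has_derivative (*) (1 / b' w0)) (at (b w0))"
  proof (rule has_derivative_inverse_strong[OF S cb hb])
    show "(b has_derivative (*) (b' w0)) (at w0)" using db[OF S(2)] by (simp add: has_field_derivative_def)
  qed (use nz in auto)
  then have "(h has_real_derivative 1 / b' w0) (at (a p0))" by (simp add: has_field_derivative_def eq)
  from DERIV_chain2[OF this da] have "((%p. h (a p)) has_real_derivative a' / b' w0) (at p0)" by simp
  moreover have "\<forall>\<^sub>F p in nhds p0. a p \<in> b ` S"
  proof -
    have "(a \<longlongrightarrow> a p0) (nhds p0)" using DERIV_isCont[OF da] tendsto_at_iff_tendsto_nhds[of a p0] by (simp add: isCont_def)
    then show ?thesis by (rule topological_tendstoD[OF _ op]) (use eq S in auto)
  qed
  then have "\<forall>\<^sub>F p in nhds p0. h (a p) \<in> S \<and> b (h (a p)) = a p"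
    by eventually_elim (use hb in auto)
  ultimately show thesis using that by blast
qed

context half_flow begin

definition slope :: "real \<Rightarrow> real \<Rightarrow> real \<Rightarrow> real" where
  "slope mu p w = - Ku mu (- p) / Ku (- mu) w"

text \<open>The scale at which c p^(2 k) dominates the shifts by mu. It makes \<open>p\<close> outer
  and the two ends of a passage comparable; it is much weaker than what the expansions
  require.\<close>

definition good :: "real \<Rightarrow> real \<Rightarrow> bool" where
  "good mu p \<longleftrightarrow> 0 < p \<and> p < r \<and> 0 < mu \<and> mu < r \<and> mu \<le> c * p ^ (2 * k)"

lemma pow_le_imp: "0 \<le> x ==> 0 \<le> y ==> x ^ (2 * k) \<le> y ^ (2 * k) ==> x \<le> y" for x y :: real
  using k power_mono_iff[of x y "2 * k"] by simp

lemma nine_pow: "9 * x ^ (2 * k) \<le> (3 * x) ^ (2 * k)" "4 * x ^ (2 * k) \<le> (2 * x) ^ (2 * k)" for x :: real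
proof -
  have "(3::real) ^ 2 \<le> 3 ^ (2 * k)" "(2::real) ^ 2 \<le> 2 ^ (2 * k)" using k by (intro power_increasing; simp)+
  moreover have "0 \<le> x ^ (2 * k)" by simp
  ultimately show "9 * x ^ (2 * k) \<le> (3 * x) ^ (2 * k)" "4 * x ^ (2 * k) \<le> (2 * x) ^ (2 * k)"
    unfolding power_mult_distrib by (intro mult_right_mono; simp)+
qed

lemma good_outer: "good mu p ==> outer mu p"
proof (rule outerI)
  assume g: "good mu p"
  then show "0 < p" "p < r" "0 < mu" by (auto simp: good_def)
  have "mu / c \<le> p ^ (2 * k)" using g c by (simp add: good_def pos_divide_le_eq mult.commute)
  moreover have "3 / (8 * c) * mu = 3 / 8 * (mu / c)" by simp
  moreover have "0 \<le> mu / c" using g c by (simp add: good_def)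
  ultimately show "3 / (8 * c) * mu \<le> p ^ (2 * k)" by linarith
qed

lemma step_compare:
  assumes st: "step mu p w" and g: "good mu p"
  shows "w \<le> 3 * p" "p \<le> 2 * w"
proof -
  have r': "0 < p" "p < r" "0 < w" "w < r" "0 < mu" "mu < r" "mu \<le> c * p ^ (2 * k)"
    using st g by (auto simp: step_def good_def)
  have G: "K 0 (- p) \<le> 2 * c * p ^ (2 * k)" "c / 2 * p ^ (2 * k) \<le> K 0 (- p)" "c / 2 * w ^ (2 * k) \<le> K 0 w" "K 0 w \<le> 2 * c * w ^ (2 * k)"
    using G_bounds[of "- p"] G_bounds[of w] r' by (auto simp: even_pow)
  note gain = step_level_gain[OF st r'(5,6)]
  have "c * w ^ (2 * k) \<le> c * (9 * p ^ (2 * k))" using G gain(2) r'(7) by linarith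
  then have "w ^ (2 * k) \<le> (3 * p) ^ (2 * k)" using c nine_pow(1)[of p] by (meson mult_le_cancel_left_pos order_trans)
  then show "w \<le> 3 * p" by (rule pow_le_imp[rotated 2]) (use r' in auto)
  have "c * p ^ (2 * k) \<le> c * (4 * w ^ (2 * k))" using G gain(1) r'(5) by linarith
  then have "p ^ (2 * k) \<le> (2 * w) ^ (2 * k)" using c nine_pow(2)[of w] by (meson mult_le_cancel_left_pos order_trans)
  then show "p \<le> 2 * w" by (rule pow_le_imp[rotated 2]) (use r' in auto)
qed

text \<open>The level at w is at least 5 mu, of which at most 5 mu / 2 was gained during the
  passage; the rest bounds p from below. This is the origin of the factor 10.\<close>

lemma good_of_end:
  assumes st: "step mu p w" and mu: "0 < mu" "mu < r" "10 * mu \<le> c * w ^ (2 * k)"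
  shows "good mu p"
proof -
  have r': "0 \<le> p" "p < r" "0 < w" "w < r" using st by (auto simp: step_def)
  have G: "K 0 (- p) \<le> 2 * c * p ^ (2 * k)" "c / 2 * w ^ (2 * k) \<le> K 0 w"
    using G_bounds[of "- p"] G_bounds[of w] r' by (auto simp: even_pow)
  have "mu \<le> c * p ^ (2 * k)" using G step_level_gain(2)[OF st mu(1,2)] mu by linarith
  moreover have "p \<noteq> 0" using calculation mu(1) k by (auto simp: power_0_left)
  ultimately show ?thesis using r' mu by (simp add: good_def)
qed

lemma Q_bounds:
  assumes "0 < u" "u < r"
  shows "7 / 8 * u \<le> Q (- u)" "Q (- u) \<le> 9 / 8 * u" "7 / 8 * u \<le> - Q u" "- Q u \<le> 9 / 8 * u"
    "\<bar>Q (- u) - u\<bar> \<le> L * u\<^sup>2" "\<bar>- Q u - u\<bar> \<le> L * u\<^sup>2"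
proof -
  have "L * u \<le> L * r" using assms L by (intro mult_left_mono) auto
  then have "L * u \<le> 1 / 8" using small(2) by linarith
  then have "(L * u) * u \<le> 1 / 8 * u" using assms by (intro mult_right_mono) auto
  then have R: "L * u\<^sup>2 \<le> u / 8" by (simp add: power2_eq_square)
  have 1: "\<bar>Q (- u) - u\<bar> \<le> L * u\<^sup>2" using Q_est[of "- u"] assms by simp
  have 2: "\<bar>- Q u - u\<bar> \<le> L * u\<^sup>2" using Q_est[of u] assms abs_minus_commute[of "- Q u" u] by simp
  show "7 / 8 * u \<le> Q (- u)" using 1 R by linarith
  show "Q (- u) \<le> 9 / 8 * u" using 1 R by linarith
  show "7 / 8 * u \<le> - Q u" using 2 R by linarith
  show "- Q u \<le> 9 / 8 * u" using 2 R by linarith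
  show "\<bar>Q (- u) - u\<bar> \<le> L * u\<^sup>2" "\<bar>- Q u - u\<bar> \<le> L * u\<^sup>2" by fact+
qed

lemma Q_K: "\<bar>u\<bar> < r ==> K 0 (Q u) = K 0 u" using Q_level by (simp add: K0)

lemma Q_bound_abs: assumes "\<bar>u\<bar> < r / 2" shows "\<bar>Q u\<bar> < r"
proof (cases "u = 0")
  case True
  then show ?thesis using Q_est[of 0] r by simp
next
  case False
  then consider "0 < u" | "0 < - u" by linarith
  then show ?thesis
  proof cases
    case 1
    then show ?thesis using Q_bounds(3,4)[of u] assms by auto
  next
    case 2
    then show ?thesis using Q_bounds(1,2)[of "- u"] assms by auto
  qed
qed

lemma Q_deriv_eq:
  assumes "\<bar>u\<bar> < r / 2" shows "Ku 0 (Q u) * deriv Q u = Ku 0 u"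
proof (rule DERIV_unique)
  have u: "\<bar>u\<bar> < r" using assms by linarith
  show "((%u. K 0 (Q u)) has_real_derivative Ku 0 (Q u) * deriv Q u) (at u)"
    by (rule DERIV_chain2[OF K_deriv_u Q_deriv]) (use Q_bound_abs[OF assms] r u in auto)
  show "((%u. K 0 (Q u)) has_real_derivative Ku 0 u) (at u)"
    by (rule has_field_derivative_transform_within_open[OF K_deriv_u, of 0 u "{-r<..<r}"]) (use u r Q_K in auto)
qed

lemma K0_increment_upper:
  assumes sig: "sig = 1 \<or> sig = - 1" and vw: "0 \<le> v" "v < w" "w < r"
  obtains \<xi> where "v < \<xi>" "\<xi> < w" "K 0 (sig * w) - K 0 (sig * v) = (sig * Ku 0 (sig * \<xi>)) * (w - v)"
    "real k * c * \<xi> ^ (2 * k - 1) \<le> sig * Ku 0 (sig * \<xi>)" "sig * Ku 0 (sig * \<xi>) \<le> 3 * real k * c * \<xi> ^ (2 * k - 1)"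
proof -
  have "\<exists>\<xi>. v < \<xi> \<and> \<xi> < w \<and> K 0 (sig * w) - K 0 (sig * v) = (w - v) * (sig * Ku 0 (sig * \<xi>))"
  proof (rule MVT2[OF vw(2)])
    fix x assume x: "v \<le> x" "x \<le> w"
    have "\<bar>sig * x\<bar> < r" using x vw sig by auto
    then show "((%x. K 0 (sig * x)) has_real_derivative sig * Ku 0 (sig * x)) (at x)"
      using DERIV_chain2[OF K_deriv_u[of 0 "sig * x"] DERIV_cmult_Id[of sig x]] r by (simp add: mult.commute)
  qed
  then obtain \<xi> where \<xi>: "v < \<xi>" "\<xi> < w" "K 0 (sig * w) - K 0 (sig * v) = (w - v) * (sig * Ku 0 (sig * \<xi>))" by blast
  have "0 \<le> \<xi>" "\<xi> < r" using \<xi> vw by auto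
  from G'_bounds[OF this] show thesis using that[of \<xi>] \<xi> sig by (auto simp: mult.commute)
qed

lemma pow_split2: "x ^ (2 * k - 1) = x * x ^ (2 * k - 2)" for x :: real
proof -
  have "Suc (2 * k - 2) = 2 * k - 1" using k by simp
  then show ?thesis by (metis power_Suc)
qed

lemma power_diff_lower:
  fixes v w :: real
  assumes "0 \<le> v" "v \<le> w" shows "w ^ (2 * k - 2) * (w - v) \<le> w ^ (2 * k - 1) - v ^ (2 * k - 1)"
proof -
  have "v * v ^ (2 * k - 2) \<le> v * w ^ (2 * k - 2)" using assms by (intro mult_left_mono power_mono) auto
  then show ?thesis unfolding pow_split2 by (simp add: algebra_simps)
qed

text \<open>The second entry makes the Lipschitz error L mu in the derivative of K, with its weight,
  smaller than the gain mu / (6 p) from convexity; see \<open>slope_upper\<close>. The final + 1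
  covers L = 0.\<close>

definition eps0 :: real where "eps0 = min (r / 8) (1 / (6 * L * (3 * 2 ^ (2 * k - 1) + 1) + 1))"

lemma eps0: "0 < eps0" "eps0 \<le> r / 8" "p \<le> eps0 ==> 0 < p ==> L * (3 * 2 ^ (2 * k - 1) + 1) \<le> 1 / (6 * p)"
proof -
  define M where "M = 6 * L * (3 * 2 ^ (2 * k - 1) + 1) + 1"
  have M: "M > 0" unfolding M_def using L by (intro add_nonneg_pos mult_nonneg_nonneg) auto
  show "0 < eps0" unfolding eps0_def M_def[symmetric] using r M by simp
  show "eps0 \<le> r / 8" by (simp add: eps0_def)
  assume p: "p \<le> eps0" "0 < p"
  have "p \<le> 1 / M" using p unfolding eps0_def M_def[symmetric] by simp
  then have "p * M \<le> 1" using M by (simp add: pos_le_divide_eq)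
  then have "6 * p * (L * (3 * 2 ^ (2 * k - 1) + 1)) \<le> 1" using p unfolding M_def by (simp add: algebra_simps)
  then show "L * (3 * 2 ^ (2 * k - 1) + 1) \<le> 1 / (6 * p)" using p by (simp add: pos_le_divide_eq mult_ac)
qed

lemma Ku_pos:
  assumes "outer mu w" "\<bar>x\<bar> = mu" "mu < r" shows "0 < Ku x w" "0 < - Ku x (- w)"
proof -
  have w: "0 < w" "w < r" "L * mu < c / 2 * w ^ (2 * k - 1)" using assms by (auto simp: outer_def)
  have "c * w ^ (2 * k - 1) \<le> real k * c * w ^ (2 * k - 1)" using kc1 w by (intro mult_right_mono) auto
  moreover have "0 < c * w ^ (2 * k - 1)" using c w by simp
  moreover have "\<bar>Ku x w - Ku 0 w\<bar> \<le> L * mu" "\<bar>Ku x (- w) - Ku 0 (- w)\<bar> \<le> L * mu"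
    using Ku_lip[of x w] Ku_lip[of x "- w"] assms w by auto
  moreover note G'_bounds(1,3)[of w]
  ultimately show "0 < Ku x w" "0 < - Ku x (- w)" using w by linarith+
qed

lemma slope_pos: "step mu p w ==> good mu p ==> 0 < slope mu p w"
  using Ku_pos(2)[OF good_outer, of mu p mu] Ku_pos(1)[OF step_outer, of mu p w "- mu"]
  unfolding slope_def good_def by (auto intro!: divide_pos_pos divide_neg_pos simp: abs_of_pos)

text \<open>With A = Q(- p), a = - Ku 0 (- p) and b = Ku 0 A the derivative without hysteresis is a
  / b. The gain of level pushes w beyond A, and by convexity the denominator grows by at least mu /
  (6 p); moving numerator and denominator off x = 0 costs only L mu each. No expansion in mu is
  used, so the bound holds on the whole section.\<close>

lemma slope_upper:
  assumes st: "step mu p w" and g: "good mu p" and p: "p \<le> eps0"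
  shows "slope mu p w \<le> - deriv Q (- p)"
proof -
  have r': "0 < p" "p < r / 2" "0 < w" "w < r" "0 < mu" "mu < r" "\<bar>mu\<bar> < r" "\<bar>- mu\<bar> < r"
    using st g p eps0(2) r by (auto simp: step_def good_def)
  define A where "A = Q (- p)"
  have A: "0 < A" "A \<le> 2 * p" "A < r" "K 0 A = K 0 (- p)" using Q_bounds(1,2)[of p] r' Q_K[of "- p"] by (auto simp: A_def)
  have gain: "K 0 A + 3 / 2 * mu \<le> K 0 w" using step_level_gain(1)[OF st r'(5,6)] A by simp
  have Aw: "A < w"
  proof (rule ccontr)
    assume "\<not> A < w"
    then have "K 0 w \<le> K 0 A" using G_mono[of 1 w A] A r' by simp
    then show False using gain r' by linarith
  qed
  obtain \<xi> where \<xi>: "A < \<xi>" "\<xi> < w" "K 0 (1 * w) - K 0 (1 * A) = (1 * Ku 0 (1 * \<xi>)) * (w - A)" "1 * Ku 0 (1 * \<xi>) \<le> 3 * real k * c * \<xi> ^ (2 * k - 1)"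
    using K0_increment_upper[of 1 A w] A Aw r' by (metis less_imp_le)
  define a where "a = - Ku 0 (- p)"
  define b where "b = Ku 0 A"
  have "\<xi> ^ (2 * k - 1) \<le> w ^ (2 * k - 1)" using \<xi> A by (intro power_mono) auto
  then have "3 * real k * c * \<xi> ^ (2 * k - 1) \<le> 3 * real k * c * w ^ (2 * k - 1)" using c by (intro mult_left_mono) auto
  then have "K 0 w - K 0 A \<le> (3 * real k * c * w ^ (2 * k - 1)) * (w - A)"
    using \<xi>(3,4) Aw mult_right_mono[of "Ku 0 \<xi>" "3 * real k * c * w ^ (2 * k - 1)" "w - A"] by simp
  \<comment> \<open>Splitting off one factor w turns the increment of K into 3 w times an increment
    of \<open>Ku\<close>, through \<open>power_diff_lower\<close> and
    \<open>G'_convex\<close>.\<close>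
  also have "\<dots> = 3 * (real k * c * (w * (w ^ (2 * k - 2) * (w - A))))"
    unfolding pow_split2[of w] by (simp add: mult_ac)
  also have "\<dots> \<le> 3 * (real k * c * (w * (w ^ (2 * k - 1) - A ^ (2 * k - 1))))"
    using power_diff_lower[of A w] A Aw r' c by (intro mult_left_mono) auto
  also have "\<dots> = 3 * w * (real k * c * (w ^ (2 * k - 1) - A ^ (2 * k - 1)))" by (simp add: mult_ac)
  also have "\<dots> \<le> 3 * w * (Ku 0 w - b)"
    using G'_convex[of A w] A Aw r' unfolding b_def Ku0 by (intro mult_left_mono) auto
  finally have "3 / 2 * mu \<le> 3 * w * (Ku 0 w - b)" using gain by linarith
  then have "mu / (2 * w) \<le> Ku 0 w - b" using r' by (simp add: field_simps)
  moreover have "mu / (6 * p) \<le> mu / (2 * w)" using step_compare(1)[OF st g] r' by (intro divide_left_mono) auto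
  moreover have "\<bar>Ku (- mu) w - Ku 0 w\<bar> \<le> L * mu" using Ku_lip[of "- mu" w] r' by simp
  ultimately have w': "b + mu / (6 * p) - L * mu \<le> Ku (- mu) w" by linarith
  have a0: "a > 0" "real k * c * p ^ (2 * k - 1) \<le> a" "- Ku mu (- p) \<le> a + L * mu"
  proof -
    show 1: "real k * c * p ^ (2 * k - 1) \<le> a" using G'_bounds(3)[of p] r' by (simp add: a_def)
    have "0 < real k * c * p ^ (2 * k - 1)" using k c r' by simp
    then show "a > 0" using 1 by linarith
    show "- Ku mu (- p) \<le> a + L * mu" using Ku_lip[of mu "- p"] r' unfolding a_def by (simp add: abs_le_iff)
  qed
  have b0: "0 < b" "b \<le> 3 * 2 ^ (2 * k - 1) * a"
  proof -
    have "0 < real k * c * A ^ (2 * k - 1)" using k c A by simp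
    then show "0 < b" using G'_bounds(1)[of A] A by (simp add: b_def)
    have "b \<le> 3 * real k * c * A ^ (2 * k - 1)" using G'_bounds(2)[of A] A by (simp add: b_def)
    also have "\<dots> \<le> 3 * real k * c * (2 * p) ^ (2 * k - 1)" using A c by (intro mult_left_mono power_mono) auto
    also have "\<dots> = 3 * 2 ^ (2 * k - 1) * (real k * c * p ^ (2 * k - 1))" by (simp add: power_mult_distrib mult_ac)
    also have "\<dots> \<le> 3 * 2 ^ (2 * k - 1) * a" using a0 by (intro mult_left_mono) auto
    finally show "b \<le> 3 * 2 ^ (2 * k - 1) * a" .
  qed
  \<comment> \<open>The cross-multiplied form of (a + L mu) / (b + mu / (6 p) - L mu) \<le> a / b.
    Since b may exceed a by the factor 3 times 2^(2 k - 1), this factor appears in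
    \<open>eps0\<close>.\<close>
  have key: "L * mu * b + L * mu * a \<le> a * (mu / (6 * p))"
  proof -
    have "L * mu * b + L * mu * a \<le> L * mu * (3 * 2 ^ (2 * k - 1) * a) + L * mu * a"
      using b0 L r' by (intro add_right_mono mult_left_mono) auto
    also have "\<dots> = a * mu * (L * (3 * 2 ^ (2 * k - 1) + 1))" by (simp add: algebra_simps)
    also have "\<dots> \<le> a * mu * (1 / (6 * p))" using eps0(3)[OF p r'(1)] a0 r' by (intro mult_left_mono) auto
    finally show ?thesis by simp
  qed
  have pos: "0 < Ku (- mu) w" by (rule Ku_pos(1)[OF step_outer[OF st r'(5,6)]]) (use r' in auto)
  have "- Ku mu (- p) * b \<le> (a + L * mu) * b" using a0 b0 by (intro mult_right_mono) auto
  also have "\<dots> \<le> a * (b + mu / (6 * p) - L * mu)" using key by (simp add: algebra_simps)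
  also have "\<dots> \<le> a * Ku (- mu) w" using w' a0 by (intro mult_left_mono) auto
  finally have "slope mu p w \<le> a / b" unfolding slope_def using pos b0 by (simp add: divide_le_eq pos_le_divide_eq field_simps)
  moreover have "- deriv Q (- p) = a / b"
    using Q_deriv_eq[of "- p"] r' b0 unfolding A_def[symmetric] a_def b_def by (simp add: field_simps)
  ultimately show ?thesis by simp
qed

text \<open>The mirror image of \<open>slope_upper\<close>, seen from the end w: the entry p falls
  short of B = - Q w, so the numerator is smaller by at least mu / (6 w). It serves the second half
  of a turn, which is inverted.\<close>

lemma slope_lower:
  assumes st: "step mu p w" and g: "good mu p" and w: "w \<le> eps0"
  shows "- deriv Q w \<le> 1 / slope mu p w"
proof -
  have r': "0 < p" "p < r" "0 < w" "w < r / 2" "0 < mu" "mu < r" "\<bar>mu\<bar> < r" "\<bar>- mu\<bar> < r"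
    using st g w eps0(2) r by (auto simp: step_def good_def)
  define B where "B = - Q w"
  have B: "0 < B" "B \<le> 2 * w" "B < r" "K 0 (- B) = K 0 w" using Q_bounds(3,4)[of w] r' Q_K[of w] by (auto simp: B_def)
  have gain: "K 0 (- p) + 3 / 2 * mu \<le> K 0 (- B)" using step_level_gain(1)[OF st r'(5,6)] B by simp
  have pB: "p < B"
  proof (rule ccontr)
    assume "\<not> p < B"
    then have "K 0 (- B) \<le> K 0 (- p)" using G_mono[of "- 1" B p] B r' by simp
    then show False using gain r' by linarith
  qed
  obtain \<xi> where \<xi>: "p < \<xi>" "\<xi> < B" "K 0 (- 1 * B) - K 0 (- 1 * p) = (- 1 * Ku 0 (- 1 * \<xi>)) * (B - p)" "- 1 * Ku 0 (- 1 * \<xi>) \<le> 3 * real k * c * \<xi> ^ (2 * k - 1)"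
    using K0_increment_upper[of "- 1" p B] B pB r' by (metis less_imp_le)
  define a where "a = - Ku 0 (- p)"
  define b where "b = - Ku 0 (- B)"
  define g' where "g' = Ku 0 w"
  have "\<xi> ^ (2 * k - 1) \<le> B ^ (2 * k - 1)" using \<xi> r' by (intro power_mono) auto
  then have "3 * real k * c * \<xi> ^ (2 * k - 1) \<le> 3 * real k * c * B ^ (2 * k - 1)" using c by (intro mult_left_mono) auto
  then have "K 0 (- B) - K 0 (- p) \<le> (3 * real k * c * B ^ (2 * k - 1)) * (B - p)"
    using \<xi>(3,4) pB mult_right_mono[of "- Ku 0 (- \<xi>)" "3 * real k * c * B ^ (2 * k - 1)" "B - p"] by simp
  also have "\<dots> = 3 * (real k * c * (B * (B ^ (2 * k - 2) * (B - p))))"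
    unfolding pow_split2[of B] by (simp add: mult_ac)
  also have "\<dots> \<le> 3 * (real k * c * (B * (B ^ (2 * k - 1) - p ^ (2 * k - 1))))"
    using power_diff_lower[of p B] B pB r' c by (intro mult_left_mono) auto
  also have "\<dots> = 3 * B * (real k * c * ((- p) ^ (2 * k - 1) - (- B) ^ (2 * k - 1)))" unfolding odd_pow by (simp add: algebra_simps)
  also have "\<dots> \<le> 3 * B * (b - a)"
    using G'_convex[of "- B" "- p"] B pB r' unfolding b_def a_def Ku0 by (intro mult_left_mono) auto
  finally have "3 / 2 * mu \<le> 3 * B * (b - a)" using gain by linarith
  then have "mu / (2 * B) \<le> b - a" using B by (simp add: field_simps)
  moreover have "mu / (6 * w) \<le> mu / (2 * B)" using B r' by (intro divide_left_mono) auto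
  ultimately have ba: "a \<le> b - mu / (6 * w)" by linarith
  have g0: "g' > 0" "real k * c * w ^ (2 * k - 1) \<le> g'" "g' - L * mu \<le> Ku (- mu) w" and a1: "- Ku mu (- p) \<le> a + L * mu"
  proof -
    show 1: "real k * c * w ^ (2 * k - 1) \<le> g'" using G'_bounds(1)[of w] r' by (simp add: g'_def)
    have "0 < real k * c * w ^ (2 * k - 1)" using k c r' by simp
    then show "g' > 0" using 1 by linarith
    show "- Ku mu (- p) \<le> a + L * mu" using Ku_lip[of mu "- p"] r' unfolding a_def by (simp add: abs_le_iff)
    show "g' - L * mu \<le> Ku (- mu) w" using Ku_lip[of "- mu" w] r' unfolding g'_def by (simp add: abs_le_iff)
  qed
  have b0: "0 < b" "b \<le> 3 * 2 ^ (2 * k - 1) * g'"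
  proof -
    have "0 < real k * c * B ^ (2 * k - 1)" using k c B by simp
    then show "0 < b" using G'_bounds(3)[of B] B by (simp add: b_def)
    have "b \<le> 3 * real k * c * B ^ (2 * k - 1)" using G'_bounds(4)[of B] B by (simp add: b_def)
    also have "\<dots> \<le> 3 * real k * c * (2 * w) ^ (2 * k - 1)" using B c by (intro mult_left_mono power_mono) auto
    also have "\<dots> = 3 * 2 ^ (2 * k - 1) * (real k * c * w ^ (2 * k - 1))" by (simp add: power_mult_distrib mult_ac)
    also have "\<dots> \<le> 3 * 2 ^ (2 * k - 1) * g'" using g0 by (intro mult_left_mono) auto
    finally show "b \<le> 3 * 2 ^ (2 * k - 1) * g'" .
  qed
  have key: "L * mu * b + L * mu * g' \<le> g' * (mu / (6 * w))"
  proof -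
    have "L * mu * b + L * mu * g' \<le> L * mu * (3 * 2 ^ (2 * k - 1) * g') + L * mu * g'"
      using b0 L r' by (intro add_right_mono mult_left_mono) auto
    also have "\<dots> = g' * mu * (L * (3 * 2 ^ (2 * k - 1) + 1))" by (simp add: algebra_simps)
    also have "\<dots> \<le> g' * mu * (1 / (6 * w))" using eps0(3)[OF w r'(3)] g0 r' by (intro mult_left_mono) auto
    finally show ?thesis by simp
  qed
  have pos: "0 < - Ku mu (- p)" by (rule Ku_pos(2)[OF good_outer[OF g]]) (use r' in auto)
  have "g' * (- Ku mu (- p)) \<le> g' * (b - mu / (6 * w) + L * mu)" using g0 a1 ba by (intro mult_left_mono) auto
  also have "\<dots> \<le> (g' - L * mu) * b" using key by (simp add: algebra_simps)
  also have "\<dots> \<le> Ku (- mu) w * b" using g0 b0 by (intro mult_right_mono) auto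
  finally have "g' / b \<le> Ku (- mu) w / (- Ku mu (- p))" using pos b0 by (simp only: frac_le_eq pos_divide_le_eq pos_le_divide_eq times_divide_eq_left mult.commute)
  moreover have "- deriv Q w = g' / b"
    using Q_deriv_eq[of w] r' b0 unfolding g'_def b_def B_def by (simp add: field_simps)
  ultimately show ?thesis by (simp add: slope_def)
qed

definition fwd :: "real \<Rightarrow> real \<Rightarrow> real" where "fwd mu p = (THE w. step mu p w)"
text \<open>The condition \<open>good\<close> selects the outer preimage, on which
  \<open>K mu (- p)\<close> is strictly increasing; uniqueness is not asserted in the inner
  zone.\<close>

definition bwd :: "real \<Rightarrow> real \<Rightarrow> real" where "bwd mu w = (THE p. step mu p w \<and> good mu p)"

lemma fwd_eq: "step mu p w ==> 0 < mu ==> mu < r ==> fwd mu p = w"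
  unfolding fwd_def using step_unique by blast

lemma bwd_unique:
  assumes "step mu p w" "good mu p" "step mu p' w" "good mu p'" shows "p = p'"
proof (rule ccontr)
  assume "p \<noteq> p'"
  then consider "p < p'" | "p' < p" by linarith
  then show False
    using outer_increasing[OF good_outer[OF assms(2)], of "- 1" p' mu] outer_increasing[OF good_outer[OF assms(4)], of "- 1" p mu] assms
    by cases (auto simp: step_def good_def)
qed

lemma bwd_eq: "step mu p w ==> good mu p ==> bwd mu w = p"
  unfolding bwd_def using bwd_unique by blast

text \<open>The entry without hysteresis, - Q w, has too high a level once both lines are shifted,
  and p = 0 too low a one; the preimage lies between them.\<close>

lemma bwd_exists:
  assumes w: "0 < w" "w < r / 2" and mu: "0 < mu" "mu < r" "10 * mu \<le> c * w ^ (2 * k)"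
  shows "step mu (bwd mu w) w" "good mu (bwd mu w)"
proof -
  define B where "B = - Q w"
  have B: "0 < B" "B < r" "K 0 (- B) = K 0 w" using Q_bounds(3,4)[of w] w Q_K[of w] by (auto simp: B_def)
  have wr: "\<bar>w\<bar> < r" using w by auto
  have lo: "K mu (- 0) \<le> K (- mu) w" using K00[of mu] K_bounds(3)[of mu w] G_bounds(1)[of w] mu wr by auto
  have hi: "K (- mu) w \<le> K mu (- B)" using K_bounds(1)[of mu "- B"] K_bounds(4)[of mu w] B mu wr by auto
  have "continuous_on {0..B} (%p. K mu (- p))"
  proof (rule DERIV_continuous_on[OF has_field_derivative_at_within])
    fix x assume "x \<in> {0..B}"
    then show "((%p. K mu (- p)) has_real_derivative Ku mu (- x) * - 1) (at x)"
      by (intro DERIV_chain2[OF K_deriv_u DERIV_minus[OF DERIV_ident]]) (use B mu in auto)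
  qed
  then obtain p where p: "0 \<le> p" "p \<le> B" "K mu (- p) = K (- mu) w"
    using IVT'[of "%p. K mu (- p)" 0 "K (- mu) w" B] lo hi B by auto
  have st: "step mu p w" using p B w by (simp add: step_def)
  have "good mu p" by (rule good_of_end[OF st mu])
  then show "step mu (bwd mu w) w" "good mu (bwd mu w)" using bwd_eq[OF st] st by auto
qed

lemma fwd_deriv:
  assumes st: "step mu p w" and g: "good mu p"
  shows "(fwd mu has_real_derivative slope mu p w) (at p)"
    and "\<forall>\<^sub>F p' in nhds p. step mu p' (fwd mu p')"
proof -
  have r': "0 < p" "p < r" "0 < w" "w < r" "0 < mu" "mu < r" using st g by (auto simp: step_def good_def)
  have ow: "outer mu w" by (rule step_outer[OF st r'(5,6)])
  define S where "S = {w'. 0 < w' \<and> w' < r \<and> L * mu < c / 2 * w' ^ (2 * k - 1)}"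
  have S: "open S" unfolding S_def by (intro open_Collect_conj open_Collect_less continuous_intros)
  have oS: "w' \<in> S \<longleftrightarrow> outer mu w'" for w' by (simp add: S_def outer_def)
  have inj: "inj_on (K (- mu)) S"
  proof (rule inj_onI, rule ccontr)
    fix x y assume xy: "x \<in> S" "y \<in> S" "K (- mu) x = K (- mu) y" "x \<noteq> y"
    then consider "x < y" | "y < x" by linarith
    then show False
      using outer_increasing[of mu y 1 x "- mu"] outer_increasing[of mu x 1 y "- mu"] xy r' oS
      by cases (auto simp: outer_def)
  qed
  have da: "((%p. K mu (- p)) has_real_derivative - Ku mu (- p)) (at p)"
    using DERIV_chain2[OF K_deriv_u[of mu "- p"] DERIV_minus[OF DERIV_ident]] r' by simp
  obtain h where h: "(h has_real_derivative - Ku mu (- p) / Ku (- mu) w) (at p)" "\<forall>\<^sub>F p' in nhds p. h p' \<in> S \<and> K (- mu) (h p') = K mu (- p')"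
  proof (rule implicit_function_1d[OF S _ inj _ _ da])
    show "w \<in> S" using ow oS by simp
    show "!!w. w \<in> S ==> (K (- mu) has_real_derivative Ku (- mu) w) (at w)" using K_deriv_u r' by (auto simp: S_def)
    show "Ku (- mu) w \<noteq> 0" using Ku_pos(1)[OF ow, of "- mu"] r' by auto
    show "K mu (- p) = K (- mu) w" using st by (simp add: step_def)
  qed
  have "\<forall>\<^sub>F p' in nhds p. p' \<in> {0<..<r}" by (rule eventually_nhds_in_open) (use r' in auto)
  then have ev: "\<forall>\<^sub>F p' in nhds p. step mu p' (h p') \<and> fwd mu p' = h p'"
    using h(2)
  proof eventually_elim
    case (elim p')
    then have "step mu p' (h p')" by (auto simp: step_def S_def)
    then show ?case using fwd_eq r' by blast
  qed
  then show "\<forall>\<^sub>F p' in nhds p. step mu p' (fwd mu p')" by eventually_elim auto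
  have ev': "\<forall>\<^sub>F p' in nhds p. h p' = fwd mu p'" using ev by eventually_elim auto
  show "(fwd mu has_real_derivative slope mu p w) (at p)"
    using DERIV_cong_ev[OF refl ev' refl] h(1) by (simp add: slope_def)
qed

lemma bwd_deriv:
  assumes w: "0 < w" "w < r / 2" and mu: "0 < mu" "mu < r" "10 * mu < c * w ^ (2 * k)"
  shows "(bwd mu has_real_derivative 1 / slope mu (bwd mu w) w) (at w)"
proof -
  define p where "p = bwd mu w"
  have st: "step mu p w" and g: "good mu p" using bwd_exists[of w mu] assms by (auto simp: p_def)
  have r': "0 < p" "p < r" using g by (auto simp: good_def)
  have op: "outer mu p" by (rule good_outer[OF g])
  define S where "S = {w'. 0 < w' \<and> w' < r \<and> L * mu < c / 2 * w' ^ (2 * k - 1)}"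
  have S: "open S" unfolding S_def by (intro open_Collect_conj open_Collect_less continuous_intros)
  have oS: "w' \<in> S \<longleftrightarrow> outer mu w'" for w' by (simp add: S_def outer_def)
  have inj: "inj_on (%p. K mu (- p)) S"
  proof (rule inj_onI, rule ccontr)
    fix x y assume xy: "x \<in> S" "y \<in> S" "K mu (- x) = K mu (- y)" "x \<noteq> y"
    then consider "x < y" | "y < x" by linarith
    then show False
      using outer_increasing[of mu y "- 1" x mu] outer_increasing[of mu x "- 1" y mu] xy mu oS
      by cases (auto simp: outer_def)
  qed
  have da: "(K (- mu) has_real_derivative Ku (- mu) w) (at w)" using K_deriv_u[of "- mu" w] w mu by simp
  obtain h where h: "(h has_real_derivative Ku (- mu) w / (- Ku mu (- p))) (at w)" "\<forall>\<^sub>F w' in nhds w. h w' \<in> S \<and> K mu (- h w') = K (- mu) w'"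
  proof (rule implicit_function_1d[OF S _ inj _ _ da])
    show "p \<in> S" using op oS by simp
    show "!!x. x \<in> S ==> ((%p. K mu (- p)) has_real_derivative - Ku mu (- x)) (at x)"
      using DERIV_chain2[OF K_deriv_u[of mu] DERIV_minus[OF DERIV_ident]] mu by (auto simp: S_def)
    show "- Ku mu (- p) \<noteq> 0" using Ku_pos(2)[OF op, of mu] mu by auto
    show "K (- mu) w = K mu (- p)" using st by (simp add: step_def)
  qed
  have "open {w'. 0 < w' \<and> w' < r / 2 \<and> 10 * mu < c * w' ^ (2 * k)}"
    by (intro open_Collect_conj open_Collect_less continuous_intros)
  then have "\<forall>\<^sub>F w' in nhds w. w' \<in> {w'. 0 < w' \<and> w' < r / 2 \<and> 10 * mu < c * w' ^ (2 * k)}"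
    by (rule eventually_nhds_in_open) (use assms in auto)
  then have ev: "\<forall>\<^sub>F w' in nhds w. h w' = bwd mu w'"
    using h(2)
  proof eventually_elim
    case (elim w')
    then have "step mu (h w') w'" by (auto simp: step_def S_def)
    moreover from this have "good mu (h w')" using good_of_end mu elim by auto
    ultimately show ?case using bwd_eq by simp
  qed
  then show "(bwd mu has_real_derivative 1 / slope mu (bwd mu w) w) (at w)"
    using DERIV_cong_ev[OF refl ev refl] h(1) by (simp add: slope_def p_def)
qed

end

section \<open>Leading-order expansion of a passage and of its duration\<close>

lemma power_diff_bound:
  fixes a b B :: real
  assumes "0 \<le> a" "a \<le> B" "0 \<le> b" "b \<le> B"
  shows "\<bar>a ^ m - b ^ m\<bar> \<le> real m * B ^ (m - 1) * \<bar>a - b\<bar>"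
proof -
  have "norm (a ^ m - b ^ m) \<le> real m * B ^ (m - 1) * norm (a - b)"
  proof (rule field_differentiable_bound[where S="{0..B}" and f'="%x. real m * x ^ (m - Suc 0)"])
    show "((%x. x ^ m) has_real_derivative real m * z ^ (m - Suc 0)) (at z within {0..B})" for z
      using DERIV_pow[of m z] by simp
    show "norm (real m * z ^ (m - Suc 0)) \<le> real m * B ^ (m - 1)" if "z \<in> {0..B}" for z
      using that by (auto simp: abs_mult power_abs intro!: mult_left_mono power_mono)
  qed (use assms in auto)
  then show ?thesis by simp
qed

context half_flow begin

text \<open>The level on x = 0 grows by 2 mu, with error O(mu x), between v and z, where its
  derivative is 2 k c x^(2 k - 1) to leading order; division gives mu / (k c x^(2 k - 1)). The bound
  mu \<le> M x^(2 k + 1) makes z - v = O(x^2), so the intermediate point may be replaced by x. The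
  two signs serve the forward and the backward passage.\<close>

lemma increment_expansion:
  assumes M: "M \<ge> 0"
  obtains C where "C \<ge> 0" "!!sig mu x v z. [|sig = 1 \<or> sig = - 1; 0 < x; x \<le> eps0; 0 < mu; mu \<le> M * x ^ (2 * k + 1); x / 3 \<le> v; v < z; z \<le> 3 * x;
     \<bar>v - x\<bar> \<le> L * x\<^sup>2 \<or> \<bar>z - x\<bar> \<le> L * x\<^sup>2; \<bar>K 0 (sig * z) - K 0 (sig * v) - 2 * mu\<bar> \<le> 6 * L * mu * x|] ==>
     \<bar>z - v - mu / (real k * c * x ^ (2 * k - 1))\<bar> \<le> C * (mu * x / x ^ (2 * k - 1))"
proof -
  define \<kappa> where "\<kappa> = real k * c"
  have \<kappa>: "\<kappa> > 0" using k c by (simp add: \<kappa>_def)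
  \<comment> \<open>\<open>c1\<close> bounds z - v crudely, \<open>c2\<close> the distance of the
    intermediate point from x, \<open>c3\<close> the resulting change of its power,
    \<open>c4\<close> the error of the derivative of the level.\<close>
  define c1 where "c1 = 3 * 3 ^ (2 * k - 1) / \<kappa>"
  define c2 where "c2 = L + c1 * M"
  define c3 where "c3 = real (2 * k - 1) * 3 ^ (2 * k - 2) * c2"
  define c4 where "c4 = L * 3 ^ (2 * k) + 2 * \<kappa> * c3"
  define C where "C = (6 * L + c4 * c1) / (2 * \<kappa>)"
  have nn: "c1 \<ge> 0" "c2 \<ge> 0" "c3 \<ge> 0" "c4 \<ge> 0" "C \<ge> 0"
    using \<kappa> M L by (auto simp: c1_def c2_def c3_def c4_def C_def)
  show thesis
  proof (rule that[OF nn(5)])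
    fix sig mu x v z
    assume sig: "sig = 1 \<or> sig = - 1" and x: "0 < x" "x \<le> eps0" and mu: "0 < mu" "mu \<le> M * x ^ (2 * k + 1)"
      and vz: "x / 3 \<le> v" "v < z" "z \<le> 3 * x" and near: "\<bar>v - x\<bar> \<le> L * x\<^sup>2 \<or> \<bar>z - x\<bar> \<le> L * x\<^sup>2"
      and I: "\<bar>K 0 (sig * z) - K 0 (sig * v) - 2 * mu\<bar> \<le> 6 * L * mu * x"
    define P where "P = x ^ (2 * k - 1)"
    have P: "P > 0" using x by (simp add: P_def)
    have Px: "x ^ (2 * k) = P * x" "x ^ (2 * k + 1) = P * x\<^sup>2" "x ^ (2 * k - 2) * x\<^sup>2 = P * x"
      unfolding P_def using pow_split[of x] pow_split2[of x] by (simp_all add: power2_eq_square mult_ac)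
    have zr: "z < r" using vz x eps0(2) r by linarith
    define D where "D = z - v"
    have D: "D > 0" using vz by (simp add: D_def)
    obtain \<xi> where \<xi>: "v < \<xi>" "\<xi> < z" "K 0 (sig * z) - K 0 (sig * v) = (sig * Ku 0 (sig * \<xi>)) * (z - v)"
      "real k * c * \<xi> ^ (2 * k - 1) \<le> sig * Ku 0 (sig * \<xi>)"
    proof (rule K0_increment_upper[OF sig _ vz(2) zr])
      show "0 \<le> v" using vz x by simp
    qed (rule that; assumption)
    define E where "E = sig * Ku 0 (sig * \<xi>)"
    have \<xi>x: "x / 3 \<le> \<xi>" "\<xi> \<le> 3 * x" "0 < \<xi>" "\<xi> < r" using \<xi>(1,2) vz x zr by auto
    have ED: "\<bar>E * D - 2 * mu\<bar> \<le> 6 * L * mu * x" using I \<xi>(3) by (simp add: E_def D_def)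
    have "L * x \<le> L * r" using x eps0(2) r L by (intro mult_left_mono) auto
    then have Lx: "L * x \<le> 1 / 8" using small(2) by linarith
    then have "mu * (L * x) \<le> mu * (1 / 8)" using mu(1) by (intro mult_left_mono) auto
    moreover have "6 * L * mu * x = 6 * (mu * (L * x))" by simp
    ultimately have ED2: "E * D \<le> 3 * mu" using ED mu(1) unfolding abs_le_iff by linarith
    have "\<kappa> * (P / 3 ^ (2 * k - 1)) \<le> \<kappa> * \<xi> ^ (2 * k - 1)"
      using \<xi>x x \<kappa> unfolding P_def power_divide[symmetric] by (intro mult_left_mono power_mono) auto
    then have El: "\<kappa> * (P / 3 ^ (2 * k - 1)) \<le> E" using \<xi>(4) by (simp add: E_def \<kappa>_def)
    have "\<kappa> * (P / 3 ^ (2 * k - 1)) * D \<le> 3 * mu"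
      using mult_right_mono[OF El, of D] D ED2 by linarith
    then have D1: "D \<le> c1 * (mu / P)" using P \<kappa> by (simp add: c1_def field_simps)
    have "mu / P \<le> M * x\<^sup>2" using mu(2) P unfolding Px by (simp add: pos_divide_le_eq mult_ac)
    then have "c1 * (mu / P) \<le> c1 * (M * x\<^sup>2)" using nn by (intro mult_left_mono) auto
    then have D2: "D \<le> c1 * M * x\<^sup>2" using D1 by simp
    have "\<bar>\<xi> - x\<bar> \<le> L * x\<^sup>2 + D" using near \<xi>(1,2) by (auto simp: D_def)
    then have \<xi>n: "\<bar>\<xi> - x\<bar> \<le> c2 * x\<^sup>2" using D2 by (simp add: c2_def algebra_simps)
    have "\<bar>\<xi> ^ (2 * k - 1) - x ^ (2 * k - 1)\<bar> \<le> real (2 * k - 1) * (3 * x) ^ (2 * k - 1 - 1) * \<bar>\<xi> - x\<bar>"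
      by (rule power_diff_bound) (use \<xi>x x in auto)
    also have "\<dots> \<le> real (2 * k - 1) * (3 * x) ^ (2 * k - 1 - 1) * (c2 * x\<^sup>2)"
      using \<xi>n x by (intro mult_left_mono) auto
    also have "\<dots> = real (2 * k - 1) * 3 ^ (2 * k - 2) * c2 * (x ^ (2 * k - 2) * x\<^sup>2)"
      by (simp add: power_mult_distrib mult_ac numeral_2_eq_2)
    also have "\<dots> = c3 * (P * x)" unfolding Px(3) c3_def ..
    finally have pw: "\<bar>\<xi> ^ (2 * k - 1) - P\<bar> \<le> c3 * (P * x)" by (simp add: P_def)
    have E1: "\<bar>E - 2 * \<kappa> * \<xi> ^ (2 * k - 1)\<bar> \<le> L * 3 ^ (2 * k) * (P * x)"
    proof -
      have "\<bar>Ku 0 (sig * \<xi>) - 2 * real k * c * (sig * \<xi>) ^ (2 * k - 1)\<bar> \<le> L * \<bar>sig * \<xi>\<bar> ^ (2 * k)"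
        unfolding Ku0 by (rule G'_est) (use sig \<xi>x in auto)
      moreover have "E - 2 * \<kappa> * \<xi> ^ (2 * k - 1) = sig * (Ku 0 (sig * \<xi>) - 2 * real k * c * (sig * \<xi>) ^ (2 * k - 1))"
        using sig odd_pow[of \<xi>] by (auto simp: E_def \<kappa>_def)
      moreover have "\<bar>sig * \<xi>\<bar> = \<xi>" using sig \<xi>x by auto
      ultimately have "\<bar>E - 2 * \<kappa> * \<xi> ^ (2 * k - 1)\<bar> \<le> L * \<xi> ^ (2 * k)" using sig by (auto simp: abs_mult)
      also have "\<dots> \<le> L * (3 * x) ^ (2 * k)" using \<xi>x L by (intro mult_left_mono power_mono) auto
      finally show ?thesis unfolding power_mult_distrib Px by (simp only: mult.assoc)
    qed
    have "\<bar>E - 2 * \<kappa> * P\<bar> \<le> \<bar>E - 2 * \<kappa> * \<xi> ^ (2 * k - 1)\<bar> + 2 * \<kappa> * \<bar>\<xi> ^ (2 * k - 1) - P\<bar>"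
    proof -
      have eq: "(E - 2 * \<kappa> * \<xi> ^ (2 * k - 1)) + 2 * \<kappa> * (\<xi> ^ (2 * k - 1) - P) = E - 2 * \<kappa> * P" by (simp add: algebra_simps)
      have "\<bar>2 * \<kappa> * (\<xi> ^ (2 * k - 1) - P)\<bar> = 2 * \<kappa> * \<bar>\<xi> ^ (2 * k - 1) - P\<bar>" using \<kappa> by (simp add: abs_mult)
      then show ?thesis using abs_triangle_ineq[of "E - 2 * \<kappa> * \<xi> ^ (2 * k - 1)" "2 * \<kappa> * (\<xi> ^ (2 * k - 1) - P)"] unfolding eq by linarith
    qed
    also have "\<dots> \<le> L * 3 ^ (2 * k) * (P * x) + 2 * \<kappa> * (c3 * (P * x))"
      using E1 pw \<kappa> by (intro add_mono mult_left_mono) auto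
    finally have E2: "\<bar>E - 2 * \<kappa> * P\<bar> \<le> c4 * (P * x)" by (simp add: c4_def algebra_simps)
    have "\<bar>E - 2 * \<kappa> * P\<bar> * D \<le> c4 * (P * x) * (c1 * (mu / P))"
      using E2 D1 D nn P x by (intro mult_mono) auto
    also have "\<dots> = c4 * c1 * (mu * x)" using P by simp
    finally have F: "\<bar>(E - 2 * \<kappa> * P) * D\<bar> \<le> c4 * c1 * (mu * x)" using D by (simp add: abs_mult)
    have "2 * \<kappa> * P * D - 2 * mu = (E * D - 2 * mu) - (E - 2 * \<kappa> * P) * D" by (simp add: algebra_simps)
    then have "\<bar>2 * \<kappa> * P * D - 2 * mu\<bar> \<le> 6 * L * mu * x + c4 * c1 * (mu * x)"
      using ED F abs_triangle_ineq4[of "E * D - 2 * mu" "(E - 2 * \<kappa> * P) * D"] by linarith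
    also have "\<dots> = 2 * \<kappa> * C * (mu * x)" using \<kappa> by (simp add: C_def field_simps)
    finally have fin: "\<bar>2 * \<kappa> * P * D - 2 * mu\<bar> \<le> 2 * \<kappa> * C * (mu * x)" .
    have eq: "2 * \<kappa> * P * D - 2 * mu = (2 * \<kappa> * P) * (D - mu / (\<kappa> * P))" using \<kappa> P by (simp add: field_simps)
    have "(2 * \<kappa> * P) * \<bar>D - mu / (\<kappa> * P)\<bar> \<le> (2 * \<kappa> * P) * (C * (mu * x / P))"
      using fin \<kappa> P unfolding eq by (simp add: abs_mult)
    then have "\<bar>D - mu / (\<kappa> * P)\<bar> \<le> C * (mu * x / P)"
      by (rule mult_left_le_imp_le) (use \<kappa> P in simp)
    then show "\<bar>z - v - mu / (real k * c * x ^ (2 * k - 1))\<bar> \<le> C * (mu * x / x ^ (2 * k - 1))"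
      by (simp add: D_def \<kappa>_def P_def)
  qed
qed

lemma step_increment_error:
  assumes st: "step mu p w" and g: "good mu p" and x: "p \<le> 2 * x" "mu \<le> x" "w \<le> 3 * x" "p + w \<le> 4 * x"
  shows "\<bar>K 0 w - K 0 (- p) - 2 * mu\<bar> \<le> 6 * L * mu * x"
proof -
  have r': "0 < p" "p < r" "0 < w" "w < r" "0 < mu" "mu < r" using st g by (auto simp: step_def good_def)
  have 1: "\<bar>K (- mu) w - K 0 w - - mu\<bar> \<le> L * (mu + w) * mu" using K_shift(1)[of "- mu" w] r' by simp
  have 2: "\<bar>K mu (- p) - K 0 (- p) - mu\<bar> \<le> L * (mu + p) * mu" using K_shift(1)[of mu "- p"] r' by simp
  have "K 0 w - K 0 (- p) - 2 * mu = (K mu (- p) - K 0 (- p) - mu) - (K (- mu) w - K 0 w - - mu)"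
    using st by (simp add: step_def)
  then have "\<bar>K 0 w - K 0 (- p) - 2 * mu\<bar> \<le> L * (mu + p) * mu + L * (mu + w) * mu"
    using 1 2 abs_triangle_ineq4 by (smt (verit))
  also have "\<dots> = L * mu * (2 * mu + (p + w))" by (simp add: algebra_simps)
  also have "\<dots> \<le> L * mu * (6 * x)" using x L r' by (intro mult_left_mono) auto
  finally show ?thesis by (simp add: mult_ac)
qed

lemma fwd_expansion:
  assumes M: "M \<ge> 0"
  obtains C where "C \<ge> 0" "!!mu p w. [|step mu p w; good mu p; p \<le> eps0; mu \<le> p; mu \<le> M * p ^ (2 * k + 1)|] ==>
     \<bar>w - Q (- p) - mu / (real k * c * p ^ (2 * k - 1))\<bar> \<le> C * (mu * p / p ^ (2 * k - 1))"
proof -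
  obtain C where C: "C \<ge> 0" "!!sig mu x v z. [|sig = 1 \<or> sig = - 1; 0 < x; x \<le> eps0; 0 < mu; mu \<le> M * x ^ (2 * k + 1); x / 3 \<le> v; v < z; z \<le> 3 * x;
     \<bar>v - x\<bar> \<le> L * x\<^sup>2 \<or> \<bar>z - x\<bar> \<le> L * x\<^sup>2; \<bar>K 0 (sig * z) - K 0 (sig * v) - 2 * mu\<bar> \<le> 6 * L * mu * x|] ==>
     \<bar>z - v - mu / (real k * c * x ^ (2 * k - 1))\<bar> \<le> C * (mu * x / x ^ (2 * k - 1))"
    by (rule increment_expansion[OF M]) (rule that; assumption)
  show thesis
  proof (rule that[OF C(1)])
    fix mu p w assume st: "step mu p w" and g: "good mu p" and p: "p \<le> eps0" "mu \<le> p" "mu \<le> M * p ^ (2 * k + 1)"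
    have r': "0 < p" "p < r" "0 < w" "w < r" "0 < mu" "mu < r" using st g by (auto simp: step_def good_def)
    note A = Q_bounds[OF r'(1,2)]
    have KA: "K 0 (Q (- p)) = K 0 (- p)" using Q_K[of "- p"] r' by simp
    have Aw: "Q (- p) < w"
    proof (rule ccontr)
      assume "\<not> Q (- p) < w"
      then have "K 0 w \<le> K 0 (Q (- p))" using G_mono[of 1 w "Q (- p)"] A r' p(1) eps0(2) by simp
      then show False using step_level_gain(1)[OF st r'(5,6)] KA r' by linarith
    qed
    show "\<bar>w - Q (- p) - mu / (real k * c * p ^ (2 * k - 1))\<bar> \<le> C * (mu * p / p ^ (2 * k - 1))"
    proof (rule C(2)[of 1])
      show "\<bar>K 0 (1 * w) - K 0 (1 * Q (- p)) - 2 * mu\<bar> \<le> 6 * L * mu * p"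
        using step_increment_error[OF st g, of p] step_compare(1)[OF st g] p r' KA by simp
    qed (use A Aw r' p step_compare(1)[OF st g] in auto)
  qed
qed

text \<open>Expanded at the end \<open>w\<close>, with the unperturbed entry - Q w as reference, so
  that both halves of a turn can be compared at the same point of the section.\<close>

lemma bwd_expansion:
  assumes M: "M \<ge> 0"
  obtains C where "C \<ge> 0" "!!mu p w. [|step mu p w; good mu p; w \<le> eps0; mu \<le> w; mu \<le> M * w ^ (2 * k + 1)|] ==>
     \<bar>- Q w - p - mu / (real k * c * w ^ (2 * k - 1))\<bar> \<le> C * (mu * w / w ^ (2 * k - 1))"
proof -
  obtain C where C: "C \<ge> 0" "!!sig mu x v z. [|sig = 1 \<or> sig = - 1; 0 < x; x \<le> eps0; 0 < mu; mu \<le> M * x ^ (2 * k + 1); x / 3 \<le> v; v < z; z \<le> 3 * x;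
     \<bar>v - x\<bar> \<le> L * x\<^sup>2 \<or> \<bar>z - x\<bar> \<le> L * x\<^sup>2; \<bar>K 0 (sig * z) - K 0 (sig * v) - 2 * mu\<bar> \<le> 6 * L * mu * x|] ==>
     \<bar>z - v - mu / (real k * c * x ^ (2 * k - 1))\<bar> \<le> C * (mu * x / x ^ (2 * k - 1))"
    by (rule increment_expansion[OF M]) (rule that; assumption)
  show thesis
  proof (rule that[OF C(1)])
    fix mu p w assume st: "step mu p w" and g: "good mu p" and w: "w \<le> eps0" "mu \<le> w" "mu \<le> M * w ^ (2 * k + 1)"
    have r': "0 < p" "p < r" "0 < w" "w < r" "0 < mu" "mu < r" using st g by (auto simp: step_def good_def)
    note B = Q_bounds[OF r'(3,4)]
    have KB: "K 0 (- (- Q w)) = K 0 w" using Q_K[of w] r' by simp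
    have pB: "p < - Q w"
    proof (rule ccontr)
      assume "\<not> p < - Q w"
      then have "K 0 (- (- Q w)) \<le> K 0 (- p)" using G_mono[of "- 1" "- Q w" p] B r' by simp
      then show False using step_level_gain(1)[OF st r'(5,6)] KB r' by linarith
    qed
    show "\<bar>- Q w - p - mu / (real k * c * w ^ (2 * k - 1))\<bar> \<le> C * (mu * w / w ^ (2 * k - 1))"
    proof (rule C(2)[of "- 1"])
      show "\<bar>K 0 (- 1 * (- Q w)) - K 0 (- 1 * p) - 2 * mu\<bar> \<le> 6 * L * mu * w"
        using step_increment_error[OF st g, of w] step_compare(2)[OF st g] w r' KB by simp
    qed (use B pB r' w step_compare(1)[OF st g] in auto)
  qed
qed

text \<open>At the origin the time function has gradient (0, 1 / b). The first-order error in x is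
  harmless, since x will be mu, which is O(p^2) at the periodic orbit.\<close>

lemma tm_bound:
  assumes "\<bar>x\<bar> < r" "\<bar>u\<bar> < r" shows "\<bar>tm x u - u / \<beta>\<bar> \<le> \<bar>x\<bar> + L * u\<^sup>2"
proof -
  have p: "(s * x, e * u) \<in> sqr r" "(0, e * u) \<in> sqr r" using assms r by (auto simp: sqr_iff abs_mult ss ee)
  have "\<bar>W (s * x, e * u) - W (0, e * u) - 0 * (s * x - 0)\<bar> \<le> 1 * \<bar>s * x - 0\<bar>"
  proof (rule real_deriv_bound_closed[where rho="\<bar>s * x\<bar>" and f'="%t. Wx (t, e * u)"])
    fix t assume t: "\<bar>t\<bar> \<le> \<bar>s * x\<bar>"
    have tp: "(t, e * u) \<in> sqr r" using sqr_closed_sub[OF p(1) t, of "e * u"] by simp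
    show "((%t. W (t, e * u)) has_real_derivative Wx (t, e * u)) (at t)" by (rule partial_derivs(1)[OF dW[OF tp]])
    have "\<bar>Wx (t, e * u) - Wx (0, 0)\<bar> \<le> L * (\<bar>t - 0\<bar> + \<bar>e * u - 0\<bar>)" by (rule lip) (use tp zero_in in auto)
    also have "\<dots> \<le> L * (2 * r)" using tp L by (intro mult_left_mono) (auto simp: sqr_iff)
    also have "\<dots> \<le> 1" using small(2) by simp
    finally show "\<bar>Wx (t, e * u) - 0\<bar> \<le> 1" using at0 by simp
  qed auto
  then have 1: "\<bar>tm x u - W (0, e * u)\<bar> \<le> \<bar>x\<bar>" by (simp add: tm_def abs_mult ss)
  have "\<bar>W (0, e * u) - W (0, 0) - 1 / snd (X (0, 0)) * (e * u - 0)\<bar> \<le> (L * \<bar>u\<bar>) * \<bar>e * u - 0\<bar>"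
  proof (rule real_deriv_bound_closed[where rho="\<bar>e * u\<bar>" and f'="%t. Wy (0, t)"])
    fix t assume t: "\<bar>t\<bar> \<le> \<bar>e * u\<bar>"
    have tp: "(0, t) \<in> sqr r" using sqr_closed_sub[OF p(2), of 0 t] t by simp
    show "((%t. W (0, t)) has_real_derivative Wy (0, t)) (at t)" by (rule partial_derivs(2)[OF dW[OF tp]])
    have "\<bar>Wy (0, t) - Wy (0, 0)\<bar> \<le> L * (\<bar>0 - 0\<bar> + \<bar>t - 0\<bar>)" by (rule lip) (use tp zero_in in auto)
    also have "\<dots> \<le> L * \<bar>u\<bar>" using t L by (intro mult_left_mono) (auto simp: abs_mult ee)
    finally show "\<bar>Wy (0, t) - 1 / snd (X (0, 0))\<bar> \<le> L * \<bar>u\<bar>" using at0 by simp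
  qed auto
  moreover have "1 / snd (X (0, 0)) * (e * u - 0) = u / \<beta>" unfolding b_eq using \<beta> ee by (auto simp: field_simps)
  ultimately have 2: "\<bar>W (0, e * u) - u / \<beta>\<bar> \<le> L * u\<^sup>2" using W0[of 0] by (simp add: abs_mult ee power2_eq_square)
  show ?thesis using 1 2 by linarith
qed

end

section \<open>The displacement map of the hysteretic system\<close>

text \<open>The condition \<open>|y| > mu powr (2 / (4 k\<^sub>M + 1))\<close> defining the section.\<close>

definition rng :: "nat \<Rightarrow> real \<Rightarrow> real \<Rightarrow> real \<Rightarrow> bool" where
  "rng kM eps mu p \<longleftrightarrow> 0 < p \<and> p < eps \<and> 0 < mu \<and> mu < p ^ (2 * kM) * sqrt p"

lemma rng_upward:
  assumes "rng kM eps mu p" "p \<le> p'" "p' < eps" shows "rng kM eps mu p'"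
proof -
  have "p ^ (2 * kM) * sqrt p \<le> p' ^ (2 * kM) * sqrt p'"
    using assms by (intro mult_mono power_mono) (auto simp: rng_def)
  then show ?thesis using assms by (auto simp: rng_def)
qed

lemma rng_less: "rng kM eps mu p ==> eps \<le> eps' ==> rng kM eps' mu p"
  by (auto simp: rng_def)

context half_flow begin

text \<open>The constants are such that every point of [p / 2, 3 p], where the forward image of p
  lies, satisfies the hypotheses of the passage lemmas; the factor 2^(2 k) pays for going down to p
  / 2.\<close>

definition nice :: "real \<Rightarrow> real \<Rightarrow> bool" where
  "nice mu p \<longleftrightarrow> 0 < mu \<and> 0 < p \<and> 2 * mu \<le> p \<and> 3 * p \<le> eps0 \<and> 10 * 2 ^ (2 * k) * mu < c * p ^ (2 * k)"

text \<open>The factor sqrt p in the section condition becomes smaller than any prescribed constant,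
  here B, once p is small.\<close>

lemma nice_of_rng:
  assumes "k \<le> kM"
  obtains eps where "eps > 0" "!!mu p. rng kM eps mu p ==> nice mu p"
proof -
  define B where "B = c / (10 * 2 ^ (2 * k))"
  define eps where "eps = min (eps0 / 3) (B\<^sup>2)"
  have B: "B > 0" using c by (simp add: B_def)
  show thesis
  proof (rule that)
    show "eps > 0" using eps0(1) B by (simp add: eps_def)
    fix mu p assume "rng kM eps mu p"
    then have h: "0 < p" "p < eps" "0 < mu" "mu < p ^ (2 * kM) * sqrt p" by (auto simp: rng_def)
    have p: "p < eps0 / 3" "p < B\<^sup>2" using h by (auto simp: eps_def)
    have p1: "p \<le> 1 / 4" using p(1) eps0(2) small(3) by linarith
    have sB: "sqrt p < B" using p(2) B real_sqrt_less_mono[OF p(2)] by simp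
    have s1: "sqrt p \<le> 1" using p1 by simp
    have pk: "p ^ (2 * kM) \<le> p ^ (2 * k)" "p ^ (2 * kM) \<le> p\<^sup>2"
      using h p1 assms k by (auto intro!: power_decreasing)
    have "p ^ (2 * kM) * sqrt p \<le> p\<^sup>2 * 1" using pk s1 h by (intro mult_mono) auto
    moreover have "p\<^sup>2 \<le> p * (1 / 4)" unfolding power2_eq_square using p1 h by (intro mult_left_mono) auto
    ultimately have m1: "2 * mu \<le> p" using h by linarith
    have "mu < p ^ (2 * k) * B"
    proof -
      have "p ^ (2 * kM) * sqrt p \<le> p ^ (2 * k) * B" using pk sB h by (intro mult_mono) auto
      then show ?thesis using h by linarith
    qed
    then have "10 * 2 ^ (2 * k) * mu < c * p ^ (2 * k)" by (simp add: B_def field_simps)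
    then show "nice mu p" using h m1 p by (simp add: nice_def)
  qed
qed

lemma nice_at:
  assumes "nice mu p" "p / 2 \<le> x" "x \<le> 3 * p"
  shows "0 < x" "x \<le> eps0" "x \<le> r / 8" "0 < mu" "mu < r" "mu \<le> x" "10 * mu < c * x ^ (2 * k)" "good mu x"
    "step mu x (fwd mu x)" "step mu (bwd mu x) x" "good mu (bwd mu x)"
    "fwd mu x \<le> 3 * x" "x \<le> 2 * fwd mu x" "x \<le> 3 * bwd mu x" "bwd mu x \<le> 2 * x"
proof -
  have h: "0 < mu" "0 < p" "2 * mu \<le> p" "3 * p \<le> eps0" "10 * 2 ^ (2 * k) * mu < c * p ^ (2 * k)"
    using assms(1) by (auto simp: nice_def)
  show x: "0 < x" "x \<le> eps0" "x \<le> r / 8" "0 < mu" "mu < r" "mu \<le> x" using h assms(2,3) eps0 r by linarith+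
  have "c * p ^ (2 * k) \<le> c * (2 * x) ^ (2 * k)" using assms h c by (intro mult_left_mono power_mono) auto
  then have "2 ^ (2 * k) * (10 * mu) < 2 ^ (2 * k) * (c * x ^ (2 * k))"
    using h(5) unfolding power_mult_distrib mult.left_commute[of c] by (simp only: mult.commute mult.left_commute)
  then show m: "10 * mu < c * x ^ (2 * k)" by (simp only: mult_less_cancel_left_pos zero_less_power zero_less_numeral)
  show g: "good mu x" using x m r by (simp add: good_def)
  have "c * (4 * x) ^ (2 * k) / 16 \<ge> c * x ^ (2 * k)"
  proof -
    have "(16::real) \<le> 4 ^ (2 * k)" using power_increasing[of 2 "2 * k" "4::real"] k by simp
    then have "16 * (c * x ^ (2 * k)) \<le> 4 ^ (2 * k) * (c * x ^ (2 * k))" using c x by (intro mult_right_mono) auto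
    then show ?thesis by (simp add: power_mult_distrib mult_ac)
  qed
  then obtain w where "step mu x w" using step_exists[of "4 * x" x mu] x m r by auto
  then show st: "step mu x (fwd mu x)" using fwd_eq x by simp
  show bw: "step mu (bwd mu x) x" "good mu (bwd mu x)" using bwd_exists[of x mu] x m r by auto
  show "fwd mu x \<le> 3 * x" "x \<le> 2 * fwd mu x" "x \<le> 3 * bwd mu x" "bwd mu x \<le> 2 * x"
    using step_compare[OF st g] step_compare[OF bw] by auto
qed

lemma step_mono:
  assumes "step mu p w" "step mu p' w'" "good mu p'" "p < p'" shows "w < w'"
proof (rule ccontr)
  assume "\<not> w < w'"
  have m: "0 < mu" "mu < r" using assms by (auto simp: good_def)
  have "K mu (- 1 * p) < K mu (- 1 * p')"
    by (rule outer_increasing[OF good_outer[OF assms(3)]]) (use assms m in \<open>auto simp: step_def\<close>)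
  then have lt: "K (- mu) w < K (- mu) w'" using assms by (simp add: step_def)
  then have "w' < w" using \<open>\<not> w < w'\<close> by (cases "w = w'") auto
  have "K (- mu) (1 * w') < K (- mu) (1 * w)"
    by (rule outer_increasing[OF step_outer[OF assms(1)]]) (use assms m \<open>w' < w\<close> in \<open>auto simp: step_def\<close>)
  then show False using lt by simp
qed

end

text \<open>The normalisations chain: the point (- mu, \<delta> w) at which the right half ends has
  left coordinates (mu, - w). With these signs the i-th coefficient of the displacement is (-
  \<delta>)^i times the i-th Lyapunov coefficient; this is what \<open>coeff\<close> and
  \<open>V\<close> express.\<close>

locale two_flow =
  R: half_flow XR U rR LR HR HxR HyR WR WxR WyR 1 \<delta> cR kR QR qR +
  Lf: half_flow XL U rL LL HL HxL HyL WL WxL WyL "- 1" "- \<delta>" cL kL QL qL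
  for XR XL :: vfield and U rR LR HR HxR HyR WR WxR WyR cR kR QR qR rL LL HL HxL HyL WL WxL WyL cL kL QL qL and \<delta> :: real +
  fixes n :: nat and V :: real
  assumes n: "n \<ge> 1" and coeff: "!!i. i < 2 * n ==> qR i * (- 1) ^ i + qL i = 0" and V: "qR (2 * n) + qL (2 * n) = V" "V \<noteq> 0"
begin

definition kM :: nat where "kM = max kR kL"
definition N :: nat where "N = 2 * (n + kM) - 1"
definition \<eta>R :: real where "\<eta>R = 1 / (real kR * cR)"
definition \<eta>L :: real where "\<eta>L = 1 / (real kL * cL)"
definition \<kappa> :: real where "\<kappa> = (if kL \<le> kR then \<eta>R else 0) + (if kR \<le> kL then \<eta>L else 0)"
text \<open>The displacement is taken on the intermediate line: forward image under the right half
  minus backward image under the left half, the latter being - QL(p). The two perturbations then add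
  up, and no composition has to be expanded.\<close>

definition disp0 :: "real \<Rightarrow> real" where "disp0 p = QR (- p) + QL p"
definition dd :: "real \<Rightarrow> real \<Rightarrow> real" where "dd mu p = R.fwd mu p - Lf.bwd mu p"
definition ret :: "real \<Rightarrow> real \<Rightarrow> real" where "ret mu p = Lf.fwd mu (R.fwd mu p)"
definition nice2 :: "real \<Rightarrow> real \<Rightarrow> bool" where "nice2 mu p \<longleftrightarrow> R.nice mu p \<and> Lf.nice mu p"

lemma \<eta>: "\<eta>R > 0" "\<eta>L > 0" "\<kappa> > 0"
  using R.k R.c Lf.k Lf.c by (auto simp: \<eta>R_def \<eta>L_def \<kappa>_def intro!: add_pos_pos)

lemma kM: "kR \<le> kM" "kL \<le> kM" "kM \<ge> 1" and N: "N = 2 * n + (2 * kM - 1)" "N \<ge> 2 * kM + 1" "N \<ge> 1"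
  using R.k n by (auto simp: kM_def N_def)

lemma nice2_of_rng: obtains eps where "eps > 0" "!!mu p. rng kM eps mu p ==> nice2 mu p"
proof -
  obtain e1 where e1: "e1 > 0" "!!mu p. rng kM e1 mu p ==> R.nice mu p"
    by (rule R.nice_of_rng[OF kM(1)]) (rule that; assumption)
  obtain e2 where e2: "e2 > 0" "!!mu p. rng kM e2 mu p ==> Lf.nice mu p"
    by (rule Lf.nice_of_rng[OF kM(2)]) (rule that; assumption)
  show thesis
  proof (rule that[of "min e1 e2"])
    show "nice2 mu p" if "rng kM (min e1 e2) mu p" for mu p
      unfolding nice2_def using e1(2)[OF rng_less[OF that]] e2(2)[OF rng_less[OF that]] by auto
  qed (use e1 e2 in auto)
qed

lemma nice2_fwd: assumes "nice2 mu p"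
  shows "R.step mu p (R.fwd mu p)" "R.good mu p" "Lf.step mu (R.fwd mu p) (ret mu p)" "Lf.good mu (R.fwd mu p)"
    "Lf.step mu (Lf.bwd mu p) p" "Lf.good mu (Lf.bwd mu p)" "0 < mu" "mu < rR" "mu < rL" "0 < p" "R.fwd mu p > 0"
    "p / 2 \<le> R.fwd mu p" "R.fwd mu p \<le> 3 * p"
proof -
  have h: "R.nice mu p" "Lf.nice mu p" "0 < p" "0 < mu" using assms by (auto simp: nice2_def R.nice_def)
  note 1 = R.nice_at[OF h(1), of p] Lf.nice_at[OF h(2), of p]
  have q: "p / 2 \<le> R.fwd mu p" "R.fwd mu p \<le> 3 * p" using 1 h by auto
  note 2 = Lf.nice_at[OF h(2) q]
  show "R.step mu p (R.fwd mu p)" "R.good mu p" "Lf.step mu (R.fwd mu p) (ret mu p)" "Lf.good mu (R.fwd mu p)"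
    "Lf.step mu (Lf.bwd mu p) p" "Lf.good mu (Lf.bwd mu p)" "0 < mu" "mu < rR" "mu < rL" "0 < p" "R.fwd mu p > 0"
    "p / 2 \<le> R.fwd mu p" "R.fwd mu p \<le> 3 * p"
    using 1 2 q h by (auto simp: ret_def)
qed

text \<open>The left passage is increasing in its entry, so comparing the forward image with the
  left preimage of p is comparing the return with p.\<close>

lemma ret_compare:
  assumes "nice2 mu p"
  shows "dd mu p > 0 ==> p < ret mu p" "dd mu p < 0 ==> ret mu p < p" "dd mu p = 0 ==> ret mu p = p"
proof -
  note h = nice2_fwd[OF assms]
  show "dd mu p > 0 ==> p < ret mu p" using Lf.step_mono[OF h(5) h(3) h(4)] by (simp add: dd_def)
  show "dd mu p < 0 ==> ret mu p < p" using Lf.step_mono[OF h(3) h(5) h(6)] by (simp add: dd_def)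
  show "dd mu p = 0 ==> ret mu p = p" using Lf.fwd_eq[OF h(5) h(7) h(9)] by (simp add: dd_def ret_def)
qed

lemma ret_mono:
  assumes "nice2 mu p" "nice2 mu p'" "p < p'" shows "ret mu p < ret mu p'"
  by (rule Lf.step_mono[OF nice2_fwd(3)[OF assms(1)] nice2_fwd(3,4)[OF assms(2)]])
     (rule R.step_mono[OF nice2_fwd(1)[OF assms(1)] nice2_fwd(1,2)[OF assms(2)] assms(3)])

lemma disp0_series: "has_power_series (%i. qR i * (- 1) ^ i + qL i) disp0"
  using ps_diff[OF ps_scale[OF Lf.Q_series, of 1 1] ps_scale[OF R.Q_series, of "- 1" "- 1"]]
  by (simp add: disp0_def[abs_def] add_ac)

lemma disp0_deriv:
  assumes "\<bar>p\<bar> < rR" "\<bar>p\<bar> < rL" shows "(disp0 has_real_derivative - deriv QR (- p) + deriv QL p) (at p)"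
proof -
  have "(QR has_real_derivative deriv QR (- p)) (at (- p))" by (rule R.Q_deriv) (use assms in simp)
  moreover have "((%p. - p) has_real_derivative - 1) (at p)" by (auto intro!: derivative_eq_intros)
  ultimately have "((%p. QR (- p)) has_real_derivative deriv QR (- p) * - 1) (at p)" by (rule DERIV_chain2)
  then have 1: "((%p. QR (- p)) has_real_derivative - deriv QR (- p)) (at p)" by simp
  show ?thesis unfolding disp0_def[abs_def] by (rule DERIV_add[OF 1 Lf.Q_deriv[OF assms(2)]])
qed

lemma disp0_expansion:
  obtains eps C where "eps > 0" "C \<ge> 0" "!!p. 0 < p ==> p < eps ==> \<bar>disp0 p - V * p ^ (2 * n)\<bar> \<le> C * p ^ (2 * n + 1)"
proof -
  obtain eps C where h: "eps > 0" "C \<ge> 0" "!!y. \<bar>y\<bar> < eps ==>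
     \<bar>disp0 y - (qR (2 * n) * (- 1) ^ (2 * n) + qL (2 * n)) * y ^ (2 * n)\<bar> \<le> C * \<bar>y\<bar> ^ Suc (2 * n)"
    by (rule ps_remainder[OF disp0_series coeff]) (assumption, (rule that; assumption))
  show thesis
  proof (rule that[OF h(1,2)])
    fix p :: real assume "0 < p" "p < eps"
    then show "\<bar>disp0 p - V * p ^ (2 * n)\<bar> \<le> C * p ^ (2 * n + 1)" using h(3)[of p] V by simp
  qed
qed

lemma disp0_sign:
  obtains eps where "eps > 0" "!!p. 0 < p ==> p < eps ==> sgn (disp0 p) = sgn V"
    "!!p. 0 < p ==> p < eps ==> V < 0 ==> - deriv QR (- p) + deriv QL p < 0"
proof -
  have pos: "\<forall>\<^sub>F y in at_right 0. sgn (f y) = sgn l"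
    if f: "((%y. f y / y ^ m) \<longlongrightarrow> l) (at 0)" and l: "l \<noteq> 0" for f :: "real \<Rightarrow> real" and l m
  proof -
    have t: "((%y. f y / y ^ m) \<longlongrightarrow> l) (at_right 0)" using f by (rule filterlim_mono) (auto simp: at_le)
    have "((%y. l * (f y / y ^ m)) \<longlongrightarrow> l * l) (at_right 0)" by (intro tendsto_intros t)
    then have "\<forall>\<^sub>F y in at_right 0. l * (f y / y ^ m) > 0" by (rule order_tendstoD) (use l in \<open>auto simp: zero_less_mult_iff\<close>)
    moreover have "\<forall>\<^sub>F y in at_right (0::real). y > 0" by (simp add: eventually_at_right_less)
    ultimately show ?thesis
    proof eventually_elim
      case (elim y)
      then have "y ^ m > 0" by simp
      then show ?case using elim by (auto simp: zero_less_mult_iff zero_less_divide_iff sgn_if divide_less_0_iff)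
    qed
  qed
  have 1: "\<forall>\<^sub>F y in at_right 0. sgn (disp0 y) = sgn V"
  proof (rule pos)
    show "((%y. disp0 y / y ^ (2 * n)) \<longlongrightarrow> V) (at 0)" using ps_leading[OF disp0_series, of "2 * n"] coeff V by simp
  qed (rule V)
  obtain rho where rho: "rho > 0" "!!y. \<bar>y\<bar> < rho ==> (disp0 has_real_derivative deriv disp0 y) (at y)"
    "has_power_series (%i. real (Suc i) * (qR (Suc i) * (- 1) ^ Suc i + qL (Suc i))) (deriv disp0)"
    by (rule ps_deriv[OF disp0_series]) (rule that; assumption)
  have 2: "\<forall>\<^sub>F y in at_right 0. sgn (deriv disp0 y) = sgn (real (2 * n) * V)"
  proof (rule pos)
    have "((%y. deriv disp0 y / y ^ (2 * n - 1)) \<longlongrightarrow> real (Suc (2 * n - 1)) * (qR (Suc (2 * n - 1)) * (- 1) ^ Suc (2 * n - 1) + qL (Suc (2 * n - 1)))) (at 0)"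
      by (rule ps_leading[OF rho(3)], use coeff[of "Suc _"] in force)
    moreover have "Suc (2 * n - 1) = 2 * n" using n by simp
    ultimately show "((%y. deriv disp0 y / y ^ (2 * n - 1)) \<longlongrightarrow> real (2 * n) * V) (at 0)" using V by (simp del: of_nat_Suc)
  qed (use V n in simp)
  from eventually_conj[OF 1 2] obtain b where b: "b > 0" "!!y. 0 < y ==> y < b ==> sgn (disp0 y) = sgn V \<and> sgn (deriv disp0 y) = sgn (real (2 * n) * V)"
    by (auto simp: eventually_at_right_field)
  show thesis
  proof (rule that[of "min b (min rR rL)"])
    show "min b (min rR rL) > 0" using b R.r Lf.r by simp
    fix p :: real assume p: "0 < p" "p < min b (min rR rL)"
    show "sgn (disp0 p) = sgn V" using b p by simp
    assume "V < 0"
    have "deriv disp0 p = - deriv QR (- p) + deriv QL p" by (rule DERIV_imp_deriv[OF disp0_deriv]) (use p in auto)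
    moreover have "sgn (deriv disp0 p) = - 1" using b(2)[of p] p \<open>V < 0\<close> n by (simp add: sgn_mult)
    ultimately show "- deriv QR (- p) + deriv QL p < 0" by (simp add: sgn_if split: if_splits)
  qed
qed

text \<open>\<open>slope_upper\<close> bounds the derivative of the forward passage from above,
  \<open>slope_lower\<close> that of the inverted one from below. For V < 0 the displacement is thus
  strictly decreasing wherever \<open>nice2\<close> holds, far below the balance scale too.\<close>

lemma dd_deriv:
  assumes "nice2 mu p"
  obtains d where "(dd mu has_real_derivative d) (at p)" "d \<le> - deriv QR (- p) + deriv QL p"
proof -
  note h = nice2_fwd[OF assms]
  have nc: "R.nice mu p" "Lf.nice mu p" using assms by (auto simp: nice2_def)
  note 1 = R.nice_at[OF nc(1), of p] Lf.nice_at[OF nc(2), of p]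
  have b: "(Lf.bwd mu has_real_derivative 1 / Lf.slope mu (Lf.bwd mu p) p) (at p)"
    by (rule Lf.bwd_deriv) (use 1 h Lf.r in auto)
  have le: "p \<le> R.eps0" "p \<le> Lf.eps0" using 1 h by auto
  show thesis
    by (rule that[OF _ _], unfold dd_def[abs_def], rule DERIV_diff[OF R.fwd_deriv(1)[OF h(1,2)] b])
       (use R.slope_upper[OF h(1,2) le(1)] Lf.slope_lower[OF h(5,6) le(2)] in linarith)
qed

lemma dd_decreasing:
  assumes "!!p. p1 \<le> p ==> p \<le> p2 ==> nice2 mu p \<and> - deriv QR (- p) + deriv QL p < 0" and "p1 < p2"
  shows "dd mu p2 < dd mu p1"
proof (rule DERIV_neg_imp_decreasing[OF assms(2)])
  fix p assume p: "p1 \<le> p" "p \<le> p2"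
  obtain d where "(dd mu has_real_derivative d) (at p)" "d \<le> - deriv QR (- p) + deriv QL p"
    by (rule dd_deriv) (use assms(1)[OF p] in \<open>auto intro: that\<close>)
  then show "\<exists>y. (dd mu has_real_derivative y) (at p) \<and> y < 0" using assms(1)[OF p] by force
qed

text \<open>The product of the two slopes is below 1 because R.slope \<le> - QR'(- p) < - QL'(p)
  \<le> 1 / Lf.slope; here ' is the derivative.\<close>

lemma ret_multiplier:
  assumes "nice2 mu p" "- deriv QR (- p) + deriv QL p < 0" "ret mu p = p"
  obtains d where "(ret mu has_real_derivative d) (at p)" "0 < d" "d < 1"
    "\<forall>\<^sub>F p' in nhds p. R.step mu p' (R.fwd mu p') \<and> Lf.step mu (R.fwd mu p') (ret mu p')"
proof -
  note h = nice2_fwd[OF assms(1)]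
  let ?q = "R.fwd mu p"
  have nc: "R.nice mu p" "Lf.nice mu p" using assms by (auto simp: nice2_def)
  have le: "p \<le> R.eps0" "p \<le> Lf.eps0" using R.nice_at(2)[OF nc(1), of p] Lf.nice_at(2)[OF nc(2), of p] h(10) by auto
  have Ls: "Lf.step mu ?q p" using h(3) assms(3) by simp
  note dR = R.fwd_deriv[OF h(1,2)] and dL = Lf.fwd_deriv[OF Ls h(4)]
  have pos: "0 < R.slope mu p ?q" "0 < Lf.slope mu ?q p" using R.slope_pos[OF h(1,2)] Lf.slope_pos[OF Ls h(4)] .
  have "R.slope mu p ?q < 1 / Lf.slope mu ?q p"
    using R.slope_upper[OF h(1,2) le(1)] Lf.slope_lower[OF Ls h(4) le(2)] assms(2) by linarith
  then have lt: "Lf.slope mu ?q p * R.slope mu p ?q < 1" using pos by (simp add: field_simps)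
  have d: "(ret mu has_real_derivative Lf.slope mu ?q p * R.slope mu p ?q) (at p)"
    unfolding ret_def[abs_def] by (rule DERIV_chain2[OF dL(1) dR(1)])
  have "filterlim (R.fwd mu) (nhds ?q) (nhds p)"
    using DERIV_isCont[OF dR(1)] unfolding isCont_def by (simp add: tendsto_at_iff_tendsto_nhds)
  then have "\<forall>\<^sub>F p' in nhds p. Lf.step mu (R.fwd mu p') (ret mu p')"
    unfolding ret_def by (rule eventually_compose_filterlim[OF dL(2)])
  then have ev: "\<forall>\<^sub>F p' in nhds p. R.step mu p' (R.fwd mu p') \<and> Lf.step mu (R.fwd mu p') (ret mu p')"
    using dR(2) by eventually_elim simp
  show thesis by (rule that[OF d _ lt ev]) (use pos in simp)
qed

end

text \<open>If k < kM, the excess power of p turns the contribution of this half into an error term.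
  Hence only the half with the higher contact order, or both in case of equality, enters
  \<kappa>.\<close>

lemma rescaled_increment:
  fixes p mu E C \<eta> :: real
  assumes p: "0 < p" "p \<le> 1" and k: "1 \<le> k" "k \<le> kM" and C: "C \<ge> 0" "\<eta> > 0" "mu > 0"
    and E: "\<bar>E - mu / (\<eta> * p ^ (2 * k - 1))\<bar> \<le> C * (mu * p / p ^ (2 * k - 1))"
  shows "\<bar>p ^ (2 * kM - 1) * E - mu * (if kM \<le> k then 1 / \<eta> else 0)\<bar> \<le> (C + 1 / \<eta>) * (mu * p)"
proof -
  define P where "P = p ^ (2 * k - 1)"
  define d where "d = 2 * (kM - k)"
  have P: "P > 0" using p by (simp add: P_def)
  have pd: "p ^ (2 * kM - 1) = p ^ d * P"
  proof -
    have "2 * kM - 1 = d + (2 * k - 1)" using k by (simp add: d_def)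
    then show ?thesis by (simp only: P_def power_add)
  qed
  have "P * E - mu / \<eta> = P * (E - mu / (\<eta> * P))" using P C by (simp add: field_simps)
  then have "\<bar>P * E - mu / \<eta>\<bar> = P * \<bar>E - mu / (\<eta> * P)\<bar>" using P by (simp add: abs_mult)
  also have "\<dots> \<le> P * (C * (mu * p / P))" using E P unfolding P_def by (intro mult_left_mono) auto
  also have "\<dots> = C * (mu * p)" using P by simp
  finally have e: "\<bar>P * E - mu / \<eta>\<bar> \<le> C * (mu * p)" .
  show ?thesis
  proof (cases "kM = k")
    case True
    have "0 \<le> 1 / \<eta> * (mu * p)" using C p by simp
    then show ?thesis using e True unfolding pd by (simp add: d_def distrib_right)
  next
    case False
    then have d: "d \<ge> 1" "\<not> kM \<le> k" using k by (auto simp: d_def)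
    have "p ^ d \<le> p ^ 1" using p d by (intro power_decreasing) auto
    then have pd1: "0 \<le> p ^ d" "p ^ d \<le> p" using p by auto
    have "\<bar>P * E\<bar> \<le> mu / \<eta> + C * (mu * p)"
    proof -
      have "0 \<le> mu / \<eta>" using C by simp
      then show ?thesis using e by linarith
    qed
    also have "\<dots> \<le> mu / \<eta> + C * mu" using C p by (intro add_left_mono mult_left_mono) (auto simp: mult_left_le)
    finally have "\<bar>p ^ d * (P * E)\<bar> \<le> p * (mu / \<eta> + C * mu)"
      unfolding abs_mult using pd1 by (intro mult_mono) auto
    then show ?thesis using d unfolding pd by (simp add: algebra_simps)
  qed
qed

section \<open>Expansion of the displacement and of the period; the attracting zero\<close>

context two_flow begin

definition period :: "real \<Rightarrow> real \<Rightarrow> real" where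
  "period mu p = (R.tm (- mu) (R.fwd mu p) - R.tm mu (- p)) + (Lf.tm (- mu) (ret mu p) - Lf.tm mu (- R.fwd mu p))"

lemma nice2_le_1: assumes "nice2 mu p" shows "p \<le> 1 / 16" "p < rR / 8" "p < rL / 8" "p \<le> R.eps0" "p \<le> Lf.eps0" "2 * mu \<le> p" "0 < p" "0 < mu"
proof -
  have h: "0 < mu" "0 < p" "2 * mu \<le> p" "3 * p \<le> R.eps0" "3 * p \<le> Lf.eps0"
    using assms by (auto simp: nice2_def R.nice_def Lf.nice_def)
  show "p \<le> 1 / 16" "p < rR / 8" "p < rL / 8" "p \<le> R.eps0" "p \<le> Lf.eps0" "2 * mu \<le> p" "0 < p" "0 < mu"
    using h R.eps0(2) Lf.eps0(2) R.small(3) by linarith+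
qed

lemma fwd_bwd_expansion:
  assumes M: "M \<ge> 0"
  obtains C where "C \<ge> 0" "!!mu p. [|nice2 mu p; mu \<le> M * p ^ N|] ==>
      \<bar>R.fwd mu p - QR (- p) - mu / (real kR * cR * p ^ (2 * kR - 1))\<bar> \<le> C * (mu * p / p ^ (2 * kR - 1))"
    "!!mu p. [|nice2 mu p; mu \<le> M * p ^ N|] ==>
      \<bar>- QL p - Lf.bwd mu p - mu / (real kL * cL * p ^ (2 * kL - 1))\<bar> \<le> C * (mu * p / p ^ (2 * kL - 1))"
proof -
  obtain C1 where C1: "C1 \<ge> 0" "!!mu p w. [|R.step mu p w; R.good mu p; p \<le> R.eps0; mu \<le> p; mu \<le> M * p ^ (2 * kR + 1)|] ==>
     \<bar>w - QR (- p) - mu / (real kR * cR * p ^ (2 * kR - 1))\<bar> \<le> C1 * (mu * p / p ^ (2 * kR - 1))"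
    by (rule R.fwd_expansion[OF M]) (rule that; assumption)
  obtain C2 where C2: "C2 \<ge> 0" "!!mu p w. [|Lf.step mu p w; Lf.good mu p; w \<le> Lf.eps0; mu \<le> w; mu \<le> M * w ^ (2 * kL + 1)|] ==>
     \<bar>- QL w - p - mu / (real kL * cL * w ^ (2 * kL - 1))\<bar> \<le> C2 * (mu * w / w ^ (2 * kL - 1))"
    by (rule Lf.bwd_expansion[OF M]) (rule that; assumption)
  have pw: "M * p ^ N \<le> M * p ^ (2 * k + 1)" if "k \<le> kM" "nice2 mu p" for k p mu
    using M N(2) that nice2_le_1[OF that(2)] by (intro mult_left_mono power_decreasing) auto
  show thesis
  proof (rule that[of "max C1 C2"])
    fix mu p assume nc: "nice2 mu p" and m: "mu \<le> M * p ^ N"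
    note h = nice2_fwd[OF nc] and b = nice2_le_1[OF nc]
    have pos: "0 \<le> mu * p / p ^ (2 * j - 1)" for j :: nat using b by simp
    have "\<bar>R.fwd mu p - QR (- p) - mu / (real kR * cR * p ^ (2 * kR - 1))\<bar> \<le> C1 * (mu * p / p ^ (2 * kR - 1))"
      by (rule C1(2)[OF h(1,2)]) (use b m pw[OF kM(1) nc] in linarith)+
    also have "\<dots> \<le> max C1 C2 * (mu * p / p ^ (2 * kR - 1))" by (rule mult_right_mono[OF _ pos]) simp
    finally show "\<bar>R.fwd mu p - QR (- p) - mu / (real kR * cR * p ^ (2 * kR - 1))\<bar> \<le> max C1 C2 * (mu * p / p ^ (2 * kR - 1))" .
    have "\<bar>- QL p - Lf.bwd mu p - mu / (real kL * cL * p ^ (2 * kL - 1))\<bar> \<le> C2 * (mu * p / p ^ (2 * kL - 1))"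
      by (rule C2(2)[OF h(5,6)]) (use b m pw[OF kM(2) nc] in linarith)+
    also have "\<dots> \<le> max C1 C2 * (mu * p / p ^ (2 * kL - 1))" by (rule mult_right_mono[OF _ pos]) simp
    finally show "\<bar>- QL p - Lf.bwd mu p - mu / (real kL * cL * p ^ (2 * kL - 1))\<bar> \<le> max C1 C2 * (mu * p / p ^ (2 * kL - 1))" .
  qed (use C1 C2 in auto)
qed

text \<open>Multiplication by p^(2 kM - 1) clears the denominators of the mu-terms and raises V p^(2
  n) to V p^N.\<close>

lemma dd_expansion:
  assumes M: "M \<ge> 0"
  obtains eps C where "eps > 0" "C \<ge> 0" "!!mu p. [|nice2 mu p; p < eps; mu \<le> M * p ^ N|] ==>
      \<bar>p ^ (2 * kM - 1) * dd mu p - (V * p ^ N + \<kappa> * mu)\<bar> \<le> C * p ^ (N + 1)"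
proof -
  obtain C1 where C1: "C1 \<ge> 0" "!!mu p. [|nice2 mu p; mu \<le> M * p ^ N|] ==>
      \<bar>R.fwd mu p - QR (- p) - mu / (real kR * cR * p ^ (2 * kR - 1))\<bar> \<le> C1 * (mu * p / p ^ (2 * kR - 1))"
    "!!mu p. [|nice2 mu p; mu \<le> M * p ^ N|] ==>
      \<bar>- QL p - Lf.bwd mu p - mu / (real kL * cL * p ^ (2 * kL - 1))\<bar> \<le> C1 * (mu * p / p ^ (2 * kL - 1))"
    by (rule fwd_bwd_expansion[OF M]) (rule that; assumption)
  obtain eps C0 where D: "eps > 0" "C0 \<ge> 0" "!!p. 0 < p ==> p < eps ==> \<bar>disp0 p - V * p ^ (2 * n)\<bar> \<le> C0 * p ^ (2 * n + 1)"
    by (rule disp0_expansion) (rule that; assumption)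
  define C where "C = C0 + (C1 + \<eta>R) * M + (C1 + \<eta>L) * M"
  show thesis
  proof (rule that[OF D(1)])
    show "C \<ge> 0" using C1(1) D(2) M \<eta> by (simp add: C_def)
    fix mu p assume nc: "nice2 mu p" and p: "p < eps" and m: "mu \<le> M * p ^ N"
    note b = nice2_le_1[OF nc]
    define P where "P = p ^ (2 * kM - 1)"
    define E1 where "E1 = R.fwd mu p - QR (- p)"
    define E2 where "E2 = - QL p - Lf.bwd mu p"
    have P: "P > 0" using b by (simp add: P_def)
    have PN: "P * p ^ (2 * n) = p ^ N" "P * p ^ (2 * n + 1) = p ^ (N + 1)"
      unfolding P_def N(1) by (simp_all add: power_add mult_ac)
    have mp: "mu * p \<le> M * p ^ (N + 1)" using mult_right_mono[OF m, of p] b by (simp add: mult_ac)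
    define K1 where "K1 = mu * (if kM \<le> kR then 1 / (real kR * cR) else 0)"
    define K2 where "K2 = mu * (if kM \<le> kL then 1 / (real kL * cL) else 0)"
    have 1: "\<bar>P * E1 - K1\<bar> \<le> (C1 + 1 / (real kR * cR)) * (mu * p)"
      unfolding P_def K1_def by (rule rescaled_increment) (use C1(1) C1(2)[OF nc m] b R.k R.c kM in \<open>auto simp: E1_def\<close>)
    have 2: "\<bar>P * E2 - K2\<bar> \<le> (C1 + 1 / (real kL * cL)) * (mu * p)"
      unfolding P_def K2_def by (rule rescaled_increment) (use C1(1) C1(3)[OF nc m] b Lf.k Lf.c kM in \<open>auto simp: E2_def\<close>)
    have 3: "\<bar>P * disp0 p - V * p ^ N\<bar> \<le> C0 * p ^ (N + 1)"
    proof -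
      have "P * disp0 p - V * p ^ N = P * (disp0 p - V * p ^ (2 * n))" unfolding PN(1)[symmetric] by (simp add: algebra_simps)
      then have "\<bar>P * disp0 p - V * p ^ N\<bar> = P * \<bar>disp0 p - V * p ^ (2 * n)\<bar>" using P by (simp add: abs_mult)
      also have "\<dots> \<le> P * (C0 * p ^ (2 * n + 1))" by (rule mult_left_mono[OF D(3)]) (use b p P in auto)
      finally show ?thesis unfolding PN(2)[symmetric] by (simp only: mult.left_commute)
    qed
    have 4: "(C1 + 1 / (real kR * cR)) * (mu * p) \<le> (C1 + \<eta>R) * M * p ^ (N + 1)"
      using mult_left_mono[OF mp, of "C1 + \<eta>R"] C1(1) \<eta> by (simp add: \<eta>R_def mult.assoc)
    have 5: "(C1 + 1 / (real kL * cL)) * (mu * p) \<le> (C1 + \<eta>L) * M * p ^ (N + 1)"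
      using mult_left_mono[OF mp, of "C1 + \<eta>L"] C1(1) \<eta> by (simp add: \<eta>L_def mult.assoc)
    have k: "K1 + K2 = \<kappa> * mu"
      by (simp add: K1_def K2_def \<kappa>_def kM_def \<eta>R_def \<eta>L_def algebra_simps)
    have d: "P * dd mu p = P * E1 + P * E2 + P * disp0 p" by (simp add: dd_def E1_def E2_def disp0_def algebra_simps)
    have "C * p ^ (N + 1) = C0 * p ^ (N + 1) + (C1 + \<eta>R) * M * p ^ (N + 1) + (C1 + \<eta>L) * M * p ^ (N + 1)"
      by (simp add: C_def algebra_simps)
    then show "\<bar>p ^ (2 * kM - 1) * dd mu p - (V * p ^ N + \<kappa> * mu)\<bar> \<le> C * p ^ (N + 1)"
      using 1 2 3 4 5 d unfolding P_def[symmetric] k[symmetric] abs_le_iff by (intro conjI; linarith)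
  qed
qed

lemma fwd_near:
  assumes M: "M \<ge> 0"
  obtains C where "C \<ge> 0" "!!mu p. [|nice2 mu p; mu \<le> M * p ^ N|] ==> \<bar>R.fwd mu p - p\<bar> \<le> C * p\<^sup>2"
     "!!mu p. [|nice2 mu p; mu \<le> M * p ^ N|] ==> mu \<le> C * p\<^sup>2"
proof -
  obtain C1 where C1: "C1 \<ge> 0" "!!mu p. [|nice2 mu p; mu \<le> M * p ^ N|] ==>
      \<bar>R.fwd mu p - QR (- p) - mu / (real kR * cR * p ^ (2 * kR - 1))\<bar> \<le> C1 * (mu * p / p ^ (2 * kR - 1))"
    "!!mu p. [|nice2 mu p; mu \<le> M * p ^ N|] ==>
      \<bar>- QL p - Lf.bwd mu p - mu / (real kL * cL * p ^ (2 * kL - 1))\<bar> \<le> C1 * (mu * p / p ^ (2 * kL - 1))"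
    by (rule fwd_bwd_expansion[OF M]) (rule that; assumption)
  define C where "C = LR + (\<eta>R + C1) * M + M"
  have nn: "LR \<ge> 0" "\<eta>R * M \<ge> 0" "C1 * M \<ge> 0" using R.L \<eta> M C1(1) by auto
  show thesis
  proof (rule that[of C])
    show "C \<ge> 0" using nn M by (simp add: C_def distrib_right)
    fix mu p assume nc: "nice2 mu p" and m: "mu \<le> M * p ^ N"
    note b = nice2_le_1[OF nc]
    define P where "P = p ^ (2 * kR - 1)"
    have P: "P > 0" using b by (simp add: P_def)
    have p1: "0 \<le> p" "p \<le> 1" using b by auto
    have mj: "mu \<le> M * p ^ j" if "j \<le> N" for j
      using mult_left_mono[OF power_decreasing[OF that p1] M] m by linarith
    have mm: "mu \<le> M * p ^ (2 * kR + 1)" "mu \<le> M * p\<^sup>2"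
      by (rule mj, use N(2) kM in linarith) (rule mj, use N(2) kM in linarith)
    have p2: "p\<^sup>2 \<ge> 0" by simp
    have "M * p\<^sup>2 \<le> C * p\<^sup>2" by (rule mult_right_mono[OF _ p2]) (use nn in \<open>simp add: C_def distrib_right\<close>)
    then show "mu \<le> C * p\<^sup>2" using mm by linarith
    have "p ^ (2 * kR + 1) = P * p\<^sup>2" unfolding P_def using R.k by (simp add: power2_eq_square flip: power_add power_Suc2)
    then have q: "mu / P \<le> M * p\<^sup>2" using mm(1) P by (simp add: pos_divide_le_eq mult_ac)
    have q2: "mu * p / P \<le> M * p\<^sup>2"
    proof -
      have "mu / P * p \<le> mu / P * 1" using b P by (intro mult_left_mono) auto
      then show ?thesis using q by simp
    qed
    have "mu / (real kR * cR * P) = \<eta>R * (mu / P)" by (simp add: \<eta>R_def)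
    also have "\<dots> \<le> \<eta>R * (M * p\<^sup>2)" using q \<eta> by (intro mult_left_mono) auto
    finally have t1: "mu / (real kR * cR * P) \<le> \<eta>R * M * p\<^sup>2" by simp
    have t0: "mu / (real kR * cR * P) \<ge> 0" using b P R.k R.c by simp
    have t2: "C1 * (mu * p / P) \<le> C1 * M * p\<^sup>2" using mult_left_mono[OF q2 C1(1)] by (simp only: mult.assoc)
    have t3: "\<bar>QR (- p) - p\<bar> \<le> LR * p\<^sup>2" by (rule R.Q_bounds) (use b R.r in auto)
    have "C * p\<^sup>2 = LR * p\<^sup>2 + \<eta>R * M * p\<^sup>2 + C1 * M * p\<^sup>2 + M * p\<^sup>2" by (simp add: C_def algebra_simps)
    moreover have "0 \<le> M * p\<^sup>2" using M by simp
    moreover have "\<bar>f - p\<bar> \<le> \<bar>f - Q - x\<bar> + x + \<bar>Q - p\<bar>" if "x \<ge> 0" for f Q x using that by linarith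
    from this[OF t0] have "\<bar>R.fwd mu p - p\<bar> \<le> \<bar>R.fwd mu p - QR (- p) - mu / (real kR * cR * P)\<bar> + mu / (real kR * cR * P) + \<bar>QR (- p) - p\<bar>" .
    ultimately show "\<bar>R.fwd mu p - p\<bar> \<le> C * p\<^sup>2"
      using C1(2)[OF nc m] t1 t2 t3 unfolding P_def[symmetric] by linarith
  qed
qed

text \<open>Each half turn climbs from about - p to about p at speed \<beta>, hence lasts 2 p /
  \<beta> up to O(p^2); entry height, exit height and mu all deviate by O(p^2) only.\<close>

lemma period_near:
  assumes M: "M \<ge> 0"
  obtains C where "C \<ge> 0" "!!mu p. [|nice2 mu p; mu \<le> M * p ^ N; ret mu p = p|] ==> \<bar>period mu p - (2 / R.\<beta> + 2 / Lf.\<beta>) * p\<bar> \<le> C * p\<^sup>2"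
proof -
  obtain C1 where C1: "C1 \<ge> 0" "!!mu p. [|nice2 mu p; mu \<le> M * p ^ N|] ==> \<bar>R.fwd mu p - p\<bar> \<le> C1 * p\<^sup>2"
     "!!mu p. [|nice2 mu p; mu \<le> M * p ^ N|] ==> mu \<le> C1 * p\<^sup>2"
    by (rule fwd_near[OF M]) (rule that; assumption)
  define C where "C = 4 * C1 + 10 * (LR + LL) + C1 / R.\<beta> + C1 / Lf.\<beta>"
  show thesis
  proof (rule that[of C])
    show "C \<ge> 0" using C1(1) R.L Lf.L R.\<beta> Lf.\<beta> by (simp add: C_def)
    fix mu p assume nc: "nice2 mu p" and m: "mu \<le> M * p ^ N" and rt: "ret mu p = p"
    note b = nice2_le_1[OF nc] and h = nice2_fwd[OF nc]
    define q where "q = R.fwd mu p"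
    have q: "0 < q" "q \<le> 3 * p" "q < rR" "q < rL" "p < rR" "p < rL" using h b R.r Lf.r by (auto simp: q_def)
    have qp: "\<bar>q - p\<bar> \<le> C1 * p\<^sup>2" "mu \<le> C1 * p\<^sup>2" using C1(2,3)[OF nc m] by (auto simp: q_def)
    have q2: "q\<^sup>2 \<le> 9 * p\<^sup>2" using power_mono[OF q(2), of 2] q by (simp add: power_mult_distrib)
    have m1: "\<bar>- mu\<bar> = mu" "\<bar>mu\<bar> = mu" using b by auto
    have 1: "\<bar>R.tm (- mu) q - q / R.\<beta>\<bar> \<le> mu + LR * q\<^sup>2" using R.tm_bound[of "- mu" q] q h m1 by auto
    have 2: "\<bar>R.tm mu (- p) + p / R.\<beta>\<bar> \<le> mu + LR * p\<^sup>2" using R.tm_bound[of mu "- p"] q h m1 b by auto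
    have 3: "\<bar>Lf.tm (- mu) p - p / Lf.\<beta>\<bar> \<le> mu + LL * p\<^sup>2" using Lf.tm_bound[of "- mu" p] q h m1 b by auto
    have 4: "\<bar>Lf.tm mu (- q) + q / Lf.\<beta>\<bar> \<le> mu + LL * q\<^sup>2" using Lf.tm_bound[of mu "- q"] q h m1 b by auto
    have 5: "\<bar>q / R.\<beta> - p / R.\<beta>\<bar> \<le> C1 / R.\<beta> * p\<^sup>2" "\<bar>q / Lf.\<beta> - p / Lf.\<beta>\<bar> \<le> C1 / Lf.\<beta> * p\<^sup>2"
      using qp R.\<beta> Lf.\<beta> by (simp_all add: divide_right_mono flip: diff_divide_distrib)
    have 6: "LR * q\<^sup>2 \<le> 9 * (LR * p\<^sup>2)" "LL * q\<^sup>2 \<le> 9 * (LL * p\<^sup>2)"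
      using mult_left_mono[OF q2 R.L] mult_left_mono[OF q2 Lf.L] by simp_all
    have 7: "period mu p = (R.tm (- mu) q - R.tm mu (- p)) + (Lf.tm (- mu) p - Lf.tm mu (- q))"
      by (simp add: period_def q_def rt)
    have 8: "(2 / R.\<beta> + 2 / Lf.\<beta>) * p = 2 * (p / R.\<beta>) + 2 * (p / Lf.\<beta>)" by (simp add: distrib_right)
    have "C * p\<^sup>2 = 4 * (C1 * p\<^sup>2) + 10 * (LR * p\<^sup>2) + 10 * (LL * p\<^sup>2) + C1 / R.\<beta> * p\<^sup>2 + C1 / Lf.\<beta> * p\<^sup>2"
      by (simp add: C_def algebra_simps)
    then show "\<bar>period mu p - (2 / R.\<beta> + 2 / Lf.\<beta>) * p\<bar> \<le> C * p\<^sup>2"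
      unfolding 7 8 using 1 2 3 4 5 6 qp(2) unfolding abs_le_iff by (intro conjI; linarith)
  qed
qed

text \<open>For V < 0 the positive zero of the leading part V p^N + \<kappa> mu.\<close>

definition P0 :: "real \<Rightarrow> real" where "P0 mu = (\<kappa> / \<bar>V\<bar> * mu) powr (1 / real N)"

lemma P0:
  assumes "mu > 0" shows "P0 mu > 0" "mu = \<bar>V\<bar> / \<kappa> * P0 mu ^ N"
proof -
  have x: "\<kappa> / \<bar>V\<bar> * mu > 0" using assms \<eta> V by simp
  show p: "P0 mu > 0" unfolding P0_def by (subst powr_gt_zero) (rule less_imp_neq[OF x, symmetric])
  have "P0 mu ^ N = P0 mu powr real N" by (rule powr_realpow[OF p, symmetric])
  also have "\<dots> = (\<kappa> / \<bar>V\<bar> * mu) powr (1 / real N * real N)" unfolding P0_def by (rule powr_powr)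
  also have "1 / real N * real N = 1" using N(3) by simp
  also have "(\<kappa> / \<bar>V\<bar> * mu) powr 1 = \<kappa> / \<bar>V\<bar> * mu" using x by (intro powr_one) linarith
  finally have "P0 mu ^ N = \<kappa> / \<bar>V\<bar> * mu" .
  then show "mu = \<bar>V\<bar> / \<kappa> * P0 mu ^ N" using \<eta> V by simp
qed

text \<open>The balance scale lies inside the section because N \<ge> 2 kM + 1 exceeds the section
  exponent 2 kM + 1 / 2; the remaining sqrt p beats the constant \<open>m\<close>.\<close>

lemma rng_near:
  assumes eps: "eps > 0"
  obtains eps' where "eps' > 0" "!!mu p. [|0 < mu; P0 mu < eps'; P0 mu / 2 \<le> p; p \<le> 2 * P0 mu|] ==> rng kM eps mu p"
proof -
  define m where "m = \<bar>V\<bar> / \<kappa> * 2 ^ N"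
  have m: "m > 0" using V \<eta> by (simp add: m_def)
  define eps' where "eps' = min (eps / 2) (min (1 / 2) ((1 / m)\<^sup>2 / 2))"
  show thesis
  proof (rule that[of eps'])
    show "eps' > 0" using eps m by (simp add: eps'_def)
    fix mu p assume mpos: "0 < mu" and P: "P0 mu < eps'" "P0 mu / 2 \<le> p" "p \<le> 2 * P0 mu"
    have e: "P0 mu < eps / 2" "P0 mu < 1 / 2" "P0 mu < (1 / m)\<^sup>2 / 2" using P by (auto simp: eps'_def)
    note pp = P0[OF mpos]
    have p: "0 < p" "p < eps" "p \<le> 1" "p < (1 / m)\<^sup>2" using P e pp by auto
    have "sqrt p < sqrt ((1 / m)\<^sup>2)" using p by (simp only: real_sqrt_less_iff)
    then have sm: "m * sqrt p < 1" using m by (simp add: field_simps real_sqrt_divide)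
    have "mu \<le> \<bar>V\<bar> / \<kappa> * (2 * p) ^ N"
      by (subst pp(2), intro mult_left_mono power_mono) (use P pp \<eta> in auto)
    also have "\<dots> = m * p ^ N" by (simp add: m_def power_mult_distrib)
    also have "\<dots> \<le> m * p ^ (2 * kM + 1)" using m p N(2) by (intro mult_left_mono power_decreasing) auto
    also have "\<dots> = (p ^ (2 * kM) * sqrt p) * (m * sqrt p)" using p by (simp add: mult_ac)
    also have "\<dots> < (p ^ (2 * kM) * sqrt p) * 1" using sm p by (intro mult_strict_left_mono) auto
    finally show "rng kM eps mu p" using p mpos by (simp add: rng_def)
  qed
qed

end

context two_flow begin

text \<open>Intermediate value theorem between P0 (1 - t) and P0 (1 + t) with t proportional to P0,
  which yields the relative error O(P0) at once. Only (1 - t)^N \<le> 1 - t and (1 + t)^N \<ge> 1 +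
  t are needed.\<close>

lemma dd_zero_near:
  assumes Vn: "V < 0" and eps: "eps > 0"
  obtains eps' C where "eps' > 0" "C \<ge> 0" "!!mu. 0 < mu ==> P0 mu < eps' ==>
     \<exists>p. rng kM eps mu p \<and> nice2 mu p \<and> dd mu p = 0 \<and> \<bar>p - P0 mu\<bar> \<le> C * (P0 mu)\<^sup>2 \<and> p \<le> 2 * P0 mu \<and> mu \<le> \<bar>V\<bar> / \<kappa> * 2 ^ N * p ^ N"
proof -
  define M where "M = \<bar>V\<bar> / \<kappa> * 2 ^ N"
  have M: "M \<ge> 0" using \<eta> by (simp add: M_def)
  obtain e1 where e1: "e1 > 0" "!!mu p. rng kM e1 mu p ==> nice2 mu p" by (rule nice2_of_rng) (rule that; assumption)
  obtain e2 where e2: "e2 > 0" "!!mu p. [|0 < mu; P0 mu < e2; P0 mu / 2 \<le> p; p \<le> 2 * P0 mu|] ==> rng kM (min eps e1) mu p"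
    by (rule rng_near[of "min eps e1"]) (use eps e1 in simp, (rule that; assumption))
  obtain e3 C where C: "e3 > 0" "C \<ge> 0" "!!mu p. [|nice2 mu p; p < e3; mu \<le> M * p ^ N|] ==>
      \<bar>p ^ (2 * kM - 1) * dd mu p - (V * p ^ N + \<kappa> * mu)\<bar> \<le> C * p ^ (N + 1)"
    by (rule dd_expansion[OF M]) (rule that; assumption)
  \<comment> \<open>Chosen so that the change |V| p0^N t of the leading part exceeds the remainder C
    (2 p0)^(N + 1) for t = C7 p0.\<close>
  define C7 where "C7 = C * 2 ^ (N + 1) / \<bar>V\<bar> + 1"
  have "C * 2 ^ (N + 1) / \<bar>V\<bar> \<ge> 0" using C(2) by simp
  then have C7: "C7 > 0" "\<bar>V\<bar> * C7 = C * 2 ^ (N + 1) + \<bar>V\<bar>" using V(2) unfolding C7_def by (linarith, simp add: distrib_left)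
  show thesis
  proof (rule that[of "min e2 (min (e3 / 2) (1 / (2 * C7)))" C7])
    show "min e2 (min (e3 / 2) (1 / (2 * C7))) > 0" using e2 C C7 by simp
    fix mu assume mpos: "0 < mu" and sm: "P0 mu < min e2 (min (e3 / 2) (1 / (2 * C7)))"
    define p0 where "p0 = P0 mu"
    define t where "t = C7 * p0"
    have p0: "0 < p0" "p0 < e2" "2 * p0 < e3" "mu = \<bar>V\<bar> / \<kappa> * p0 ^ N" using P0[OF mpos] sm by (auto simp: p0_def)
    have t: "0 < t" "t \<le> 1 / 2"
    proof -
      have "p0 \<le> 1 / (2 * C7)" using sm by (simp add: p0_def)
      then show "t \<le> 1 / 2" using C7(1) by (simp add: t_def field_simps)
    qed (use C7 p0(1) in \<open>simp add: t_def\<close>)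
    have "\<kappa> * (\<bar>V\<bar> / \<kappa> * p0 ^ N) = - V * p0 ^ N" using \<eta>(3) Vn by simp
    then have km: "\<kappa> * mu = - V * p0 ^ N" using p0(4) by (simp only:)
    have near: "rng kM eps mu p" "nice2 mu p" "mu \<le> M * p ^ N" "p < e3" if p: "p0 / 2 \<le> p" "p \<le> 2 * p0" for p
    proof -
      have rg: "rng kM (min eps e1) mu p" by (rule e2(2)[OF mpos]) (use p p0(2) in \<open>simp_all add: p0_def\<close>)
      show "rng kM eps mu p" "nice2 mu p" using rng_less[OF rg] e1(2)[OF rng_less[OF rg]] by auto
      have "p0 ^ N \<le> (2 * p) ^ N" using p p0(1-3) by (intro power_mono) auto
      then have "\<bar>V\<bar> / \<kappa> * p0 ^ N \<le> \<bar>V\<bar> / \<kappa> * (2 * p) ^ N" by (rule mult_left_mono) (use \<eta> in simp)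
      then show "mu \<le> M * p ^ N" using p0(4) by (simp only: M_def power_mult_distrib mult.assoc)
      show "p < e3" using p p0(1-3) by simp
    qed
    define x1 where "x1 = p0 * (1 - t)"
    define x2 where "x2 = p0 * (1 + t)"
    have pt: "p0 * t \<ge> 0" "p0 * t \<le> p0 * (1 / 2)" using p0(1) t by (auto intro!: mult_left_mono)
    have x1: "p0 / 2 \<le> x1" "x1 \<le> 2 * p0" "x1 \<le> p0" "0 < x1" and x2: "p0 / 2 \<le> x2" "x2 \<le> 2 * p0" "0 < x2" and x12: "x1 \<le> x2"
      using pt p0(1) unfolding x1_def x2_def right_diff_distrib distrib_left by auto
    have pN: "p0 ^ (N + 1) = p0 ^ N * p0" "p0 ^ N > 0" using p0(1) by (simp_all add: mult_ac)
    have s1: "dd mu x1 \<ge> 0"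
    proof -
      have "(1 - t) ^ N \<le> (1 - t) ^ 1" using t N(3) by (intro power_decreasing) auto
      then have "p0 ^ N * (1 - t) ^ N \<le> p0 ^ N * (1 - t)" using pN by (intro mult_left_mono) auto
      then have "- V * x1 ^ N \<le> - V * (p0 ^ N * (1 - t))" unfolding x1_def power_mult_distrib by (rule mult_left_mono) (use Vn in simp)
      then have "- V * (p0 ^ N * t) \<le> V * x1 ^ N + \<kappa> * mu" unfolding km by (simp add: algebra_simps)
      moreover have "C * x1 ^ (N + 1) \<le> C * p0 ^ (N + 1)" using x1 C by (intro mult_left_mono power_mono) auto
      moreover have "C * p0 ^ (N + 1) \<le> C * 2 ^ (N + 1) * p0 ^ (N + 1)"
      proof (intro mult_right_mono)
        show "C \<le> C * 2 ^ (N + 1)" using mult_left_mono[OF two_realpow_ge_one[of "N + 1"] C(2)] by simp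
      qed (use p0(1) in simp)
      moreover have "- V * (p0 ^ N * t) = C * 2 ^ (N + 1) * p0 ^ (N + 1) + \<bar>V\<bar> * p0 ^ (N + 1)"
      proof -
        have "- V * (p0 ^ N * t) = (\<bar>V\<bar> * C7) * p0 ^ (N + 1)" using Vn pN by (simp add: t_def)
        then show ?thesis unfolding C7(2) by (simp only: distrib_right)
      qed
      moreover have "0 \<le> \<bar>V\<bar> * p0 ^ (N + 1)" using p0(1) by simp
      ultimately have "0 \<le> x1 ^ (2 * kM - 1) * dd mu x1" using C(3)[OF near(2,4,3)[OF x1(1,2)]] by linarith
      then show ?thesis using zero_less_power[OF x1(4), of "2 * kM - 1"] by (simp add: zero_le_mult_iff)
    qed
    have s2: "dd mu x2 \<le> 0"
    proof -
      have "1 + real N * t \<le> (1 + t) ^ N" using t by (intro Bernoulli_inequality) auto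
      moreover have "1 * t \<le> real N * t" using t N(3) by (intro mult_right_mono) auto
      ultimately have "1 + t \<le> (1 + t) ^ N" by linarith
      then have "p0 ^ N * (1 + t) \<le> p0 ^ N * (1 + t) ^ N" using pN by (intro mult_left_mono) auto
      then have "- V * (p0 ^ N * (1 + t)) \<le> - V * x2 ^ N" unfolding x2_def power_mult_distrib by (rule mult_left_mono) (use Vn in simp)
      then have "V * x2 ^ N + \<kappa> * mu \<le> V * (p0 ^ N * t)" unfolding km by (simp add: algebra_simps)
      moreover have "C * x2 ^ (N + 1) \<le> C * (2 * p0) ^ (N + 1)" using x2 C by (intro mult_left_mono power_mono) auto
      moreover have "C * (2 * p0) ^ (N + 1) = C * 2 ^ (N + 1) * p0 ^ (N + 1)" by (simp only: power_mult_distrib mult.assoc)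
      moreover have "- V * (p0 ^ N * t) = C * 2 ^ (N + 1) * p0 ^ (N + 1) + \<bar>V\<bar> * p0 ^ (N + 1)"
      proof -
        have "- V * (p0 ^ N * t) = (\<bar>V\<bar> * C7) * p0 ^ (N + 1)" using Vn pN by (simp add: t_def)
        then show ?thesis unfolding C7(2) by (simp only: distrib_right)
      qed
      moreover have "0 \<le> \<bar>V\<bar> * p0 ^ (N + 1)" using p0(1) by simp
      ultimately have "x2 ^ (2 * kM - 1) * dd mu x2 \<le> 0" using C(3)[OF near(2,4,3)[OF x2(1,2)]] by linarith
      then show ?thesis using zero_less_power[OF x2(3), of "2 * kM - 1"] by (simp add: mult_le_0_iff)
    qed
    have "continuous_on {x1..x2} (dd mu)"
    proof (rule continuous_at_imp_continuous_on, rule ballI)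
      fix x assume "x \<in> {x1..x2}"
      then have "x1 \<le> x" "x \<le> x2" by auto
      then have "p0 / 2 \<le> x" "x \<le> 2 * p0" using x1(1) x2(2) by linarith+
      from near(2)[OF this] obtain d where "(dd mu has_real_derivative d) (at x)" by (rule dd_deriv)
      then show "isCont (dd mu) x" by (rule DERIV_isCont)
    qed
    then obtain p where p: "x1 \<le> p" "p \<le> x2" "dd mu p = 0" using IVT2'[OF s2 s1 x12] by auto
    have p': "p0 / 2 \<le> p" "p \<le> 2 * p0" using p x1 x2 by auto
    have "\<bar>p - p0\<bar> \<le> p0 * t" using p unfolding x1_def x2_def right_diff_distrib distrib_left by auto
    then have "\<bar>p - p0\<bar> \<le> C7 * p0\<^sup>2" by (simp add: t_def power2_eq_square mult_ac)
    then show "\<exists>p. rng kM eps mu p \<and> nice2 mu p \<and> dd mu p = 0 \<and> \<bar>p - P0 mu\<bar> \<le> C7 * (P0 mu)\<^sup>2 \<and> p \<le> 2 * P0 mu \<and> mu \<le> \<bar>V\<bar> / \<kappa> * 2 ^ N * p ^ N"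
      unfolding p0_def[symmetric] M_def[symmetric] by (intro exI[of _ p] conjI near[OF p'] p(3) p'(2)) (assumption)
  qed (use C7 in simp)
qed

lemma attracting_zero:
  assumes Vn: "V < 0" and eps: "eps > 0"
  obtains mu0 C where "mu0 > 0" "C \<ge> 0" "!!mu. 0 < mu ==> mu < mu0 ==>
     \<exists>p. rng kM eps mu p \<and> nice2 mu p \<and> ret mu p = p \<and> \<bar>p - P0 mu\<bar> \<le> C * (P0 mu)\<^sup>2 \<and>
       \<bar>period mu p - (2 / R.\<beta> + 2 / Lf.\<beta>) * P0 mu\<bar> \<le> C * (P0 mu)\<^sup>2"
proof -
  obtain e C1 where h: "e > 0" "C1 \<ge> 0" "!!mu. 0 < mu ==> P0 mu < e ==>
     \<exists>p. rng kM eps mu p \<and> nice2 mu p \<and> dd mu p = 0 \<and> \<bar>p - P0 mu\<bar> \<le> C1 * (P0 mu)\<^sup>2 \<and> p \<le> 2 * P0 mu \<and> mu \<le> \<bar>V\<bar> / \<kappa> * 2 ^ N * p ^ N"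
    by (rule dd_zero_near[OF Vn eps]) (rule that; assumption)
  have "\<bar>V\<bar> / \<kappa> * 2 ^ N \<ge> 0" using \<eta> by simp
  then obtain C2 where C2: "C2 \<ge> 0" "!!mu p. [|nice2 mu p; mu \<le> \<bar>V\<bar> / \<kappa> * 2 ^ N * p ^ N; ret mu p = p|] ==> \<bar>period mu p - (2 / R.\<beta> + 2 / Lf.\<beta>) * p\<bar> \<le> C2 * p\<^sup>2"
    by (rule period_near) (rule that; assumption)
  define B where "B = 2 / R.\<beta> + 2 / Lf.\<beta>"
  have B: "B > 0" using R.\<beta> Lf.\<beta> by (auto simp: B_def intro!: add_pos_pos)
  show thesis
  \<comment> \<open>The bound on mu is the value at which P0 reaches e, by the inverse relation mu =
    |V| / \<kappa> times P0^N.\<close>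
  proof (rule that[of "\<bar>V\<bar> / \<kappa> * e ^ N" "C1 + (4 * C2 + B * C1)"])
    show "\<bar>V\<bar> / \<kappa> * e ^ N > 0" using \<eta> V h(1) by simp
    show "C1 + (4 * C2 + B * C1) \<ge> 0" using h(2) C2(1) B by simp
    fix mu assume mpos: "0 < mu" "mu < \<bar>V\<bar> / \<kappa> * e ^ N"
    have "P0 mu < e"
    proof (rule ccontr)
      assume "\<not> P0 mu < e"
      then have "e ^ N \<le> P0 mu ^ N" using h(1) by (intro power_mono) auto
      then have "\<bar>V\<bar> / \<kappa> * e ^ N \<le> \<bar>V\<bar> / \<kappa> * P0 mu ^ N" using \<eta> by (intro mult_left_mono) auto
      then show False using mpos(2) P0(2)[OF mpos(1)] by linarith
    qed
    then obtain p where p: "rng kM eps mu p" "nice2 mu p" "dd mu p = 0" "\<bar>p - P0 mu\<bar> \<le> C1 * (P0 mu)\<^sup>2" "p \<le> 2 * P0 mu" "mu \<le> \<bar>V\<bar> / \<kappa> * 2 ^ N * p ^ N"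
      using h(3)[OF mpos(1)] by blast
    have rt: "ret mu p = p" using ret_compare(3)[OF p(2,3)] .
    have "p\<^sup>2 \<le> (2 * P0 mu)\<^sup>2" using p(5) nice2_le_1(7)[OF p(2)] by (intro power_mono) auto
    then have "C2 * p\<^sup>2 \<le> 4 * C2 * (P0 mu)\<^sup>2" using mult_left_mono[of "p\<^sup>2" "(2 * P0 mu)\<^sup>2" C2] C2(1) by (simp add: power_mult_distrib mult_ac)
    then have 1: "\<bar>period mu p - B * p\<bar> \<le> 4 * C2 * (P0 mu)\<^sup>2" using C2(2)[OF p(2,6) rt] by (simp add: B_def)
    have "\<bar>B * p - B * P0 mu\<bar> = B * \<bar>p - P0 mu\<bar>" using B by (simp add: abs_mult flip: right_diff_distrib)
    then have 2: "\<bar>B * p - B * P0 mu\<bar> \<le> B * C1 * (P0 mu)\<^sup>2" using mult_left_mono[OF p(4), of B] B by simp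
    have nn: "0 \<le> C1 * (P0 mu)\<^sup>2" "0 \<le> C2 * (P0 mu)\<^sup>2" "0 \<le> B * C1 * (P0 mu)\<^sup>2" using h(2) C2(1) B by auto
    have e: "(C1 + (4 * C2 + B * C1)) * (P0 mu)\<^sup>2 = C1 * (P0 mu)\<^sup>2 + 4 * (C2 * (P0 mu)\<^sup>2) + B * C1 * (P0 mu)\<^sup>2" by (simp add: algebra_simps)
    have f1: "\<bar>p - P0 mu\<bar> \<le> (C1 + (4 * C2 + B * C1)) * (P0 mu)\<^sup>2" unfolding e using p(4) nn by linarith
    have f2: "\<bar>period mu p - B * P0 mu\<bar> \<le> (C1 + (4 * C2 + B * C1)) * (P0 mu)\<^sup>2" unfolding e using 1 2 nn by linarith
    show "\<exists>p. rng kM eps mu p \<and> nice2 mu p \<and> ret mu p = p \<and> \<bar>p - P0 mu\<bar> \<le> (C1 + (4 * C2 + B * C1)) * (P0 mu)\<^sup>2 \<and>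
       \<bar>period mu p - (2 / R.\<beta> + 2 / Lf.\<beta>) * P0 mu\<bar> \<le> (C1 + (4 * C2 + B * C1)) * (P0 mu)\<^sup>2"
      unfolding B_def[symmetric] by (intro exI[of _ p] conjI p(1,2) rt f1 f2)
  qed
qed

end

section \<open>Hysteretic trajectories\<close>

lemma integral_curve_subset:
  assumes "integral_curve X U gam I" "I' \<subseteq> I" shows "integral_curve X U gam I'"
  using assms unfolding integral_curve_def by (meson has_vector_derivative_within_subset subsetD)

lemma integral_curve_cong:
  assumes "integral_curve X U gam I" "!!t. t \<in> I ==> gam' t = gam t" shows "integral_curve X U gam' I"
  unfolding integral_curve_def
proof
  fix t assume t: "t \<in> I"
  then have d: "(gam has_vector_derivative X (gam t)) (at t within I)" "gam t \<in> U" using assms(1) by (auto simp: integral_curve_def)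
  have "(gam' has_vector_derivative X (gam t)) (at t within I)"
    by (rule has_vector_derivative_transform[OF t _ d(1)]) (use assms(2) in auto)
  then show "gam' t \<in> U \<and> (gam' has_vector_derivative X (gam' t)) (at t within I)" using \<open>gam t \<in> U\<close> assms(2) t by simp
qed

lemma integral_curve_shift:
  assumes "integral_curve X U gam {c + a..c + b}" shows "integral_curve X U (%t. gam (c + t)) {a..b}"
  unfolding integral_curve_def
proof
  fix t assume t: "t \<in> {a..b}"
  have im: "(%t. c + t) ` {a..b} = {c + a..c + b}" by simp
  have 1: "(gam has_vector_derivative X (gam (c + t))) (at (c + t) within (%t. c + t) ` {a..b})" and U: "gam (c + t) \<in> U"
    using assms t unfolding integral_curve_def im by auto
  have "((%t. c + t) has_vector_derivative 1) (at t within {a..b})" by (auto intro!: derivative_eq_intros)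
  from vector_diff_chain_within[OF this 1]
  show "gam (c + t) \<in> U \<and> ((%t. gam (c + t)) has_vector_derivative X (gam (c + t))) (at t within {a..b})"
    using U by (simp add: o_def)
qed

lemma first_crossing:
  fixes g :: "real \<Rightarrow> real"
  assumes g: "continuous_on UNIV g" and ab: "a \<le> b" "g a < c" "c \<le> g b"
  obtains t where "a < t" "t \<le> b" "g t = c" "!!t'. a \<le> t' ==> t' < t ==> g t' < c"
proof -
  define S where "S = {a..b} \<inter> g -` {c..}"
  have "closed (g -` {c..})" using g by (intro closed_vimage) auto
  then have "compact S" unfolding S_def by (intro compact_Int_closed) auto
  moreover have "b \<in> S" using ab by (simp add: S_def)
  ultimately obtain t where t: "t \<in> S" "!!t'. t' \<in> S ==> t \<le> t'" using compact_attains_inf[of S] by blast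
  have before: "g t' < c" if "a \<le> t'" "t' < t" for t' using t(2)[of t'] that t(1) by (auto simp: S_def not_le[symmetric])
  have t': "a \<le> t" "t \<le> b" "c \<le> g t" using t by (auto simp: S_def)
  have "continuous_on {a..t} g" using g continuous_on_subset by blast
  then obtain u where u: "a \<le> u" "u \<le> t" "g u = c" using IVT'[of g a c t] ab t' by auto
  have "u = t" using before[of u] u by (cases "u = t") auto
  then show thesis using that[of t] t' before u ab by (cases "a = t") auto
qed

lemma last_crossing:
  fixes g :: "real \<Rightarrow> real"
  assumes g: "continuous_on UNIV g" and ab: "a \<le> b" "g a \<le> c" "c < g b"
  obtains t where "a \<le> t" "t < b" "g t = c" "!!t'. t < t' ==> t' \<le> b ==> c < g t'"
proof -
  have "continuous_on UNIV (%x. - g (- x))" by (intro continuous_intros continuous_on_compose2[OF g]) auto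
  moreover have "- b \<le> - a" "- g (- (- b)) < - c" "- c \<le> - g (- (- a))" using ab by auto
  ultimately obtain t where t: "- b < t" "t \<le> - a" "- g (- t) = - c" "!!t'. - b \<le> t' ==> t' < t ==> - g (- t') < - c"
    by (rule first_crossing) (rule that; assumption)
  show thesis
  proof (rule that[of "- t"])
    show "c < g t'" if "- t < t'" "t' \<le> b" for t' using t(4)[of "- t'"] that by simp
  qed (use t in auto)
qed

definition sg :: "side \<Rightarrow> real" where "sg J = (case J of Rgt \<Rightarrow> 1 | Lft \<Rightarrow> - 1)"
definition opp :: "side \<Rightarrow> side" where "opp J = (case J of Rgt \<Rightarrow> Lft | Lft \<Rightarrow> Rgt)"

lemma sg_simps [simp]: "sg Rgt = 1" "sg Lft = - 1" "opp Rgt = Lft" "opp Lft = Rgt" "sg (opp J) = - sg J" "opp (opp J) = J"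
  by (cases J; simp add: sg_def opp_def)+

lemma side_neq: "J' \<noteq> J \<longleftrightarrow> J' = opp J" by (cases J; cases J'; simp)

locale trajectory =
  fixes X :: "side \<Rightarrow> vfield" and U :: "(real \<times> real) set" and mu :: real and gam :: "real \<Rightarrow> real \<times> real" and m :: "real \<Rightarrow> side"
  assumes traj: "hysteretic_trajectory X U mu gam m" and mpos: "mu > 0"
begin

lemma cont: "continuous_on UNIV gam" "continuous_on UNIV (%t. c * fst (gam t))"
  using traj by (auto simp: hysteretic_trajectory_def intro!: continuous_intros)

lemma forced: "sg J * fst (gam t) \<ge> mu ==> m t = J"
  using traj by (cases J) (auto simp: hysteretic_trajectory_def)

lemma persist_strip: "s \<le> t ==> (!!r. s < r ==> r \<le> t ==> - mu < fst (gam r) \<and> fst (gam r) < mu) ==> m t = m s"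
  using traj unfolding hysteretic_trajectory_def by auto

lemma curve: "s < t ==> (!!r. s \<le> r ==> r < t ==> m r = J) ==> integral_curve (X J) U gam {s..t}"
  using traj unfolding hysteretic_trajectory_def by auto

text \<open>Unlike \<open>persist_strip\<close>, this allows visits to the region where J is forced.
  Only the last such visit matters: J is active there, and afterwards the orbit is in the open
  strip.\<close>

lemma persist:
  assumes t0: "m t0 = J" "t0 \<le> t" and up: "!!r. t0 \<le> r ==> r \<le> t ==> - mu < sg J * fst (gam r)"
  shows "m t = J"
proof -
  have strip: "- mu < fst (gam r) \<and> fst (gam r) < mu" if "- mu < sg J * fst (gam r)" "sg J * fst (gam r) < mu" for r
    using that by (cases J) auto
  show ?thesis
  proof (cases "sg J * fst (gam t) < mu \<and> (\<exists>r\<in>{t0..t}. sg J * fst (gam r) \<ge> mu)")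
    case True
    then obtain r where r: "t0 \<le> r" "r \<le> t" "sg J * fst (gam r) \<ge> mu" by auto
    have "- sg J * fst (gam r) \<le> - mu" "- mu < - sg J * fst (gam t)" using r True by auto
    then obtain u where u: "r \<le> u" "u < t" "- sg J * fst (gam u) = - mu" "!!t'. u < t' ==> t' \<le> t ==> - mu < - sg J * fst (gam t')"
      by (rule last_crossing[OF cont(2) r(2)]) (rule that; assumption)
    have "m t = m u"
    proof (rule persist_strip)
      fix v assume "u < v" "v \<le> t"
      then show "- mu < fst (gam v) \<and> fst (gam v) < mu" using strip[of v] up[of v] u(1,4) r by simp
    qed (use u in simp)
    then show ?thesis using forced[of J u] u(3) by simp
  next
    case False
    show ?thesis
    proof (cases "sg J * fst (gam t) < mu")
      case True
      have "m t = m t0"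
      proof (rule persist_strip[OF t0(2)])
        fix v assume "t0 < v" "v \<le> t"
        then have v: "v \<in> {t0..t}" "- mu < sg J * fst (gam v)" using up[of v] by auto
        then have "sg J * fst (gam v) < mu" using False True not_le by blast
        then show "- mu < fst (gam v) \<and> fst (gam v) < mu" by (rule strip[OF v(2)])
      qed
      then show ?thesis using t0 by simp
    qed (use forced[of J t] in simp)
  qed
qed

text \<open>Looking back from a time in the forced region of J: \<open>b\<close> is the last time on
  the opposite line and \<open>a\<close> the first later time on the line of J. Before
  \<open>a\<close> the other mode has been active since \<open>b\<close>, from \<open>a\<close> on
  it is J. This is the only access to the past of an unknown trajectory.\<close>

lemma previous_phase:
  assumes t: "sg J * fst (gam t) \<ge> mu" and r: "r \<le> t" "sg J * fst (gam r) \<le> - mu"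
  obtains b a where "r \<le> b" "b < a" "a \<le> t" "sg J * fst (gam b) = - mu" "sg J * fst (gam a) = mu"
    "!!u. b \<le> u ==> u < a ==> m u = opp J" "!!u. b \<le> u ==> u < a ==> sg J * fst (gam u) < mu"
    "!!u. a \<le> u ==> u \<le> t ==> m u = J" "!!u. b < u ==> u \<le> t ==> - mu < sg J * fst (gam u)"
proof -
  have "- mu < sg J * fst (gam t)" using t mpos by linarith
  then obtain b where b: "r \<le> b" "b < t" "sg J * fst (gam b) = - mu" "!!t'. b < t' ==> t' \<le> t ==> - mu < sg J * fst (gam t')"
    by (rule last_crossing[OF cont(2) r]) (rule that; assumption)
  have "b \<le> t" "sg J * fst (gam b) < mu" using b(2,3) mpos by linarith+
  then obtain a where a: "b < a" "a \<le> t" "sg J * fst (gam a) = mu" "!!t'. b \<le> t' ==> t' < a ==> sg J * fst (gam t') < mu"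
    by (rule first_crossing[OF cont(2) _ _ t]) (rule that; assumption)
  have mb: "m b = opp J" by (rule forced) (use b in simp)
  have ma: "m a = J" by (rule forced) (use a in simp)
  show thesis
  proof (rule that[OF b(1) a(1,2) b(3) a(3)])
    show "m u = opp J" if "b \<le> u" "u < a" for u
    proof (rule persist[OF mb that(1)])
      show "- mu < sg (opp J) * fst (gam r)" if "b \<le> r" "r \<le> u" for r using a(4)[of r] that \<open>u < a\<close> by simp
    qed
    show "m u = J" if "a \<le> u" "u \<le> t" for u
    proof (rule persist[OF ma that(1)])
      show "- mu < sg J * fst (gam r)" if "a \<le> r" "r \<le> u" for r using b(4)[of r] a(1) that \<open>u \<le> t\<close> by simp
    qed
  qed (use a b in auto)
qed

end

locale periodic_trajectory = trajectory +
  fixes \<tau> :: real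
  assumes tau: "\<tau> > 0" and per: "gam (t + \<tau>) = gam t" "m (t + \<tau>) = m t"
begin

lemma per_nat: "gam (t + real k * \<tau>) = gam t" "m (t + real k * \<tau>) = m t"
proof (induction k)
  case (Suc k)
  have e: "t + real (Suc k) * \<tau> = (t + real k * \<tau>) + \<tau>" by (simp add: algebra_simps)
  { case 1 show ?case using Suc(1) per(1) unfolding e by metis }
  { case 2 show ?case using Suc(2) per(2) unfolding e by metis }
qed simp_all

lemma shift_above: obtains t' where "c \<le> t'" "gam t' = gam t" "m t' = m t"
proof -
  obtain k where "c - t < real k * \<tau>" using reals_Archimedean3[OF tau] by blast
  then show thesis using that[of "t + real k * \<tau>"] per_nat by simp
qed

lemma shift_below: obtains t' where "t' \<le> c" "gam t' = gam t" "m t' = m t"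
proof -
  obtain k where "t - c < real k * \<tau>" using reals_Archimedean3[OF tau] by blast
  then show thesis using that[of "t - real k * \<tau>"] per_nat[of "t - real k * \<tau>" k] by simp
qed

lemma compact_range: "compact (range gam)"
proof -
  have "range gam \<subseteq> gam ` {0..\<tau>}"
  proof
    fix z assume "z \<in> range gam"
    then obtain t where z: "z = gam t" by auto
    obtain t' where t': "0 \<le> t'" "gam t' = z" using shift_above[of 0 t] z by metis
    define k where "k = nat \<lfloor>t' / \<tau>\<rfloor>"
    have k: "real k \<le> t' / \<tau>" "t' / \<tau> < real k + 1" using t' tau by (auto simp: k_def)
    have "0 \<le> t' - real k * \<tau>" "t' - real k * \<tau> \<le> \<tau>" using k tau by (simp_all add: field_simps)
    moreover have "gam (t' - real k * \<tau>) = z" using per_nat(1)[of "t' - real k * \<tau>" k] t' by simp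
    ultimately show "z \<in> gam ` {0..\<tau>}" by force
  qed
  then have "range gam = gam ` {0..\<tau>}" by auto
  then show ?thesis using compact_continuous_image[OF continuous_on_subset[OF cont(1), of "{0..\<tau>}"]] by simp
qed

end

context half_flow begin

text \<open>The trajectory could deviate from the arc only by switching before time T. At a first
  such time it would still agree with the arc by uniqueness, and the arc is not on the switching
  line there.\<close>

lemma phase_follow:
  assumes tr: "trajectory Xs U mu gam m" and J: "Xs J = X" "s = sg J" "m t0 = J" and T: "0 < T"
    and arc: "integral_curve X U gam1 {0..T}" "gam1 ` {0..T} \<subseteq> sqr r" "!!t. 0 \<le> t ==> t < T ==> - mu < s * fst (gam1 t)"
    and start: "gam t0 = gam1 0"
  shows "0 \<le> t ==> t \<le> T ==> gam (t0 + t) = gam1 t" and "0 \<le> t ==> t < T ==> m (t0 + t) = J"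
proof -
  interpret trajectory Xs U mu gam m by (rule tr)
  have follow: "gam (t0 + u) = gam1 u" "t < t1 ==> 0 \<le> t ==> m (t0 + t) = J"
    if t1: "0 < t1" "t1 \<le> T" "!!t. 0 \<le> t ==> t < t1 ==> - mu < s * fst (gam (t0 + t))" and u: "0 \<le> u" "u \<le> t1" for t1 u t
  proof -
    have md: "m v = J" if "t0 \<le> v" "v < t0 + t1" for v
    proof (rule persist[OF J(3)])
      fix w assume "t0 \<le> w" "w \<le> v"
      then show "- mu < sg J * fst (gam w)" using t1(3)[of "w - t0"] that J(2) by simp
    qed (use that in simp)
    then show "t < t1 ==> 0 \<le> t ==> m (t0 + t) = J" by simp
    have "integral_curve X U gam {t0 + 0..t0 + t1}" using curve[of t0 "t0 + t1" J] md t1 J by simp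
    then have ic: "integral_curve X U (%t. gam (t0 + t)) {0..t1}" by (rule integral_curve_shift)
    show "gam (t0 + u) = gam1 u"
    proof (rule integral_curve_unique[OF integral_curve_subset[OF arc(1)] _ ic, where c=0 and t=u])
      show "gam1 ` {0..t1} \<subseteq> sqr r" using arc(2) t1(2) by force
    qed (use t1 u start in auto)
  qed
  have up: "- mu < s * fst (gam (t0 + t))" if t: "0 \<le> t" "t < T" for t
  proof (rule ccontr)
    assume "\<not> ?thesis"
    then have le: "mu \<le> - s * fst (gam (t0 + t))" by simp
    have c: "continuous_on UNIV (%t. - s * fst (gam (t0 + t)))"
      by (intro continuous_intros continuous_on_compose2[OF cont(1)]) auto
    have "- s * fst (gam (t0 + 0)) < mu" using arc(3)[of 0] T start by simp
    then obtain t1 where t1: "0 < t1" "t1 \<le> t" "- s * fst (gam (t0 + t1)) = mu" "!!t'. 0 \<le> t' ==> t' < t1 ==> - s * fst (gam (t0 + t')) < mu"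
      by (rule first_crossing[OF c t(1) _ le]) (rule that; assumption)
    have "gam (t0 + t1) = gam1 t1"
    proof (rule follow(1)[OF t1(1)])
      show "- mu < s * fst (gam (t0 + t'))" if "0 \<le> t'" "t' < t1" for t' using t1(4)[OF that] by simp
    qed (use t1 t in auto)
    then show False using arc(3)[of t1] t1 t by simp
  qed
  show "0 \<le> t ==> t \<le> T ==> gam (t0 + t) = gam1 t" using follow(1)[OF T order_refl up] by blast
  show "0 \<le> t ==> t < T ==> m (t0 + t) = J" using follow(2)[OF T order_refl up] T by force
qed

text \<open>In a single mode the time function W would grow by \<tau> over one period of a periodic
  curve.\<close>

lemma no_constant_mode:
  assumes tr: "periodic_trajectory Xs U mu gam m \<tau>" and J: "Xs J = X" and r: "range gam \<subseteq> sqr r"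
  shows "\<exists>t. m t \<noteq> J"
proof (rule ccontr)
  interpret periodic_trajectory Xs U mu gam m \<tau> by (rule tr)
  assume "\<nexists>t. m t \<noteq> J"
  then have "integral_curve X U gam {0..\<tau>}" using curve[of 0 \<tau> J] tau J by simp
  from integral_curve_constant(2)[OF this, of 0 \<tau>] have "W (gam \<tau>) = W (gam 0) + \<tau>" using r tau by auto
  then show False using per(1)[of 0] tau by simp
qed

end

lemma periodic_orbitE:
  assumes "hysteretic_periodic_orbit X U mu \<tau> \<Gamma>" "mu > 0"
  obtains gam m where "periodic_trajectory X U mu gam m \<tau>" "\<Gamma> = range gam"
    "!!T'. 0 < T' ==> \<forall>t. gam (t + T') = gam t \<and> m (t + T') = m t ==> \<tau> \<le> T'"
proof -
  obtain gam m where h: "hysteretic_trajectory X U mu gam m" "\<Gamma> = range gam" "\<tau> > 0" "\<forall>t. gam (t + \<tau>) = gam t \<and> m (t + \<tau>) = m t"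
    "\<forall>T'. 0 < T' \<and> T' < \<tau> \<longrightarrow> \<not> (\<forall>t. gam (t + T') = gam t \<and> m (t + T') = m t)"
    using assms(1) unfolding hysteretic_periodic_orbit_def by (elim exE conjE) (rule that)
  show thesis
  proof (rule that[OF _ h(2)])
    show "periodic_trajectory X U mu gam m \<tau>" using h assms(2) by unfold_locales auto
    show "\<tau> \<le> T'" if "0 < T'" "\<forall>t. gam (t + T') = gam t \<and> m (t + T') = m t" for T'
      using h(5) that not_le by blast
  qed
qed

lemma sqr_fs: "z \<in> sqr r \<longleftrightarrow> \<bar>fst z\<bar> < r \<and> \<bar>snd z\<bar> < r"
  by (cases z) (simp add: sqr_iff)

text \<open>A candidate period valid from some time on holds for all times, since any time can be
  moved forward by whole periods \<tau>.\<close>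

lemma (in periodic_trajectory) period_from:
  assumes "!!t. t1 \<le> t ==> gam (t + T) = gam t \<and> m (t + T) = m t"
  shows "gam (t + T) = gam t \<and> m (t + T) = m t"
proof -
  obtain k where k: "t1 - t < real k * \<tau>" using reals_Archimedean3[OF tau] by blast
  have e: "t + T + real k * \<tau> = t + real k * \<tau> + T" by simp
  show ?thesis using assms[of "t + real k * \<tau>"] k per_nat[of "t + T" k] per_nat[of t k] unfolding e by simp
qed

definition join :: "(real \<Rightarrow> 'a) \<Rightarrow> real \<Rightarrow> (real \<Rightarrow> 'a) \<Rightarrow> real \<Rightarrow> 'a" where
  "join gam1 T1 gam2 t = (if t < T1 then gam1 t else gam2 (t - T1))"

section \<open>Full turns of the hysteretic system and the periodic orbits through the
  section\<close>

locale hysteresis = two_flow "X Rgt" "X Lft" for X :: "side \<Rightarrow> vfield"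
begin

definition rm :: real where "rm = min rR rL"

lemma rm: "0 < rm" "rm \<le> rR" "rm \<le> rL" "sqr rm \<subseteq> sqr rR" "sqr rm \<subseteq> sqr rL"
  using R.r Lf.r sqr_mono[of rm rR] sqr_mono[of rm rL] by (simp_all add: rm_def)

lemma dd1: "\<delta> * \<delta> = 1" "\<bar>\<delta>\<bar> = 1" "\<delta> * (\<delta> * x) = x"
  using R.ee by (simp_all flip: mult.assoc)

lemma pts: "R.pt x u = (x, \<delta> * u)" "Lf.pt x u = (- x, - (\<delta> * u))"
  by (simp_all add: R.pt_def Lf.pt_def)

definition loop :: "real \<Rightarrow> real \<Rightarrow> real \<Rightarrow> (real \<Rightarrow> real \<times> real) \<Rightarrow> real \<Rightarrow> (real \<Rightarrow> real \<times> real) \<Rightarrow> real \<Rightarrow> bool" where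
  "loop mu p p' gam1 T1 gam2 T2 \<longleftrightarrow> 0 < T1 \<and> 0 < T2 \<and> T1 + T2 = period mu p \<and>
     integral_curve (X Rgt) U gam1 {0..T1} \<and> gam1 ` {0..T1} \<subseteq> sqr rm \<and> gam1 0 = (mu, - (\<delta> * p)) \<and> fst (gam1 T1) = - mu \<and>
     (\<forall>t. 0 \<le> t \<and> t < T1 \<longrightarrow> - mu < fst (gam1 t)) \<and>
     integral_curve (X Lft) U gam2 {0..T2} \<and> gam2 ` {0..T2} \<subseteq> sqr rm \<and> gam2 0 = gam1 T1 \<and> gam2 T2 = (mu, - (\<delta> * p')) \<and>
     (\<forall>t. 0 \<le> t \<and> t < T2 \<longrightarrow> fst (gam2 t) < mu)"

lemma loopD:
  assumes "loop mu p p' gam1 T1 gam2 T2"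
  shows "0 < T1" "0 < T2" "T1 + T2 = period mu p" "integral_curve (X Rgt) U gam1 {0..T1}" "gam1 ` {0..T1} \<subseteq> sqr rm"
    "gam1 0 = (mu, - (\<delta> * p))" "fst (gam1 T1) = - mu" "!!t. 0 \<le> t ==> t < T1 ==> - mu < fst (gam1 t)"
    "integral_curve (X Lft) U gam2 {0..T2}" "gam2 ` {0..T2} \<subseteq> sqr rm" "gam2 0 = gam1 T1" "gam2 T2 = (mu, - (\<delta> * p'))"
    "!!t. 0 \<le> t ==> t < T2 ==> fst (gam2 t) < mu" "gam1 ` {0..T1} \<subseteq> sqr rR" "gam2 ` {0..T2} \<subseteq> sqr rL"
  using assms order_trans[OF _ rm(4), of "gam1 ` {0..T1}"] order_trans[OF _ rm(5), of "gam2 ` {0..T2}"]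
  unfolding loop_def by simp_all

lemma R_confinement:
  assumes "0 < r0" "r0 < rR"
  obtains rho where "0 < rho" "rho < r0" "!!mu gam a b. [|0 < mu; mu < rho; a \<le> b; integral_curve (X Rgt) U gam {a..b}; gam b \<in> sqr rho;
     \<forall>t\<in>{a..b}. - mu \<le> fst (gam t)|] ==> gam ` {a..b} \<subseteq> sqr r0"
proof (rule R.confinement[OF assms], goal_cases)
  case (1 rho)
  show ?case by (rule that[OF 1(2,3)], rule 1(4)) auto
qed

lemma L_confinement:
  assumes "0 < r0" "r0 < rL"
  obtains rho where "0 < rho" "rho < r0" "!!mu gam a b. [|0 < mu; mu < rho; a \<le> b; integral_curve (X Lft) U gam {a..b}; gam b \<in> sqr rho;
     \<forall>t\<in>{a..b}. fst (gam t) \<le> mu|] ==> gam ` {a..b} \<subseteq> sqr r0"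
proof (rule Lf.confinement[OF assms], goal_cases)
  case (1 rho)
  show ?case by (rule that[OF 1(2,3)], rule 1(4)) auto
qed

lemma loop_exists:
  obtains eps where "eps > 0" "!!mu p. nice2 mu p ==> p < eps ==> \<exists>gam1 T1 gam2 T2. loop mu p (ret mu p) gam1 T1 gam2 T2"
proof -
  have rm2: "0 < rm / 2" "rm / 2 < rR" "rm / 2 < rL" using rm by auto
  obtain rho1 where rho1: "0 < rho1" "!!mu p w. 0 < mu ==> mu < rho1 ==> R.step mu p w ==> p < rho1 ==> w < rho1 ==>
     \<exists>gam. let T = R.tm (- mu) w - R.tm mu (- p) in T > 0 \<and> integral_curve (X Rgt) U gam {0..T} \<and> gam 0 = R.pt mu (- p) \<and> gam T = R.pt (- mu) w \<and>
        gam ` {0..T} \<subseteq> sqr rR \<and> (\<forall>t. 0 \<le> t \<and> t < T \<longrightarrow> 1 * fst (gam t) > - mu)"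
    by (rule R.arc_exists) (rule that; assumption)
  obtain rho2 where rho2: "0 < rho2" "!!mu p w. 0 < mu ==> mu < rho2 ==> Lf.step mu p w ==> p < rho2 ==> w < rho2 ==>
     \<exists>gam. let T = Lf.tm (- mu) w - Lf.tm mu (- p) in T > 0 \<and> integral_curve (X Lft) U gam {0..T} \<and> gam 0 = Lf.pt mu (- p) \<and> gam T = Lf.pt (- mu) w \<and>
        gam ` {0..T} \<subseteq> sqr rL \<and> (\<forall>t. 0 \<le> t \<and> t < T \<longrightarrow> - 1 * fst (gam t) > - mu)"
    by (rule Lf.arc_exists) (rule that; assumption)
  obtain rho3 where rho3: "0 < rho3" "rho3 < rm / 2" "!!mu gam a b. [|0 < mu; mu < rho3; a \<le> b; integral_curve (X Rgt) U gam {a..b}; gam b \<in> sqr rho3;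
     \<forall>t\<in>{a..b}. - mu \<le> fst (gam t)|] ==> gam ` {a..b} \<subseteq> sqr (rm / 2)"
    by (rule R_confinement[OF rm2(1,2)]) (rule that; assumption)
  obtain rho4 where rho4: "0 < rho4" "rho4 < rm / 2" "!!mu gam a b. [|0 < mu; mu < rho4; a \<le> b; integral_curve (X Lft) U gam {a..b}; gam b \<in> sqr rho4;
     \<forall>t\<in>{a..b}. fst (gam t) \<le> mu|] ==> gam ` {a..b} \<subseteq> sqr (rm / 2)"
    by (rule L_confinement[OF rm2(1,3)]) (rule that; assumption)
  \<comment> \<open>Each passage enlarges the height at most by the factor 3, so a full turn stays
    below 9 times the initial height.\<close>
  define eps where "eps = min (min rho1 rho2) (min rho3 rho4) / 9"
  show thesis
  proof (rule that[of eps])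
    show "eps > 0" using rho1 rho2 rho3 rho4 by (simp add: eps_def)
    fix mu p assume nc: "nice2 mu p" and p: "p < eps"
    note h = nice2_fwd[OF nc] and b = nice2_le_1[OF nc]
    define q where "q = R.fwd mu p"
    define p' where "p' = ret mu p"
    have st: "R.step mu p q" "Lf.step mu q p'" using h by (auto simp: q_def p'_def)
    have "p' \<le> 3 * q" using Lf.step_compare(1)[OF h(3,4)] by (simp add: q_def p'_def)
    then have le: "p < eps" "q < 9 * eps" "p' < 9 * eps" "mu < 9 * eps" "p < 9 * eps" "0 < q" "0 < p'" using p h b st(2) by (auto simp: q_def Lf.step_def)
    have small: "x < 9 * eps ==> x < rho1 \<and> x < rho2 \<and> x < rho3 \<and> x < rho4" for x by (simp add: eps_def)
    note sm = small[OF le(2)] small[OF le(3)] small[OF le(4)] small[OF le(5)]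
    define T1 where "T1 = R.tm (- mu) q - R.tm mu (- p)"
    define T2 where "T2 = Lf.tm (- mu) p' - Lf.tm mu (- q)"
    obtain gam1 where g1: "T1 > 0" "integral_curve (X Rgt) U gam1 {0..T1}" "gam1 0 = (mu, - (\<delta> * p))" "gam1 T1 = (- mu, \<delta> * q)"
        "!!t. 0 \<le> t ==> t < T1 ==> fst (gam1 t) > - mu"
      using rho1(2)[OF h(7) _ st(1)] sm by (auto simp: Let_def T1_def pts)
    obtain gam2 where g2: "T2 > 0" "integral_curve (X Lft) U gam2 {0..T2}" "gam2 0 = (- mu, \<delta> * q)" "gam2 T2 = (mu, - (\<delta> * p'))"
        "!!t. 0 \<le> t ==> t < T2 ==> fst (gam2 t) < mu"
      using rho2(2)[OF h(7) _ st(2)] sm by (auto simp: Let_def T2_def pts)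
    have "gam1 ` {0..T1} \<subseteq> sqr (rm / 2)"
    proof (rule rho3(3)[OF h(7) _ _ g1(2)])
      show "\<forall>t\<in>{0..T1}. - mu \<le> fst (gam1 t)"
      proof
        fix t assume "t \<in> {0..T1}"
        then show "- mu \<le> fst (gam1 t)" using g1(5)[of t] g1(4) by (cases "t = T1") auto
      qed
      show "gam1 T1 \<in> sqr rho3" using sm h le(6) by (simp add: g1(4) sqr_fs abs_mult dd1)
    qed (use sm g1 in auto)
    then have s1: "gam1 ` {0..T1} \<subseteq> sqr rm" using rm(1) by (fastforce simp: sqr_fs)
    have "gam2 ` {0..T2} \<subseteq> sqr (rm / 2)"
    proof (rule rho4(3)[OF h(7) _ _ g2(2)])
      show "\<forall>t\<in>{0..T2}. fst (gam2 t) \<le> mu"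
      proof
        fix t assume "t \<in> {0..T2}"
        then show "fst (gam2 t) \<le> mu" using g2(5)[of t] g2(4) by (cases "t = T2") auto
      qed
      show "gam2 T2 \<in> sqr rho4" using sm h le(7) by (simp add: g2(4) sqr_fs abs_mult dd1)
    qed (use sm g2 in auto)
    then have s2: "gam2 ` {0..T2} \<subseteq> sqr rm" using rm(1) by (fastforce simp: sqr_fs)
    have "loop mu p (ret mu p) gam1 T1 gam2 T2"
      unfolding loop_def using g1 g2 s1 s2 by (simp add: T1_def T2_def period_def q_def p'_def)
    then show "\<exists>gam1 T1 gam2 T2. loop mu p (ret mu p) gam1 T1 gam2 T2" by blast
  qed
qed

lemma loop_follow:
  assumes tr: "trajectory X U mu gam m" and l: "loop mu p p' gam1 T1 gam2 T2" and t0: "gam t0 = (mu, - (\<delta> * p))"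
  shows "0 \<le> t ==> t \<le> T1 + T2 ==> gam (t0 + t) = join gam1 T1 gam2 t"
    and "0 \<le> t ==> t < T1 + T2 ==> m (t0 + t) = (if t < T1 then Rgt else Lft)"
    and "gam (t0 + (T1 + T2)) = (mu, - (\<delta> * p'))" "fst (gam (t0 + T1)) = - mu"
proof -
  note l = loopD[OF l]
  interpret trajectory X U mu gam m by (rule tr)
  have m0: "m t0 = Rgt" by (rule forced) (use t0 in simp)
  have up: "- mu < 1 * fst (gam1 t)" if "0 \<le> t" "t < T1" for t using l(8) that by simp
  have s0: "gam t0 = gam1 0" using t0 l(6) by simp
  have s1: "1 = sg Rgt" "- 1 = sg Lft" by simp_all
  note A = R.phase_follow[OF tr refl s1(1) m0 l(1) l(4) l(14) up s0]
  have e: "gam (t0 + T1) = gam1 T1" using A(1)[of T1] l(1) by simp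
  then show e1: "fst (gam (t0 + T1)) = - mu" using l(7) by simp
  have m1: "m (t0 + T1) = Lft" by (rule forced) (use e1 in simp)
  have up2: "- mu < - 1 * fst (gam2 t)" if "0 \<le> t" "t < T2" for t using l(13) that by simp
  have s2: "gam (t0 + T1) = gam2 0" using e l(11) by simp
  note B = Lf.phase_follow[OF tr refl s1(2) m1 l(2) l(9) l(15) up2 s2]
  have e: "gam (t0 + t) = join gam1 T1 gam2 t" if "0 \<le> t" "t \<le> T1 + T2" for t
    using A(1)[of t] B(1)[of "t - T1"] that by (simp add: join_def)
  then show "0 \<le> t ==> t \<le> T1 + T2 ==> gam (t0 + t) = join gam1 T1 gam2 t" .
  show "0 \<le> t ==> t < T1 + T2 ==> m (t0 + t) = (if t < T1 then Rgt else Lft)"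
    using A(2)[of t] B(2)[of "t - T1"] by simp
  show "gam (t0 + (T1 + T2)) = (mu, - (\<delta> * p'))" using e[of "T1 + T2"] l(1,2,12) by (simp add: join_def)
qed

lemma loop_section:
  assumes l: "loop mu p p gam1 T1 gam2 T2" and nc: "nice2 mu p" and t: "0 \<le> t" "t \<le> T1 + T2"
    and z: "fst (join gam1 T1 gam2 t) = mu" "\<delta> * snd (join gam1 T1 gam2 t) \<le> 0"
  shows "join gam1 T1 gam2 t = (mu, - (\<delta> * p))"
proof (cases "t < T1")
  case False
  then show ?thesis using loopD(13)[OF l, of "t - T1"] loopD(12)[OF l] z(1) t by (cases "t = T1 + T2") (auto simp: join_def)
next
  case True
  note l = loopD[OF l] and h = nice2_fwd[OF nc]
  define v where "v = - (\<delta> * snd (gam1 t))"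
  have z': "fst (gam1 t) = mu" "v \<ge> 0" using z True by (auto simp: join_def v_def)
  have pt: "gam1 t = R.pt mu (- v)" "gam1 0 = R.pt mu (- p)" using z' l(6) by (auto simp: pts v_def prod_eq_iff dd1)
  have "gam1 t \<in> sqr rR" using l(14) t True by auto
  then have vr: "v < rR" using z' by (simp add: v_def sqr_fs abs_le_iff) (use dd1 in \<open>simp add: sqr_fs abs_if split: if_splits\<close>)
  have "HR (gam1 t) = HR (gam1 0)" by (rule R.integral_curve_constant(1)[OF l(4) _ l(14)]) (use t True in auto)
  then have lev: "R.K mu (- 1 * v) = R.K mu (- 1 * p)" by (simp add: pt R.K_pt)
  have o: "R.outer mu p" by (rule R.good_outer[OF h(2)])
  have "v = p"
  proof (rule linorder_cases[of v p])
    assume "v < p"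
    then have "R.K mu (- 1 * v) < R.K mu (- 1 * p)" by (intro R.outer_increasing[OF o]) (use z' h in auto)
    then show ?thesis using lev by simp
  next
    assume "p < v"
    then have "R.K mu (- 1 * p) < R.K mu (- 1 * v)"
      by (intro R.outer_increasing[OF R.outer_mono[OF o]]) (use vr h in auto)
    then show ?thesis using lev by simp
  qed
  then show ?thesis using pt(1) True by (simp add: join_def pts)
qed

text \<open>From the fixed point on the trajectory is forced to repeat the loop. No shorter period
  exists: the mode after time \<tau> is the right one, so \<tau> falls into the first right phase,
  along which the height increases strictly.\<close>

lemma through_fixed:
  assumes tr: "periodic_trajectory X U mu gam m \<tau>" and l: "loop mu p p gam1 T1 gam2 T2" and t1: "gam t1 = (mu, - (\<delta> * p))"
    and min: "!!T'. 0 < T' ==> \<forall>t. gam (t + T') = gam t \<and> m (t + T') = m t ==> \<tau> \<le> T'"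
  shows "range gam = join gam1 T1 gam2 ` {0..T1 + T2}" "\<tau> = period mu p"
proof -
  interpret periodic_trajectory X U mu gam m \<tau> by (rule tr)
  note ld = loopD[OF l]
  define T where "T = T1 + T2"
  have T: "T > 0" using ld by (simp add: T_def)
  note F = loop_follow[OF trajectory_axioms l, folded T_def]
  have pt: "gam (t1 + real j * T) = (mu, - (\<delta> * p))" for j
  proof (induction j)
    case (Suc j)
    have "t1 + real (Suc j) * T = (t1 + real j * T) + T" by (simp add: algebra_simps)
    then show ?case using F(3)[OF Suc] by (simp only:)
  qed (use t1 in simp)
  have dec: "\<exists>j u. t = t1 + real j * T + u \<and> 0 \<le> u \<and> u < T" if "t1 \<le> t" for t
  proof -
    define j where "j = nat \<lfloor>(t - t1) / T\<rfloor>"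
    have "real j \<le> (t - t1) / T" "(t - t1) / T < real j + 1" using that T by (auto simp: j_def)
    then have "0 \<le> t - t1 - real j * T" "t - t1 - real j * T < T" using T by (simp_all add: field_simps)
    then show ?thesis by (intro exI[of _ j] exI[of _ "t - t1 - real j * T"]) simp
  qed
  have "gam (t + T) = gam t \<and> m (t + T) = m t" if "t1 \<le> t" for t
  proof -
    obtain j u where ju: "t = t1 + real j * T + u" "0 \<le> u" "u < T" using dec[OF \<open>t1 \<le> t\<close>] by blast
    have e: "t + T = t1 + real (Suc j) * T + u" using ju by (simp add: algebra_simps)
    have "gam (t + T) = join gam1 T1 gam2 u \<and> m (t + T) = (if u < T1 then Rgt else Lft)"
      unfolding e by (intro conjI F(1)[OF pt] F(2)[OF pt]) (use ju in auto)
    moreover have "gam t = join gam1 T1 gam2 u \<and> m t = (if u < T1 then Rgt else Lft)"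
      unfolding ju(1) by (intro conjI F(1)[OF pt] F(2)[OF pt]) (use ju in auto)
    ultimately show ?thesis by simp
  qed
  then have perT: "gam (t + T) = gam t \<and> m (t + T) = m t" for t by (rule period_from)
  have "\<tau> \<le> T" by (rule min[OF T allI[OF perT]])
  moreover have "\<not> \<tau> < T"
  proof
    assume lt: "\<tau> < T"
    have "m t1 = Rgt" by (rule forced) (use t1 in simp)
    then have "\<tau> < T1" using F(2)[OF t1, of \<tau>] per(2)[of t1] lt tau by (simp split: if_splits)
    then have "gam1 \<tau> = gam1 0" using F(1)[OF t1, of \<tau>] per(1)[of t1] lt tau t1 ld(6) by (simp add: join_def)
    then show False using R.curve_rises[OF ld(4,14), of 0 \<tau>] tau \<open>\<tau> < T1\<close> by simp
  qed
  ultimately show "\<tau> = period mu p" using ld(3) by (simp add: T_def)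
  show "range gam = join gam1 T1 gam2 ` {0..T1 + T2}"
  proof (intro equalityI subsetI)
    fix z assume "z \<in> range gam"
    then obtain t where "z = gam t" by auto
    then obtain t' where t': "t1 \<le> t'" "gam t' = z" using shift_above[of t1 t] by metis
    obtain j u where ju: "t' = t1 + real j * T + u" "0 \<le> u" "u < T" using dec[OF t'(1)] by blast
    then have "z = join gam1 T1 gam2 u" using F(1)[OF pt[of j], of u] t' by simp
    then show "z \<in> join gam1 T1 gam2 ` {0..T1 + T2}" using ju by (auto simp: T_def)
  next
    fix z assume "z \<in> join gam1 T1 gam2 ` {0..T1 + T2}"
    then obtain u where "0 \<le> u" "u \<le> T" "z = join gam1 T1 gam2 u" by (auto simp: T_def)
    then have "z = gam (t1 + u)" using F(1)[OF t1, of u] by simp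
    then show "z \<in> range gam" by simp
  qed
qed

text \<open>Covers orbits that turn several times. The heights between p0 and the fixed point that
  lie on the orbit form a compact set; at the one nearest to the fixed point the return map would
  lead strictly closer without overshooting, and again onto the orbit.\<close>

lemma fixed_reached:
  assumes tr: "periodic_trajectory X U mu gam m \<tau>"
    and dom: "!!p. rng kM eps mu p ==> nice2 mu p \<and> - deriv QR (- p) + deriv QL p < 0 \<and> (\<exists>gam1 T1 gam2 T2. loop mu p (ret mu p) gam1 T1 gam2 T2)"
    and ps: "rng kM eps mu ps" "ret mu ps = ps" and p0: "rng kM eps mu p0" "(mu, - (\<delta> * p0)) \<in> range gam"
  shows "(mu, - (\<delta> * ps)) \<in> range gam"
proof -
  interpret periodic_trajectory X U mu gam m \<tau> by (rule tr)
  define a where "a = min p0 ps"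
  define b where "b = max p0 ps"
  have rg: "rng kM eps mu p" if "a \<le> p" "p \<le> b" for p
  proof -
    have "rng kM eps mu a" "b < eps" using ps p0 by (auto simp: a_def b_def min_def max_def rng_def)
    then show ?thesis using rng_upward[of kM eps mu a p] that by simp
  qed
  define S where "S = {a..b} \<inter> (%p. (mu, - (\<delta> * p))) -` range gam"
  have "closed ((%p. (mu, - (\<delta> * p))) -` range gam)"
    by (rule closed_vimage[OF compact_imp_closed[OF compact_range]]) (intro continuous_intros)
  then have cS: "compact S" unfolding S_def by (intro compact_Int_closed) auto
  have "p0 \<in> S" using p0 by (auto simp: S_def a_def b_def)
  then have "\<exists>p\<in>S. \<forall>p'\<in>S. \<bar>p - ps\<bar> \<le> \<bar>p' - ps\<bar>"
    by (intro continuous_attains_inf[OF cS]) (auto intro!: continuous_intros)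
  then obtain p where p: "p \<in> S" "!!p'. p' \<in> S ==> \<bar>p - ps\<bar> \<le> \<bar>p' - ps\<bar>" by blast
  have pab: "a \<le> p" "p \<le> b" "(mu, - (\<delta> * p)) \<in> range gam" and psab: "a \<le> ps" "ps \<le> b" using p(1) by (auto simp: S_def a_def b_def)
  note np = dom[OF rg[OF pab(1,2)]] and nps = dom[OF ps(1)]
  have nicep: "nice2 mu p" "nice2 mu ps" using np nps by auto
  have dps: "dd mu ps = 0" using ret_compare[OF nicep(2)] ps(2) by (cases "dd mu ps" "0::real" rule: linorder_cases) auto
  have retS: "ret mu p \<in> S" if "a \<le> ret mu p" "ret mu p \<le> b"
  proof -
    obtain t where t: "gam t = (mu, - (\<delta> * p))" using pab(3) by (metis imageE)
    obtain gam1 T1 gam2 T2 where "loop mu p (ret mu p) gam1 T1 gam2 T2" using np by blast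
    from loop_follow(3)[OF trajectory_axioms this t] have "(mu, - (\<delta> * ret mu p)) \<in> range gam" by (metis rangeI)
    then show ?thesis using that by (auto simp: S_def)
  qed
  have "p = ps"
  proof (rule linorder_cases[of p ps])
    assume lt: "p < ps"
    have "dd mu ps < dd mu p" by (rule dd_decreasing[OF _ lt]) (use dom rg pab psab in force)
    then have "p < ret mu p" using ret_compare(1)[OF nicep(1)] dps by simp
    moreover have "ret mu p < ps" using ret_mono[OF nicep lt] ps(2) by simp
    ultimately show ?thesis using p(2)[OF retS] pab psab by auto
  next
    assume lt: "ps < p"
    have "dd mu p < dd mu ps" by (rule dd_decreasing[OF _ lt]) (use dom rg pab psab in force)
    then have "ret mu p < p" using ret_compare(2)[OF nicep(1)] dps by simp
    moreover have "ps < ret mu p" using ret_mono[OF nicep(2,1) lt] ps(2) by simp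
    ultimately show ?thesis using p(2)[OF retS] pab psab by auto
  qed
  then show ?thesis using pab by simp
qed

text \<open>Singles out ends of left phases among all meetings with x = mu. The sign of p is left
  open; it is derived from the arc that precedes.\<close>

definition arrival :: "(real \<Rightarrow> real \<times> real) \<Rightarrow> (real \<Rightarrow> side) \<Rightarrow> real \<Rightarrow> real \<Rightarrow> real \<Rightarrow> bool" where
  "arrival gam m mu a p \<longleftrightarrow> gam a = (mu, - (\<delta> * p)) \<and> (\<exists>b<a. fst (gam b) = - mu \<and> (\<forall>u. b \<le> u \<and> u < a \<longrightarrow> m u = Lft \<and> fst (gam u) < mu))"

lemma pt_of_fst:
  "fst z = mu ==> z = (mu, - (\<delta> * - (\<delta> * snd z)))" "fst z = - mu ==> z = Lf.pt mu (- (\<delta> * snd z))"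
  by (simp_all add: prod_eq_iff pts dd1)

text \<open>By \<open>no_constant_mode\<close> both modes occur, and a mode can only be left by
  reaching its switching line; so both lines are met, and \<open>previous_phase\<close>
  applies.\<close>

lemma arrival_exists:
  assumes tr: "periodic_trajectory X U mu gam m \<tau>" and r: "range gam \<subseteq> sqr rm"
  obtains a p where "arrival gam m mu a p" "p > 0"
proof -
  interpret periodic_trajectory X U mu gam m \<tau> by (rule tr)
  have rR: "range gam \<subseteq> sqr rR" "range gam \<subseteq> sqr rL" using order_trans[OF r rm(4)] order_trans[OF r rm(5)] by simp_all
  have both: "\<exists>t. m t = J" for J
    using R.no_constant_mode[OF tr refl rR(1)] Lf.no_constant_mode[OF tr refl rR(2)] side_neq by (cases J) auto
  have ex: "\<exists>t. sg J * fst (gam t) \<le> - mu" for J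
  proof (rule ccontr)
    assume "\<not> ?thesis"
    then have up: "- mu < sg J * fst (gam t)" for t by (simp add: not_le)
    obtain t0 where t0: "m t0 = J" using both by blast
    obtain t1 where "m t1 = opp J" using both by blast
    then obtain t where "t0 \<le> t" "m t = opp J" using shift_above[of t0 t1] by metis
    then show False using persist[OF t0, of t] up side_neq[of "opp J" J] by simp
  qed
  obtain t where t: "sg Rgt * fst (gam t) \<ge> mu" using ex[of Lft] by auto
  obtain r0 where "sg Rgt * fst (gam r0) \<le> - mu" using ex[of Rgt] by auto
  then obtain r where r: "r \<le> t" "sg Rgt * fst (gam r) \<le> - mu" using shift_below[of t r0] by metis
  obtain b a where ba: "b < a" "sg Rgt * fst (gam b) = - mu" "sg Rgt * fst (gam a) = mu"
    "!!u. b \<le> u ==> u < a ==> m u = opp Rgt" "!!u. b \<le> u ==> u < a ==> sg Rgt * fst (gam u) < mu"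
    by (rule previous_phase[OF t r]) (rule that; assumption)
  define p where "p = - (\<delta> * snd (gam a))"
  have ga: "gam a = (mu, - (\<delta> * p))" using pt_of_fst(1)[of "gam a" mu] ba(3) by (simp add: p_def)
  have arr: "arrival gam m mu a p" unfolding arrival_def using ga ba by auto
  have ic: "integral_curve (X Lft) U gam {b..a}" by (rule curve[OF ba(1)]) (use ba in simp)
  have "\<bar>fst (gam a)\<bar> < rL" using rR(2) by (force simp: sqr_fs)
  then have "0 < p" using ga mpos
    by (intro Lf.arrival_outer(1)[OF ic _ ba(1) mpos _ pt_of_fst(2)]) (use rR ba in \<open>auto simp: pts\<close>)
  then show thesis using that arr by blast
qed

end

lemma integral_curve_continuous:
  "integral_curve X U gam I ==> continuous_on I gam"
  unfolding integral_curve_def by (rule continuous_on_vector_derivative) blast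

lemma open_rng: "open {p. rng kM eps mu p}"
proof -
  have eq: "{p. rng kM eps mu p} = (if 0 < mu then {0<..<eps} \<inter> {p. mu < p ^ (2 * kM) * sqrt p} else {})" by (auto simp: rng_def)
  have "open {p. mu < p ^ (2 * kM) * sqrt p}" by (rule open_Collect_less) (intro continuous_intros)+
  then show ?thesis unfolding eq by auto
qed

context hysteresis begin

text \<open>The loop is extended by reduction modulo T, with phase \<open>ph\<close> computed from
  the floor. The seams at T1 and T are where modes switch, so continuity is checked on three
  adjacent closed arcs.\<close>

lemma loop_periodic_orbit:
  assumes l: "loop mu p p gam1 T1 gam2 T2" and mpos: "mu > 0"
  shows "hysteretic_periodic_orbit X U mu (period mu p) (join gam1 T1 gam2 ` {0..T1 + T2})"
proof -
  note ld = loopD[OF l]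
  define T where "T = T1 + T2"
  have T: "T > 0" "T1 < T" using ld by (auto simp: T_def)
  define c where "c = join gam1 T1 gam2"
  define fl where "fl t = real_of_int \<lfloor>t / T\<rfloor>" for t
  define ph where "ph t = t - fl t * T" for t
  define gam where "gam t = c (ph t)" for t
  define m where "m t = (if ph t < T1 then Rgt else Lft)" for t
  have ph: "0 \<le> ph t" "ph t < T" "t = fl t * T + ph t" for t
  proof -
    have "fl t \<le> t / T" "t / T < fl t + 1" by (auto simp: fl_def)
    then show "0 \<le> ph t" "ph t < T" using T(1) by (simp_all add: ph_def field_simps)
  qed (simp add: ph_def)
  have rep: "ph (real_of_int j * T + u) = u" if "0 \<le> u" "u < T" for j u
  proof -
    have "\<lfloor>(real_of_int j * T + u) / T\<rfloor> = j" by (rule floor_unique) (use that T in \<open>simp_all add: field_simps\<close>)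
    then show ?thesis by (simp add: ph_def fl_def)
  qed
  have flj: "\<exists>j. fl t = real_of_int j" for t by (simp add: fl_def)
  have cT: "c T = c 0" using ld(1,2,6,12) by (simp add: c_def join_def T_def)
  have cyc: "gam (real_of_int j * T + u) = c u" if "0 \<le> u" "u \<le> T" for j u
  proof (cases "u = T")
    case True
    have "real_of_int j * T + u = real_of_int (j + 1) * T + 0" using True by (simp add: algebra_simps)
    then show ?thesis unfolding gam_def using rep[of 0 "j + 1"] T cT True by simp
  qed (use rep[of u j] that in \<open>simp add: gam_def\<close>)
  have cR: "gam (real_of_int j * T + u) = gam1 u" if "0 \<le> u" "u \<le> T1" for j u
    using cyc[of u j] that T ld(11) by (auto simp: c_def join_def)
  have cL: "gam (real_of_int j * T + T1 + u) = gam2 u" if "0 \<le> u" "u \<le> T2" for j u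
    using cyc[of "T1 + u" j] that ld(1) by (simp add: c_def join_def T_def add.assoc)
  have mR: "m (real_of_int j * T + u) = Rgt" if "0 \<le> u" "u < T1" for j u using rep[of u j] that T by (simp add: m_def)
  have mL: "m (real_of_int j * T + T1 + u) = Lft" if "0 \<le> u" "u < T2" for j u
    using rep[of "T1 + u" j] that ld(1) by (simp add: m_def T_def add.assoc)
  have icR: "integral_curve (X Rgt) U gam {real_of_int j * T..real_of_int j * T + T1}" for j
  proof (rule integral_curve_cong[OF integral_curve_shift[where c="- (real_of_int j * T)" and gam=gam1]])
    show "gam t = gam1 (- (real_of_int j * T) + t)" if "t \<in> {real_of_int j * T..real_of_int j * T + T1}" for t
      using cR[of "t - real_of_int j * T" j] that by simp
  qed (use ld(4) in simp)
  have icL: "integral_curve (X Lft) U gam {real_of_int j * T + T1..real_of_int j * T + T}" for j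
  proof (rule integral_curve_cong[OF integral_curve_shift[where c="- (real_of_int j * T + T1)" and gam=gam2]])
    show "gam t = gam2 (- (real_of_int j * T + T1) + t)" if "t \<in> {real_of_int j * T + T1..real_of_int j * T + T}" for t
    proof -
      define x where "x = real_of_int j * T + T1"
      have "0 \<le> t - x" "t - x \<le> T2" using that T_def by (auto simp: x_def)
      from cL[OF this, of j] have "gam t = gam2 (t - x)" unfolding x_def[symmetric] by simp
      then show ?thesis unfolding x_def[symmetric] by simp
    qed
  qed (use ld(9) in \<open>simp add: T_def\<close>)
  have cont: "isCont gam t" for t
  proof -
    obtain j where j: "fl t = real_of_int j" using flj by blast
    define A where "A = {real_of_int (j - 1) * T + T1..real_of_int (j - 1) * T + T}"
    define B where "B = {real_of_int j * T..real_of_int j * T + T1}"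
    define C where "C = {real_of_int j * T + T1..real_of_int j * T + T}"
    have "continuous_on (A \<union> (B \<union> C)) gam"
      unfolding A_def B_def C_def
      by (intro continuous_on_closed_Un closed_Un closed_atLeastAtMost integral_curve_continuous[OF icR] integral_curve_continuous[OF icL])
    moreover have "{real_of_int (j - 1) * T + T1<..<real_of_int j * T + T} \<subseteq> A \<union> (B \<union> C)"
      by (auto simp: A_def B_def C_def left_diff_distrib)
    ultimately have "continuous_on {real_of_int (j - 1) * T + T1<..<real_of_int j * T + T} gam" by (rule continuous_on_subset)
    moreover have "t \<in> {real_of_int (j - 1) * T + T1<..<real_of_int j * T + T}"
      using ph[of t] T unfolding j by (simp add: left_diff_distrib)
    ultimately show ?thesis using continuous_on_eq_continuous_at[OF open_greaterThanLessThan] by blast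
  qed
  have traj: "hysteretic_trajectory X U mu gam m"
    unfolding hysteretic_trajectory_def
  proof (intro conjI allI impI)
    show "continuous_on UNIV gam" using cont continuous_at_imp_continuous_on by blast
  next
    fix t assume x: "mu \<le> fst (gam t)"
    show "m t = Rgt"
    proof (rule ccontr)
      assume "m t \<noteq> Rgt"
      then have "T1 \<le> ph t" by (auto simp: m_def split: if_splits)
      then show False using x ld(13)[of "ph t - T1"] ph[of t] by (simp add: gam_def c_def join_def T_def)
    qed
  next
    fix t assume x: "fst (gam t) \<le> - mu"
    show "m t = Lft"
    proof (rule ccontr)
      assume "m t \<noteq> Lft"
      then have "ph t < T1" by (auto simp: m_def split: if_splits)
      then show False using x ld(8)[of "ph t"] ph[of t] by (simp add: gam_def c_def join_def)
    qed
  next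
    fix s t assume h: "s \<le> t \<and> (\<forall>r\<in>{s<..t}. - mu < fst (gam r) \<and> fst (gam r) < mu)"
    obtain j where j: "fl s = real_of_int j" using flj by blast
    have s: "s = real_of_int j * T + ph s" using ph(3)[of s] j by simp
    show "m t = m s"
    proof (cases "ph s < T1")
      case True
      have "t < real_of_int j * T + T1"
      proof (rule ccontr)
        assume "\<not> ?thesis"
        then have "real_of_int j * T + T1 \<in> {s<..t}" using s True by auto
        then have "- mu < fst (gam (real_of_int j * T + T1))" using h by blast
        then show False using cR[of T1 j] ld(1,7) by simp
      qed
      then have "m t = Rgt" using mR[of "t - real_of_int j * T" j] h s ph(1)[of s] by simp
      then show ?thesis using True by (simp add: m_def)
    next
      case False
      have "t < real_of_int j * T + T"
      proof (rule ccontr)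
        assume "\<not> ?thesis"
        then have "real_of_int j * T + T \<in> {s<..t}" using s ph(2)[of s] by auto
        then have "fst (gam (real_of_int j * T + T)) < mu" using h by blast
        moreover have "real_of_int j * T + T = real_of_int j * T + T1 + T2" by (simp add: T_def)
        ultimately have "fst (gam (real_of_int j * T + T1 + T2)) < mu" by (simp only:)
        then show False using cL[of T2 j] ld(2,12) by simp
      qed
      then have "m t = Lft" using mL[of "t - real_of_int j * T - T1" j] h s False by (simp add: T_def)
      then show ?thesis using False by (simp add: m_def)
    qed
  next
    fix J s t assume h: "s < t \<and> (\<forall>r\<in>{s..<t}. m r = J)"
    obtain j where j: "fl s = real_of_int j" using flj by blast
    have s: "s = real_of_int j * T + ph s" using ph(3)[of s] j by simp
    have ms: "m s = J" using h by auto
    show "integral_curve (X J) U gam {s..t}"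
    proof (cases "ph s < T1")
      case True
      then have J: "J = Rgt" using ms by (simp add: m_def)
      have "t \<le> real_of_int j * T + T1"
      proof (rule ccontr)
        assume "\<not> ?thesis"
        then have "m (real_of_int j * T + T1 + 0) = J" using h s True by auto
        then show False using mL[of 0 j] ld(2) J by simp
      qed
      then show ?thesis unfolding J by (intro integral_curve_subset[OF icR[of j]]) (use s ph(1)[of s] in auto)
    next
      case False
      then have J: "J = Lft" using ms by (simp add: m_def)
      have "t \<le> real_of_int j * T + T"
      proof (rule ccontr)
        assume "\<not> ?thesis"
        moreover have "real_of_int (j + 1) * T + 0 = real_of_int j * T + T" by (simp add: algebra_simps)
        ultimately have "m (real_of_int (j + 1) * T + 0) = J" using h s ph(2)[of s] by auto
        then show False using mR[of 0 "j + 1"] ld(1) J by simp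
      qed
      then show ?thesis unfolding J by (intro integral_curve_subset[OF icL[of j]]) (use s False in auto)
    qed
  qed
  have per: "ph (t + T) = ph t" for t
  proof -
    obtain j where j: "fl t = real_of_int j" using flj by blast
    have "t + T = real_of_int (j + 1) * T + ph t" using ph(3)[of t] j by (simp add: algebra_simps)
    then show ?thesis using rep[of "ph t" "j + 1"] ph[of t] by simp
  qed
  have range: "range gam = c ` {0..T}"
  proof (intro equalityI subsetI)
    fix z assume "z \<in> range gam"
    then obtain t where "z = c (ph t)" by (auto simp: gam_def)
    then show "z \<in> c ` {0..T}" using ph(1,2)[of t] by auto
  next
    fix z assume "z \<in> c ` {0..T}"
    then obtain u where "0 \<le> u" "u \<le> T" "z = gam (real_of_int 0 * T + u)" using cyc[of _ 0] by auto
    then show "z \<in> range gam" by blast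
  qed
  have min: "\<not> (\<forall>t. gam (t + T') = gam t \<and> m (t + T') = m t)" if T': "0 < T'" "T' < T" for T'
  proof
    assume "\<forall>t. gam (t + T') = gam t \<and> m (t + T') = m t"
    then have "gam (0 + T') = gam 0 \<and> m (0 + T') = m 0" by blast
    then have e: "gam T' = gam 0" "m T' = m 0" by auto
    have p: "ph T' = T'" "ph 0 = 0" using rep[of T' 0] rep[of 0 0] T' T by simp_all
    have lt: "T' < T1" using e(2) p ld(1) by (simp add: m_def split: if_splits)
    then have "gam1 T' = gam1 0" using e(1) p ld(1) by (simp add: gam_def c_def join_def)
    then show False using R.curve_rises[OF ld(4,14), of 0 T'] T' lt by simp
  qed
  have pT: "period mu p = T" using ld(3) by (simp add: T_def)
  have pers: "gam (t + T) = gam t" "m (t + T) = m t" for t by (simp_all add: gam_def m_def per)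
  show ?thesis
    unfolding hysteretic_periodic_orbit_def pT T_def[symmetric] c_def[symmetric]
  proof (rule exI[of _ gam], rule exI[of _ m], intro conjI traj range[symmetric] T(1) allI pers impI)
    fix T' assume "0 < T' \<and> T' < T"
    then show "\<not> (\<forall>t. gam (t + T') = gam t \<and> m (t + T') = m t)" using min by blast
  qed
qed

end

context hysteresis begin

text \<open>Every periodic orbit through the section passes through the fixed point by
  \<open>fixed_reached\<close>, and is then determined by \<open>through_fixed\<close>. Isolation is
  deduced from the same uniqueness.\<close>

lemma attracting_orbit:
  assumes dom: "!!p. rng kM eps mu p ==> nice2 mu p \<and> - deriv QR (- p) + deriv QL p < 0 \<and> (\<exists>gam1 T1 gam2 T2. loop mu p (ret mu p) gam1 T1 gam2 T2)"
    and ps: "rng kM eps mu ps" "ret mu ps = ps"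
  obtains \<Gamma> where "hysteretic_periodic_orbit X U mu (period mu ps) \<Gamma>"
    "!!\<tau> \<Gamma>' p. [|hysteretic_periodic_orbit X U mu \<tau> \<Gamma>'; rng kM eps mu p; (mu, - (\<delta> * p)) \<in> \<Gamma>'|] ==> \<Gamma>' = \<Gamma> \<and> \<tau> = period mu ps"
    "(mu, - (\<delta> * ps)) \<in> \<Gamma>" "!!p. rng kM eps mu p ==> (mu, - (\<delta> * p)) \<in> \<Gamma> ==> p = ps"
    "hyperbolic_attracting_limit_cycle X U mu \<Gamma>"
proof -
  note nps = dom[OF ps(1)]
  obtain gam1 T1 gam2 T2 where l: "loop mu ps ps gam1 T1 gam2 T2" using nps ps(2) by auto
  note ld = loopD[OF l]
  have nc: "nice2 mu ps" using nps by simp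
  have mpos: "mu > 0" using nice2_fwd(7)[OF nc] .
  define \<Gamma> where "\<Gamma> = join gam1 T1 gam2 ` {0..T1 + T2}"
  have per: "hysteretic_periodic_orbit X U mu (period mu ps) \<Gamma>" unfolding \<Gamma>_def by (rule loop_periodic_orbit[OF l mpos])
  have uniq: "\<Gamma>' = \<Gamma> \<and> \<tau> = period mu ps"
    if o: "hysteretic_periodic_orbit X U mu \<tau> \<Gamma>'" and p: "rng kM eps mu p" "(mu, - (\<delta> * p)) \<in> \<Gamma>'" for \<tau> \<Gamma>' p
  proof -
    obtain gam m where g: "periodic_trajectory X U mu gam m \<tau>" "\<Gamma>' = range gam"
      "!!T'. 0 < T' ==> \<forall>t. gam (t + T') = gam t \<and> m (t + T') = m t ==> \<tau> \<le> T'"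
      using o mpos by (rule periodic_orbitE) (rule that; assumption)
    have "(mu, - (\<delta> * ps)) \<in> range gam" by (rule fixed_reached[OF g(1) dom ps p(1)], assumption) (use p(2) g(2) in simp)
    then obtain t where t: "gam t = (mu, - (\<delta> * ps))" by (metis imageE)
    have "range gam = join gam1 T1 gam2 ` {0..T1 + T2}" by (rule through_fixed(1)[OF g(1) l t]) (rule g(3); assumption)
    moreover have "\<tau> = period mu ps" by (rule through_fixed(2)[OF g(1) l t]) (rule g(3); assumption)
    ultimately show ?thesis using g(2) by (simp add: \<Gamma>_def)
  qed
  have sect: "z = (mu, - (\<delta> * ps))" if zz: "z \<in> \<Gamma>" "fst z = mu" "\<delta> * snd z \<le> 0" for z
  proof -
    obtain t where t: "z = join gam1 T1 gam2 t" "t \<in> {0..T1 + T2}" using zz(1) unfolding \<Gamma>_def by (rule imageE)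
    have t': "0 \<le> t" "t \<le> T1 + T2" using t(2) by auto
    show ?thesis unfolding t(1) by (rule loop_section[OF l nc t']) (use zz(2,3) in \<open>simp_all only: t(1)\<close>)
  qed
  have in\<Gamma>: "(mu, - (\<delta> * ps)) \<in> \<Gamma>" unfolding \<Gamma>_def
    by (rule image_eqI[of _ _ 0]) (use ld(1,2,6) in \<open>simp_all add: join_def\<close>)
  have only: "p = ps" if "rng kM eps mu p" "(mu, - (\<delta> * p)) \<in> \<Gamma>" for p
  proof -
    have "\<delta> * p = \<delta> * ps" using sect[OF that(2)] that(1) by (simp add: rng_def dd1)
    then have "\<delta> * (\<delta> * p) = \<delta> * (\<delta> * ps)" by (rule arg_cong)
    then show ?thesis by (simp only: dd1)
  qed
  \<comment> \<open>An open set that leaves of the half line x = mu, \<delta> y \<le> 0 only the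
    section. A periodic orbit inside it has an arrival with p > 0, which must then lie in the
    section.\<close>
  define W where "W = sqr rm \<inter> ({z. fst z \<noteq> mu} \<union> {z. 0 < \<delta> * snd z} \<union> (%z. - (\<delta> * snd z)) -` {p. rng kM eps mu p})"
  have o1: "open {z :: real \<times> real. fst z \<noteq> mu}" by (rule open_Collect_neq) (intro continuous_intros)+
  have o2: "open {z :: real \<times> real. 0 < \<delta> * snd z}" by (rule open_Collect_less) (intro continuous_intros)+
  have o3: "open ((%z :: real \<times> real. - (\<delta> * snd z)) -` {p. rng kM eps mu p})"
    by (rule open_vimage[OF open_rng]) (intro continuous_intros)
  have W: "open W" unfolding W_def by (rule open_Int[OF open_sqr open_Un[OF open_Un[OF o1 o2] o3]])
  have \<Gamma>W: "\<Gamma> \<subseteq> W"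
  proof
    fix z assume z: "z \<in> \<Gamma>"
    obtain t where tz: "z = join gam1 T1 gam2 t" "t \<in> {0..T1 + T2}" using z unfolding \<Gamma>_def by (rule imageE)
    then have t: "0 \<le> t" "t \<le> T1 + T2" "z = join gam1 T1 gam2 t" by auto
    have "z \<in> sqr rm"
    proof (cases "t < T1")
      case True
      then have "gam1 t \<in> gam1 ` {0..T1}" using t by simp
      then show ?thesis using ld(5) True t(3) by (auto simp: join_def)
    next
      case False
      then have "gam2 (t - T1) \<in> gam2 ` {0..T2}" using t by simp
      then show ?thesis using ld(10) False t(3) by (auto simp: join_def)
    qed
    moreover have "fst z \<noteq> mu \<or> 0 < \<delta> * snd z \<or> rng kM eps mu (- (\<delta> * snd z))"
    proof (cases "fst z = mu \<and> \<delta> * snd z \<le> 0")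
      case True
      then have "z = (mu, - (\<delta> * ps))" using sect[OF z] by blast
      then have "- (\<delta> * snd z) = ps" by (simp add: dd1)
      then show ?thesis using ps(1) by simp
    qed auto
    ultimately show "z \<in> W" by (auto simp: W_def)
  qed
  have iso: "\<Gamma>' = \<Gamma>" if o: "hysteretic_periodic_orbit X U mu T' \<Gamma>'" and sub: "\<Gamma>' \<subseteq> W" for T' \<Gamma>'
  proof -
    obtain gam m where g: "periodic_trajectory X U mu gam m T'" "\<Gamma>' = range gam" using o mpos by (rule periodic_orbitE) (rule that)
    have "range gam \<subseteq> sqr rm" using sub g(2) by (auto simp: W_def)
    then obtain a p where a: "arrival gam m mu a p" "p > 0" using arrival_exists[OF g(1)] by blast
    have ga: "gam a = (mu, - (\<delta> * p))" using a by (simp add: arrival_def)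
    have "gam a \<in> W" using sub g(2) by blast
    then have "rng kM eps mu p" using ga a(2) by (auto simp: W_def dd1)
    moreover have "(mu, - (\<delta> * p)) \<in> \<Gamma>'" using ga g(2) by (metis rangeI)
    ultimately show ?thesis using uniq[OF o] by blast
  qed
  have D: "- deriv QR (- ps) + deriv QL ps < 0" using nps by simp
  obtain d where d: "(ret mu has_real_derivative d) (at ps)" "0 < d" "d < 1"
    by (rule ret_multiplier[OF nc D ps(2)]) (rule that)
  define y where "y = - (\<delta> * ps)"
  define rho where "rho z = - (\<delta> * ret mu (- (\<delta> * z)))" for z
  have yp: "- (\<delta> * y) = ps" by (simp add: y_def dd1)
  have "open ((%z. - (\<delta> * z)) -` {p. rng kM eps mu p})"
    by (rule open_vimage[OF open_rng]) (intro continuous_intros)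
  then have ev: "\<forall>\<^sub>F z in nhds y. rng kM eps mu (- (\<delta> * z))"
    using ps(1) yp unfolding eventually_nhds by (intro exI[of _ "(%z. - (\<delta> * z)) -` {p. rng kM eps mu p}"]) auto
  have "hysteretic_return X U mu z (rho z)" if rz: "rng kM eps mu (- (\<delta> * z))" for z
  proof -
    obtain \<beta>1 S1 \<beta>2 S2 where "loop mu (- (\<delta> * z)) (ret mu (- (\<delta> * z))) \<beta>1 S1 \<beta>2 S2" using dom[OF rz] by blast
    note e = loopD[OF this]
    obtain w where b: "\<beta>1 S1 = (- mu, w)" using e(7) by (metis prod.collapse)
    have "first_hit (X Rgt) U (- mu) (mu, z) (- mu, w)"
      unfolding first_hit_def
    proof (intro exI[of _ \<beta>1] exI[of _ S1] conjI ballI)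
      show "\<beta>1 0 = (mu, z)" using e(6) dd1(3)[of z] by simp
      show "fst (\<beta>1 t) \<noteq> - mu" if "t \<in> {0..<S1}" for t using e(8)[of t] that by auto
    qed (use e(1,4) b in auto)
    moreover have "first_hit (X Lft) U mu (- mu, w) (mu, rho z)"
      unfolding first_hit_def
    proof (intro exI[of _ \<beta>2] exI[of _ S2] conjI ballI)
      show "\<beta>2 0 = (- mu, w)" using e(11) b by (rule trans)
      show "\<beta>2 S2 = (mu, rho z)" using e(12) by (simp add: rho_def)
      show "fst (\<beta>2 t) \<noteq> mu" if "t \<in> {0..<S2}" for t using e(13)[of t] that by auto
    qed (use e(2,9) in auto)
    ultimately show ?thesis unfolding hysteretic_return_def by blast
  qed
  then have ev: "\<forall>\<^sub>F z in nhds y. hysteretic_return X U mu z (rho z)" using ev by (rule eventually_mono[rotated])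
  have "((%z. - (\<delta> * z)) has_real_derivative - \<delta>) (at y)" by (auto intro!: derivative_eq_intros)
  moreover have "(ret mu has_real_derivative d) (at (- (\<delta> * y)))" using d(1) yp by simp
  ultimately have "((%z. ret mu (- (\<delta> * z))) has_real_derivative d * - \<delta>) (at y)" by (rule DERIV_chain2[rotated])
  then have "(rho has_real_derivative - (\<delta> * (d * - \<delta>))) (at y)" unfolding rho_def[abs_def]
    by (intro DERIV_minus DERIV_cmult)
  moreover have "- (\<delta> * (d * - \<delta>)) = d * (\<delta> * \<delta>)" by simp
  ultimately have dr: "(rho has_real_derivative d) (at y)" by (simp only: dd1 mult_1_right)
  have hyp: "hyperbolic_attracting_limit_cycle X U mu \<Gamma>"
    unfolding hyperbolic_attracting_limit_cycle_def
  proof (intro conjI)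
    show "\<exists>T. hysteretic_periodic_orbit X U mu T \<Gamma>" using per by blast
    show "\<exists>W. open W \<and> \<Gamma> \<subseteq> W \<and> (\<forall>T' \<Gamma>'. hysteretic_periodic_orbit X U mu T' \<Gamma>' \<and> \<Gamma>' \<subseteq> W \<longrightarrow> \<Gamma>' = \<Gamma>)"
      by (rule exI[of _ W]) (use W \<Gamma>W iso in blast)
    have "rho y = y" unfolding rho_def yp ps(2) by (simp add: y_def)
    moreover have "(mu, y) \<in> \<Gamma>" "\<bar>d\<bar> < 1" using in\<Gamma> d by (simp_all add: y_def)
    ultimately show "\<exists>y rho D. (mu, y) \<in> \<Gamma> \<and> rho y = y \<and> (\<forall>\<^sub>F z in nhds y. hysteretic_return X U mu z (rho z)) \<and>
        (rho has_real_derivative D) (at y) \<and> \<bar>D\<bar> < 1" using ev dr by blast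
  qed
  show thesis by (rule that[OF per uniq in\<Gamma> only hyp])
qed

end

section \<open>Absence of periodic orbits when the coefficient is positive\<close>

context hysteresis begin

text \<open>One turn backwards. The right passage ends above QR(- p'), which for V > 0 lies above -
  QL(p'); hence the following left passage starts at a level not below that of p', and then gains at
  least 3 mu / 2. The lower level keeps p' in the same neighbourhood, so the step can be
  iterated.\<close>

lemma arrival_predecessor:
  assumes Vp: "V > 0"
  obtains rho where "rho > 0" "rho < rL" "!!mu gam m \<tau> a p. [|periodic_trajectory X U mu gam m \<tau>; mu < rho; \<exists>t. fst (gam t) \<le> - mu; arrival gam m mu a p; \<bar>p\<bar> < rho|] ==>
     \<exists>a' p'. arrival gam m mu a' p' \<and> \<bar>p'\<bar> < rho \<and> Lf.K 0 p' + 3 / 2 * mu \<le> Lf.K 0 p"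
proof -
  obtain epsD where D: "epsD > 0" "!!p. 0 < p ==> p < epsD ==> sgn (disp0 p) = sgn V" by (rule disp0_sign) (rule that; assumption)
  \<comment> \<open>The radii are nested against the direction of time: the last left arc stays in
    the square of \<open>rho2\<close>, the right arc before it in that of \<open>r2\<close>, and the
    left arc before that in the box of the left flow.\<close>
  have r3: "0 < rL / 2" "rL / 2 < rL" using Lf.r by auto
  obtain rho3 where rho3: "0 < rho3" "rho3 < rL / 2" "!!mu gam a b. [|0 < mu; mu < rho3; a \<le> b; integral_curve (X Lft) U gam {a..b}; gam b \<in> sqr rho3;
     \<forall>t\<in>{a..b}. fst (gam t) \<le> mu|] ==> gam ` {a..b} \<subseteq> sqr (rL / 2)"
    by (rule L_confinement[OF r3]) (rule that; assumption)
  define r2 where "r2 = min (min rho3 epsD) (rR / 2)"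
  have r2: "0 < r2" "r2 < rR" "r2 \<le> rho3" "r2 \<le> epsD" using rho3 D R.r by (auto simp: r2_def)
  obtain rho2 where rho2: "0 < rho2" "rho2 < r2" "!!mu gam a b. [|0 < mu; mu < rho2; a \<le> b; integral_curve (X Rgt) U gam {a..b}; gam b \<in> sqr rho2;
     \<forall>t\<in>{a..b}. - mu \<le> fst (gam t)|] ==> gam ` {a..b} \<subseteq> sqr r2"
    by (rule R_confinement[OF r2(1,2)]) (rule that; assumption)
  have r1: "rho2 < rL" using rho2 r2 rho3 Lf.r by simp
  obtain rho where rho: "0 < rho" "rho < rho2" "!!mu gam a b. [|0 < mu; mu < rho; a \<le> b; integral_curve (X Lft) U gam {a..b}; gam b \<in> sqr rho;
     \<forall>t\<in>{a..b}. fst (gam t) \<le> mu|] ==> gam ` {a..b} \<subseteq> sqr rho2"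
    by (rule L_confinement[OF rho2(1) r1]) (rule that; assumption)
  show thesis
  proof (rule that[OF rho(1)])
    show "rho < rL" using rho r1 by simp
    fix mu gam m \<tau> a p
    assume tr: "periodic_trajectory X U mu gam m \<tau>" and mr: "mu < rho" and vis: "\<exists>t. fst (gam t) \<le> - mu"
      and arr: "arrival gam m mu a p" and p: "\<bar>p\<bar> < rho"
    interpret periodic_trajectory X U mu gam m \<tau> by (rule tr)
    have mlt: "mu < rL" "mu < rR" "mu < rho2" "mu < r2" "mu < rho3" "\<bar>mu\<bar> = mu" using mr mpos rho rho2 r1 r2 by auto
    have ga: "gam a = (mu, - (\<delta> * p))" using arr by (simp add: arrival_def)
    obtain b where b: "b < a" "fst (gam b) = - mu" "!!u. b \<le> u ==> u < a ==> m u = Lft \<and> fst (gam u) < mu"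
      using arr by (auto simp: arrival_def)
    have tb: "mu \<le> sg Lft * fst (gam b)" using b by simp
    obtain rb where rb0: "rb \<le> b" "gam rb = gam a" by (rule shift_below[of b a]) (rule that)
    have rb: "rb \<le> b" "sg Lft * fst (gam rb) \<le> - mu" using rb0 ga by simp_all
    obtain b2 a2 where ba2: "b2 < a2" "a2 \<le> b" "sg Lft * fst (gam b2) = - mu" "sg Lft * fst (gam a2) = mu"
      "!!u. b2 \<le> u ==> u < a2 ==> m u = opp Lft" "!!u. b2 \<le> u ==> u < a2 ==> sg Lft * fst (gam u) < mu"
      "!!u. a2 \<le> u ==> u \<le> b ==> m u = Lft" "!!u. b2 < u ==> u \<le> b ==> - mu < sg Lft * fst (gam u)"
      by (rule previous_phase[OF tb rb]) (rule that; assumption)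
    have x2: "fst (gam b2) = mu" "fst (gam a2) = - mu" using ba2(3,4) by auto
    have a2a: "a2 < a" using ba2 b by simp
    have Lc: "integral_curve (X Lft) U gam {a2..a}"
    proof (rule curve[OF a2a])
      show "m u = Lft" if "a2 \<le> u" "u < a" for u using ba2(7)[of u] b(3)[of u] that by (cases "u \<le> b") auto
    qed
    have Lx: "\<forall>u\<in>{a2..a}. fst (gam u) \<le> mu"
    proof
      fix u assume u: "u \<in> {a2..a}"
      consider "u \<le> b" | "b < u" "u < a" | "u = a" using u by force
      then show "fst (gam u) \<le> mu"
      proof cases
        case 1 then show ?thesis using ba2(8)[of u] ba2(1) u by simp
      next
        case 2 then show ?thesis using b(3)[of u] by simp
      qed (use ga in simp)
    qed
    have "gam a \<in> sqr rho" using p mr mlt by (simp add: ga sqr_fs abs_mult dd1)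
    then have L2: "gam ` {a2..a} \<subseteq> sqr rho2" using rho(3)[OF mpos mr _ Lc _ Lx] a2a by simp
    then have g2: "gam a2 \<in> sqr rho2" "gam ` {a2..a} \<subseteq> sqr rL" using a2a r1 sqr_mono[of rho2 rL] by auto
    define v where "v = - (\<delta> * snd (gam a2))"
    note LA = Lf.arrival_outer[OF Lc g2(2) a2a mpos mlt(1) pt_of_fst(2)[OF x2(2)], folded v_def, of p]
    have LA: "0 < p" "v < p" "Lf.K 0 v + 3 / 2 * mu \<le> Lf.K 0 p" using LA ga by (simp_all add: pts)
    have tb2: "mu \<le> sg Rgt * fst (gam b2)" using x2 by simp
    obtain t0 where t0: "fst (gam t0) \<le> - mu" using vis by blast
    obtain rb2 where rb3: "rb2 \<le> b2" "gam rb2 = gam t0" by (rule shift_below[of b2 t0]) (rule that)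
    have rb2: "rb2 \<le> b2" "sg Rgt * fst (gam rb2) \<le> - mu" using rb3 t0 by simp_all
    obtain b3 a3 where ba3: "b3 < a3" "a3 \<le> b2" "sg Rgt * fst (gam b3) = - mu" "sg Rgt * fst (gam a3) = mu"
      "!!u. b3 \<le> u ==> u < a3 ==> m u = opp Rgt" "!!u. b3 \<le> u ==> u < a3 ==> sg Rgt * fst (gam u) < mu"
      "!!u. a3 \<le> u ==> u \<le> b2 ==> m u = Rgt" "!!u. b3 < u ==> u \<le> b2 ==> - mu < sg Rgt * fst (gam u)"
      by (rule previous_phase[OF tb2 rb2]) (rule that; assumption)
    have x3: "fst (gam b3) = - mu" "fst (gam a3) = mu" using ba3(3,4) by auto
    have a32: "a3 < a2" using ba3 ba2 by simp
    have Rc: "integral_curve (X Rgt) U gam {a3..a2}"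
    proof (rule curve[OF a32])
      show "m u = Rgt" if "a3 \<le> u" "u < a2" for u using ba3(7)[of u] ba2(5)[of u] that by (cases "u \<le> b2") auto
    qed
    have Rx: "\<forall>u\<in>{a3..a2}. - mu \<le> fst (gam u)"
    proof
      fix u assume u: "u \<in> {a3..a2}"
      consider "u \<le> b2" | "b2 < u" "u < a2" | "u = a2" using u by force
      then show "- mu \<le> fst (gam u)"
      proof cases
        case 1 then show ?thesis using ba3(8)[of u] ba3(1) u by simp
      next
        case 2 then show ?thesis using ba2(6)[of u] by simp
      qed (use x2 in simp)
    qed
    have R2: "gam ` {a3..a2} \<subseteq> sqr r2" using rho2(3)[OF mpos mlt(3) _ Rc g2(1) Rx] a32 by simp
    then have g3: "gam a3 \<in> sqr r2" "gam ` {a3..a2} \<subseteq> sqr rR" using a32 r2 sqr_mono[of r2 rR] by auto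
    define p' where "p' = - (\<delta> * snd (gam a3))"
    have ga3: "gam a3 = (mu, - (\<delta> * p'))" using pt_of_fst(1)[OF x3(2)] by (simp add: p'_def)
    have ra3: "gam a3 = R.pt mu (- p')" "gam a2 = R.pt (- mu) (- v)" using ga3 x2 by (simp_all add: pts v_def prod_eq_iff dd1)
    note RA = R.arrival_outer[OF Rc g3(2) a32 mpos mlt(2) ra3]
    have Lc3: "integral_curve (X Lft) U gam {b3..a3}" by (rule curve[OF ba3(1)]) (use ba3(5) in simp)
    have Lx3: "\<forall>u\<in>{b3..a3}. fst (gam u) \<le> mu"
    proof
      fix u assume "u \<in> {b3..a3}"
      then show "fst (gam u) \<le> mu" using ba3(6)[of u] x3 by (cases "u = a3") auto
    qed
    have "gam a3 \<in> sqr rho3" using g3(1) r2(3) by (auto simp: sqr_fs)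
    then have "gam ` {b3..a3} \<subseteq> sqr (rL / 2)" using rho3(3)[OF mpos mlt(5) _ Lc3 _ Lx3] ba3(1) by simp
    then have g4: "gam ` {b3..a3} \<subseteq> sqr rL" using sqr_mono[of "rL / 2" rL] r3 by auto
    have p': "0 < p'" using Lf.arrival_outer(1)[OF Lc3 g4 ba3(1) mpos mlt(1) pt_of_fst(2)[OF x3(1)], of p'] ga3 by (simp add: pts)
    have "\<bar>p'\<bar> < r2" using g3(1) by (simp add: ga3 sqr_fs abs_mult dd1)
    then have p'r: "p' < rR" "p' < epsD" "p' < rL" "p' < rL / 2" using p' r2 rho3 r3 by auto
    have arr3: "arrival gam m mu a3 p'" unfolding arrival_def using ga3 ba3(1,5,6) x3 by (intro conjI exI[of _ b3]) auto
    have "\<bar>v\<bar> < rho2" using g2(1) by (simp add: v_def sqr_fs abs_mult dd1)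
    then have vq: "0 < - v" "- v < rL" using RA(1) r1 by auto
    note QA = R.Q_bounds[OF p' p'r(1)] and QB = Lf.Q_bounds[OF p' p'r(3)]
    have Aq: "QR (- p') < - v"
    proof (rule ccontr)
      assume n: "\<not> ?thesis"
      have "9 / 8 * p' < rR" using \<open>\<bar>p'\<bar> < r2\<close> p' R.r by (simp add: r2_def)
      then have "R.K 0 (1 * (- v)) \<le> R.K 0 (1 * QR (- p'))" by (intro R.G_mono) (use n vq QA in auto)
      moreover have "R.K 0 (QR (- p')) = R.K 0 (- p')" by (rule R.Q_K) (use p' p'r in auto)
      ultimately show False using RA(4) mpos by simp
    qed
    have "sgn (disp0 p') = 1" using D(2)[OF p' p'r(2)] Vp by simp
    \<comment> \<open>The only place where the sign of V enters: the displacement without hysteresis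
      is positive.\<close>
    then have BA: "- QL p' < QR (- p')" by (simp add: disp0_def sgn_if split: if_splits)
    have "Lf.K 0 (- 1 * (- QL p')) \<le> Lf.K 0 (- 1 * (- v))" by (rule Lf.G_mono) (use BA Aq QB p' vq in auto)
    moreover have "Lf.K 0 (QL p') = Lf.K 0 p'" by (rule Lf.Q_K) (use p' p'r in auto)
    ultimately have gain: "Lf.K 0 p' + 3 / 2 * mu \<le> Lf.K 0 p" using LA(3) by simp
    have "p' < p"
    proof (rule ccontr)
      assume "\<not> p' < p"
      then have "Lf.K 0 (1 * p) \<le> Lf.K 0 (1 * p')" by (intro Lf.G_mono) (use LA(1) p'r in auto)
      then show False using gain mpos by simp
    qed
    then have "\<bar>p'\<bar> < rho" using p p' by simp
    then show "\<exists>a' p'. arrival gam m mu a' p' \<and> \<bar>p'\<bar> < rho \<and> Lf.K 0 p' + 3 / 2 * mu \<le> Lf.K 0 p" using arr3 gain by blast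
  qed
qed

text \<open>Infinite descent: j predecessors force the level of an arrival to be at least 3 j mu / 2
  for every j, since levels on x = 0 are nonnegative.\<close>

lemma no_periodic_orbit:
  assumes Vp: "V > 0"
  obtains eps where "eps > 0" "!!mu p \<tau> \<Gamma>. [|rng kM eps mu p; hysteretic_periodic_orbit X U mu \<tau> \<Gamma>|] ==> (mu, - (\<delta> * p)) \<notin> \<Gamma>"
proof -
  obtain rho where rho: "rho > 0" "rho < rL" "!!mu gam m \<tau> a p. [|periodic_trajectory X U mu gam m \<tau>; mu < rho; \<exists>t. fst (gam t) \<le> - mu; arrival gam m mu a p; \<bar>p\<bar> < rho|] ==>
     \<exists>a' p'. arrival gam m mu a' p' \<and> \<bar>p'\<bar> < rho \<and> Lf.K 0 p' + 3 / 2 * mu \<le> Lf.K 0 p"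
    by (rule arrival_predecessor[OF Vp]) (rule that; assumption)
  have none: False
    if tr: "periodic_trajectory X U mu gam m \<tau>" and mr: "mu < rho" and vis: "\<exists>t. fst (gam t) \<le> - mu" and "arrival gam m mu a p" "\<bar>p\<bar> < rho" for mu gam m \<tau> a p
  proof -
    have mpos: "mu > 0" using tr by (simp add: periodic_trajectory_def trajectory_def)
    have lev: "real j * (3 / 2 * mu) \<le> Lf.K 0 p" if "arrival gam m mu a p" "\<bar>p\<bar> < rho" for j a p
      using that
    proof (induction j arbitrary: a p)
      case 0
      have "0 \<le> cL / 2 * p ^ (2 * kL)" using Lf.c by (simp add: zero_le_even_power)
      then show ?case using Lf.G_bounds(1)[of p] 0(2) rho(2) by simp
    next
      case (Suc j)
      obtain a' p' where "arrival gam m mu a' p'" "\<bar>p'\<bar> < rho" "Lf.K 0 p' + 3 / 2 * mu \<le> Lf.K 0 p"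
        using rho(3)[OF tr mr vis Suc.prems] by blast
      then show ?case using Suc.IH[of a' p'] by (simp add: algebra_simps)
    qed
    obtain j where "Lf.K 0 p < real j * (3 / 2 * mu)" using reals_Archimedean3[of "3 / 2 * mu"] mpos by auto
    then show False using lev[OF that(4,5), of j] by simp
  qed
  define r0 where "r0 = min rho (rR / 2)"
  have r0: "0 < r0" "r0 < rR" "r0 \<le> rho" using rho R.r by (auto simp: r0_def)
  obtain sig where sig: "0 < sig" "sig < r0" "!!mu gam a b. [|0 < mu; mu < sig; a \<le> b; integral_curve (X Rgt) U gam {a..b}; gam b \<in> sqr sig;
     \<forall>t\<in>{a..b}. - mu \<le> fst (gam t)|] ==> gam ` {a..b} \<subseteq> sqr r0"
    by (rule R_confinement[OF r0(1,2)]) (rule that; assumption)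
  obtain e1 where e1: "e1 > 0" "!!mu p. nice2 mu p ==> p < e1 ==> \<exists>gam1 T1 gam2 T2. loop mu p (ret mu p) gam1 T1 gam2 T2"
    by (rule loop_exists) (rule that; assumption)
  obtain e2 where e2: "e2 > 0" "!!mu p. rng kM e2 mu p ==> nice2 mu p" by (rule nice2_of_rng) (rule that; assumption)
  show thesis
  proof (rule that[of "min sig (min e1 e2)"])
    show "min sig (min e1 e2) > 0" using sig e1 e2 by simp
    fix mu p0 \<tau> \<Gamma> assume rg: "rng kM (min sig (min e1 e2)) mu p0" and o: "hysteretic_periodic_orbit X U mu \<tau> \<Gamma>"
    have nc: "nice2 mu p0" by (rule e2(2)[OF rng_less[OF rg]]) simp
    have p0: "0 < p0" "p0 < sig" "p0 < e1" "0 < mu" using rg by (auto simp: rng_def)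
    have ms: "mu < sig" "mu < rho" using nice2_le_1(6,7)[OF nc] p0 sig(2) r0(3) by linarith+
    obtain gam m where g: "periodic_trajectory X U mu gam m \<tau>" "\<Gamma> = range gam" using o p0(4) by (rule periodic_orbitE) (rule that)
    interpret periodic_trajectory X U mu gam m \<tau> by (rule g(1))
    show "(mu, - (\<delta> * p0)) \<notin> \<Gamma>"
    proof
      assume "(mu, - (\<delta> * p0)) \<in> \<Gamma>"
      then obtain t0 where t0: "gam t0 = (mu, - (\<delta> * p0))" using g(2) by auto
      obtain gam1 T1 gam2 T2 where l: "loop mu p0 (ret mu p0) gam1 T1 gam2 T2" using e1(2)[OF nc p0(3)] by blast
      have v: "fst (gam (t0 + T1)) = - mu" by (rule loop_follow(4)[OF trajectory_axioms l t0])
      obtain r where r1: "r \<le> t0" "gam r = gam (t0 + T1)" by (rule shift_below[of t0 "t0 + T1"]) (rule that)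
      have r: "r \<le> t0" "sg Rgt * fst (gam r) \<le> - mu" using r1 v by simp_all
      have tt: "mu \<le> sg Rgt * fst (gam t0)" using t0 by simp
      obtain b a where ba: "b < a" "a \<le> t0" "sg Rgt * fst (gam b) = - mu" "sg Rgt * fst (gam a) = mu"
        "!!u. b \<le> u ==> u < a ==> m u = opp Rgt" "!!u. b \<le> u ==> u < a ==> sg Rgt * fst (gam u) < mu"
        "!!u. a \<le> u ==> u \<le> t0 ==> m u = Rgt" "!!u. b < u ==> u \<le> t0 ==> - mu < sg Rgt * fst (gam u)"
        by (rule previous_phase[OF tt r]) (rule that; assumption)
      define p where "p = - (\<delta> * snd (gam a))"
      have ga: "gam a = (mu, - (\<delta> * p))" using pt_of_fst(1)[of "gam a" mu] ba(4) by (simp add: p_def)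
      have arr: "arrival gam m mu a p" unfolding arrival_def using ga ba(1,3,5,6) by (intro conjI exI[of _ b]) auto
      \<comment> \<open>The meeting with the section need not be an arrival, as the orbit may be in
        the middle of a right phase. The arrival that opened this phase is kept near the origin by
        confinement.\<close>
      have "gam a \<in> sqr rho"
      proof (cases "a = t0")
        case True
        then show ?thesis using t0 p0 ms sig(2) r0(3) by (simp add: sqr_fs abs_mult dd1)
      next
        case False
        then have lt: "a < t0" using ba by simp
        have Rc: "integral_curve (X Rgt) U gam {a..t0}" by (rule curve[OF lt]) (use ba(7) in simp)
        have "\<forall>u\<in>{a..t0}. - mu \<le> fst (gam u)" using ba(8) ba(1) by (auto intro: less_imp_le)
        moreover have "gam t0 \<in> sqr sig" using t0 p0 ms by (simp add: sqr_fs abs_mult dd1)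
        ultimately have "gam ` {a..t0} \<subseteq> sqr r0" using sig(3)[OF p0(4) ms(1) _ Rc] lt by simp
        moreover have "gam a \<in> gam ` {a..t0}" using lt by simp
        ultimately show ?thesis using sqr_mono[OF r0(3)] by blast
      qed
      then have pr: "\<bar>p\<bar> < rho" by (simp add: ga sqr_fs abs_mult dd1)
      have "\<exists>t. fst (gam t) \<le> - mu" by (rule exI[of _ "t0 + T1"]) (use v in simp)
      then show False by (rule none[OF g(1) ms(2) _ arr pr])
    qed
  qed
qed

end

section \<open>Proof of the theorem\<close>

text \<open>Behind the fact that the first nonzero Lyapunov coefficient has even index. With u = P y
  and v = S y the difference E = P - S satisfies E(y) = u - v and, both maps being involutions, E(u)
  = S v - S u. As S decreases, E(y) and E(u) have the same sign; a leading term of odd order would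
  make them opposite, since u < 0 < y.\<close>

lemma involution_difference_even:
  assumes P: "has_power_series \<alpha> P" and S: "has_power_series \<beta> S"
    and c: "\<alpha> 0 = 0" "\<beta> 0 = 0" "\<alpha> 1 = - 1" "\<beta> 1 = - 1"
    and d: "d1 > 0" "d2 > 0" "!!y. \<bar>y\<bar> < d1 ==> \<bar>P y\<bar> < d1 ==> P (P y) = y" "!!y. \<bar>y\<bar> < d2 ==> \<bar>S y\<bar> < d2 ==> S (S y) = y"
    and m: "odd m" "!!j. j < m ==> \<alpha> j = \<beta> j"
  shows "\<alpha> m = \<beta> m"
proof (rule ccontr)
  assume "\<alpha> m \<noteq> \<beta> m"
  define C where "C = \<alpha> m - \<beta> m"
  define E where "E y = P y - S y" for y
  have C: "C \<noteq> 0" using \<open>\<alpha> m \<noteq> \<beta> m\<close> by (simp add: C_def)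
  have "((%y. E y / y ^ m) \<longlongrightarrow> C) (at 0)"
    unfolding C_def E_def by (rule ps_leading[OF ps_diff[OF P S]]) (use m in simp)
  then have "((%y. C * (E y / y ^ m)) \<longlongrightarrow> C * C) (at 0)" by (intro tendsto_intros)
  then have ev1: "\<forall>\<^sub>F y in at 0. 0 < C * (E y / y ^ m)" by (rule order_tendstoD) (use C in \<open>auto simp: zero_less_mult_iff\<close>)
  have "((%y. P y / y ^ 1) \<longlongrightarrow> \<alpha> 1) (at 0)" by (rule ps_leading[OF P]) (use c in simp)
  then have ev2: "\<forall>\<^sub>F y in at 0. P y / y ^ 1 < 0" by (rule order_tendstoD) (use c in simp)
  obtain rho where rho: "rho > 0" "!!y. \<bar>y\<bar> < rho ==> (S has_real_derivative deriv S y) (at y)"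
    "has_power_series (%i. real (Suc i) * \<beta> (Suc i)) (deriv S)"
    by (rule ps_deriv[OF S]) (rule that; assumption)
  have dS0: "deriv S 0 = - 1" using ps_0[OF rho(3)] c by simp
  have "((deriv S) \<longlongrightarrow> - 1) (at 0)" using ps_isCont[OF rho(3)] dS0 by (simp add: isCont_def)
  then have ev3: "\<forall>\<^sub>F y in at 0. deriv S y < 0" by (rule order_tendstoD) simp
  have "\<forall>\<^sub>F y in at 0. 0 < C * (E y / y ^ m) \<and> P y / y ^ 1 < 0 \<and> deriv S y < 0"
    using ev1 ev2 ev3 by eventually_elim simp
  then obtain \<eta> where \<eta>: "\<eta> > 0" "!!y. y \<noteq> 0 ==> \<bar>y\<bar> < \<eta> ==> 0 < C * (E y / y ^ m) \<and> P y / y ^ 1 < 0 \<and> deriv S y < 0"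
    unfolding eventually_at by (auto simp: dist_real_def)
  \<comment> \<open>At z = 0 the punctured-neighbourhood estimate is silent; the value
    \<open>deriv S 0 = - 1\<close> is used there.\<close>
  have Sdec: "S y < S x" if "x < y" "\<bar>x\<bar> < min \<eta> rho" "\<bar>y\<bar> < min \<eta> rho" for x y
  proof (rule DERIV_neg_imp_decreasing[OF that(1)])
    fix z assume "x \<le> z" "z \<le> y"
    then have z: "\<bar>z\<bar> < rho" "\<bar>z\<bar> < \<eta>" using that by auto
    show "\<exists>y. (S has_real_derivative y) (at z) \<and> y < 0" using rho(2)[OF z(1)] \<eta>(2)[of z] z(2) dS0 by (cases "z = 0") force+
  qed
  define h where "h = min (min \<eta> rho) (min d1 d2)"
  have h: "h > 0" "h \<le> \<eta>" "h \<le> d1" "h \<le> d2" "!!x. \<bar>x\<bar> < h ==> \<bar>x\<bar> < min \<eta> rho" using \<eta> rho d by (auto simp: h_def)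
  have "(P \<longlongrightarrow> 0) (at 0)" "(S \<longlongrightarrow> 0) (at 0)"
    using ps_isCont[OF P] ps_isCont[OF S] ps_0[OF P] ps_0[OF S] c by (simp_all add: isCont_def)
  then have "\<forall>\<^sub>F y in at 0. \<bar>P y\<bar> < h" "\<forall>\<^sub>F y in at 0. \<bar>S y\<bar> < h" using h(1) by (auto simp: tendsto_iff dist_real_def)
  then have "\<forall>\<^sub>F y in at 0. \<bar>P y\<bar> < h \<and> \<bar>S y\<bar> < h" by eventually_elim simp
  then obtain g where g: "g > 0" "!!y. y \<noteq> 0 ==> \<bar>y\<bar> < g ==> \<bar>P y\<bar> < h \<and> \<bar>S y\<bar> < h"
    unfolding eventually_at by (auto simp: dist_real_def)
  define y where "y = min g h / 2"
  have y: "0 < y" "y < g" "y < h" "\<bar>y\<bar> = y" using g h by (auto simp: y_def)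
  define u where "u = P y"
  define v where "v = S y"
  have uv: "\<bar>u\<bar> < h" "\<bar>v\<bar> < h" using g(2)[of y] y by (auto simp: u_def v_def)
  have inv: "P u = y" "S v = y" using d(3)[of y] d(4)[of y] uv y h by (auto simp: u_def v_def)
  have e1: "0 < C * (E y / y ^ m)" "u < 0" using \<eta>(2)[of y] y h by (auto simp: u_def divide_less_0_iff)
  have e2: "0 < C * (E u / u ^ m)" using \<eta>(2)[of u] uv h e1(2) by simp
  have um: "u ^ m < 0" using e1(2) m(1) by (simp add: power_less_zero_eq)
  have ym: "y ^ m > 0" using y by simp
  have Ey: "E y = u - v" and Eu: "E u = S v - S u" using inv by (simp_all add: E_def u_def v_def)
  have "0 < C * e / q ==> 0 < q ==> 0 < C * e" "0 < C * e / q ==> q < 0 ==> C * e < 0" for e q :: real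
    by (simp_all add: zero_less_divide_iff)
  from this(1)[OF _ ym, of "E y"] this(2)[OF _ um, of "E u"] have CE: "0 < C * E y" "C * E u < 0" using e1(1) e2 by simp_all
  show False
  proof (cases "C > 0")
    case True
    then have "E y > 0" "E u < 0" using CE by (simp_all add: zero_less_mult_iff mult_less_0_iff)
    then show False using Sdec[of v u] h(5)[OF uv(1)] h(5)[OF uv(2)] Ey Eu by simp
  next
    case False
    then have "E y < 0" "E u > 0" using C CE by (simp_all add: zero_less_mult_iff mult_less_0_iff)
    then show False using Sdec[of u v] h(5)[OF uv(1)] h(5)[OF uv(2)] Ey Eu by simp
  qed
qed

lemma section_h_eq:
  assumes "\<delta> * \<delta> = (1::real)" "mu > 0"
  shows "section_h \<delta> kM mu eps = {(mu, - (\<delta> * p)) |p. rng kM eps mu p}"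
proof -
  have \<delta>: "\<delta> = 1 \<or> \<delta> = - 1" using assms(1) by (simp add: square_eq_1_iff)
  have pw: "p powr (2 * real kM + 1 / 2) = p ^ (2 * kM) * sqrt p" if "p > 0" for p
  proof -
    have "p powr real (2 * kM) = p ^ (2 * kM)" by (rule powr_realpow[OF that])
    moreover have "p powr (1 / 2) = sqrt p" using that by (simp add: powr_half_sqrt)
    ultimately show ?thesis by (simp add: powr_add)
  qed
  have key: "(- eps < y \<and> y < eps \<and> \<bar>y\<bar> powr (2 * real kM + 1 / 2) > mu \<and> \<delta> * y < 0) \<longleftrightarrow> rng kM eps mu (- (\<delta> * y))" for y
  proof (cases "\<delta> * y < 0")
    case True
    have "\<bar>y\<bar> = - (\<delta> * y)" using \<delta> True by auto
    then show ?thesis using pw[of "- (\<delta> * y)"] True assms(2) \<delta> by (auto simp: rng_def)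
  qed (auto simp: rng_def)
  have inv: "- (\<delta> * - (\<delta> * y)) = y" for y using \<delta> by auto
  show ?thesis
  proof (intro set_eqI iffI)
    fix z assume "z \<in> section_h \<delta> kM mu eps"
    then obtain y where "z = (mu, y)" "rng kM eps mu (- (\<delta> * y))" unfolding section_h_def using key by auto
    then show "z \<in> {(mu, - (\<delta> * p)) |p. rng kM eps mu p}" using inv[of y] by (intro CollectI exI[of _ "- (\<delta> * y)"]) simp
  next
    fix z assume "z \<in> {(mu, - (\<delta> * p)) |p. rng kM eps mu p}"
    then obtain p where "z = (mu, - (\<delta> * p))" "rng kM eps mu p" by auto
    then show "z \<in> section_h \<delta> kM mu eps" unfolding section_h_def using key[of "- (\<delta> * p)", unfolded inv] by simp
  qed
qed

lemma bigo_powr_of_bound: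
  fixes F :: "real \<Rightarrow> real"
  assumes "mu0 > 0" "K \<ge> 0" "!!mu. 0 < mu ==> mu < mu0 ==> \<bar>F mu\<bar> \<le> C * ((K * mu) powr (1 / N))\<^sup>2"
  shows "F \<in> O[at_right 0](%mu. mu powr (2 / N))"
proof (rule bigoI[of _ "C * K powr (2 / N)"])
  have "\<forall>\<^sub>F mu in at_right 0. mu \<in> {0<..<mu0}" by (rule eventually_at_right_real[OF assms(1)])
  then show "\<forall>\<^sub>F mu in at_right 0. norm (F mu) \<le> C * K powr (2 / N) * norm (mu powr (2 / N))"
  proof eventually_elim
    case (elim mu)
    have "((K * mu) powr (1 / N))\<^sup>2 = (K * mu) powr (1 / N + 1 / N)" by (simp only: powr_add power2_eq_square)
    also have "1 / N + 1 / N = 2 / N" by (simp flip: add_divide_distrib)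
    also have "(K * mu) powr (2 / N) = K powr (2 / N) * mu powr (2 / N)" using elim assms(2) by (simp add: powr_mult)
    finally show ?case using assms(3)[of mu] elim by (simp add: mult.assoc)
  qed
qed

context hysteresis begin

lemma attracting_case:
  assumes Vn: "V < 0"
  shows "\<exists>eps>0. \<exists>mu0>0. \<exists>P T :: real \<Rightarrow> real.
     (\<forall>mu\<in>{0<..<mu0}.
        (\<exists>!\<Gamma>. (\<exists>\<tau>. hysteretic_periodic_orbit X U mu \<tau> \<Gamma>) \<and> \<Gamma> \<inter> section_h \<delta> kM mu eps \<noteq> {}) \<and>
        (\<forall>\<tau> \<Gamma>. hysteretic_periodic_orbit X U mu \<tau> \<Gamma> \<and> \<Gamma> \<inter> section_h \<delta> kM mu eps \<noteq> {} \<longrightarrow>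
           hyperbolic_attracting_limit_cycle X U mu \<Gamma> \<and>
           \<Gamma> \<inter> section_h \<delta> kM mu eps = {(mu, - \<delta> * P mu)} \<and> T mu = \<tau>)) \<and>
     (%mu. P mu - P0 mu) \<in> O[at_right 0](%mu. mu powr (2 / real N)) \<and>
     (%mu. T mu - (2 / R.\<beta> + 2 / Lf.\<beta>) * P0 mu) \<in> O[at_right 0](%mu. mu powr (2 / real N))"
proof -
  obtain e1 where e1: "e1 > 0" "!!mu p. rng kM e1 mu p ==> nice2 mu p" by (rule nice2_of_rng) (rule that; assumption)
  obtain e2 where e2: "e2 > 0" "!!p. 0 < p ==> p < e2 ==> sgn (disp0 p) = sgn V"
    "!!p. 0 < p ==> p < e2 ==> V < 0 ==> - deriv QR (- p) + deriv QL p < 0" by (rule disp0_sign) (rule that; assumption)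
  obtain e3 where e3: "e3 > 0" "!!mu p. nice2 mu p ==> p < e3 ==> \<exists>gam1 T1 gam2 T2. loop mu p (ret mu p) gam1 T1 gam2 T2"
    by (rule loop_exists) (rule that; assumption)
  define eps where "eps = min e1 (min e2 e3)"
  have eps: "eps > 0" using e1 e2 e3 by (simp add: eps_def)
  have dom: "nice2 mu p \<and> - deriv QR (- p) + deriv QL p < 0 \<and> (\<exists>gam1 T1 gam2 T2. loop mu p (ret mu p) gam1 T1 gam2 T2)"
    if r: "rng kM eps mu p" for mu p
  proof -
    have nc: "nice2 mu p" by (rule e1(2)[OF rng_less[OF r]]) (simp add: eps_def)
    have "0 < p" "p < e2" "p < e3" using r by (auto simp: rng_def eps_def)
    then show ?thesis using nc e2(3)[OF _ _ Vn, of p] e3(2)[OF nc] by blast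
  qed
  obtain mu0 C where A: "mu0 > 0" "C \<ge> 0" "!!mu. 0 < mu ==> mu < mu0 ==>
     \<exists>p. rng kM eps mu p \<and> nice2 mu p \<and> ret mu p = p \<and> \<bar>p - P0 mu\<bar> \<le> C * (P0 mu)\<^sup>2 \<and>
       \<bar>period mu p - (2 / R.\<beta> + 2 / Lf.\<beta>) * P0 mu\<bar> \<le> C * (P0 mu)\<^sup>2"
    by (rule attracting_zero[OF Vn eps]) (rule that; assumption)
  define P where "P mu = (SOME p. rng kM eps mu p \<and> nice2 mu p \<and> ret mu p = p \<and> \<bar>p - P0 mu\<bar> \<le> C * (P0 mu)\<^sup>2 \<and>
       \<bar>period mu p - (2 / R.\<beta> + 2 / Lf.\<beta>) * P0 mu\<bar> \<le> C * (P0 mu)\<^sup>2)" for mu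
  have P: "rng kM eps mu (P mu)" "ret mu (P mu) = P mu" "\<bar>P mu - P0 mu\<bar> \<le> C * (P0 mu)\<^sup>2"
     "\<bar>period mu (P mu) - (2 / R.\<beta> + 2 / Lf.\<beta>) * P0 mu\<bar> \<le> C * (P0 mu)\<^sup>2" if "0 < mu" "mu < mu0" for mu
    using someI_ex[OF A(3)[OF that]] unfolding P_def[symmetric] by auto
  have orb: "(\<exists>!\<Gamma>. (\<exists>\<tau>. hysteretic_periodic_orbit X U mu \<tau> \<Gamma>) \<and> \<Gamma> \<inter> section_h \<delta> kM mu eps \<noteq> {}) \<and>
        (\<forall>\<tau> \<Gamma>. hysteretic_periodic_orbit X U mu \<tau> \<Gamma> \<and> \<Gamma> \<inter> section_h \<delta> kM mu eps \<noteq> {} \<longrightarrow>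
           hyperbolic_attracting_limit_cycle X U mu \<Gamma> \<and>
           \<Gamma> \<inter> section_h \<delta> kM mu eps = {(mu, - \<delta> * P mu)} \<and> period mu (P mu) = \<tau>)" if mpos: "0 < mu" "mu < mu0" for mu
  proof -
    note S = section_h_eq[OF dd1(1) mpos(1), of kM eps]
    obtain \<Gamma> where G: "hysteretic_periodic_orbit X U mu (period mu (P mu)) \<Gamma>"
      "!!\<tau> \<Gamma>' p. [|hysteretic_periodic_orbit X U mu \<tau> \<Gamma>'; rng kM eps mu p; (mu, - (\<delta> * p)) \<in> \<Gamma>'|] ==> \<Gamma>' = \<Gamma> \<and> \<tau> = period mu (P mu)"
      "(mu, - (\<delta> * P mu)) \<in> \<Gamma>" "!!p. rng kM eps mu p ==> (mu, - (\<delta> * p)) \<in> \<Gamma> ==> p = P mu"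
      "hyperbolic_attracting_limit_cycle X U mu \<Gamma>"
      by (rule attracting_orbit[OF dom P(1,2)[OF mpos]]) (assumption, (rule that; assumption))
    have GS: "\<Gamma> \<inter> section_h \<delta> kM mu eps = {(mu, - \<delta> * P mu)}"
    proof (intro equalityI subsetI)
      fix z assume z: "z \<in> \<Gamma> \<inter> section_h \<delta> kM mu eps"
      then obtain p where p: "z = (mu, - (\<delta> * p))" "rng kM eps mu p" unfolding S by blast
      have "p = P mu" by (rule G(4)[OF p(2)]) (use z p(1) in blast)
      then show "z \<in> {(mu, - \<delta> * P mu)}" using p(1) by simp
    next
      fix z assume "z \<in> {(mu, - \<delta> * P mu)}"
      then have "z = (mu, - (\<delta> * P mu))" by simp
      then show "z \<in> \<Gamma> \<inter> section_h \<delta> kM mu eps" unfolding S using G(3) P(1)[OF mpos] by blast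
    qed
    have uq: "\<Gamma>' = \<Gamma> \<and> \<tau> = period mu (P mu)" if hh: "hysteretic_periodic_orbit X U mu \<tau> \<Gamma>'" "\<Gamma>' \<inter> section_h \<delta> kM mu eps \<noteq> {}" for \<tau> \<Gamma>'
    proof -
      obtain z where z: "z \<in> \<Gamma>'" "z \<in> section_h \<delta> kM mu eps" using hh(2) by blast
      obtain p where p: "z = (mu, - (\<delta> * p))" "rng kM eps mu p" using z(2) unfolding S by blast
      show ?thesis using G(2)[OF hh(1) p(2)] z(1) p(1) by simp
    qed
    have ne: "\<Gamma> \<inter> section_h \<delta> kM mu eps \<noteq> {}" unfolding GS by simp
    show ?thesis
    proof (intro conjI allI impI)
      show "\<exists>!\<Gamma>. (\<exists>\<tau>. hysteretic_periodic_orbit X U mu \<tau> \<Gamma>) \<and> \<Gamma> \<inter> section_h \<delta> kM mu eps \<noteq> {}"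
      proof (rule ex1I[of _ \<Gamma>])
        show "(\<exists>\<tau>. hysteretic_periodic_orbit X U mu \<tau> \<Gamma>) \<and> \<Gamma> \<inter> section_h \<delta> kM mu eps \<noteq> {}" using G(1) ne by blast
        show "\<Gamma>' = \<Gamma>" if "(\<exists>\<tau>. hysteretic_periodic_orbit X U mu \<tau> \<Gamma>') \<and> \<Gamma>' \<inter> section_h \<delta> kM mu eps \<noteq> {}" for \<Gamma>'
          using that uq by blast
      qed
    next
      fix \<tau> \<Gamma>' assume h: "hysteretic_periodic_orbit X U mu \<tau> \<Gamma>' \<and> \<Gamma>' \<inter> section_h \<delta> kM mu eps \<noteq> {}"
      then have e: "\<Gamma>' = \<Gamma>" "\<tau> = period mu (P mu)" using uq by blast+
      show "hyperbolic_attracting_limit_cycle X U mu \<Gamma>'" "\<Gamma>' \<inter> section_h \<delta> kM mu eps = {(mu, - \<delta> * P mu)}" "period mu (P mu) = \<tau>"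
        unfolding e by (rule G(5) GS refl)+
    qed
  qed
  have K: "\<kappa> / \<bar>V\<bar> \<ge> 0" using \<eta> by simp
  have o1: "(%mu. P mu - P0 mu) \<in> O[at_right 0](%mu. mu powr (2 / real N))"
    by (rule bigo_powr_of_bound[OF A(1) K, of _ C]) (use P(3) in \<open>simp add: P0_def\<close>)
  have o2: "(%mu. period mu (P mu) - (2 / R.\<beta> + 2 / Lf.\<beta>) * P0 mu) \<in> O[at_right 0](%mu. mu powr (2 / real N))"
    by (rule bigo_powr_of_bound[OF A(1) K, of _ C]) (use P(4) in \<open>simp add: P0_def\<close>)
  show ?thesis
    by (rule exI[of _ eps], rule conjI[OF eps], rule exI[of _ mu0], rule conjI[OF A(1)],
        rule exI[of _ P], rule exI[of _ "%mu. period mu (P mu)"],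
        rule conjI[OF ballI[OF orb] conjI[OF o1 o2]]) auto
qed

lemma repelling_case:
  assumes "V > 0"
  shows "\<exists>eps>0. \<exists>mu0>0. \<forall>mu\<in>{0<..<mu0}.
    \<not> (\<exists>\<tau> \<Gamma>. hysteretic_periodic_orbit X U mu \<tau> \<Gamma> \<and> \<Gamma> \<inter> section_h \<delta> kM mu eps \<noteq> {})"
proof -
  obtain eps where eps: "eps > 0" "!!mu p \<tau> \<Gamma>. [|rng kM eps mu p; hysteretic_periodic_orbit X U mu \<tau> \<Gamma>|] ==> (mu, - (\<delta> * p)) \<notin> \<Gamma>"
    by (rule no_periodic_orbit[OF assms]) (rule that; assumption)
  have "\<Gamma> \<inter> section_h \<delta> kM mu eps = {}" if "0 < mu" "hysteretic_periodic_orbit X U mu \<tau> \<Gamma>" for mu \<tau> \<Gamma>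
    unfolding section_h_eq[OF dd1(1) that(1)] using eps(2)[OF _ that(2)] by blast
  then show ?thesis by (intro exI[of _ eps] conjI eps(1) exI[of _ 1]) auto
qed

end

theorem theorem1:
  fixes X :: "side \<Rightarrow> real \<times> real \<Rightarrow> real \<times> real"
    and U :: "(real \<times> real) set"
    and a b :: "side \<Rightarrow> nat \<Rightarrow> nat \<Rightarrow> real"
    and k :: "side \<Rightarrow> nat"
    and n kM N :: nat
    and V :: "nat \<Rightarrow> real"
    and \<delta> \<kappa> :: real
  assumes "open U" and "(0, 0) \<in> U"
    and "\<And>J. analytic_vfield_on (X J) U"
    and "\<And>J. has_power_series2 (a J) (\<lambda>p. fst (X J p)) (0, 0)"
    and "\<And>J. has_power_series2 (b J) (\<lambda>p. snd (X J p)) (0, 0)"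
    and "monodromic_tangential X k"
  defines "V \<equiv> lyapunov_coeff X U"
    and "\<delta> \<equiv> sgn (b Rgt 0 0)"
    and "\<kappa> \<equiv> kappa_h a b k"
    and "kM \<equiv> max (k Lft) (k Rgt)"
    and "N \<equiv> 2 * (n + kM) - 1"
  assumes "n \<ge> 1" and "V (2 * n) \<noteq> 0" and "\<And>j. 1 \<le> j \<Longrightarrow> j < n \<Longrightarrow> V (2 * j) = 0"
  shows "(V (2 * n) < 0 \<longrightarrow>
           (\<exists>\<epsilon>>0. \<exists>\<mu>0>0. \<exists>P T :: real \<Rightarrow> real.
              (\<forall>\<mu>\<in>{0<..<\<mu>0}.
                 (\<exists>!\<Gamma>. (\<exists>\<tau>. hysteretic_periodic_orbit X U \<mu> \<tau> \<Gamma>) \<and> \<Gamma> \<inter> section_h \<delta> kM \<mu> \<epsilon> \<noteq> {}) \<and>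
                 (\<forall>\<tau> \<Gamma>. hysteretic_periodic_orbit X U \<mu> \<tau> \<Gamma> \<and> \<Gamma> \<inter> section_h \<delta> kM \<mu> \<epsilon> \<noteq> {} \<longrightarrow>
                    hyperbolic_attracting_limit_cycle X U \<mu> \<Gamma> \<and>
                    \<Gamma> \<inter> section_h \<delta> kM \<mu> \<epsilon> = {(\<mu>, - \<delta> * P \<mu>)} \<and> T \<mu> = \<tau>)) \<and>
              (\<lambda>\<mu>. P \<mu> - \<bar>\<kappa> / V (2 * n)\<bar> powr (1 / real N) * \<mu> powr (1 / real N))
                \<in> O[at_right 0](\<lambda>\<mu>. \<mu> powr (2 / real N)) \<and>
              (\<lambda>\<mu>. T \<mu> - \<bar>2 / b Lft 0 0 - 2 / b Rgt 0 0\<bar> *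
                            \<bar>\<kappa> / V (2 * n)\<bar> powr (1 / real N) * \<mu> powr (1 / real N))
                \<in> O[at_right 0](\<lambda>\<mu>. \<mu> powr (2 / real N)))) \<and>
         (V (2 * n) > 0 \<longrightarrow>
           (\<exists>\<epsilon>>0. \<exists>\<mu>0>0. \<forall>\<mu>\<in>{0<..<\<mu>0}.
              \<not> (\<exists>\<tau> \<Gamma>. hysteretic_periodic_orbit X U \<mu> \<tau> \<Gamma> \<and> \<Gamma> \<inter> section_h \<delta> kM \<mu> \<epsilon> \<noteq> {})))"
proof -
  have mono: "monodromic_tangential X k" by fact
  note mt = mono[unfolded monodromic_tangential_def]
  obtain rR LR HR HxR HyR WR WxR WyR cR QR PR dR where R:
    "half_flow (X Rgt) U rR LR HR HxR HyR WR WxR WyR 1 (sgn (b Rgt 0 0)) cR (k Rgt) QR (%i. sgn (b Rgt 0 0) * half_return_coeff (X Rgt) U i * sgn (b Rgt 0 0) ^ i)"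
    "b Rgt 0 0 \<noteq> 0" "a Rgt 0 (2 * k Rgt - 1) = - (b Rgt 0 0 * (2 * real (k Rgt)) * (1 * cR))"
    "has_power_series (half_return_coeff (X Rgt) U) PR" "half_return_coeff (X Rgt) U 0 = 0" "half_return_coeff (X Rgt) U 1 = - 1"
    "dR > 0" "PR 0 = 0" "!!y. \<bar>y\<bar> < dR ==> \<bar>PR y\<bar> < dR ==> PR (PR y) = y"
  proof (rule half_flow_exists[where X="X Rgt" and U=U and a="a Rgt" and b="b Rgt" and k="k Rgt" and s="1" and e="sgn (b Rgt 0 0)",
      OF \<open>open U\<close> \<open>(0, 0) \<in> U\<close> assms(4,5)], goal_cases)
    case (6 r L H Hx Hy W Wx Wy c Q P d)
    show ?case by (rule that[OF 6(2-9)]) (rule 6(10))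
  qed (use mt in auto)
  obtain rL LL HL HxL HyL WL WxL WyL cL QL PL dL where L:
    "half_flow (X Lft) U rL LL HL HxL HyL WL WxL WyL (- 1) (sgn (b Lft 0 0)) cL (k Lft) QL (%i. sgn (b Lft 0 0) * half_return_coeff (X Lft) U i * sgn (b Lft 0 0) ^ i)"
    "b Lft 0 0 \<noteq> 0" "a Lft 0 (2 * k Lft - 1) = - (b Lft 0 0 * (2 * real (k Lft)) * (- 1 * cL))"
    "has_power_series (half_return_coeff (X Lft) U) PL" "half_return_coeff (X Lft) U 0 = 0" "half_return_coeff (X Lft) U 1 = - 1"
    "dL > 0" "PL 0 = 0" "!!y. \<bar>y\<bar> < dL ==> \<bar>PL y\<bar> < dL ==> PL (PL y) = y"
  proof (rule half_flow_exists[where X="X Lft" and U=U and a="a Lft" and b="b Lft" and k="k Lft" and s="- 1" and e="sgn (b Lft 0 0)",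
      OF \<open>open U\<close> \<open>(0, 0) \<in> U\<close> assms(4,5)], goal_cases)
    case (6 r L H Hx Hy W Wx Wy c Q P d)
    show ?case by (rule that[OF 6(2-9)]) (rule 6(10))
  qed (use mt in auto)
  have b00: "snd (X J (0, 0)) = b J 0 0" for J using an2_of_power_series2(2)[OF assms(5)[of J]] .
  obtain l where l0: "l < 0" "X Lft (0, 0) = l *\<^sub>R X Rgt (0, 0)" using mt by blast
  have l: "l < 0" "b Lft 0 0 = l * b Rgt 0 0" using l0(1) b00[of Lft] b00[of Rgt] l0(2) by simp_all
  have sL: "sgn (b Lft 0 0) = - \<delta>" unfolding \<delta>_def l(2) using l(1) by (simp add: sgn_mult)
  have \<delta>: "\<delta> = 1 \<or> \<delta> = - 1" using R(2) by (auto simp: \<delta>_def sgn_if)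
  have ori: "orientation X = \<delta>" by (simp add: orientation_def b00 \<delta>_def)
  have Vi: "V i = \<delta> * (half_return_coeff (X Rgt) U i - half_return_coeff (X Lft) U i)" for i
    by (simp add: V_def lyapunov_coeff_def ori)
  \<comment> \<open>The hypothesis concerns even indices only. Odd ones follow by induction from
    \<open>involution_difference_even\<close>, and index 0 from the vanishing of both half-return
    maps at 0.\<close>
  have V0: "V i = 0" if "i < 2 * n" for i
    using that
  proof (induction i rule: less_induct)
    case (less i)
    show ?case
    proof (cases "even i")
      case True
      then obtain j where j: "i = 2 * j" by blast
      show ?thesis
      proof (cases "j = 0")
        case True then show ?thesis using j R(5) L(5) by (simp add: Vi)
      next
        case False
        then have "1 \<le> j" "j < n" using less.prems j by auto
        then show ?thesis unfolding j by (rule \<open>!!j. 1 \<le> j ==> j < n ==> V (2 * j) = 0\<close>)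
      qed
    next
      case False
      have "half_return_coeff (X Rgt) U i = half_return_coeff (X Lft) U i"
      proof (rule involution_difference_even[OF R(4) L(4) R(5) L(5) R(6) L(6) R(7) L(7) R(9) L(9) False])
        show "half_return_coeff (X Rgt) U j = half_return_coeff (X Lft) U j" if "j < i" for j
          using less.IH[OF that] less.prems that \<delta> by (auto simp: Vi)
      qed
      then show ?thesis by (simp add: Vi)
    qed
  qed
  \<comment> \<open>Translates the normalised coefficients of \<open>two_flow\<close> into Lyapunov
    coefficients; for even i the factor is 1.\<close>
  have co: "(\<delta> * half_return_coeff (X Rgt) U i * \<delta> ^ i) * (- 1) ^ i + - \<delta> * half_return_coeff (X Lft) U i * (- \<delta>) ^ i = (- \<delta>) ^ i * V i" for i
  proof -
    have "(- \<delta>) ^ i = \<delta> ^ i * (- 1) ^ i" by (simp flip: power_mult_distrib)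
    then show ?thesis unfolding Vi by (simp only:) (simp add: algebra_simps)
  qed
  have e2n: "(- \<delta>) ^ (2 * n) = 1" "(- 1 :: real) ^ (2 * n) = 1" using \<delta> by (auto simp: power_mult)
  interpret H: hysteresis where X = X and U = U and rR = rR and LR = LR and HR = HR and HxR = HxR and HyR = HyR and WR = WR
    and WxR = WxR and WyR = WyR and cR = cR and kR = "k Rgt" and QR = QR and qR = "%i. \<delta> * half_return_coeff (X Rgt) U i * \<delta> ^ i"
    and rL = rL and LL = LL and HL = HL and HxL = HxL and HyL = HyL and WL = WL and WxL = WxL and WyL = WyL and cL = cL and kL = "k Lft"
    and QL = QL and qL = "%i. - \<delta> * half_return_coeff (X Lft) U i * (- \<delta>) ^ i" and \<delta> = \<delta> and n = n and V = "V (2 * n)"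
  proof (rule hysteresis.intro, rule two_flow.intro)
    show "half_flow (X Rgt) U rR LR HR HxR HyR WR WxR WyR 1 \<delta> cR (k Rgt) QR (%i. \<delta> * half_return_coeff (X Rgt) U i * \<delta> ^ i)"
      using R(1) by (simp only: \<delta>_def)
    show "half_flow (X Lft) U rL LL HL HxL HyL WL WxL WyL (- 1) (- \<delta>) cL (k Lft) QL (%i. - \<delta> * half_return_coeff (X Lft) U i * (- \<delta>) ^ i)"
      using L(1) by (simp only: sL)
    show "two_flow_axioms (%i. \<delta> * half_return_coeff (X Rgt) U i * \<delta> ^ i) (%i. - \<delta> * half_return_coeff (X Lft) U i * (- \<delta>) ^ i) n (V (2 * n))"
    proof (rule two_flow_axioms.intro)
      show "n \<ge> 1" "V (2 * n) \<noteq> 0" by fact+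
      show "(\<delta> * half_return_coeff (X Rgt) U i * \<delta> ^ i) * (- 1) ^ i + - \<delta> * half_return_coeff (X Lft) U i * (- \<delta>) ^ i = 0" if "i < 2 * n" for i
        unfolding co using V0[OF that] by simp
      show "\<delta> * half_return_coeff (X Rgt) U (2 * n) * \<delta> ^ (2 * n) + - \<delta> * half_return_coeff (X Lft) U (2 * n) * (- \<delta>) ^ (2 * n) = V (2 * n)"
        using co[of "2 * n"] e2n by simp
    qed
  qed
  have kM': "H.kM = kM" by (simp add: H.kM_def kM_def max.commute)
  have N': "H.N = N" by (simp add: H.N_def N_def kM')
  have etaR: "eta_h a b k Rgt = - H.\<eta>R" unfolding eta_h_def R(3) H.\<eta>R_def using R(2) H.R.k H.R.c by (simp add: field_simps)
  have etaL: "eta_h a b k Lft = H.\<eta>L" unfolding eta_h_def L(3) H.\<eta>L_def using L(2) H.Lf.k H.Lf.c by (simp add: field_simps)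
  \<comment> \<open>The three cases of \<open>kappa_h\<close> match the two conditional summands of
    \<open>H.\<kappa>\<close>; the signs come from \<open>etaR\<close> and
    \<open>etaL\<close>.\<close>
  have kap: "\<kappa> = - H.\<kappa>" unfolding \<kappa>_def kappa_h_def etaR etaL H.\<kappa>_def by auto
  have kapV: "\<bar>\<kappa> / V (2 * n)\<bar> = H.\<kappa> / \<bar>V (2 * n)\<bar>" using H.\<eta>(3) by (simp add: kap abs_divide)
  have opp: "b Lft 0 0 * b Rgt 0 0 < 0"
  proof -
    have "(b Rgt 0 0)\<^sup>2 > 0" using R(2) by simp
    then have "l * (b Rgt 0 0)\<^sup>2 < 0" by (rule mult_neg_pos[OF l(1)])
    then show ?thesis unfolding l(2) by (simp only: power2_eq_square mult.assoc)
  qed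
  have bet: "\<bar>2 / b Lft 0 0 - 2 / b Rgt 0 0\<bar> = 2 / H.R.\<beta> + 2 / H.Lf.\<beta>"
  proof -
    have "\<bar>2 / x - 2 / y\<bar> = 2 / \<bar>y\<bar> + 2 / \<bar>x\<bar>" if xy: "x * y < 0" for x y :: real
    proof -
      consider "0 < x" "y < 0" | "x < 0" "0 < y" using xy by (auto simp: mult_less_0_iff)
      then show ?thesis
      proof cases
        case 1
        then have "0 < 2 / x" "2 / y < 0" by simp_all
        moreover have "2 / \<bar>x\<bar> = 2 / x" "2 / \<bar>y\<bar> = - (2 / y)" using 1 by simp_all
        ultimately show ?thesis by linarith
      next
        case 2
        then have "2 / x < 0" "0 < 2 / y" by simp_all
        moreover have "2 / \<bar>y\<bar> = 2 / y" "2 / \<bar>x\<bar> = - (2 / x)" using 2 by simp_all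
        ultimately show ?thesis by linarith
      qed
    qed
    from this[OF opp] show ?thesis by (simp add: H.R.\<beta>_def H.Lf.\<beta>_def b00)
  qed
  have P0: "H.P0 mu = \<bar>\<kappa> / V (2 * n)\<bar> powr (1 / real N) * mu powr (1 / real N)" if "0 < mu" for mu
    unfolding H.P0_def kapV N' by (rule powr_mult)
  have ev: "\<forall>\<^sub>F mu in at_right (0::real). 0 < mu" by (rule eventually_at_right_less)
  have oP: "(%mu. F mu - H.P0 mu) \<in> O[at_right 0](g) \<longleftrightarrow>
      (%mu. F mu - \<bar>\<kappa> / V (2 * n)\<bar> powr (1 / real N) * mu powr (1 / real N)) \<in> O[at_right 0](g)" for F g :: "real \<Rightarrow> real"
    by (rule landau_o.big.in_cong[OF eventually_mono[OF ev]]) (simp only: P0)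
  have oT: "(%mu. F mu - (2 / H.R.\<beta> + 2 / H.Lf.\<beta>) * H.P0 mu) \<in> O[at_right 0](g) \<longleftrightarrow>
      (%mu. F mu - \<bar>2 / b Lft 0 0 - 2 / b Rgt 0 0\<bar> * \<bar>\<kappa> / V (2 * n)\<bar> powr (1 / real N) * mu powr (1 / real N)) \<in> O[at_right 0](g)"
    for F g :: "real \<Rightarrow> real"
    by (rule landau_o.big.in_cong[OF eventually_mono[OF ev]]) (simp only: P0 bet mult.assoc)
  show ?thesis
  proof (intro conjI impI)
    assume "V (2 * n) < 0"
    then show "\<exists>eps>0. \<exists>mu0>0. \<exists>P T :: real \<Rightarrow> real.
              (\<forall>mu\<in>{0<..<mu0}.
                 (\<exists>!\<Gamma>. (\<exists>\<tau>. hysteretic_periodic_orbit X U mu \<tau> \<Gamma>) \<and> \<Gamma> \<inter> section_h \<delta> kM mu eps \<noteq> {}) \<and>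
                 (\<forall>\<tau> \<Gamma>. hysteretic_periodic_orbit X U mu \<tau> \<Gamma> \<and> \<Gamma> \<inter> section_h \<delta> kM mu eps \<noteq> {} \<longrightarrow>
                    hyperbolic_attracting_limit_cycle X U mu \<Gamma> \<and>
                    \<Gamma> \<inter> section_h \<delta> kM mu eps = {(mu, - \<delta> * P mu)} \<and> T mu = \<tau>)) \<and>
              (%mu. P mu - \<bar>\<kappa> / V (2 * n)\<bar> powr (1 / real N) * mu powr (1 / real N))
                \<in> O[at_right 0](%mu. mu powr (2 / real N)) \<and>
              (%mu. T mu - \<bar>2 / b Lft 0 0 - 2 / b Rgt 0 0\<bar> *
                            \<bar>\<kappa> / V (2 * n)\<bar> powr (1 / real N) * mu powr (1 / real N))
                \<in> O[at_right 0](%mu. mu powr (2 / real N))"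
      by (rule H.attracting_case[unfolded kM' N' oP oT])
  next
    assume "V (2 * n) > 0"
    then show "\<exists>eps>0. \<exists>mu0>0. \<forall>mu\<in>{0<..<mu0}.
              \<not> (\<exists>\<tau> \<Gamma>. hysteretic_periodic_orbit X U mu \<tau> \<Gamma> \<and> \<Gamma> \<inter> section_h \<delta> kM mu eps \<noteq> {})"
      by (rule H.repelling_case[unfolded kM'])
  qed
qed

end
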